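(* Let $(V,\Omega)$ be a real symplectic vector space of dimension $2n$, $F\subset V$ a real Lagrangian subspace and $j\in j_+(V,\Omega)$. Then $Sp(V,\Omega,F)=\{g\in Sp(V,\Omega)\mid g(F)\subset F\}$ has a homomorphism into $Mp^c(V,\Omega,j)$ lifting the inclusion $Sp(V,\Omega,F)\subset Sp(V,\Omega)$. This lifting maps $g\in Sp(V,\Omega,F)$ to the element of $Mp^c(V,\Omega,j)$ with parameters $(g,f_F(g))$, where $$f_F(g)=|\mathrm{Det}_F(A_g)|^{-\frac12}\,e^{-\frac12a_F\left(\frac12(I_F+(A_g^TA_g)^{-1}-iS_g)\right)},$$ $A_g=g|_F$, and $S_g$ is the endomorphism of $F$ determined by: for $v\in F$, $A_gS_gv$ is the $F$-component of $gjv$ relative to the decomposition $V=F+jF$.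
   Context: Fix $h>0$, $\hbar=h/2\pi$. $j_+(V,\Omega)$ is the set of positive compatible complex structures: $j\in Sp(V,\Omega)$, $j^2=-\mathrm{Id}$, $G_j(v,w)=\Omega(v,jw)$ positive definite. For such $j$ and a real Lagrangian $F$, $V=F\oplus jF$ is $G_j$-orthogonal. The transpose $A^T$ of $A\in\mathrm{End}(F)$ is taken with respect to $G_j|_F$; $S_g$ is symmetric. On the contractible open set of endomorphisms of $F^{\mathbb C}$ whose Hermitean real part (with respect to the Hermitean extension of $G_j$) is positive definite, $a_F$ is the unique smooth complex function with $\mathrm{Det}_{F^{\mathbb C}}x=e^{a_F(x)}$, $a_F(I)=0$. Put $\langle v,w\rangle_j=\Omega(v,jw)-i\Omega(v,w)$ (complex linear in the first argument). $\mathcal H(V,\Omega,j)$ is the Hilbert space of $j$-holomorphic functions $f$ on $V$ with $\|f\|^2=h^{-n}\int_V|f(z)|^2e^{-\langle z,z\rangle_j/2\hbar}dz<\infty$. The Heisenberg group $V\times\mathbb R$, with product $(v_1,t_1)(v_2,t_2)=(v_1+v_2,t_1+t_2-\frac12\Omega(v_1,v_2))$, acts on it unitarily and irreducibly by $(U_j(v,t)f)(z)=e^{-it/\hbar+\langle z,v\rangle_j/2\hbar-\langle v,v\rangle_j/4\hbar}f(z-v)$. $Mp^c(V,\Omega,j)$ is the group of pairs $(U,g)$, $U$ unitary on $\mathcal H(V,\Omega,j)$, $g\in Sp(V,\Omega)$, with $U_j(gv,t)=U\,U_j(v,t)\,U^{-1}$ for all $(v,t)$, with diagonal multiplication; $\sigma(U,g)=g$.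 For $g\in Sp(V,\Omega)$: $C_g=\frac12(g-jgj)$ ($j$-linear, invertible), $Z_g=C_g^{-1}\cdot\frac12(g+jgj)$. $\mathrm{Det}_j$ is the complex determinant on $(V,j)$. On the set of $j$-linear maps $x$ of $V$ with $x+x^*$ positive definite, $a$ is the unique smooth function with $\mathrm{Det}_jx=e^{a(x)}$, $a(I)=0$. Known facts: let $e_v(z)=e^{\langle z,v\rangle_j/2\hbar}$. Every $(U,g)\in Mp^c(V,\Omega,j)$ satisfies $(Ue_v)(z)=\lambda\exp\frac1{4\hbar}\{2\langle C_g^{-1}z,v\rangle_j-\langle z,Z_{g^{-1}}z\rangle_j-\langle Z_gv,v\rangle_j\}$ with $\lambda=(Ue_0)(0)$ and $|\lambda^2\mathrm{Det}_jC_g|=1$; conversely each pair $(g,\lambda)$ with $|\lambda^2\mathrm{Det}_jC_g|=1$ arises from a unique element; $(g,\lambda)$ are called its parameters. The product of elements with parameters $(g_1,\lambda_1),(g_2,\lambda_2)$ has parameters $\left(g_1g_2,\ \lambda_1\lambda_2e^{-\frac12a(1-Z_{g_1}Z_{g_2^{-1}})}\right)$. *)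

theory Defs
  imports
    "HOL-Analysis.Analysis"
    "HOL-Algebra.Group"
    "Jordan_Normal_Form.Determinant"
begin

section \<open>Symplectic linear algebra\<close>

text \<open>The inner product of the class \<open>euclidean_space\<close> is auxiliary: it only supplies the
  topology of the finite-dimensional space \<open>V\<close>.\<close>

definition symplectic_form :: "('v::euclidean_space \<Rightarrow> 'v \<Rightarrow> real) \<Rightarrow> bool" where
  "symplectic_form \<Omega> \<longleftrightarrow> bilinear \<Omega> \<and> (\<forall>v. \<Omega> v v = 0) \<and> (\<forall>v. (\<forall>w. \<Omega> v w = 0) \<longrightarrow> v = 0)"

definition Sp :: "('v::euclidean_space \<Rightarrow> 'v \<Rightarrow> real) \<Rightarrow> ('v \<Rightarrow> 'v) set" where
  "Sp \<Omega> = {g. linear g \<and> bij g \<and> (\<forall>v w. \<Omega> (g v) (g w) = \<Omega> v w)}"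

definition lagrangian :: "('v::euclidean_space \<Rightarrow> 'v \<Rightarrow> real) \<Rightarrow> 'v set \<Rightarrow> bool" where
  "lagrangian \<Omega> F \<longleftrightarrow> subspace F \<and> F = {v. \<forall>w\<in>F. \<Omega> v w = 0}"

definition Gform :: "('v \<Rightarrow> 'v \<Rightarrow> real) \<Rightarrow> ('v \<Rightarrow> 'v) \<Rightarrow> 'v \<Rightarrow> 'v \<Rightarrow> real" where
  "Gform \<Omega> j v w = \<Omega> v (j w)"

definition j_plus :: "('v::euclidean_space \<Rightarrow> 'v \<Rightarrow> real) \<Rightarrow> ('v \<Rightarrow> 'v) set" where
  "j_plus \<Omega> = {j \<in> Sp \<Omega>. (\<forall>v. j (j v) = - v) \<and> (\<forall>v. v \<noteq> 0 \<longrightarrow> Gform \<Omega> j v v > 0)}"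

definition SpF_group :: "('v::euclidean_space \<Rightarrow> 'v \<Rightarrow> real) \<Rightarrow> 'v set \<Rightarrow> ('v \<Rightarrow> 'v) monoid" where
  "SpF_group \<Omega> F = \<lparr>carrier = {g \<in> Sp \<Omega>. g ` F \<subseteq> F}, mult = (\<circ>), one = id\<rparr>"


section \<open>The Bargmann--Fock space and \<open>Mp\<^sup>c\<close>\<close>

definition hbar :: "real \<Rightarrow> real" where
  "hbar h = h / (2 * pi)"

definition hprod :: "('v \<Rightarrow> 'v \<Rightarrow> real) \<Rightarrow> ('v \<Rightarrow> 'v) \<Rightarrow> 'v \<Rightarrow> 'v \<Rightarrow> complex" where
  "hprod \<Omega> j v w = complex_of_real (\<Omega> v (j w)) - \<i> * complex_of_real (\<Omega> v w)"

text \<open>Lebesgue measure of the Euclidean space \<open>(V, G)\<close>: the image of standard Lebesgue measure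
  under a linear map carrying the auxiliary inner product to \<open>G\<close>.  It does not depend on the
  choice of that map, and for \<open>G = Gform \<Omega> j\<close> it is the Liouville measure of \<open>\<Omega>\<close>; the constant
  function 1 then has norm 1 in the space below.\<close>

definition vol :: "('v::euclidean_space \<Rightarrow> 'v \<Rightarrow> real) \<Rightarrow> 'v measure" where
  "vol G = distr lborel borel (SOME T :: 'v \<Rightarrow> 'v. linear T \<and> (\<forall>v w. G (T v) (T w) = inner v w))"

definition j_holomorphic :: "('v::euclidean_space \<Rightarrow> 'v) \<Rightarrow> ('v \<Rightarrow> complex) \<Rightarrow> bool" where
  "j_holomorphic j f \<longleftrightarrow> (\<forall>z. \<exists>D. (f has_derivative D) (at z) \<and> (\<forall>v. D (j v) = \<i> * D v))"

text \<open>The weight uses \<open>Gform \<Omega> j z z\<close>, which is \<open>hprod \<Omega> j z z\<close> as a real number.\<close>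

definition fock ::
  "real \<Rightarrow> ('v::euclidean_space \<Rightarrow> 'v \<Rightarrow> real) \<Rightarrow> ('v \<Rightarrow> 'v) \<Rightarrow> ('v \<Rightarrow> complex) set" where
  "fock h \<Omega> j = {f. j_holomorphic j f \<and>
     integrable (vol (Gform \<Omega> j)) (\<lambda>z. (cmod (f z))\<^sup>2 * exp (- Gform \<Omega> j z z / (2 * hbar h)))}"

definition fock_inner ::
  "real \<Rightarrow> ('v::euclidean_space \<Rightarrow> 'v \<Rightarrow> real) \<Rightarrow> ('v \<Rightarrow> 'v) \<Rightarrow> ('v \<Rightarrow> complex) \<Rightarrow> ('v \<Rightarrow> complex) \<Rightarrow> complex"
  where
  "fock_inner h \<Omega> j f g = complex_of_real (1 / h ^ (DIM('v) div 2)) *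
     (LINT z|vol (Gform \<Omega> j).
        f z * cnj (g z) * complex_of_real (exp (- Gform \<Omega> j z z / (2 * hbar h))))"

text \<open>Operators on the Fock space are taken to be \<open>undefined\<close> off the space, so that equality of
  such functions is equality of operators.\<close>

definition fock_unitary ::
  "real \<Rightarrow> ('v::euclidean_space \<Rightarrow> 'v \<Rightarrow> real) \<Rightarrow> ('v \<Rightarrow> 'v) \<Rightarrow>
    (('v \<Rightarrow> complex) \<Rightarrow> ('v \<Rightarrow> complex)) set" where
  "fock_unitary h \<Omega> j = {U \<in> extensional (fock h \<Omega> j).
     bij_betw U (fock h \<Omega> j) (fock h \<Omega> j) \<and>
     (\<forall>f\<in>fock h \<Omega> j. \<forall>g\<in>fock h \<Omega> j. U (\<lambda>z. f z + g z) = (\<lambda>z. U f z + U g z)) \<and>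
     (\<forall>c. \<forall>f\<in>fock h \<Omega> j. U (\<lambda>z. c * f z) = (\<lambda>z. c * U f z)) \<and>
     (\<forall>f\<in>fock h \<Omega> j. \<forall>g\<in>fock h \<Omega> j. fock_inner h \<Omega> j (U f) (U g) = fock_inner h \<Omega> j f g)}"

definition heis ::
  "real \<Rightarrow> ('v::euclidean_space \<Rightarrow> 'v \<Rightarrow> real) \<Rightarrow> ('v \<Rightarrow> 'v) \<Rightarrow> 'v \<Rightarrow> real \<Rightarrow>
    ('v \<Rightarrow> complex) \<Rightarrow> ('v \<Rightarrow> complex)" where
  "heis h \<Omega> j v t f = (\<lambda>z.
     exp (- \<i> * t / hbar h + hprod \<Omega> j z v / (2 * hbar h) - hprod \<Omega> j v v / (4 * hbar h)) * f (z - v))"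

definition Mpc ::
  "real \<Rightarrow> ('v::euclidean_space \<Rightarrow> 'v \<Rightarrow> real) \<Rightarrow> ('v \<Rightarrow> 'v) \<Rightarrow>
    ((('v \<Rightarrow> complex) \<Rightarrow> ('v \<Rightarrow> complex)) \<times> ('v \<Rightarrow> 'v)) monoid" where
  "Mpc h \<Omega> j =
    \<lparr>carrier = {(U, g). U \<in> fock_unitary h \<Omega> j \<and> g \<in> Sp \<Omega> \<and>
        (\<forall>v t. \<forall>f\<in>fock h \<Omega> j.
           heis h \<Omega> j (g v) t f = U (heis h \<Omega> j v t (inv_into (fock h \<Omega> j) U f)))},
     mult = (\<lambda>(U\<^sub>1, g\<^sub>1) (U\<^sub>2, g\<^sub>2). (compose (fock h \<Omega> j) U\<^sub>1 U\<^sub>2, g\<^sub>1 \<circ> g\<^sub>2)),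
     one = (restrict id (fock h \<Omega> j), id)\<rparr>"

definition mpc_proj :: "'u \<times> ('v \<Rightarrow> 'v) \<Rightarrow> 'v \<Rightarrow> 'v" where
  "mpc_proj m = snd m"

definition coherent ::
  "real \<Rightarrow> ('v \<Rightarrow> 'v \<Rightarrow> real) \<Rightarrow> ('v \<Rightarrow> 'v) \<Rightarrow> 'v \<Rightarrow> 'v \<Rightarrow> complex" where
  "coherent h \<Omega> j v = (\<lambda>z. exp (hprod \<Omega> j z v / (2 * hbar h)))"

definition parameters ::
  "real \<Rightarrow> ('v::euclidean_space \<Rightarrow> 'v \<Rightarrow> real) \<Rightarrow> ('v \<Rightarrow> 'v) \<Rightarrow>
    (('v \<Rightarrow> complex) \<Rightarrow> ('v \<Rightarrow> complex)) \<times> ('v \<Rightarrow> 'v) \<Rightarrow> ('v \<Rightarrow> 'v) \<times> complex" where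
  "parameters h \<Omega> j m = (snd m, fst m (coherent h \<Omega> j 0) 0)"


section \<open>Endomorphisms of subspaces\<close>

text \<open>In this section \<open>s\<close> is a scalar multiplication making the ambient type a vector space, and
  \<open>W\<close> is a subspace for \<open>s\<close>.\<close>

definition End_on :: "('a \<Rightarrow> 'w::ab_group_add \<Rightarrow> 'w) \<Rightarrow> 'w set \<Rightarrow> ('w \<Rightarrow> 'w) set" where
  "End_on s W = {x \<in> W \<rightarrow>\<^sub>E W.
     (\<forall>p\<in>W. \<forall>q\<in>W. x (p + q) = x p + x q) \<and> (\<forall>c. \<forall>p\<in>W. x (s c p) = s c (x p))}"

definition Det_on :: "('a::field \<Rightarrow> 'w::ab_group_add \<Rightarrow> 'w) \<Rightarrow> 'w set \<Rightarrow> ('w \<Rightarrow> 'w) \<Rightarrow> 'a" where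
  "Det_on s W x =
    (let bs = (SOME bs. distinct bs \<and> \<not> module.dependent s (set bs) \<and> module.span s (set bs) = W)
     in Determinant.det (Matrix.mat (length bs) (length bs)
          (\<lambda>(i, k). module.representation s (set bs) (x (bs ! k)) (bs ! i))))"

text \<open>The adjoint with respect to \<open>B\<close>: the transpose for an inner product, the Hermitean adjoint
  for a Hermitean one.\<close>

definition adjoint_on :: "'w set \<Rightarrow> ('w \<Rightarrow> 'w \<Rightarrow> 'a) \<Rightarrow> ('w \<Rightarrow> 'w) \<Rightarrow> 'w \<Rightarrow> 'w" where
  "adjoint_on W B x = (\<lambda>p\<in>W. THE q. q \<in> W \<and> (\<forall>r\<in>W. B q r = B p (x r)))"

text \<open>\<open>S\<close> may have empty interior.  It will be relatively open in a linear subspace \<open>E\<close>; there the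
  derivative within \<open>S\<close> is determined on \<open>E\<close>, and requiring that some choice of it be
  of class \<open>C\<^sup>k\<close> is the usual notion for functions on an open subset of \<open>E\<close>.\<close>

primrec Ck_on ::
  "nat \<Rightarrow> 'e::real_normed_vector set \<Rightarrow> ('e \<Rightarrow> 'b::real_normed_vector) \<Rightarrow> bool" where
  "Ck_on 0 S f \<longleftrightarrow> continuous_on S f"
| "Ck_on (Suc k) S f \<longleftrightarrow>
     (\<exists>f'. (\<forall>x\<in>S. (f has_derivative f' x) (at x within S)) \<and> (\<forall>v. Ck_on k S (\<lambda>x. f' x v)))"

text \<open>Smoothness of a function on a set \<open>S\<close> of endomorphisms of \<open>W\<close>: the endomorphisms of \<open>W\<close> are a
  quotient, by restriction, of a linear subspace of the normed space of operators on the ambient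
  space, and the function is smooth if its pullback is.\<close>

definition smooth_on_End ::
  "'w::real_normed_vector set \<Rightarrow> ('w \<Rightarrow> 'w) set \<Rightarrow> (('w \<Rightarrow> 'w) \<Rightarrow> complex) \<Rightarrow> bool" where
  "smooth_on_End W S a \<longleftrightarrow>
     (\<forall>k. Ck_on k {X :: 'w \<Rightarrow>\<^sub>L 'w. restrict (blinfun_apply X) W \<in> S}
            (\<lambda>X. a (restrict (blinfun_apply X) W)))"


section \<open>The complexification of a real subspace\<close>

text \<open>The complexification of \<open>F\<close> is \<open>F \<times> F\<close>, the pair \<open>(u, w)\<close> standing for \<open>u + \<i> w\<close>.\<close>

definition cx_scale :: "complex \<Rightarrow> 'v::real_vector \<times> 'v \<Rightarrow> 'v \<times> 'v" where
  "cx_scale c p = (Re c *\<^sub>R fst p - Im c *\<^sub>R snd p, Re c *\<^sub>R snd p + Im c *\<^sub>R fst p)"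

lemma vector_space_cx_scale: "vector_space cx_scale"
  by unfold_locales (auto simp: cx_scale_def prod_eq_iff algebra_simps)

text \<open>The endomorphism \<open>X + \<i> Y\<close> of the complexification, for real endomorphisms \<open>X\<close>, \<open>Y\<close>.\<close>

definition cx_end ::
  "'v::real_vector set \<Rightarrow> ('v \<Rightarrow> 'v) \<Rightarrow> ('v \<Rightarrow> 'v) \<Rightarrow> 'v \<times> 'v \<Rightarrow> 'v \<times> 'v" where
  "cx_end F X Y = (\<lambda>(u, w)\<in>F \<times> F. (X u - Y w, X w + Y u))"

text \<open>The Hermitean extension of \<open>B\<close>, complex linear in the first argument.\<close>

definition herm_ext :: "('v \<Rightarrow> 'v \<Rightarrow> real) \<Rightarrow> 'v \<times> 'v \<Rightarrow> 'v \<times> 'v \<Rightarrow> complex" where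
  "herm_ext B p q = Complex (B (fst p) (fst q) + B (snd p) (snd q))
                            (B (snd p) (fst q) - B (fst p) (snd q))"

definition pos_real_part :: "('v::real_vector \<Rightarrow> 'v \<Rightarrow> real) \<Rightarrow> 'v set \<Rightarrow> ('v \<times> 'v \<Rightarrow> 'v \<times> 'v) set" where
  "pos_real_part B F = {x \<in> End_on cx_scale (F \<times> F).
     \<forall>p\<in>F \<times> F. p \<noteq> 0 \<longrightarrow>
       Re (herm_ext B ((1/2) *\<^sub>R (x p + adjoint_on (F \<times> F) (herm_ext B) x p)) p) > 0}"

definition a_F ::
  "('v::euclidean_space \<Rightarrow> 'v \<Rightarrow> real) \<Rightarrow> 'v set \<Rightarrow> ('v \<times> 'v \<Rightarrow> 'v \<times> 'v) \<Rightarrow> complex" where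
  "a_F B F = (THE a. a \<in> extensional (pos_real_part B F) \<and>
     smooth_on_End (F \<times> F) (pos_real_part B F) a \<and>
     (\<forall>x\<in>pos_real_part B F. Det_on cx_scale (F \<times> F) x = exp (a x)) \<and>
     a (restrict id (F \<times> F)) = 0)"


section \<open>The factor \<open>f_F\<close>\<close>

definition F_component :: "('v::real_vector \<Rightarrow> 'v) \<Rightarrow> 'v set \<Rightarrow> 'v \<Rightarrow> 'v" where
  "F_component j F v = (THE u. u \<in> F \<and> (\<exists>w\<in>F. v = u + j w))"

definition S_map :: "('v::real_vector \<Rightarrow> 'v) \<Rightarrow> 'v set \<Rightarrow> ('v \<Rightarrow> 'v) \<Rightarrow> 'v \<Rightarrow> 'v" where
  "S_map j F g = (\<lambda>v\<in>F. THE s. s \<in> F \<and> restrict g F s = F_component j F (g (j v)))"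

definition f_F ::
  "('v::euclidean_space \<Rightarrow> 'v \<Rightarrow> real) \<Rightarrow> ('v \<Rightarrow> 'v) \<Rightarrow> 'v set \<Rightarrow> ('v \<Rightarrow> 'v) \<Rightarrow> complex" where
  "f_F \<Omega> j F g =
    (let A = restrict g F;
         AT = adjoint_on F (Gform \<Omega> j) A;
         R = inv_into F (\<lambda>v. AT (A v));
         x = cx_end F (\<lambda>v. (1/2) *\<^sub>R (v + R v)) (\<lambda>v. - (1/2) *\<^sub>R S_map j F g v)
     in complex_of_real (\<bar>Det_on scaleR F A\<bar> powr (- 1/2)) * exp (- (1/2) * a_F (Gform \<Omega> j) F x))"

end

theory Submission
  imports Defs "HOL-Probability.Probability" "HOL-Complex_Analysis.Complex_Analysis"
begin

text \<open>An orthonormal basis of \<open>F\<close> identifies \<open>V = F + jF\<close> with pairs of real coordinate vectors. In the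
  Schroedinger model on functions of the coordinates of \<open>jF\<close>, the subspace \<open>F\<close> acts by phases and \<open>jF\<close> by
  translations; an element \<open>g\<close> of the stabiliser of \<open>F\<close> is block triangular and acts by a linear substitution, a
  quadratic phase and the scalar \<open>|Det A\<^sub>g| powr (1/2)\<close>. No Fourier transform occurs, so this action is a
  true representation, and the Bargmann transform moves it to the Fock space.

  Only the continuous functions with Gaussian decay are needed from \<open>L\<^sup>2\<close>: the Fock space has a
  reproducing kernel \<open>e\<^sub>v\<close>, and a unitary operator is determined by, and can be constructed from, the images
  of the kernel functions.

  The parameter \<open>\<lambda>\<close> of \<open>g\<close> is then the matrix coefficient of \<open>g\<close> at the Gaussian representing \<open>e\<^sub>0\<close>, a complex
  Gaussian integral equal to a power \<open>-1/2\<close> of a determinant; the branch is found by deforming the exponent to a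
  real one, which is how \<open>a\<^sub>F\<close> is normalised. Finally, a unitary operator commuting with the Heisenberg group
  sends \<open>e\<^sub>0\<close> to a function that is both holomorphic and conjugate to a holomorphic one, so it is a scalar,
  and equal parameters (which do not vanish) force the scalar 1.\<close>

text \<open>The delicate point is the branch of the square root. On the Fock side, multiplicativity
  of the factor is an identity between logarithms of several determinants. On the Schroedinger side
  the scalar is the positive root of \<open>|Det A_g|\<close>, which is visibly multiplicative, so
  \<open>a_F\<close> is met only once, in the evaluation of one Gaussian integral for a fixed
  \<open>g\<close>. There the matrices in question lie in a convex set containing the identity.
  Along the segment from the identity, the integral and the exponential of \<open>- a_F / 2\<close>
  have, up to a constant, the same square; both are continuous and they agree at the starting point.
  The two models are compared through Gram matrices: the Gaussians \<open>b v\<close> have the same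
  inner products as the kernel functions \<open>e v\<close>. A family of vectors with the right Gram
  matrix already determines a unitary operator on the Fock space. Completeness is thus used only on
  the side where limits of functions are again genuine functions, because point evaluations are
  continuous there.\<close>

hide_const (open) Determinant.det Matrix.mat
no_notation fps_nth (infixl "$" 75)
no_notation Matrix.vec_index (infixl "$" 100)
no_notation Matrix.scalar_prod (infix "\<bullet>" 70)

section \<open>Lebesgue measure in linear coordinates\<close>

text \<open>A type with \<open>n\<close> elements when the dimension is \<open>2 * n\<close>, so that \<open>real ^ 'a half_index\<close> can serve as
  the coordinate space of a Lagrangian subspace. The order is what the change of variables theorem of
  the library asks for.\<close>

typedef (overloaded) ('a::euclidean_space) half_index = "{i::nat. i < max 1 (DIM('a) div 2)}"
  by (rule exI[of _ 0]) auto

lemma card_half_index: "CARD('a::euclidean_space half_index) = max 1 (DIM('a) div 2)"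
  using type_definition.card[OF type_definition_half_index] by simp

instance half_index :: (euclidean_space) finite
proof
  show "finite (UNIV :: 'a half_index set)"
    using card_half_index[where 'a='a] by (intro card_ge_0_finite) simp
qed

instantiation half_index :: (euclidean_space) wellorder
begin

definition "x \<le> y \<longleftrightarrow> Rep_half_index x \<le> Rep_half_index y"
definition "x < y \<longleftrightarrow> Rep_half_index x < Rep_half_index y"

instance
proof
  fix P :: "'a half_index \<Rightarrow> bool" and a :: "'a half_index"
  assume *: "\<And>x. (\<And>y. y < x \<Longrightarrow> P y) \<Longrightarrow> P x"
  show "P a"
    by (induction a rule: measure_induct_rule[of Rep_half_index])
      (rule *, simp add: less_half_index_def)
qed (auto simp: less_eq_half_index_def less_half_index_def Rep_half_index_inject)

end

text \<open>Two measures are compared on boxes: the preimage of a box under \<open>f\<close> is its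
  image under the inverse map \<open>g\<close>, whose volume is multiplied by
  \<open>|det g|\<close>, and \<open>det f * det g = 1\<close>.\<close>

lemma lborel_linear_vec:
  fixes f :: "real^'n::{finite,wellorder} \<Rightarrow> real^'n::_"
  assumes f: "linear f" and det: "det (matrix f) \<noteq> 0"
  shows "lborel = density (distr lborel borel f) (\<lambda>_. ennreal \<bar>det (matrix f)\<bar>)"
proof (rule lborel_eqI)
  fix l u :: "real^'n::{finite,wellorder}"
  assume le: "\<And>b. b \<in> Basis \<Longrightarrow> l \<bullet> b \<le> u \<bullet> b"
  have [measurable]: "f \<in> borel_measurable borel"
    using f by (simp add: borel_measurable_continuous_onI linear_continuous_on linear_conv_bounded_linear)
  have "inj f" "surj f"
    using det f by (auto simp: det_nz_iff_inj linear_injective_imp_surjective)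
  then obtain g where g: "linear g" "f \<circ> g = id" "g \<circ> f = id"
    using f linear_injective_left_inverse linear_inverse_left
    by (metis linear_surjective_right_inverse)
  have vim: "f -` box l u = g ` box l u"
    using g(2,3) by (auto simp: fun_eq_iff image_iff vimage_def) (metis)
  have dg: "det (matrix f) * det (matrix g) = 1"
    using matrix_compose[OF g(1) f] g(2) by (metis det_I det_mul matrix_id_mat_1)
  have lm: "box l u \<in> lmeasurable" by simp
  have fin: "emeasure lborel (g ` box l u) = ennreal (measure lebesgue (g ` box l u))"
  proof -
    have "g ` box l u \<in> lmeasurable" using measurable_linear_image[OF g(1) lm] .
    then have "emeasure lebesgue (g ` box l u) = ennreal (measure lebesgue (g ` box l u))"
      by (simp add: emeasure_eq_measure2 fmeasurableD2)
    moreover have "f -` box l u \<in> sets borel"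
      using measurable_sets[of f borel borel "box l u"] by simp
    ultimately show ?thesis by (simp add: vim)
  qed
  have "emeasure (density (distr lborel borel f) (\<lambda>_. ennreal \<bar>det (matrix f)\<bar>)) (box l u)
      = ennreal \<bar>det (matrix f)\<bar> * emeasure lborel (f -` box l u)"
    by (subst emeasure_density_const) (auto simp: emeasure_distr)
  also have "\<dots> = ennreal (\<bar>det (matrix f)\<bar> * (\<bar>det (matrix g)\<bar> * measure lebesgue (box l u)))"
    using measure_linear_image[OF g(1) lm] by (simp add: vim fin ennreal_mult)
  also have "\<bar>det (matrix f)\<bar> * (\<bar>det (matrix g)\<bar> * measure lebesgue (box l u)) = measure lebesgue (box l u)"
    using dg by (metis abs_1 abs_mult mult.assoc mult_1)
  also have "ennreal \<dots> = ennreal (\<Prod>b\<in>Basis. (u - l) \<bullet> b)"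
    using le by (subst measure_completion) (auto simp: emeasure_lborel_box_eq measure_def prod_nonneg inner_diff_left)
  finally show "emeasure (density (distr lborel borel f) (\<lambda>_. ennreal \<bar>det (matrix f)\<bar>)) (box l u)
      = (\<Prod>b\<in>Basis. (u - l) \<bullet> b)" .
qed simp

lemma
  fixes f :: "real^'n::{finite,wellorder} \<Rightarrow> real^'n::_" and h :: "real^'n::_ \<Rightarrow> 'b::{banach,second_countable_topology}"
  assumes f: "linear f" and det: "det (matrix f) \<noteq> 0" and [measurable]: "h \<in> borel_measurable borel"
  shows integral_lborel_linear_vec: "(LINT x|lborel. h (f x)) = (1 / \<bar>det (matrix f)\<bar>) *\<^sub>R (LINT x|lborel. h x)"
    and integrable_lborel_linear_vec: "integrable lborel (\<lambda>x. h (f x)) \<longleftrightarrow> integrable lborel h"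
proof -
  have [measurable]: "f \<in> borel_measurable borel"
    using f by (simp add: borel_measurable_continuous_onI linear_continuous_on linear_conv_bounded_linear)
  have "(LINT x|lborel. h x) = \<bar>det (matrix f)\<bar> *\<^sub>R (LINT x|lborel. h (f x))"
    by (subst lborel_linear_vec[OF f det]) (simp add: integral_density integral_distr)
  then show "(LINT x|lborel. h (f x)) = (1 / \<bar>det (matrix f)\<bar>) *\<^sub>R (LINT x|lborel. h x)"
    using det by simp
  have "integrable lborel h \<longleftrightarrow> integrable lborel (\<lambda>x. \<bar>det (matrix f)\<bar> *\<^sub>R h (f x))"
    by (subst lborel_linear_vec[OF f det]) (simp add: integrable_density integrable_distr_eq)
  then show "integrable lborel (\<lambda>x. h (f x)) \<longleftrightarrow> integrable lborel h"
    using det integrable_scaleR_right[of "1 / \<bar>det (matrix f)\<bar>" lborel "\<lambda>x. \<bar>det (matrix f)\<bar> *\<^sub>R h (f x)"]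
    by auto
qed

text \<open>Each coordinate of \<open>f x\<close> is a coordinate of \<open>x\<close>, so the
  preimage of a box is a box with the same side lengths in another order. This carries Lebesgue
  measure between different types of equal dimension.\<close>

lemma lborel_basis_bij:
  fixes f :: "'a::euclidean_space \<Rightarrow> 'b::euclidean_space"
  assumes f: "linear f" and bij: "bij_betw f Basis Basis"
  shows "distr lborel borel f = lborel"
proof (rule lborel_eqI[symmetric])
  fix l u :: 'b
  assume le: "\<And>b. b \<in> Basis \<Longrightarrow> l \<bullet> b \<le> u \<bullet> b"
  have [measurable]: "f \<in> borel_measurable borel"
    using f by (simp add: borel_measurable_continuous_onI linear_continuous_on linear_conv_bounded_linear)
  have fb: "f b \<in> Basis" if "b \<in> Basis" for b using bij that by (auto simp: bij_betw_def)
  have ff: "f x \<bullet> f b = x \<bullet> b" if b: "b \<in> Basis" for x b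
  proof -
    have "f x = f (\<Sum>c\<in>Basis. (x \<bullet> c) *\<^sub>R c)" by (simp add: euclidean_representation)
    also have "\<dots> = (\<Sum>c\<in>Basis. (x \<bullet> c) *\<^sub>R f c)"
      by (simp add: linear_sum[OF f] linear_cmul[OF f])
    finally have "f x \<bullet> f b = (\<Sum>c\<in>Basis. (x \<bullet> c) * (f c \<bullet> f b))" by (simp add: inner_sum_left)
    also have "\<dots> = (\<Sum>c\<in>Basis. (x \<bullet> c) * (if c = b then 1 else 0))"
      using bij b fb by (intro sum.cong refl) (auto simp: inner_Basis bij_betw_def inj_on_def)
    also have "\<dots> = x \<bullet> b" using b by (simp add: sum.delta if_distrib cong: if_cong)
    finally show ?thesis .
  qed
  define p where "p v = (\<Sum>b\<in>Basis. (v \<bullet> f b) *\<^sub>R b)" for v :: 'b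
  have p: "p v \<bullet> b = v \<bullet> f b" if "b \<in> Basis" for v b
    using that by (simp add: p_def inner_sum_left inner_Basis sum.delta if_distrib cong: if_cong)
  have img: "f ` Basis = Basis" using bij by (simp add: bij_betw_def)
  have vim: "f -` box l u = box (p l) (p u)"
    unfolding box_def vimage_def by (subst img[symmetric]) (auto simp: ff p)
  have "emeasure (distr lborel borel f) (box l u) = emeasure lborel (box (p l) (p u))"
    by (subst emeasure_distr) (auto simp: vim)
  also have "\<dots> = ennreal (\<Prod>b\<in>Basis. (p u - p l) \<bullet> b)"
    using le fb by (subst emeasure_lborel_box) (auto simp: p inner_diff_left prod_ennreal)
  also have "(\<Prod>b\<in>Basis. (p u - p l) \<bullet> b) = (\<Prod>b\<in>Basis. (u - l) \<bullet> f b)"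
    by (intro prod.cong refl) (simp add: p inner_diff_left)
  also have "\<dots> = (\<Prod>b\<in>Basis. (u - l) \<bullet> b)"
    using prod.reindex_bij_betw[OF bij, of "\<lambda>b. (u - l) \<bullet> b"] by simp
  finally show "emeasure (distr lborel borel f) (box l u) = ennreal (\<Prod>b\<in>Basis. (u - l) \<bullet> b)" .
qed simp

lemma basis_bij_exists:
  fixes A :: "'a::euclidean_space itself" and B :: "'b::euclidean_space itself"
  assumes "DIM('a) = DIM('b)"
  obtains f :: "'a \<Rightarrow> 'b" where "linear f" "bij_betw f Basis Basis" "\<And>x y. f x \<bullet> f y = x \<bullet> y"
proof -
  obtain h where h: "bij_betw h (Basis::'a set) (Basis::'b set)"
    using finite_same_card_bij[OF finite_Basis finite_Basis assms] by blast
  define f :: "'a \<Rightarrow> 'b" where "f x = (\<Sum>b\<in>Basis. (x \<bullet> b) *\<^sub>R h b)" for x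
  have fb: "f b = h b" if "b \<in> Basis" for b
    using that by (simp add: f_def inner_Basis if_distrib[of "\<lambda>t. t *\<^sub>R _"] cong: if_cong)
  have lin: "linear f" unfolding f_def
    by (intro linearI) (simp_all add: inner_add_left scaleR_add_left sum.distrib scaleR_sum_right)
  have bij: "bij_betw f Basis Basis" using h fb by (simp cong: bij_betw_cong)
  have hh: "h b \<bullet> h c = (if b = c then 1 else 0)" if "b \<in> Basis" "c \<in> Basis" for b c
  proof -
    have "h b \<in> Basis" "h c \<in> Basis" using h that by (auto simp: bij_betw_def)
    then show ?thesis using h that by (auto simp: inner_Basis bij_betw_def inj_on_def)
  qed
  have "f x \<bullet> f y = x \<bullet> y" for x y
  proof -
    have "f x \<bullet> f y = (\<Sum>b\<in>Basis. \<Sum>c\<in>Basis. (x \<bullet> b) * (y \<bullet> c) * (if c = b then 1 else 0))"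
      unfolding f_def inner_sum_left inner_sum_right
      by (subst sum.swap) (intro sum.cong refl, simp add: hh)
    also have "\<dots> = (\<Sum>b\<in>Basis. (x \<bullet> b) * (y \<bullet> b))"
      by (simp add: if_distrib cong: if_cong)
    also have "\<dots> = x \<bullet> y" by (rule euclidean_inner[symmetric])
    finally show ?thesis .
  qed
  with lin bij that show ?thesis by blast
qed

text \<open>An orthogonal matrix has determinant of modulus 1. The maps \<open>s\<close> and
  \<open>t\<close>, which match standard bases, turn \<open>Q\<close> into such a matrix
  \<open>P\<close> on a coordinate space.\<close>

lemma lborel_isometry:
  fixes Q :: "'a::euclidean_space \<Rightarrow> 'b::euclidean_space"
  assumes Q: "linear Q" "\<And>x y. Q x \<bullet> Q y = x \<bullet> y" and dim: "DIM('a) = DIM('b)"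
  shows "distr lborel borel Q = lborel"
proof -
  \<comment> \<open>The product type doubles the dimension, so halving it again gives a well-ordered
    index type with exactly \<open>DIM('a)\<close> elements.\<close>
  have c: "CARD(('a \<times> 'a) half_index) = DIM('a)"
    using DIM_positive[where 'a='a] by (simp add: card_half_index del: DIM_positive)
  obtain s :: "real^(('a \<times> 'a) half_index) \<Rightarrow> 'a"
    where s: "linear s" "bij_betw s Basis Basis" "\<And>x y. s x \<bullet> s y = x \<bullet> y"
    by (rule basis_bij_exists[where 'a="real^(('a \<times> 'a) half_index)" and 'b='a]) (simp_all add: c)
  obtain t :: "'b \<Rightarrow> real^(('a \<times> 'a) half_index)"
    where t: "linear t" "bij_betw t Basis Basis" "\<And>x y. t x \<bullet> t y = x \<bullet> y"
    by (rule basis_bij_exists[where 'b="real^(('a \<times> 'a) half_index)" and 'a='b]) (simp_all add: c dim)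
  define P where "P = t \<circ> Q \<circ> s"
  have P: "linear P" "\<And>x y. P x \<bullet> P y = x \<bullet> y"
    unfolding P_def using s t Q by (auto intro: linear_compose)
  then have "orthogonal_transformation P" by (simp add: orthogonal_transformation_def)
  then have "orthogonal_matrix (matrix P)" by (simp add: orthogonal_transformation_matrix)
  then have d: "\<bar>det (matrix P)\<bar> = 1" using det_orthogonal_matrix by fastforce
  have meas: "f \<in> borel_measurable borel" if "linear f" for f :: "'x::euclidean_space \<Rightarrow> 'y::euclidean_space"
    using that by (simp add: borel_measurable_continuous_onI linear_continuous_on linear_conv_bounded_linear)
  note [measurable] = meas[OF s(1)] meas[OF t(1)] meas[OF Q(1)] meas[OF P(1)]
  have dP: "distr lborel borel P = lborel"
  proof -
    have "det (matrix P) \<noteq> 0" using d by auto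
    from lborel_linear_vec[OF P(1) this] show ?thesis using d by (simp add: density_1)
  qed
  obtain t' where t': "linear t'" "t' \<circ> t = id" 
    using linear_injective_left_inverse[OF t(1)] t(3)
    by (metis (no_types, lifting) inj_onI inner_eq_zero_iff linear_injective_0 t(1))
  note [measurable] = meas[OF t'(1)]
  have "distr lborel borel t = lborel" using lborel_basis_bij[OF t(1,2)] .
  then have t'l: "distr (lborel) borel t' = (lborel :: 'b measure)"
  proof -
    have "distr (distr lborel borel t) borel t' = distr lborel borel (t' \<circ> t)"
      by (subst distr_distr) auto
    also have "\<dots> = lborel" using t'(2) by (simp add: distr_id2 id_def)
    finally show ?thesis using \<open>distr lborel borel t = lborel\<close> by simp
  qed
  have "distr lborel borel Q = distr (distr lborel borel s) borel Q"
    using lborel_basis_bij[OF s(1,2)] by simp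
  also have "\<dots> = distr lborel borel (t' \<circ> P)"
  proof -
    have "t' \<circ> P = Q \<circ> s" using t'(2) by (auto simp: P_def fun_eq_iff)
    then show ?thesis by (subst distr_distr) auto
  qed
  also have "\<dots> = distr (distr lborel borel P) borel t'"
    by (subst distr_distr) auto
  also have "\<dots> = lborel" by (simp add: dP t'l)
  finally show ?thesis .
qed

section \<open>Gaussian integrals and the Plancherel formula\<close>

lemma
  fixes f :: "'e::euclidean_space \<Rightarrow> 'b::{banach,second_countable_topology}"
  assumes c: "c \<noteq> 0" and [measurable]: "f \<in> borel_measurable borel"
  shows integral_lborel_affine: "(LINT x|lborel. f (t + c *\<^sub>R x)) = (1 / \<bar>c\<bar> ^ DIM('e)) *\<^sub>R (LINT x|lborel. f x)"
    and integrable_lborel_affine: "integrable lborel (\<lambda>x. f (t + c *\<^sub>R x)) \<longleftrightarrow> integrable lborel f"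
proof -
  have "(LINT x|lborel. f x) = \<bar>c\<bar> ^ DIM('e) *\<^sub>R (LINT x|lborel. f (t + c *\<^sub>R x))"
    by (subst lborel_affine[OF c, of t]) (simp add: integral_density integral_distr)
  then show "(LINT x|lborel. f (t + c *\<^sub>R x)) = (1 / \<bar>c\<bar> ^ DIM('e)) *\<^sub>R (LINT x|lborel. f x)"
    using c by simp
  have "integrable lborel f \<longleftrightarrow> integrable lborel (\<lambda>x. \<bar>c\<bar> ^ DIM('e) *\<^sub>R f (t + c *\<^sub>R x))"
    by (subst lborel_affine[OF c, of t]) (simp add: integrable_density integrable_distr_eq)
  then show "integrable lborel (\<lambda>x. f (t + c *\<^sub>R x)) \<longleftrightarrow> integrable lborel f"
    using c integrable_scaleR_right[of "1 / \<bar>c\<bar> ^ DIM('e)" lborel "\<lambda>x. \<bar>c\<bar> ^ DIM('e) *\<^sub>R f (t + c *\<^sub>R x)"]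
    by auto
qed

lemma
  fixes f :: "'e::euclidean_space \<Rightarrow> 'b::{banach,second_countable_topology}"
  assumes "f \<in> borel_measurable borel"
  shows integral_lborel_reflect: "(LINT x|lborel. f (t - x)) = (LINT x|lborel. f x)"
    and integrable_lborel_reflect: "integrable lborel (\<lambda>x. f (t - x)) \<longleftrightarrow> integrable lborel f"
    and integral_lborel_shift: "(LINT x|lborel. f (x - t)) = (LINT x|lborel. f x)"
    and integrable_lborel_shift: "integrable lborel (\<lambda>x. f (x - t)) \<longleftrightarrow> integrable lborel f"
  using integral_lborel_affine[of "-1" f t] integrable_lborel_affine[of "-1" f t]
    integral_lborel_affine[of 1 f "-t"] integrable_lborel_affine[of 1 f "-t"] assms by simp_all

text \<open>Only the real part of \<open>s\<close> is absorbed by completing the square, which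
  recentres at \<open>t = \<sigma> / (2 * a)\<close>. The scale \<open>b\<close> turns the quadratic
  term into that of the standard normal density, and the imaginary part of \<open>s\<close> survives
  as a frequency; the characteristic function of the normal law gives the value.\<close>

lemma
  fixes a :: real and s :: complex
  assumes a: "0 < a"
  shows gaussian_integral_real: "(LINT x|lborel. exp (- complex_of_real (a * x\<^sup>2) + s * complex_of_real x)) =
      complex_of_real (sqrt (pi / a)) * exp (s\<^sup>2 / (4 * a))" (is ?I)
    and gaussian_integrable_real: "integrable lborel (\<lambda>x. exp (- complex_of_real (a * x\<^sup>2) + s * complex_of_real x))" (is ?J)
proof -
  define b where "b = 1 / sqrt (2 * a)"
  define \<sigma> \<tau> where "\<sigma> = Re s" and "\<tau> = Im s"
  have s: "s = complex_of_real \<sigma> + \<i> * complex_of_real \<tau>" by (simp add: \<sigma>_def \<tau>_def complex_eq_iff)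
  have b: "b \<noteq> 0" "b > 0" "2 * a * b\<^sup>2 = 1" using a by (auto simp: b_def power_divide)
  define t where "t = \<sigma> / (2 * a)"
  define K where "K = complex_of_real (sqrt (2 * pi)) * exp (complex_of_real (\<sigma>\<^sup>2 / (4 * a)) + \<i> * complex_of_real (\<tau> * t))"
  have eq: "exp (- complex_of_real (a * (t + b * y)\<^sup>2) + s * complex_of_real (t + b * y)) =
      K * (std_normal_density y *\<^sub>R iexp ((\<tau> * b) * y))" for y
  proof -
    have e1: "- (a * (t + b * y)\<^sup>2) + \<sigma> * (t + b * y) = \<sigma>\<^sup>2 / (4 * a) - y\<^sup>2 / 2"
    proof -
      have "- (a * (t + b * y)\<^sup>2) + \<sigma> * (t + b * y)
         = - (a * t\<^sup>2) + \<sigma> * t + (\<sigma> - 2 * a * t) * (b * y) - (2 * a * b\<^sup>2) * y\<^sup>2 / 2"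
        by (simp add: power2_eq_square algebra_simps)
      also have "\<dots> = - (a * t\<^sup>2) + \<sigma> * t - y\<^sup>2 / 2" using a by (simp add: b t_def)
      also have "- (a * t\<^sup>2) + \<sigma> * t = \<sigma>\<^sup>2 / (4 * a)"
        using a by (simp add: t_def power2_eq_square field_simps)
      finally show ?thesis .
    qed
    have "- complex_of_real (a * (t + b * y)\<^sup>2) + s * complex_of_real (t + b * y) =
       complex_of_real (- (a * (t + b * y)\<^sup>2) + \<sigma> * (t + b * y)) + \<i> * complex_of_real (\<tau> * (t + b * y))"
      unfolding s by (simp add: algebra_simps)
    also have "\<dots> = (complex_of_real (\<sigma>\<^sup>2 / (4 * a)) + \<i> * complex_of_real (\<tau> * t))
        + complex_of_real (- y\<^sup>2 / 2) + \<i> * complex_of_real ((\<tau> * b) * y)"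
      unfolding e1 by (simp add: algebra_simps)
    finally have "exp (- complex_of_real (a * (t + b * y)\<^sup>2) + s * complex_of_real (t + b * y)) =
      exp (complex_of_real (\<sigma>\<^sup>2 / (4 * a)) + \<i> * complex_of_real (\<tau> * t)) * complex_of_real (exp (- y\<^sup>2 / 2)) * iexp ((\<tau> * b) * y)"
      by (simp only: exp_add exp_of_real)
    then show ?thesis by (simp add: K_def std_normal_density_def scaleR_conv_of_real)
  qed
  have int: "integrable lborel (\<lambda>y. std_normal_density y *\<^sub>R iexp ((\<tau> * b) * y))"
  proof (rule Bochner_Integration.integrable_bound[of _ std_normal_density])
    show "integrable lborel std_normal_density" by simp
    show "AE x in lborel. norm (std_normal_density x *\<^sub>R iexp (\<tau> * b * x)) \<le> norm (std_normal_density x)"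
      by (simp add: norm_mult)
  qed simp
  have "(LINT y|lborel. std_normal_density y *\<^sub>R iexp ((\<tau> * b) * y)) = char std_normal_distribution (\<tau> * b)"
    unfolding char_def by (subst integral_density) auto
  also have "\<dots> = complex_of_real (exp (- (\<tau>\<^sup>2 / (4 * a))))"
  proof -
    have "(\<tau> * b)\<^sup>2 / 2 = \<tau>\<^sup>2 / (4 * a)" using a by (simp add: b_def power_mult_distrib power_divide)
    then show ?thesis by (simp add: char_std_normal_distribution)
  qed
  finally have c: "(LINT y|lborel. std_normal_density y *\<^sub>R iexp ((\<tau> * b) * y)) = complex_of_real (exp (- (\<tau>\<^sup>2 / (4 * a))))" .
  have "(LINT x|lborel. exp (- complex_of_real (a * x\<^sup>2) + s * complex_of_real x)) =
    \<bar>b\<bar> *\<^sub>R (LINT y|lborel. exp (- complex_of_real (a * (t + b * y)\<^sup>2) + s * complex_of_real (t + b * y)))"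
    by (rule lborel_integral_real_affine[OF b(1)])
  also have "\<dots> = complex_of_real b * K * complex_of_real (exp (- (\<tau>\<^sup>2 / (4 * a))))"
    unfolding eq using c b(2) by (simp add: scaleR_conv_of_real)
  also have "\<dots> = complex_of_real (b * sqrt (2 * pi)) *
      exp (complex_of_real (\<sigma>\<^sup>2 / (4 * a)) + \<i> * complex_of_real (\<tau> * t) + complex_of_real (- (\<tau>\<^sup>2 / (4 * a))))"
    by (simp only: K_def exp_add exp_of_real of_real_mult mult_ac)
  also have "b * sqrt (2 * pi) = sqrt (pi / a)"
    by (simp add: b_def flip: real_sqrt_divide)
  also have "complex_of_real (\<sigma>\<^sup>2 / (4 * a)) + \<i> * complex_of_real (\<tau> * t) + complex_of_real (- (\<tau>\<^sup>2 / (4 * a))) = s\<^sup>2 / (4 * a)"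
    unfolding s t_def using a by (simp add: power2_sum power_mult_distrib field_simps) 
  finally show ?I .
  have "integrable lborel (\<lambda>y. exp (- complex_of_real (a * (t + b * y)\<^sup>2) + s * complex_of_real (t + b * y)))"
    unfolding eq by (rule integrable_mult_right[OF int])
  then show ?J by (subst (asm) lborel_integrable_real_affine_iff[OF b(1)])
qed

lemma lborel_eq_PiM_Basis:
  "(lborel :: 'e::euclidean_space measure) = distr (\<Pi>\<^sub>M b\<in>Basis. lborel) borel (\<lambda>f. \<Sum>b\<in>Basis. f b *\<^sub>R b)"
  by (subst lborel_def) (simp add: lborel_eq_real)

lemma
  fixes f :: "'e::euclidean_space \<Rightarrow> real \<Rightarrow> complex"
  assumes int: "\<And>b. b \<in> Basis \<Longrightarrow> integrable lborel (f b)"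
  shows integral_lborel_prod: "(LINT x|lborel. (\<Prod>b\<in>Basis. f b (x \<bullet> b))) = (\<Prod>b\<in>Basis. LINT x|lborel. f b x)"
    and integrable_lborel_prod: "integrable (lborel::'e measure) (\<lambda>x. (\<Prod>b\<in>Basis. f b (x \<bullet> b)))"
proof -
  interpret product_sigma_finite "\<lambda>_::'e. lborel :: real measure" ..
  have [measurable]: "f b \<in> borel_measurable borel" if "b \<in> Basis" for b
    using borel_measurable_integrable[OF int[OF that]] by simp
  have [measurable]: "(\<lambda>x. (\<Prod>b\<in>Basis. f b (x \<bullet> b))) \<in> borel_measurable borel"
    by measurable
  have s: "(\<Prod>b\<in>Basis. f b ((\<Sum>c\<in>Basis. g c *\<^sub>R c) \<bullet> b)) = (\<Prod>b\<in>Basis. f b (g b))" for g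
    by (intro prod.cong refl) (simp add: inner_sum_left inner_Basis if_distrib cong: if_cong)
  have [measurable]: "(\<lambda>g. \<Sum>b\<in>Basis. g b *\<^sub>R b) \<in> (\<Pi>\<^sub>M b\<in>Basis. lborel) \<rightarrow>\<^sub>M (borel :: 'e measure)"
    by measurable
  show "(LINT x|lborel. (\<Prod>b\<in>Basis. f b (x \<bullet> b))) = (\<Prod>b\<in>Basis. LINT x|lborel. f b x)"
    by (subst lborel_eq_PiM_Basis, subst integral_distr) (simp_all add: s product_integral_prod int)
  show "integrable (lborel::'e measure) (\<lambda>x. (\<Prod>b\<in>Basis. f b (x \<bullet> b)))"
    by (subst lborel_eq_PiM_Basis, subst integrable_distr_eq) (simp_all add: s product_integrable_prod int)
qed

text \<open>The integrand is a product over the coordinates. The exponents add up to the complex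
  bilinear square of \<open>\<sigma> + i \<tau>\<close>, not to a Hermitean norm; this is where the
  cross term comes from.\<close>

lemma
  fixes a :: real and \<sigma> \<tau> :: "'e::euclidean_space"
  assumes a: "0 < a"
  shows gaussian_integral: "(LINT x|lborel. exp (complex_of_real (- a * (x \<bullet> x) + \<sigma> \<bullet> x) + \<i> * complex_of_real (\<tau> \<bullet> x))) =
      complex_of_real (sqrt (pi / a) ^ DIM('e)) *
      exp ((complex_of_real (\<sigma> \<bullet> \<sigma> - \<tau> \<bullet> \<tau>) + 2 * \<i> * complex_of_real (\<sigma> \<bullet> \<tau>)) / (4 * a))" (is ?I)
    and gaussian_integrable: "integrable lborel (\<lambda>x. exp (complex_of_real (- a * (x \<bullet> x) + \<sigma> \<bullet> x) + \<i> * complex_of_real (\<tau> \<bullet> x)))" (is ?J)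
proof -
  define s where "s b = Complex (\<sigma> \<bullet> b) (\<tau> \<bullet> b)" for b :: 'e
  define f where "f b y = exp (- complex_of_real (a * y\<^sup>2) + s b * complex_of_real y)" for b :: 'e and y
  have int: "integrable lborel (f b)" for b
    using gaussian_integrable_real[OF a, of "s b"] by (simp add: f_def[abs_def])
  have val: "(LINT y|lborel. f b y) = complex_of_real (sqrt (pi / a)) * exp ((s b)\<^sup>2 / (4 * a))" for b
    unfolding f_def by (rule gaussian_integral_real[OF a])
  have eq: "exp (complex_of_real (- a * (x \<bullet> x) + \<sigma> \<bullet> x) + \<i> * complex_of_real (\<tau> \<bullet> x)) = (\<Prod>b\<in>Basis. f b (x \<bullet> b))" for x
  proof -
    have "complex_of_real (- a * (x \<bullet> x) + \<sigma> \<bullet> x) + \<i> * complex_of_real (\<tau> \<bullet> x) =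
      (\<Sum>b\<in>Basis. - complex_of_real (a * (x \<bullet> b)\<^sup>2) + s b * complex_of_real (x \<bullet> b))"
      by (subst (1 2 3) euclidean_inner)
        (simp add: sum_distrib_left sum.distrib[symmetric] s_def Complex_eq power2_eq_square algebra_simps
          flip: sum_negf sum_subtractf)
    then show ?thesis by (simp add: f_def exp_sum)
  qed
  have ss: "(\<Sum>b\<in>Basis. (s b)\<^sup>2) = complex_of_real (\<sigma> \<bullet> \<sigma> - \<tau> \<bullet> \<tau>) + 2 * \<i> * complex_of_real (\<sigma> \<bullet> \<tau>)"
    by (subst (1 2 3) euclidean_inner)
      (simp add: complex_eq_iff s_def power2_eq_square Re_sum Im_sum sum_subtractf sum_distrib_left algebra_simps sum.distrib)
  show ?I unfolding eq by (subst integral_lborel_prod[OF int])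
      (simp add: val prod.distrib exp_sum[symmetric] ss sum_divide_distrib[symmetric])
  show ?J unfolding eq by (rule integrable_lborel_prod[OF int])
qed

lemma
  fixes a :: real
  assumes a: "0 < a"
  shows gaussian_integral_norm: "(LINT x::'e|lborel. exp (- a * (x \<bullet> x))) = sqrt (pi / a) ^ DIM('e)"
    and gaussian_integrable_norm: "integrable lborel (\<lambda>x::'e::euclidean_space. exp (- a * (x \<bullet> x)))"
proof -
  have eq: "exp (complex_of_real (- a * (x \<bullet> x) + 0 \<bullet> x) + \<i> * complex_of_real (0 \<bullet> x)) = complex_of_real (exp (- a * (x \<bullet> x)))" for x :: 'e
    by (simp flip: exp_of_real)
  have "integrable lborel (\<lambda>x::'e. complex_of_real (exp (- a * (x \<bullet> x))))"
    using gaussian_integrable[OF a, of "0::'e" 0] unfolding eq .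
  then show *: "integrable lborel (\<lambda>x::'e. exp (- a * (x \<bullet> x)))" by (simp only: complex_of_real_integrable_eq)
  have "(LINT x::'e|lborel. complex_of_real (exp (- a * (x \<bullet> x)))) = complex_of_real (sqrt (pi / a) ^ DIM('e))"
    using gaussian_integral[OF a, of "0::'e" 0] unfolding eq by simp
  then show "(LINT x::'e|lborel. exp (- a * (x \<bullet> x))) = sqrt (pi / a) ^ DIM('e)"
    by (simp only: integral_complex_of_real of_real_eq_iff flip: of_real_power)
qed

section \<open>Differentiation under the integral sign for exponential integrands\<close>

text \<open>The Taylor remainder of \<open>exp (L w \<eta>)\<close> is quadratic in
  \<open>L w \<eta>\<close>. Of the available factor \<open>exp (2 * r * \<l> w)\<close>, one half
  bounds the exponential of the real part for \<open>norm \<eta> \<le> r\<close>, and the other half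
  absorbs the square of \<open>r * \<l> w\<close>. What is left is a constant times the square of
  \<open>norm \<eta>\<close>.\<close>

lemma exp_integral_has_derivative_0:
  fixes L :: "'w \<Rightarrow> 'e::real_normed_vector \<Rightarrow> complex" and \<psi> :: "'w \<Rightarrow> complex"
  assumes lin: "\<And>w. linear (L w)" and bnd: "\<And>w \<eta>. cmod (L w \<eta>) \<le> \<l> w * norm \<eta>" and pos: "\<And>w. 0 \<le> \<l> w"
    and [measurable]: "\<psi> \<in> borel_measurable M" "\<And>\<eta>. (\<lambda>w. L w \<eta>) \<in> borel_measurable M"
    and r: "0 < r" and int: "integrable M (\<lambda>w. cmod (\<psi> w) * exp (2 * r * \<l> w))"
  shows "((\<lambda>\<eta>. LINT w|M. \<psi> w * exp (L w \<eta>)) has_derivative (\<lambda>\<eta>. LINT w|M. \<psi> w * L w \<eta>)) (at 0)"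
    and "bounded_linear (\<lambda>\<eta>. LINT w|M. \<psi> w * L w \<eta>)"
    and "integrable M \<psi>"
proof -
  define E where "E w = cmod (\<psi> w) * exp (2 * r * \<l> w)" for w
  have E: "integrable M E" unfolding E_def using int .
  have l1: "r * \<l> w \<le> exp (r * \<l> w)" for w using exp_ge_add_one_self[of "r * \<l> w"] by linarith
  have l2: "(r * \<l> w)\<^sup>2 \<le> 2 * exp (r * \<l> w)" for w
    using exp_lower_Taylor_quadratic[of "r * \<l> w"] pos r by (simp add: field_simps power2_eq_square)
      (smt (verit) mult_nonneg_nonneg pos)
  have ee: "exp (r * \<l> w) \<le> exp (2 * r * \<l> w)" for w using pos r by simp
  show ip: "integrable M \<psi>"
    by (rule Bochner_Integration.integrable_bound[OF E])
      (use r pos in \<open>auto simp: E_def mult_le_cancel_left1\<close>)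
  have b1: "norm (\<psi> w * L w \<eta>) \<le> norm (E w * (norm \<eta> / r))" for w \<eta>
  proof -
    have "cmod (L w \<eta>) \<le> (r * \<l> w) * (norm \<eta> / r)" using bnd r by simp
    also have "\<dots> \<le> exp (2 * r * \<l> w) * (norm \<eta> / r)"
      using order_trans[OF l1 ee] r by (intro mult_right_mono) auto
    finally have "cmod (\<psi> w) * cmod (L w \<eta>) \<le> cmod (\<psi> w) * (exp (2 * r * \<l> w) * (norm \<eta> / r))"
      by (rule mult_left_mono) simp
    then show ?thesis using r by (simp add: norm_mult E_def mult_ac)
  qed
  have i1: "integrable M (\<lambda>w. \<psi> w * L w \<eta>)" for \<eta>
    by (rule Bochner_Integration.integrable_bound[OF integrable_mult_left[OF E, of "norm \<eta> / r"]]) (use b1 in auto)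
  have b2: "norm (\<psi> w * (exp (L w \<eta>) - 1 - L w \<eta>)) \<le> E w * ((norm \<eta>)\<^sup>2 * (2 / r\<^sup>2))" if \<eta>: "norm \<eta> \<le> r" for w \<eta>
  proof -
    have "cmod (exp (L w \<eta>) - 1 - L w \<eta>) \<le> exp \<bar>Re (L w \<eta>)\<bar> * (cmod (L w \<eta>))\<^sup>2"
      using Taylor_exp[of "L w \<eta>" 1] by (simp add: diff_diff_eq power2_eq_square)
    also have "\<dots> \<le> exp (r * \<l> w) * (\<l> w * norm \<eta>)\<^sup>2"
    proof (rule mult_mono)
      have "\<bar>Re (L w \<eta>)\<bar> \<le> \<l> w * norm \<eta>" using abs_Re_le_cmod bnd order_trans by blast
      also have "\<dots> \<le> \<l> w * r" using \<eta> pos by (intro mult_left_mono) auto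
      finally show "exp \<bar>Re (L w \<eta>)\<bar> \<le> exp (r * \<l> w)" by (simp add: mult.commute)
    qed (use bnd in \<open>auto intro!: power_mono\<close>)
    also have "\<dots> = exp (r * \<l> w) * (r * \<l> w)\<^sup>2 * ((norm \<eta>)\<^sup>2 / r\<^sup>2)"
      using r by (simp add: power_mult_distrib)
    also have "\<dots> \<le> exp (r * \<l> w) * (2 * exp (r * \<l> w)) * ((norm \<eta>)\<^sup>2 / r\<^sup>2)"
      using l2 by (intro mult_right_mono mult_left_mono) auto
    also have "\<dots> = exp (2 * r * \<l> w) * ((norm \<eta>)\<^sup>2 * (2 / r\<^sup>2))"
      by (simp add: mult_exp_exp)
    finally have "cmod (\<psi> w) * cmod (exp (L w \<eta>) - 1 - L w \<eta>) \<le> cmod (\<psi> w) * (exp (2 * r * \<l> w) * ((norm \<eta>)\<^sup>2 * (2 / r\<^sup>2)))"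
      by (rule mult_left_mono) simp
    then show ?thesis by (simp add: norm_mult E_def mult_ac)
  qed
  have i2: "integrable M (\<lambda>w. \<psi> w * (exp (L w \<eta>) - 1 - L w \<eta>))" if "norm \<eta> \<le> r" for \<eta>
    by (rule Bochner_Integration.integrable_bound[OF integrable_mult_left[OF E, of "(norm \<eta>)\<^sup>2 * (2 / r\<^sup>2)"]])
      (use order_trans[OF b2[OF that] abs_ge_self] in auto)
  show bl: "bounded_linear (\<lambda>\<eta>. LINT w|M. \<psi> w * L w \<eta>)"
  proof (rule bounded_linear_intro)
    fix x y and c :: real
    show "(LINT w|M. \<psi> w * L w (x + y)) = (LINT w|M. \<psi> w * L w x) + (LINT w|M. \<psi> w * L w y)"
      by (subst Bochner_Integration.integral_add[OF i1 i1, symmetric]) (simp add: linear_add[OF lin] algebra_simps)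
    show "(LINT w|M. \<psi> w * L w (c *\<^sub>R x)) = c *\<^sub>R (LINT w|M. \<psi> w * L w x)"
      by (subst integral_scaleR_right[symmetric]) (simp add: linear_cmul[OF lin])
    have "norm (LINT w|M. \<psi> w * L w x) \<le> (LINT w|M. E w * (norm x / r))"
    proof (rule order_trans[OF integral_norm_bound integral_mono])
      show "norm (\<psi> w * L w x) \<le> E w * (norm x / r)" for w
        using b1[of w x] r by (simp add: E_def)
    qed (intro integrable_norm i1 integrable_mult_left E)+
    also have "\<dots> = norm x * ((LINT w|M. E w) / r)" by simp
    finally show "norm (LINT w|M. \<psi> w * L w x) \<le> norm x * ((LINT w|M. E w) / r)" .
  qed
  have key: "norm ((LINT w|M. \<psi> w * exp (L w \<eta>)) - (LINT w|M. \<psi> w) - (LINT w|M. \<psi> w * L w \<eta>))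
      \<le> (LINT w|M. E w) * (2 / r\<^sup>2) * (norm \<eta>)\<^sup>2" if \<eta>: "norm \<eta> \<le> r" for \<eta>
  proof -
    have e: "\<psi> w * exp (L w \<eta>) = \<psi> w * (exp (L w \<eta>) - 1 - L w \<eta>) + \<psi> w + \<psi> w * L w \<eta>" for w
      by (simp add: algebra_simps)
    have "(LINT w|M. \<psi> w * exp (L w \<eta>)) = (LINT w|M. \<psi> w * (exp (L w \<eta>) - 1 - L w \<eta>)) + (LINT w|M. \<psi> w) + (LINT w|M. \<psi> w * L w \<eta>)"
      unfolding e using i1 i2[OF \<eta>] ip by simp
    then have "norm ((LINT w|M. \<psi> w * exp (L w \<eta>)) - (LINT w|M. \<psi> w) - (LINT w|M. \<psi> w * L w \<eta>))
       = norm (LINT w|M. \<psi> w * (exp (L w \<eta>) - 1 - L w \<eta>))" by simp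
    also have "\<dots> \<le> (LINT w|M. E w * ((norm \<eta>)\<^sup>2 * (2 / r\<^sup>2)))"
      by (rule order_trans[OF integral_norm_bound integral_mono])
        (use b2[OF \<eta>] in \<open>auto intro!: integrable_norm i2[OF \<eta>] integrable_mult_left E\<close>)
    finally show ?thesis by (simp add: mult_ac)
  qed
  have L0: "L w 0 = 0" for w using linear_0[OF lin] .
  define K where "K = (LINT w|M. E w) * (2 / r\<^sup>2)"
  show "((\<lambda>\<eta>. LINT w|M. \<psi> w * exp (L w \<eta>)) has_derivative (\<lambda>\<eta>. LINT w|M. \<psi> w * L w \<eta>)) (at 0)"
    unfolding has_derivative_at
  proof (intro conjI bl)
    show "(\<lambda>h. norm ((LINT w|M. \<psi> w * exp (L w (0 + h))) - (LINT w|M. \<psi> w * exp (L w 0)) - (LINT w|M. \<psi> w * L w h)) / norm h) \<midarrow>0\<rightarrow> 0"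
    proof (rule Lim_null_comparison)
      show "\<forall>\<^sub>F h in at 0. norm (norm ((LINT w|M. \<psi> w * exp (L w (0 + h))) - (LINT w|M. \<psi> w * exp (L w 0)) - (LINT w|M. \<psi> w * L w h)) / norm h) \<le> K * norm h"
        unfolding eventually_at
      proof (intro exI conjI ballI impI)
        show "0 < r" by fact
        fix h :: 'e assume h: "h \<noteq> 0 \<and> dist h 0 < r"
        then have "norm ((LINT w|M. \<psi> w * exp (L w h)) - (LINT w|M. \<psi> w) - (LINT w|M. \<psi> w * L w h)) \<le> K * norm h * norm h"
          using key[of h] by (simp add: K_def power2_eq_square mult_ac)
        then show "norm (norm ((LINT w|M. \<psi> w * exp (L w (0 + h))) - (LINT w|M. \<psi> w * exp (L w 0)) - (LINT w|M. \<psi> w * L w h)) / norm h) \<le> K * norm h"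
          using h by (simp add: L0 divide_le_eq)
      qed
      have "((\<lambda>h::'e. K * norm h) \<longlongrightarrow> K * norm (0::'e)) (at 0)" by (intro tendsto_intros)
      then show "((\<lambda>h::'e. K * norm h) \<longlongrightarrow> 0) (at 0)" by simp
    qed
  qed
qed

text \<open>Merging \<open>exp (L w z)\<close> into \<open>\<psi>\<close> moves the base point to 0.
  This costs a factor \<open>exp (norm z * \<l> w)\<close>, and \<open>z\<close> is arbitrary; hence
  integrability is asked for every \<open>K\<close>.\<close>

lemma exp_integral_has_derivative:
  fixes L :: "'w \<Rightarrow> 'e::real_normed_vector \<Rightarrow> complex" and \<psi> :: "'w \<Rightarrow> complex"
  assumes lin: "\<And>w. linear (L w)" and bnd: "\<And>w \<eta>. cmod (L w \<eta>) \<le> \<l> w * norm \<eta>" and pos: "\<And>w. 0 \<le> \<l> w"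
    and [measurable]: "\<psi> \<in> borel_measurable M" "\<And>\<eta>. (\<lambda>w. L w \<eta>) \<in> borel_measurable M" "\<l> \<in> borel_measurable M"
    and int: "\<And>K. integrable M (\<lambda>w. cmod (\<psi> w) * exp (K * \<l> w))"
  shows "((\<lambda>z. LINT w|M. \<psi> w * exp (L w z)) has_derivative (\<lambda>\<eta>. LINT w|M. \<psi> w * exp (L w z) * L w \<eta>)) (at z)"
proof -
  have ex: "integrable M (\<lambda>w. cmod (\<psi> w * exp (L w z)) * exp (2 * 1 * \<l> w))"
  proof (rule Bochner_Integration.integrable_bound[OF int[of "norm z + 2"]])
    have "exp (Re (L w z)) * exp (2 * \<l> w) \<le> exp ((norm z + 2) * \<l> w)" for w
      using order_trans[OF complex_Re_le_cmod bnd[of w z]] by (simp add: mult_exp_exp algebra_simps)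
    then show "AE w in M. norm (cmod (\<psi> w * exp (L w z)) * exp (2 * 1 * \<l> w)) \<le> norm (cmod (\<psi> w) * exp ((norm z + 2) * \<l> w))"
      by (auto simp: norm_mult abs_mult mult.assoc intro!: mult_left_mono)
  qed simp
  have "((\<lambda>\<eta>. LINT w|M. (\<psi> w * exp (L w z)) * exp (L w \<eta>)) has_derivative (\<lambda>\<eta>. LINT w|M. (\<psi> w * exp (L w z)) * L w \<eta>)) (at 0)"
    by (rule exp_integral_has_derivative_0(1)[OF lin bnd pos _ _ _ ex]) auto
  moreover have "(LINT w|M. (\<psi> w * exp (L w z)) * exp (L w \<eta>)) = (LINT w|M. \<psi> w * exp (L w (z + \<eta>)))" for \<eta>
    by (simp add: linear_add[OF lin] exp_add mult.assoc)
  ultimately show ?thesis by (simp add: has_derivative_at)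
qed

lemma borel_measurable_cnj [measurable (raw)]:
  "f \<in> borel_measurable M \<Longrightarrow> (\<lambda>x. cnj (f x)) \<in> borel_measurable M"
  by (rule measurable_compose[OF _ borel_measurable_continuous_onI]) (auto intro: continuous_intros)

section \<open>Continuous functions with Gaussian decay\<close>

text \<open>The decay rate may depend on the function; this keeps the class stable under
  translations and invertible linear substitutions, which both change the rate. Decay makes all
  integrals below absolutely convergent even against exponentials of linear size, and continuity
  gives the limit of the autocorrelation at 0 in the Plancherel formula.\<close>

definition gauss_class :: "('e::euclidean_space \<Rightarrow> complex) set" where
  "gauss_class = {\<psi>. continuous_on UNIV \<psi> \<and> (\<exists>C c. 0 < c \<and> (\<forall>y. cmod (\<psi> y) \<le> C * exp (- c * (y \<bullet> y))))}"

lemma gauss_class_measurable: "\<psi> \<in> gauss_class \<Longrightarrow> \<psi> \<in> borel_measurable borel"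
  by (simp add: gauss_class_def borel_measurable_continuous_onI)

lemma gauss_class_bound:
  assumes "\<psi> \<in> gauss_class"
  obtains C c where "0 < c" "0 < C" "\<And>y. cmod (\<psi> y) \<le> C * exp (- c * (y \<bullet> y))"
proof -
  obtain C c where C: "0 < c" "\<And>y. cmod (\<psi> y) \<le> C * exp (- c * (y \<bullet> y))"
    using assms by (auto simp: gauss_class_def)
  have "C * exp (- c * (y \<bullet> y)) \<le> (\<bar>C\<bar> + 1) * exp (- c * (y \<bullet> y))" for y :: 'a
    by (intro mult_right_mono) auto
  then have "cmod (\<psi> y) \<le> (\<bar>C\<bar> + 1) * exp (- c * (y \<bullet> y))" for y
    using C(2) order_trans by blast
  then show ?thesis using C by (intro that[of c "\<bar>C\<bar> + 1"]) auto
qed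

lemma gauss_class_add:
  assumes "\<psi> \<in> gauss_class" "\<phi> \<in> gauss_class"
  shows "(\<lambda>y. \<psi> y + \<phi> y) \<in> gauss_class"
proof -
  obtain C c D d where C: "0 < c" "0 < C" "\<And>y. cmod (\<psi> y) \<le> C * exp (- c * (y \<bullet> y))"
    and D: "0 < d" "0 < D" "\<And>y. cmod (\<phi> y) \<le> D * exp (- d * (y \<bullet> y))"
    using gauss_class_bound[OF assms(1)] gauss_class_bound[OF assms(2)] by metis
  have "cmod (\<psi> y + \<phi> y) \<le> (C + D) * exp (- min c d * (y \<bullet> y))" for y
  proof -
    have "C * exp (- c * (y \<bullet> y)) \<le> C * exp (- min c d * (y \<bullet> y))"
      using C by (intro mult_left_mono) (auto intro!: mult_right_mono)
    moreover have "D * exp (- d * (y \<bullet> y)) \<le> D * exp (- min c d * (y \<bullet> y))"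
      using D by (intro mult_left_mono) (auto intro!: mult_right_mono)
    ultimately show ?thesis using C(3)[of y] D(3)[of y] norm_triangle_ineq[of "\<psi> y" "\<phi> y"]
      by (simp add: algebra_simps)
  qed
  then show ?thesis using assms C(1) D(1)
    unfolding gauss_class_def
    by (intro CollectI conjI exI[of _ "C + D"] exI[of _ "min c d"] continuous_intros)
      (auto simp: gauss_class_def)
qed

lemma gauss_class_mult:
  assumes "\<psi> \<in> gauss_class" "continuous_on UNIV u" "\<And>y. cmod (u y) \<le> B"
  shows "(\<lambda>y. u y * \<psi> y) \<in> gauss_class"
proof -
  obtain C c where C: "0 < c" "0 < C" "\<And>y. cmod (\<psi> y) \<le> C * exp (- c * (y \<bullet> y))"
    using gauss_class_bound[OF assms(1)] by metis
  have "cmod (u y * \<psi> y) \<le> (B * C) * exp (- c * (y \<bullet> y))" for y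
    using mult_mono[OF assms(3)[of y] C(3)[of y]] order_trans[OF norm_ge_zero assms(3)[of y]]
    by (simp add: norm_mult mult.assoc)
  then show ?thesis using assms C(1)
    unfolding gauss_class_def
    by (intro CollectI conjI exI[of _ "B * C"] exI[of _ c] continuous_intros)
      (auto simp: gauss_class_def)
qed

lemma gauss_class_scale: "\<psi> \<in> gauss_class \<Longrightarrow> (\<lambda>y. c * \<psi> y) \<in> gauss_class"
  by (rule gauss_class_mult[where B="cmod c"]) auto

lemma gauss_class_cnj: "\<psi> \<in> gauss_class \<Longrightarrow> (\<lambda>y. cnj (\<psi> y)) \<in> gauss_class"
  by (auto simp: gauss_class_def intro!: continuous_intros)

text \<open>The square of \<open>K - c * norm y\<close> shows that \<open>K * norm y\<close> is at
  most a constant plus half of the Gaussian exponent; the other half ensures integrability.\<close>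

lemma gauss_class_exp_integrable:
  assumes \<psi>: "\<psi> \<in> gauss_class"
  shows "integrable lborel (\<lambda>y. cmod (\<psi> y) * exp (K * norm y))"
proof -
  obtain C c where C: "0 < c" "0 < C" "\<And>y. cmod (\<psi> y) \<le> C * exp (- c * (y \<bullet> y))"
    using gauss_class_bound[OF \<psi>] by metis
  note [measurable] = gauss_class_measurable[OF \<psi>]
  have b: "cmod (\<psi> y) * exp (K * norm y) \<le> C * exp (K\<^sup>2 / (2 * c)) * exp (- (c / 2) * (y \<bullet> y))" for y
  proof -
    have "K * norm y \<le> K\<^sup>2 / (2 * c) + (c / 2) * (y \<bullet> y)"
    proof -
      have "0 \<le> (K - c * norm y)\<^sup>2 / (2 * c)" using C by simp
      also have "\<dots> = K\<^sup>2 / (2 * c) + (c / 2) * (y \<bullet> y) - K * norm y"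
        using C by (simp add: power2_diff add_divide_distrib diff_divide_distrib power_mult_distrib power2_norm_eq_inner[symmetric])
          (simp add: power2_eq_square)
      finally show ?thesis by simp
    qed
    then have "exp (K * norm y) \<le> exp (K\<^sup>2 / (2 * c)) * exp ((c / 2) * (y \<bullet> y))"
      by (simp add: mult_exp_exp)
    then have "cmod (\<psi> y) * exp (K * norm y) \<le> (C * exp (- c * (y \<bullet> y))) * (exp (K\<^sup>2 / (2 * c)) * exp ((c / 2) * (y \<bullet> y)))"
      using C by (intro mult_mono) auto
    also have "\<dots> = C * exp (K\<^sup>2 / (2 * c)) * (exp (- c * (y \<bullet> y)) * exp ((c / 2) * (y \<bullet> y)))" by simp
    also have "exp (- c * (y \<bullet> y)) * exp ((c / 2) * (y \<bullet> y)) = exp (- (c / 2) * (y \<bullet> y))"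
      by (simp add: mult_exp_exp)
    finally show ?thesis .
  qed
  show ?thesis
    by (rule Bochner_Integration.integrable_bound[OF integrable_mult_right[OF gaussian_integrable_norm[of "c / 2"], of "C * exp (K\<^sup>2 / (2 * c))"]])
      (use C b in \<open>auto simp: abs_mult\<close>)
qed

lemma gauss_class_integrable:
  assumes \<psi>: "\<psi> \<in> gauss_class"
  shows "integrable lborel \<psi>"
  by (rule Bochner_Integration.integrable_bound[OF gauss_class_exp_integrable[OF \<psi>, of 0]])
    (simp_all add: gauss_class_measurable[OF \<psi>])

lemma gauss_class_bounded:
  assumes \<psi>: "\<psi> \<in> gauss_class"
  obtains B where "\<And>y. cmod (\<psi> y) \<le> B"
proof -
  obtain C c where C: "0 < c" "0 < C" "\<And>y. cmod (\<psi> y) \<le> C * exp (- c * (y \<bullet> y))"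
    using gauss_class_bound[OF \<psi>] by metis
  have "C * exp (- c * (y \<bullet> y)) \<le> C * 1" for y :: 'a using C by (intro mult_left_mono) auto
  then show ?thesis using that[of C] C(3) order_trans by fastforce
qed

lemma gauss_class_prod:
  assumes "\<psi> \<in> gauss_class" "\<phi> \<in> gauss_class"
  shows "(\<lambda>y. \<psi> y * \<phi> y) \<in> gauss_class"
proof -
  obtain B where "\<And>y. cmod (\<psi> y) \<le> B" using gauss_class_bounded[OF assms(1)] by blast
  then show ?thesis using assms by (intro gauss_class_mult[where B=B]) (auto simp: gauss_class_def)
qed

text \<open>Translation is paid for with half of the decay rate: \<open>|y - p|^2\<close> is at
  least \<open>|y|^2 / 2 - |p|^2\<close>.\<close>

lemma gauss_class_shift:
  assumes "\<psi> \<in> gauss_class"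
  shows "(\<lambda>y. \<psi> (y - p)) \<in> gauss_class"
proof -
  obtain C c where C: "0 < c" "0 < C" "\<And>y. cmod (\<psi> y) \<le> C * exp (- c * (y \<bullet> y))"
    using gauss_class_bound[OF assms(1)] by metis
  have "cmod (\<psi> (y - p)) \<le> (C * exp (c * (p \<bullet> p))) * exp (- (c / 2) * (y \<bullet> y))" for y
  proof -
    have "0 \<le> (y - 2 *\<^sub>R p) \<bullet> (y - 2 *\<^sub>R p)" by simp
    then have "(y \<bullet> y) / 2 - p \<bullet> p \<le> (y - p) \<bullet> (y - p)"
      by (simp add: inner_diff_left inner_diff_right inner_commute)
    then have "c * ((y \<bullet> y) / 2 - p \<bullet> p) \<le> c * ((y - p) \<bullet> (y - p))" using C by (intro mult_left_mono) auto
    then have "exp (- c * ((y - p) \<bullet> (y - p))) \<le> exp (c * (p \<bullet> p)) * exp (- (c / 2) * (y \<bullet> y))"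
      by (simp add: mult_exp_exp algebra_simps)
    then have "C * exp (- c * ((y - p) \<bullet> (y - p))) \<le> C * (exp (c * (p \<bullet> p)) * exp (- (c / 2) * (y \<bullet> y)))"
      using C by (intro mult_left_mono) auto
    then show ?thesis using C(3)[of "y - p"] by (simp add: mult.assoc)
  qed
  moreover have "continuous_on UNIV (\<lambda>y. \<psi> (y - p))"
    using assms by (auto simp: gauss_class_def intro!: continuous_on_compose2[of UNIV \<psi>] continuous_intros)
  ultimately show ?thesis using C(1) unfolding gauss_class_def
    by (intro CollectI conjI exI[of _ "C * exp (c * (p \<bullet> p))"] exI[of _ "c / 2"]) auto
qed

section \<open>The Plancherel formula by Gaussian regularisation\<close>

text \<open>The squared modulus of \<open>F\<close> is the Fourier transform of the autocorrelation
  of \<open>\<psi>\<close>. Its integral against a wide Gaussian in \<open>q\<close> is an average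
  of the autocorrelation over a narrow Gaussian around 0, where the value is the squared norm. The
  width is then sent to its limit, by dominated convergence on the autocorrelation side and by
  monotone convergence in \<open>q\<close>.\<close>

lemma
  fixes \<psi> :: "'e::euclidean_space \<Rightarrow> complex" and \<kappa> :: real
  defines "F \<equiv> \<lambda>q. LINT y|lborel. \<psi> y * exp (- \<i> * complex_of_real (\<kappa> * (q \<bullet> y)))"
  assumes \<psi>: "\<psi> \<in> gauss_class" and \<kappa>: "0 < \<kappa>"
  shows plancherel_integrable: "integrable lborel (\<lambda>q. (cmod (F q))\<^sup>2)"
    and plancherel_integral: "(LINT q|lborel. (cmod (F q))\<^sup>2) = (2 * pi / \<kappa>) ^ DIM('e) * (LINT y|lborel. (cmod (\<psi> y))\<^sup>2)"
proof -
  note [measurable] = gauss_class_measurable[OF \<psi>]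
  have \<psi>i: "integrable lborel \<psi>" by (rule gauss_class_integrable[OF \<psi>])
  obtain B where B: "\<And>y. cmod (\<psi> y) \<le> B" using gauss_class_bounded[OF \<psi>] by blast
  \<comment> \<open>Autocorrelation of \<open>\<psi>\<close>: its Fourier transform will be
    \<open>F q * cnj (F q)\<close>, and its value at 0 is the squared norm of
    \<open>\<psi>\<close>.\<close>
  define A where "A s = (LINT y|lborel. \<psi> y * cnj (\<psi> (y - s)))" for s
  have Fm[measurable]: "F \<in> borel_measurable borel"
    unfolding F_def by measurable
  have Am[measurable]: "A \<in> borel_measurable borel"
    unfolding A_def by measurable
  have ci: "integrable lborel (\<lambda>s. cnj (\<psi> (y - s)))" for y
    using integrable_lborel_reflect[of "\<lambda>u. cnj (\<psi> u)" y] gauss_class_integrable[OF gauss_class_cnj[OF \<psi>]]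
    by simp
  have jm: "(\<lambda>(y, s). \<psi> y * cnj (\<psi> (y - s)) * exp (- \<i> * complex_of_real (\<kappa> * (q \<bullet> s)))) \<in> borel_measurable (lborel \<Otimes>\<^sub>M lborel)" for q
    by measurable
  have joint: "integrable (lborel \<Otimes>\<^sub>M lborel) (\<lambda>(y, s). \<psi> y * cnj (\<psi> (y - s)) * exp (- \<i> * complex_of_real (\<kappa> * (q \<bullet> s))))" for q
  proof (rule lborel_pair.Fubini_integrable[OF jm])
    have "(LINT s|lborel. norm (case (y, s) of (y, s) \<Rightarrow> \<psi> y * cnj (\<psi> (y - s)) * exp (- \<i> * complex_of_real (\<kappa> * (q \<bullet> s)))))
       = cmod (\<psi> y) * (LINT s|lborel. cmod (\<psi> s))" for y
      using integral_lborel_reflect[of "\<lambda>u. cmod (\<psi> u)" y] by (simp add: norm_mult)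
    then show "integrable lborel (\<lambda>y. LINT s|lborel. norm (case (y, s) of (y, s) \<Rightarrow> \<psi> y * cnj (\<psi> (y - s)) * exp (- \<i> * complex_of_real (\<kappa> * (q \<bullet> s)))))"
      using \<psi>i by simp
    show "AE y in lborel. integrable lborel (\<lambda>s. case (y, s) of (y, s) \<Rightarrow> \<psi> y * cnj (\<psi> (y - s)) * exp (- \<i> * complex_of_real (\<kappa> * (q \<bullet> s))))"
    proof (rule AE_I2)
      fix y
      show "integrable lborel (\<lambda>s. case (y, s) of (y, s) \<Rightarrow> \<psi> y * cnj (\<psi> (y - s)) * exp (- \<i> * complex_of_real (\<kappa> * (q \<bullet> s))))"
        by (rule Bochner_Integration.integrable_bound[OF integrable_mult_right[OF ci, of "\<psi> y" y]])
          (auto simp: norm_mult)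
    qed
  qed
  have P1: "(LINT s|lborel. A s * exp (- \<i> * complex_of_real (\<kappa> * (q \<bullet> s)))) = F q * cnj (F q)" for q
  proof -
    have inner: "(LINT s|lborel. \<psi> y * cnj (\<psi> (y - s)) * exp (- \<i> * complex_of_real (\<kappa> * (q \<bullet> s))))
      = \<psi> y * exp (- \<i> * complex_of_real (\<kappa> * (q \<bullet> y))) * cnj (F q)" for y
    proof -
      have "(LINT s|lborel. \<psi> y * cnj (\<psi> (y - s)) * exp (- \<i> * complex_of_real (\<kappa> * (q \<bullet> s))))
        = (LINT s|lborel. (\<lambda>u. \<psi> y * exp (- \<i> * complex_of_real (\<kappa> * (q \<bullet> y))) * cnj (\<psi> u * exp (- \<i> * complex_of_real (\<kappa> * (q \<bullet> u))))) (y - s))"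
        by (intro Bochner_Integration.integral_cong refl)
          (simp add: exp_cnj inner_diff_right algebra_simps mult_exp_exp flip: exp_add)
      also have "\<dots> = (LINT u|lborel. \<psi> y * exp (- \<i> * complex_of_real (\<kappa> * (q \<bullet> y))) * cnj (\<psi> u * exp (- \<i> * complex_of_real (\<kappa> * (q \<bullet> u)))))"
        by (rule integral_lborel_reflect) measurable
      also have "\<dots> = \<psi> y * exp (- \<i> * complex_of_real (\<kappa> * (q \<bullet> y))) * cnj (F q)"
        by (simp only: F_def integral_mult_right_zero Bochner_Integration.integral_cnj)
      finally show ?thesis .
    qed
    have "(LINT s|lborel. A s * exp (- \<i> * complex_of_real (\<kappa> * (q \<bullet> s))))
      = (LINT s|lborel. LINT y|lborel. \<psi> y * cnj (\<psi> (y - s)) * exp (- \<i> * complex_of_real (\<kappa> * (q \<bullet> s))))"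
      unfolding A_def by simp
    also have "\<dots> = (LINT y|lborel. LINT s|lborel. \<psi> y * cnj (\<psi> (y - s)) * exp (- \<i> * complex_of_real (\<kappa> * (q \<bullet> s))))"
      by (rule lborel_pair.Fubini_integral[OF joint])
    also have "\<dots> = F q * cnj (F q)"
      unfolding inner by (simp only: F_def integral_mult_left_zero)
    finally show ?thesis .
  qed
  have Ai: "integrable lborel A"
  proof -
    have "integrable (lborel \<Otimes>\<^sub>M lborel) (\<lambda>(y, s). \<psi> y * cnj (\<psi> (y - s)))" using joint[of 0] by simp
    from lborel_pair.integrable_snd[OF this] show ?thesis by (simp add: A_def[abs_def])
  qed
  have AB: "cmod (A s) \<le> (LINT y|lborel. cmod (\<psi> y) * B)" for s
    unfolding A_def
  proof (rule order_trans[OF integral_norm_bound integral_mono])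
    show "norm (\<psi> y * cnj (\<psi> (y - s))) \<le> cmod (\<psi> y) * B" for y
      using B by (simp add: norm_mult mult_left_mono)
    then show "integrable lborel (\<lambda>y. norm (\<psi> y * cnj (\<psi> (y - s))))"
      by (intro Bochner_Integration.integrable_bound[OF integrable_mult_left[OF integrable_norm[OF \<psi>i], of B]])
       (auto intro!: AE_I2 order_trans[OF _ abs_ge_self])
  qed (use \<psi>i in simp)
  define n where "n = DIM('e)"
  have Fb: "cmod (F q) \<le> (LINT y|lborel. cmod (\<psi> y))" for q
    unfolding F_def by (rule order_trans[OF integral_norm_bound]) (simp add: norm_mult)
  \<comment> \<open>The Gaussian in \<open>q\<close> makes the double integral absolutely
    convergent, so the order can be exchanged. The resulting Gaussian in \<open>s\<close> has width
    of order \<open>sqrt \<epsilon>\<close> and is rescaled to a fixed one; thereby the powers of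
    \<open>\<epsilon>\<close> cancel and it remains only in the argument of
    \<open>A\<close>.\<close>
  have P2: "(LINT q|lborel. complex_of_real (exp (- (\<epsilon>/2) * (q \<bullet> q))) * (F q * cnj (F q)))
      = complex_of_real ((sqrt (2 * pi) / \<kappa>) ^ n) * (LINT t|lborel. A ((sqrt \<epsilon> / \<kappa>) *\<^sub>R t) * complex_of_real (exp (- (1/2) * (t \<bullet> t))))"
    if \<epsilon>: "0 < \<epsilon>" for \<epsilon>
  proof -
    let ?h = "\<lambda>s q. complex_of_real (exp (- (\<epsilon>/2) * (q \<bullet> q))) * (A s * exp (- \<i> * complex_of_real (\<kappa> * (q \<bullet> s))))"
    have gi: "integrable lborel (\<lambda>q::'e. exp (- (\<epsilon>/2) * (q \<bullet> q)))"
      using \<epsilon> by (intro gaussian_integrable_norm) simp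
    have int: "integrable (lborel \<Otimes>\<^sub>M lborel) (\<lambda>(s, q). ?h s q)"
    proof (rule lborel_pair.Fubini_integrable)
      show "integrable lborel (\<lambda>s. LINT q|lborel. norm (case (s, q) of (s, q) \<Rightarrow> ?h s q))"
        using Ai by (simp add: norm_mult)
      show "AE s in lborel. integrable lborel (\<lambda>q. case (s, q) of (s, q) \<Rightarrow> ?h s q)"
      proof (rule AE_I2)
        fix s
        show "integrable lborel (\<lambda>q. case (s, q) of (s, q) \<Rightarrow> ?h s q)"
          by (rule Bochner_Integration.integrable_bound[OF integrable_mult_left[OF gi, of "cmod (A s)"]])
            (auto simp: norm_mult)
      qed
    qed measurable
    have inner: "(LINT q|lborel. ?h s q) = complex_of_real (sqrt (2 * pi / \<epsilon>) ^ n) * (A s * complex_of_real (exp (- (\<kappa>\<^sup>2 / (2 * \<epsilon>)) * (s \<bullet> s))))" for s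
    proof -
      have "?h s q = A s * exp (complex_of_real (- (\<epsilon>/2) * (q \<bullet> q) + 0 \<bullet> q) + \<i> * complex_of_real ((- \<kappa> *\<^sub>R s) \<bullet> q))" for q
        by (simp only: exp_add exp_of_real inner_zero_left add_0_right) (simp add: inner_commute mult_ac)
      then have "(LINT q|lborel. ?h s q) = A s * (LINT q|lborel. exp (complex_of_real (- (\<epsilon>/2) * (q \<bullet> q) + 0 \<bullet> q) + \<i> * complex_of_real ((- \<kappa> *\<^sub>R s) \<bullet> q)))"
        by (simp only: integral_mult_right_zero)
      also have "(LINT q|lborel. exp (complex_of_real (- (\<epsilon>/2) * (q \<bullet> q) + 0 \<bullet> q) + \<i> * complex_of_real ((- \<kappa> *\<^sub>R s) \<bullet> q)))
        = complex_of_real (sqrt (pi / (\<epsilon>/2)) ^ DIM('e)) * exp ((complex_of_real (0 \<bullet> 0 - (- \<kappa> *\<^sub>R s) \<bullet> (- \<kappa> *\<^sub>R s)) + 2 * \<i> * complex_of_real (0 \<bullet> (- \<kappa> *\<^sub>R s))) / complex_of_real (4 * (\<epsilon>/2)))"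
        using gaussian_integral[of "\<epsilon>/2" "0::'e" "- \<kappa> *\<^sub>R s"] \<epsilon> by simp
      also have "exp ((complex_of_real (0 \<bullet> 0 - (- \<kappa> *\<^sub>R s) \<bullet> (- \<kappa> *\<^sub>R s)) + 2 * \<i> * complex_of_real (0 \<bullet> (- \<kappa> *\<^sub>R s))) / complex_of_real (4 * (\<epsilon>/2)))
        = complex_of_real (exp (- (\<kappa>\<^sup>2 / (2 * \<epsilon>)) * (s \<bullet> s)))"
        by (simp add: power2_eq_square mult.assoc flip: exp_of_real)
      finally show ?thesis by (simp add: n_def mult_ac)
    qed
    have sc: "(LINT s|lborel. A s * complex_of_real (exp (- (\<kappa>\<^sup>2 / (2 * \<epsilon>)) * (s \<bullet> s)))) =
       complex_of_real ((sqrt \<epsilon> / \<kappa>) ^ n) * (LINT t|lborel. A ((sqrt \<epsilon> / \<kappa>) *\<^sub>R t) * complex_of_real (exp (- (1/2) * (t \<bullet> t))))"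
    proof -
      define c where "c = sqrt \<epsilon> / \<kappa>"
      have c: "c > 0" "c \<noteq> 0" "\<kappa>\<^sup>2 / (2 * \<epsilon>) * c\<^sup>2 = 1/2" using \<epsilon> \<kappa> by (auto simp: c_def power_divide)
      have "(LINT t|lborel. (\<lambda>s. A s * complex_of_real (exp (- (\<kappa>\<^sup>2 / (2 * \<epsilon>)) * (s \<bullet> s)))) (0 + c *\<^sub>R t))
        = (1 / \<bar>c\<bar> ^ DIM('e)) *\<^sub>R (LINT s|lborel. A s * complex_of_real (exp (- (\<kappa>\<^sup>2 / (2 * \<epsilon>)) * (s \<bullet> s))))"
        by (rule integral_lborel_affine[OF c(2)]) measurable
      moreover have "- (\<kappa>\<^sup>2 / (2 * \<epsilon>)) * ((0 + c *\<^sub>R t) \<bullet> (0 + c *\<^sub>R t)) = - (1/2) * (t \<bullet> t)" for t :: 'e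
      proof -
        have "- (\<kappa>\<^sup>2 / (2 * \<epsilon>)) * ((0 + c *\<^sub>R t) \<bullet> (0 + c *\<^sub>R t)) = - (\<kappa>\<^sup>2 / (2 * \<epsilon>) * c\<^sup>2) * (t \<bullet> t)"
          by (simp add: power2_eq_square)
        then show ?thesis by (simp only: c(3))
      qed
      ultimately have "(1 / \<bar>c\<bar> ^ DIM('e)) *\<^sub>R (LINT s|lborel. A s * complex_of_real (exp (- (\<kappa>\<^sup>2 / (2 * \<epsilon>)) * (s \<bullet> s))))
        = (LINT t|lborel. A (c *\<^sub>R t) * complex_of_real (exp (- (1/2) * (t \<bullet> t))))"
        by (simp only: add_0_left)
      then have "complex_of_real (c ^ n) * (LINT t|lborel. A (c *\<^sub>R t) * complex_of_real (exp (- (1/2) * (t \<bullet> t))))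
        = complex_of_real (c ^ n) * ((1 / \<bar>c\<bar> ^ DIM('e)) *\<^sub>R (LINT s|lborel. A s * complex_of_real (exp (- (\<kappa>\<^sup>2 / (2 * \<epsilon>)) * (s \<bullet> s)))))"
        by (simp only:)
      also have "\<dots> = (LINT s|lborel. A s * complex_of_real (exp (- (\<kappa>\<^sup>2 / (2 * \<epsilon>)) * (s \<bullet> s))))"
        using c(1) by (simp add: n_def scaleR_conv_of_real)
      finally show ?thesis unfolding c_def ..
    qed
    have "(LINT q|lborel. complex_of_real (exp (- (\<epsilon>/2) * (q \<bullet> q))) * (F q * cnj (F q))) = (LINT q|lborel. LINT s|lborel. ?h s q)"
      by (simp only: P1[symmetric] integral_mult_right_zero)
    also have "\<dots> = (LINT s|lborel. LINT q|lborel. ?h s q)"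
      by (rule lborel_pair.Fubini_integral[OF int])
    also have "\<dots> = complex_of_real (sqrt (2 * pi / \<epsilon>) ^ n) * (complex_of_real ((sqrt \<epsilon> / \<kappa>) ^ n) * (LINT t|lborel. A ((sqrt \<epsilon> / \<kappa>) *\<^sub>R t) * complex_of_real (exp (- (1/2) * (t \<bullet> t)))))"
      unfolding inner integral_mult_right_zero sc ..
    also have "\<dots> = complex_of_real (sqrt (2 * pi / \<epsilon>) ^ n * (sqrt \<epsilon> / \<kappa>) ^ n) * (LINT t|lborel. A ((sqrt \<epsilon> / \<kappa>) *\<^sub>R t) * complex_of_real (exp (- (1/2) * (t \<bullet> t))))"
      by (simp only: of_real_mult mult.assoc)
    also have "sqrt (2 * pi / \<epsilon>) ^ n * (sqrt \<epsilon> / \<kappa>) ^ n = (sqrt (2 * pi) / \<kappa>) ^ n"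
      using \<epsilon> by (simp add: real_sqrt_divide flip: power_mult_distrib)
    finally show ?thesis .
  qed
  have A0: "A 0 = complex_of_real (LINT y|lborel. (cmod (\<psi> y))\<^sup>2)"
    unfolding A_def integral_complex_of_real[symmetric] complex_norm_square diff_zero ..
  define \<epsilon> where "\<epsilon> k = 1 / real (Suc k)" for k
  have \<epsilon>0: "0 < \<epsilon> k" for k by (simp add: \<epsilon>_def)
  have \<epsilon>lim: "\<epsilon> \<longlonglongrightarrow> 0" unfolding \<epsilon>_def using LIMSEQ_inverse_real_of_nat by (simp add: inverse_eq_divide)
  have Alim: "(\<lambda>k. A ((sqrt (\<epsilon> k) / \<kappa>) *\<^sub>R t)) \<longlonglongrightarrow> A 0" for t
    unfolding A_def
  proof (rule integral_dominated_convergence[where w="\<lambda>y. cmod (\<psi> y) * B"])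
    have sl: "(\<lambda>k. y - (sqrt (\<epsilon> k) / \<kappa>) *\<^sub>R t) \<longlonglongrightarrow> y - (sqrt 0 / \<kappa>) *\<^sub>R t" for y
      using \<kappa> by (intro tendsto_intros \<epsilon>lim) auto
    have "isCont \<psi> y" for y using \<psi> by (simp add: gauss_class_def continuous_on_eq_continuous_at)
    then have "(\<lambda>k. \<psi> (y - (sqrt (\<epsilon> k) / \<kappa>) *\<^sub>R t)) \<longlonglongrightarrow> \<psi> y" for y
      using isCont_tendsto_compose[OF _ sl[of y], of \<psi>] by simp
    then show "AE y in lborel. (\<lambda>k. \<psi> y * cnj (\<psi> (y - (sqrt (\<epsilon> k) / \<kappa>) *\<^sub>R t))) \<longlonglongrightarrow> \<psi> y * cnj (\<psi> (y - 0))"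
      unfolding diff_zero by (intro AE_I2 tendsto_mult tendsto_const tendsto_cnj)
    show "AE y in lborel. norm (\<psi> y * cnj (\<psi> (y - (sqrt (\<epsilon> k) / \<kappa>) *\<^sub>R t))) \<le> cmod (\<psi> y) * B" for k
      using B by (auto simp: norm_mult mult_left_mono)
  qed (use \<psi>i in \<open>auto\<close>)
  define C where "C = (LINT y|lborel. cmod (\<psi> y) * B)"
  have lim: "(\<lambda>k. LINT t|lborel. A ((sqrt (\<epsilon> k) / \<kappa>) *\<^sub>R t) * complex_of_real (exp (- (1/2) * (t \<bullet> t))))
     \<longlonglongrightarrow> (LINT t|lborel. A 0 * complex_of_real (exp (- (1/2) * ((t::'e) \<bullet> t))))"
  proof (rule integral_dominated_convergence[where w="\<lambda>t. C * exp (- (1/2) * (t \<bullet> t))"])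
    show "integrable lborel (\<lambda>t::'e. C * exp (- (1/2) * (t \<bullet> t)))"
      by (intro integrable_mult_right gaussian_integrable_norm) simp
    show "AE t in lborel. norm (A ((sqrt (\<epsilon> k) / \<kappa>) *\<^sub>R t) * complex_of_real (exp (- (1/2) * (t \<bullet> t)))) \<le> C * exp (- (1/2) * (t \<bullet> t))" for k
      using AB by (auto simp: norm_mult C_def intro!: mult_right_mono)
    show "AE t in lborel. (\<lambda>k. A ((sqrt (\<epsilon> k) / \<kappa>) *\<^sub>R t) * complex_of_real (exp (- (1/2) * (t \<bullet> t)))) \<longlonglongrightarrow> A 0 * complex_of_real (exp (- (1/2) * (t \<bullet> t)))"
      by (intro AE_I2 tendsto_intros Alim)
  qed measurable
  have gi1: "(LINT t|lborel. A 0 * complex_of_real (exp (- (1/2) * ((t::'e) \<bullet> t)))) = A 0 * complex_of_real (sqrt (2 * pi) ^ n)"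
    using gaussian_integral_norm[of "1/2", where 'e='e] by (simp add: n_def mult.commute)
  define f where "f k q = exp (- (\<epsilon> k/2) * (q \<bullet> q)) * (cmod (F q))\<^sup>2" for k and q :: 'e
  have fi: "integrable lborel (f k)" for k
  proof (rule Bochner_Integration.integrable_bound)
    show "integrable lborel (\<lambda>q::'e. exp (- (\<epsilon> k/2) * (q \<bullet> q)) * (LINT y|lborel. cmod (\<psi> y))\<^sup>2)"
      using \<epsilon>0[of k] by (intro integrable_mult_left gaussian_integrable_norm) simp
    show "AE q in lborel. norm (f k q) \<le> norm (exp (- (\<epsilon> k/2) * (q \<bullet> q)) * (LINT y|lborel. cmod (\<psi> y))\<^sup>2)"
      using Fb by (auto simp: f_def abs_mult intro!: power_mono)
  qed (simp add: f_def[abs_def])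
  have fint: "complex_of_real (LINT q|lborel. f k q) = complex_of_real ((sqrt (2 * pi) / \<kappa>) ^ n) * (LINT t|lborel. A ((sqrt (\<epsilon> k) / \<kappa>) *\<^sub>R t) * complex_of_real (exp (- (1/2) * (t \<bullet> t))))" for k
    unfolding P2[OF \<epsilon>0, symmetric] integral_complex_of_real[symmetric] f_def of_real_mult complex_norm_square ..
  have "(\<lambda>k. complex_of_real (LINT q|lborel. f k q)) \<longlonglongrightarrow> complex_of_real ((sqrt (2 * pi) / \<kappa>) ^ n) * (A 0 * complex_of_real (sqrt (2 * pi) ^ n))"
    unfolding fint gi1[symmetric] by (intro tendsto_intros lim)
  also have "complex_of_real ((sqrt (2 * pi) / \<kappa>) ^ n) * (A 0 * complex_of_real (sqrt (2 * pi) ^ n)) =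
     complex_of_real ((2 * pi / \<kappa>) ^ n * (LINT y|lborel. (cmod (\<psi> y))\<^sup>2))"
  proof -
    have "(sqrt (2 * pi) / \<kappa>) ^ n * sqrt (2 * pi) ^ n = (2 * pi / \<kappa>) ^ n"
      by (simp flip: power_mult_distrib)
    then have "(sqrt (2 * pi) / \<kappa>) ^ n * (I * sqrt (2 * pi) ^ n) = (2 * pi / \<kappa>) ^ n * I" for I
      by (metis mult.assoc mult.commute)
    then show ?thesis unfolding A0 of_real_mult[symmetric] by presburger
  qed
  finally have flim: "(\<lambda>k. LINT q|lborel. f k q) \<longlonglongrightarrow> (2 * pi / \<kappa>) ^ n * (LINT y|lborel. (cmod (\<psi> y))\<^sup>2)"
    by (simp only: tendsto_of_real_iff)
  \<comment> \<open>Integrability of the limit is part of the claim, so monotone rather than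
    dominated convergence is used; since \<open>\<epsilon>\<close> decreases, the damping factors
    increase to 1.\<close>
  have mono: "mono (\<lambda>k. f k q)" for q
  proof (rule monoI)
    fix k l :: nat assume "k \<le> l"
    then have "\<epsilon> l \<le> \<epsilon> k" by (simp add: \<epsilon>_def frac_le)
    then have "\<epsilon> l / 2 * (q \<bullet> q) \<le> \<epsilon> k / 2 * (q \<bullet> q)" by (intro mult_right_mono) auto
    then show "f k q \<le> f l q" by (auto simp: f_def intro!: mult_right_mono)
  qed
  have fl: "(\<lambda>k. f k q) \<longlonglongrightarrow> (cmod (F q))\<^sup>2" for q
  proof -
    have "(\<lambda>k. f k q) \<longlonglongrightarrow> exp (- (0/2) * (q \<bullet> q)) * (cmod (F q))\<^sup>2"
      unfolding f_def by (intro tendsto_intros \<epsilon>lim) auto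
    then show ?thesis by simp
  qed
  have um: "(\<lambda>q. (cmod (F q))\<^sup>2) \<in> borel_measurable lborel" by measurable
  show "integrable lborel (\<lambda>q. (cmod (F q))\<^sup>2)"
    by (rule integrable_monotone_convergence[OF fi _ _ flim um]) (use mono fl in auto)
  show "(LINT q|lborel. (cmod (F q))\<^sup>2) = (2 * pi / \<kappa>) ^ DIM('e) * (LINT y|lborel. (cmod (\<psi> y))\<^sup>2)"
    unfolding n_def[symmetric]
    by (rule integral_monotone_convergence[OF fi _ _ flim um]) (use mono fl in auto)
qed

section \<open>Complex Gaussian determinants\<close>

text \<open>Orthonormal families are independent, so their size is bounded and one of maximal size
  exists. If it did not span \<open>W\<close>, a Gram-Schmidt step on a vector outside the span
  would enlarge it. Positivity is demanded on \<open>W\<close> only, so that the same lemma serves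
  for \<open>V\<close> and for a Lagrangian subspace.\<close>

lemma orthonormal_family_exists:
  fixes B :: "'v::euclidean_space \<Rightarrow> 'v \<Rightarrow> real"
  assumes bil: "bilinear B" and sym: "\<And>x y. B x y = B y x" and W: "subspace W"
    and pos: "\<And>x. x \<in> W \<Longrightarrow> x \<noteq> 0 \<Longrightarrow> B x x > 0"
  obtains b where "b \<subseteq> W" "finite b" "\<And>x y. x \<in> b \<Longrightarrow> y \<in> b \<Longrightarrow> B x y = (if x = y then 1 else 0)"
    "independent b" "span b = W"
proof -
  define P where "P b \<longleftrightarrow> b \<subseteq> W \<and> finite b \<and> (\<forall>x\<in>b. \<forall>y\<in>b. B x y = (if x = y then 1 else 0))" for b
  have lin: "linear (\<lambda>x. B x y)" "linear (B x)" for x y using bil by (auto simp: bilinear_def)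
  have ind: "independent b" if b: "P b" for b
  proof (rule independent_if_scalars_zero)
    show "finite b" using b by (simp add: P_def)
    fix u x assume s: "(\<Sum>x\<in>b. u x *\<^sub>R x) = 0" and x: "x \<in> b"
    have "0 = B (\<Sum>y\<in>b. u y *\<^sub>R y) x" using s linear_0[OF lin(1)] by simp
    also have "\<dots> = (\<Sum>y\<in>b. u y * B y x)"
      by (simp add: linear_sum[OF lin(1)] linear_cmul[OF lin(1)])
    also have "\<dots> = (\<Sum>y\<in>b. u y * (if y = x then 1 else 0))"
      using b x by (intro sum.cong) (auto simp: P_def)
    also have "\<dots> = u x" using b x by (simp add: P_def if_distrib cong: if_cong)
    finally show "u x = 0" by simp
  qed
  have "\<forall>b. P b \<longrightarrow> card b < DIM('v) + 1" using ind independent_bound by fastforce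
  moreover have "P {}" by (simp add: P_def)
  ultimately obtain b where b: "P b" and max: "\<And>c. P c \<Longrightarrow> card c \<le> card b"
    using ex_has_greatest_nat[of P "{}" card "DIM('v) + 1"] by auto
  have "W \<subseteq> span b"
  proof (rule ccontr)
    assume "\<not> W \<subseteq> span b"
    then obtain w where w: "w \<in> W" "w \<notin> span b" by blast
    define u where "u = w - (\<Sum>x\<in>b. B w x *\<^sub>R x)"
    have bW: "b \<subseteq> W" and fin: "finite b" using b by (auto simp: P_def)
    have s: "(\<Sum>x\<in>b. B w x *\<^sub>R x) \<in> span b" by (intro span_sum span_scale span_base)
    have "(\<Sum>x\<in>b. B w x *\<^sub>R x) \<in> W" using bW W by (intro subspace_sum subspace_scale) auto
    then have uW: "u \<in> W" using w W by (auto simp: u_def intro: subspace_diff)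
    have u0: "u \<noteq> 0" using s w by (auto simp: u_def)
    have ux: "B u x = 0" if "x \<in> b" for x
    proof -
      have "B u x = B w x - (\<Sum>y\<in>b. B w y * B y x)"
        by (simp add: u_def linear_diff[OF lin(1)] linear_sum[OF lin(1)] linear_cmul[OF lin(1)])
      also have "(\<Sum>y\<in>b. B w y * B y x) = (\<Sum>y\<in>b. B w y * (if y = x then 1 else 0))"
        using b that by (intro sum.cong) (auto simp: P_def)
      also have "\<dots> = B w x" using fin that by (simp add: if_distrib cong: if_cong)
      finally show ?thesis by simp
    qed
    define e where "e = (1 / sqrt (B u u)) *\<^sub>R u"
    have "B u u > 0" using pos uW u0 by blast
    then have ee: "B e e = 1"
      by (simp add: e_def linear_cmul[OF lin(1)] linear_cmul[OF lin(2)])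
    have ex: "B e x = 0" "B x e = 0" if "x \<in> b" for x
      using ux[OF that] sym by (simp_all add: e_def linear_cmul[OF lin(1)] linear_cmul[OF lin(2)])
    have "e \<notin> b" using ex ee by force
    moreover have "P (insert e b)"
      using b uW W ex ee by (auto simp: P_def e_def intro: subspace_scale)
    ultimately show False using max[of "insert e b"] fin by simp
  qed
  moreover have "span b \<subseteq> W" using b W by (simp add: P_def span_minimal)
  ultimately have "span b = W" by blast
  then show ?thesis using b ind[OF b] unfolding P_def by (intro that[of b]) blast+
qed

lemma bilinear_matrix: "bilinear (\<lambda>x y::real^'m. x \<bullet> (M *v y))"
  unfolding bilinear_def
  by (auto intro!: linearI simp: inner_add_left inner_add_right matrix_vector_right_distrib
      matrix_vector_mult_scaleR)

lemma symmetric_matrix_inner: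
  fixes M :: "real^'m^'m"
  assumes "transpose M = M"
  shows "x \<bullet> (M *v y) = y \<bullet> (M *v x)"
  by (metis assms dot_lmul_matrix inner_commute transpose_matrix_vector)

text \<open>The columns of \<open>T\<close> form a basis orthonormal for the form of
  \<open>M\<close>, that is, \<open>T^T M T\<close> is the identity matrix; the determinant relation
  is its determinant.\<close>

lemma positive_matrix_diagonalizable:
  fixes M :: "real^'m^'m"
  assumes sym: "transpose M = M" and pos: "\<And>y. y \<noteq> 0 \<Longrightarrow> y \<bullet> (M *v y) > 0"
  obtains T :: "real^'m^'m" where "det T ^ 2 * det M = 1" "\<And>x y. (T *v x) \<bullet> (M *v (T *v y)) = x \<bullet> y"
proof -
  obtain b where b: "finite b" "\<And>x y. x \<in> b \<Longrightarrow> y \<in> b \<Longrightarrow> x \<bullet> (M *v y) = (if x = y then 1 else 0)"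
    "independent b" "span b = UNIV"
    by (rule orthonormal_family_exists[OF bilinear_matrix[of M] symmetric_matrix_inner[OF sym] subspace_UNIV pos]) auto
  have "card b = dim (UNIV :: (real^'m) set)"
    using b(3,4) dim_eq_card[of b UNIV] by simp
  then have "card b = CARD('m)" by simp
  then obtain f where f: "bij_betw f (UNIV :: 'm set) b"
    using finite_same_card_bij[of "UNIV :: 'm set" b] b(1) by auto
  define t where "t y = (\<Sum>i\<in>UNIV. (y $ i) *\<^sub>R f i)" for y :: "real^'m"
  have t: "linear t"
    unfolding t_def by (intro linearI) (simp_all add: scaleR_add_left sum.distrib scaleR_sum_right)
  define T where "T = matrix t"
  have Tt: "T *v x = t x" for x unfolding T_def using t by simp
  have fM: "f i \<bullet> (M *v f k) = (if i = k then 1 else 0)" for i k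
    using b(2)[of "f i" "f k"] f by (auto simp: bij_betw_def inj_on_def)
  have tt: "t x \<bullet> (M *v t y) = x \<bullet> y" for x y
  proof -
    have "t x \<bullet> (M *v t y) = (\<Sum>i\<in>UNIV. \<Sum>k\<in>UNIV. x $ i * (y $ k * (f i \<bullet> (M *v f k))))"
      unfolding t_def
      by (simp add: inner_sum_left inner_sum_right linear_sum[OF matrix_vector_mul_linear] matrix_vector_mult_scaleR
          sum_distrib_left) (subst sum.swap, simp add: mult_ac)
    also have "\<dots> = (\<Sum>i\<in>UNIV. x $ i * y $ i)"
      by (simp add: fM if_distrib cong: if_cong)
    finally show ?thesis by (simp add: inner_vec_def)
  qed
  have TT: "(T *v x) \<bullet> (M *v (T *v y)) = x \<bullet> y" for x y by (simp add: Tt tt)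
  have "x \<bullet> ((transpose T ** M ** T) *v y) = x \<bullet> (mat 1 *v y)" for x y
  proof -
    have "x \<bullet> ((transpose T ** M ** T) *v y) = x \<bullet> (transpose T *v (M *v (T *v y)))"
      by (simp only: matrix_vector_mul_assoc matrix_mul_assoc)
    also have "\<dots> = ((M *v (T *v y)) v* T) \<bullet> x"
      by (simp add: inner_commute)
    also have "\<dots> = (T *v x) \<bullet> (M *v (T *v y))"
      by (simp only: dot_lmul_matrix[of _ T x] inner_commute[of "T *v x"])
    finally show ?thesis by (simp add: TT)
  qed
  then have "(transpose T ** M ** T) *v y = mat 1 *v y" for y
    by (metis vector_eq_ldot)
  then have TMT: "transpose T ** M ** T = mat 1" by (simp add: matrix_eq)
  have "det T ^ 2 * det M = 1"
    using arg_cong[OF TMT, of det] by (simp add: det_mul det_transpose power2_eq_square mult_ac)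
  then show ?thesis using that TT by blast
qed

text \<open>The substitution by \<open>T\<close> makes the form standard and produces the factor
  \<open>|det T|\<close>; squaring removes the modulus, and the relation
  \<open>det T ^ 2 * det M = 1\<close> remains. The lower bound for the form is the boundedness of
  \<open>T\<close> read backwards.\<close>

lemma gaussian_matrix_real:
  fixes M :: "real^'m::{finite,wellorder}^'m::_"
  assumes sym: "transpose M = M" and pos: "\<And>y. y \<noteq> 0 \<Longrightarrow> y \<bullet> (M *v y) > 0"
  shows "(LINT y|lborel. exp (- (y \<bullet> (M *v y))))\<^sup>2 * det M = pi ^ CARD('m)"
    and "\<exists>c>0. \<forall>y. c * (y \<bullet> y) \<le> y \<bullet> (M *v y)"
proof -
  obtain T :: "real^'m::_^'m::_" where T: "det T ^ 2 * det M = 1" "\<And>x y. (T *v x) \<bullet> (M *v (T *v y)) = x \<bullet> y"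
    using positive_matrix_diagonalizable[OF sym pos] by metis
  have lin: "linear ((*v) T)" by (rule matrix_vector_mul_linear)
  have mat: "matrix ((*v) T) = T" by simp
  have d: "det (matrix ((*v) T)) \<noteq> 0" using T(1) unfolding mat by auto
  have [measurable]: "(\<lambda>y. exp (- (y \<bullet> (M *v y)))) \<in> borel_measurable borel"
    by (intro borel_measurable_continuous_onI continuous_intros matrix_vector_mult_linear_continuous_on)
  have "(LINT y|lborel. exp (- ((T *v y) \<bullet> (M *v (T *v y))))) =
    (1 / \<bar>det T\<bar>) *\<^sub>R (LINT y|lborel. exp (- (y \<bullet> (M *v y))))"
    using integral_lborel_linear_vec[OF lin d, of "\<lambda>y. exp (- (y \<bullet> (M *v y)))"] unfolding mat by simp
  moreover have "(LINT y|lborel. exp (- ((T *v y) \<bullet> (M *v (T *v y))))) = sqrt pi ^ CARD('m)"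
    unfolding T(2) using gaussian_integral_norm[of 1, where 'e="real^'m::_"] by simp
  ultimately have "(LINT y|lborel. exp (- (y \<bullet> (M *v y)))) = \<bar>det T\<bar> * sqrt pi ^ CARD('m)"
    using d unfolding mat by (simp add: field_simps)
  then have "(LINT y|lborel. exp (- (y \<bullet> (M *v y))))\<^sup>2 * det M = (det T ^ 2 * det M) * (sqrt pi ^ CARD('m))\<^sup>2"
    by (simp add: power_mult_distrib)
  then show "(LINT y|lborel. exp (- (y \<bullet> (M *v y))))\<^sup>2 * det M = pi ^ CARD('m)"
    using T(1) by (simp add: power_mult[symmetric] mult.commute[of _ 2]) (simp add: power_mult)
  have "surj ((*v) T)" using d det_nz_iff_inj[OF lin] linear_injective_imp_surjective[OF lin] by blast
  obtain K where K: "K > 0" "\<And>z. norm (T *v z) \<le> K * norm z"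
    using linear_bounded_pos[OF lin] by (auto simp: mult.commute)
  show "\<exists>c>0. \<forall>y. c * (y \<bullet> y) \<le> y \<bullet> (M *v y)"
  proof (intro exI conjI allI)
    show "0 < 1 / K\<^sup>2" using K by simp
    fix y
    obtain z where z: "y = T *v z" using \<open>surj ((*v) T)\<close> by (metis surjD)
    have "(norm y)\<^sup>2 \<le> K\<^sup>2 * (norm z)\<^sup>2"
      using power_mono[OF K(2)[of z], of 2] by (simp add: z power_mult_distrib)
    then show "1 / K\<^sup>2 * (y \<bullet> y) \<le> y \<bullet> (M *v y)"
      using K(1) by (simp add: z T(2) power2_norm_eq_inner field_simps)
  qed
qed

text \<open>Coercivity at the base point leaves room for complex perturbations of \<open>t\<close>,
  because \<open>q\<close> is at most quadratic. This yields holomorphy in the pencil parameter as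
  well as continuity along a segment.\<close>

lemma gaussian_family_deriv:
  fixes A q :: "'e::euclidean_space \<Rightarrow> complex"
  assumes A: "continuous_on UNIV A" and q: "continuous_on UNIV q" and K: "\<And>y. cmod (q y) \<le> K * (y \<bullet> y)"
    and c: "0 < c" "\<And>y. c * (y \<bullet> y) \<le> Re (A y + t\<^sub>0 * q y)"
  shows "\<exists>D. ((\<lambda>t. LINT y|lborel. exp (- (A y + t * q y))) has_field_derivative D) (at t\<^sub>0)"
proof -
  have [measurable]: "A \<in> borel_measurable borel" "q \<in> borel_measurable borel"
    using A q by (auto intro: borel_measurable_continuous_onI)
  define K' where "K' = max K 1"
  have K': "0 < K'" "\<And>y. cmod (q y) \<le> K' * (y \<bullet> y)"
    by (simp add: K'_def) (rule order_trans[OF K], simp add: K'_def mult_right_mono)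
  \<comment> \<open>With this radius \<open>2 * r * K' = c / 2\<close>, so the perturbed integrand
    still decays at rate \<open>c / 2\<close>.\<close>
  define r where "r = c / (4 * K')"
  define \<psi> where "\<psi> y = exp (- (A y + t\<^sub>0 * q y))" for y
  have [measurable]: "\<psi> \<in> borel_measurable borel" unfolding \<psi>_def by measurable
  have r: "0 < r" using c K' by (simp add: r_def)
  have int: "integrable lborel (\<lambda>y. cmod (\<psi> y) * exp (2 * r * (K' * (y \<bullet> y))))"
  proof (rule Bochner_Integration.integrable_bound)
    show "integrable lborel (\<lambda>y::'e. exp (- (c / 2) * (y \<bullet> y)))"
      using c by (intro gaussian_integrable_norm) simp
    show "AE y in lborel. norm (cmod (\<psi> y) * exp (2 * r * (K' * (y \<bullet> y)))) \<le> norm (exp (- (c / 2) * (y \<bullet> y)))"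
    proof (rule AE_I2)
      fix y
      have "cmod (\<psi> y) * exp (2 * r * (K' * (y \<bullet> y))) = exp (- Re (A y + t\<^sub>0 * q y) + c / 2 * (y \<bullet> y))"
        using K' by (simp add: \<psi>_def r_def mult_exp_exp)
      also have "\<dots> \<le> exp (- (c / 2) * (y \<bullet> y))" using c(2)[of y] by simp
      finally show "norm (cmod (\<psi> y) * exp (2 * r * (K' * (y \<bullet> y)))) \<le> norm (exp (- (c / 2) * (y \<bullet> y)))"
        by (simp add: abs_mult)
    qed
  qed measurable
  have "((\<lambda>\<eta>. LINT y|lborel. \<psi> y * exp (- (\<eta> * q y))) has_derivative (\<lambda>\<eta>. LINT y|lborel. \<psi> y * (- (\<eta> * q y)))) (at 0)"
  proof (rule exp_integral_has_derivative_0(1)[OF _ _ _ _ _ r int])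
    show "linear (\<lambda>\<eta>. - (\<eta> * q y))" for y by (intro linearI) (simp_all add: algebra_simps)
    show "cmod (- (\<eta> * q y)) \<le> K' * (y \<bullet> y) * cmod \<eta>" for y \<eta>
      using mult_right_mono[OF K'(2)[of y], of "cmod \<eta>"] by (simp add: norm_mult mult_ac)
    show "0 \<le> K' * (y \<bullet> y)" for y :: 'e using K' by simp
  qed measurable
  moreover have "(LINT y|lborel. \<psi> y * exp (- (\<eta> * q y))) = (LINT y|lborel. exp (- (A y + (t\<^sub>0 + \<eta>) * q y)))" for \<eta>
    by (simp add: \<psi>_def mult_exp_exp algebra_simps flip: exp_add)
  moreover have "(LINT y|lborel. \<psi> y * (- (\<eta> * q y))) = (- (LINT y|lborel. \<psi> y * q y)) * \<eta>" for \<eta>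
  proof -
    have "(LINT y|lborel. \<psi> y * (- (\<eta> * q y))) = (LINT y|lborel. (- \<eta>) * (\<psi> y * q y))"
      by (intro Bochner_Integration.integral_cong) (auto simp: mult_ac)
    then show ?thesis by simp
  qed
  ultimately have "((\<lambda>\<eta>. LINT y|lborel. exp (- (A y + (t\<^sub>0 + \<eta>) * q y))) has_field_derivative (- (LINT y|lborel. \<psi> y * q y))) (at 0)"
    unfolding has_field_derivative_def by (simp only: mult_commute_abs)
  then have "((\<lambda>t. LINT y|lborel. exp (- (A y + t * q y))) has_field_derivative (- (LINT y|lborel. \<psi> y * q y))) (at t\<^sub>0)"
    using DERIV_at_within_shift[of _ _ t\<^sub>0 0 UNIV] by simp
  then show ?thesis by blast
qed

definition complex_pencil :: "real^'m^'m \<Rightarrow> real^'m^'m \<Rightarrow> complex \<Rightarrow> complex^'m^'m" where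
  "complex_pencil X Y t = (\<chi> i j. complex_of_real (X $ i $ j) + t * complex_of_real (Y $ i $ j))"

lemma transpose_eq_iff: "transpose M = M \<longleftrightarrow> (\<forall>i j. M $ i $ j = M $ j $ i)"
  by (auto simp: Finite_Cartesian_Product.transpose_def Finite_Cartesian_Product.vec_eq_iff)

lemma det_complex_of_real: "det (\<chi> i j. complex_of_real (M $ i $ j)) = complex_of_real (det M)"
  by (simp add: Determinants.det_def)

lemma quadratic_form_continuous: "continuous_on UNIV (\<lambda>y::real^'m. y \<bullet> (M *v y))"
  by (intro continuous_intros matrix_vector_mult_linear_continuous_on)

lemma quadratic_form_bound:
  obtains K where "0 < K" "\<And>y::real^'m. \<bar>y \<bullet> (M *v y)\<bar> \<le> K * (y \<bullet> y)"
proof -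
  obtain K where K: "K > 0" "\<And>z::real^'m. norm (M *v z) \<le> K * norm z"
    using linear_bounded_pos[OF matrix_vector_mul_linear, of M] by (auto simp: mult.commute)
  have "\<bar>y \<bullet> (M *v y)\<bar> \<le> K * (y \<bullet> y)" for y
  proof -
    have "\<bar>y \<bullet> (M *v y)\<bar> \<le> norm y * norm (M *v y)" by (rule Cauchy_Schwarz_ineq2)
    also have "\<dots> \<le> norm y * (K * norm y)" using K by (intro mult_left_mono) auto
    also have "\<dots> = K * (y \<bullet> y)" by (simp add: power2_norm_eq_inner[symmetric] power2_eq_square)
    finally show ?thesis .
  qed
  with K(1) that show ?thesis by blast
qed

text \<open>A Gaussian integral rather than a determinant: up to a power of \<open>pi\<close> its
  square is the inverse of the determinant of \<open>X + i Y\<close>, so it is a preferred inverse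
  square root of that determinant.\<close>

definition gaussian_det :: "real^'m::{finite,wellorder}^'m::_ \<Rightarrow> real^'m::_^'m::_ \<Rightarrow> complex" where
  "gaussian_det X Y = (LINT y|lborel. exp (- (complex_of_real (y \<bullet> (X *v y)) + \<i> * complex_of_real (y \<bullet> (Y *v y)))))"

text \<open>For small real \<open>t\<close> the matrix \<open>X + t Y\<close> is real and positive
  definite, where the identity is the real Gaussian integral. Both sides are holomorphic in
  \<open>t\<close> on a connected domain that contains \<open>i\<close>, so the identity theorem
  carries it there.\<close>

lemma gaussian_det_squared:
  fixes X Y :: "real^'m::{finite,wellorder}^'m::_"
  assumes X: "transpose X = X" and Y: "transpose Y = Y" and pos: "\<And>y. y \<noteq> 0 \<Longrightarrow> y \<bullet> (X *v y) > 0"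
  shows "(gaussian_det X Y)\<^sup>2 * det (complex_pencil X Y \<i>) = pi ^ CARD('m)"
proof -
  obtain c where c: "c > 0" "\<And>y. c * (y \<bullet> y) \<le> y \<bullet> (X *v y)"
    using gaussian_matrix_real(2)[OF X pos] by blast
  obtain K where K: "K > 0" "\<And>y. \<bar>y \<bullet> (Y *v y)\<bar> \<le> K * (y \<bullet> y)"
    using quadratic_form_bound[of Y] by blast
  define \<delta> where "\<delta> = c / (2 * K)"
  have \<delta>: "0 < \<delta>" using c K by (simp add: \<delta>_def)
  \<comment> \<open>Only the real part of \<open>t\<close> affects the real part of the exponent, so
    the integral converges on a whole vertical strip, and this reaches \<open>t = i\<close> however
    large \<open>Y\<close> is.\<close>
  define S where "S = {t. \<bar>Re t\<bar> < \<delta>}"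
  have S: "S = {t. Re t < \<delta>} \<inter> {t. - \<delta> < Re t}" by (auto simp: S_def)
  have oS: "open S" unfolding S by (intro open_Int open_halfspace_Re_lt open_halfspace_Re_gt)
  have cS: "connected S"
    unfolding S by (intro convex_connected convex_Int convex_halfspace_Re_lt convex_halfspace_Re_gt)
  have low: "c / 2 * (y \<bullet> y) \<le> y \<bullet> (X *v y) + r * (y \<bullet> (Y *v y))" if "\<bar>r\<bar> < \<delta>" for r y
  proof -
    have "\<bar>r * (y \<bullet> (Y *v y))\<bar> \<le> \<delta> * (K * (y \<bullet> y))"
      unfolding abs_mult using that K by (intro mult_mono) auto
    also have "\<dots> = c / 2 * (y \<bullet> y)" using K by (simp add: \<delta>_def)
    finally show ?thesis using c(2)[of y] by (simp add: field_simps)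
  qed
  define f where "f t = (LINT y|lborel. exp (- (complex_of_real (y \<bullet> (X *v y)) + t * complex_of_real (y \<bullet> (Y *v y)))))" for t
  have "\<exists>D. (f has_field_derivative D) (at t)" if t: "t \<in> S" for t
    unfolding f_def
  proof (rule gaussian_family_deriv)
    show "continuous_on UNIV (\<lambda>y. complex_of_real (y \<bullet> (X *v y)))" "continuous_on UNIV (\<lambda>y. complex_of_real (y \<bullet> (Y *v y)))"
      by (intro continuous_on_of_real quadratic_form_continuous)+
    show "cmod (complex_of_real (y \<bullet> (Y *v y))) \<le> K * (y \<bullet> y)" for y using K by simp
    show "0 < c / 2" using c by simp
    show "c / 2 * (y \<bullet> y) \<le> Re (complex_of_real (y \<bullet> (X *v y)) + t * complex_of_real (y \<bullet> (Y *v y)))" for y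
      using low[of "Re t" y] t by (simp add: S_def)
  qed
  then have fh: "f holomorphic_on S"
    using holomorphic_on_open[OF oS] by blast
  define d where "d t = det (complex_pencil X Y t)" for t
  have dh: "d holomorphic_on S"
    unfolding d_def Determinants.det_def complex_pencil_def by (auto intro!: holomorphic_intros)
  define F where "F t = (f t)\<^sup>2 * d t - complex_of_real (pi ^ CARD('m))" for t
  have real: "F (complex_of_real r) = 0" if r: "\<bar>r\<bar> < \<delta>" for r
  proof -
    define M where "M = X + r *\<^sub>R Y"
    have My: "M *v y = X *v y + r *\<^sub>R (Y *v y)" for y
      by (simp add: M_def matrix_vector_mult_add_rdistrib scaleR_matrix_vector_assoc)
    have symM: "transpose M = M"
      using X Y by (auto simp: M_def transpose_eq_iff)
    have "y \<bullet> (M *v y) > 0" if "y \<noteq> 0" for y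
    proof -
      have "0 < c / 2 * (y \<bullet> y)" using c that by simp
      also have "\<dots> \<le> y \<bullet> (M *v y)" using low[OF r, of y] by (simp add: My inner_add_right)
      finally show ?thesis .
    qed
    from gaussian_matrix_real(1)[OF symM this]
    have g: "(LINT y|lborel. exp (- (y \<bullet> (M *v y))))\<^sup>2 * det M = pi ^ CARD('m)" .
    have "f (complex_of_real r) = (LINT y|lborel. complex_of_real (exp (- (y \<bullet> (M *v y)))))"
      unfolding f_def by (intro Bochner_Integration.integral_cong refl) (simp add: My inner_add_right flip: exp_of_real)
    moreover have "complex_pencil X Y (complex_of_real r) = (\<chi> i j. complex_of_real (M $ i $ j))"
      by (simp add: complex_pencil_def M_def vec_eq_iff)
    ultimately have "(f (complex_of_real r))\<^sup>2 * d (complex_of_real r) =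
      complex_of_real ((LINT y|lborel. exp (- (y \<bullet> (M *v y))))\<^sup>2 * det M)"
      by (simp add: d_def det_complex_of_real)
    then show ?thesis unfolding F_def g by simp
  qed
  have "F \<i> = 0"
  proof (rule analytic_continuation[of F S "complex_of_real ` {-\<delta><..<\<delta>}" 0 \<i>])
    show "F holomorphic_on S" unfolding F_def by (intro holomorphic_intros fh dh)
    show "complex_of_real ` {- \<delta><..<\<delta>} \<subseteq> S" by (auto simp: S_def)
    show "0 islimpt complex_of_real ` {- \<delta><..<\<delta>}"
      unfolding islimpt_approachable
    proof (intro allI impI)
      fix e :: real assume "0 < e"
      then show "\<exists>x'\<in>complex_of_real ` {- \<delta><..<\<delta>}. x' \<noteq> 0 \<and> dist x' 0 < e"
        using \<delta> by (intro bexI[of _ "complex_of_real (min (\<delta>/2) (e/2))"]) (auto simp: min_def)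
    qed
  qed (use oS cS \<delta> real in \<open>auto simp: S_def\<close>)
  then show ?thesis by (simp add: F_def f_def d_def gaussian_det_def)
qed

text \<open>The quotient \<open>\<phi>\<close> of the two sides along the segment from the identity
  matrix to \<open>X + i Y\<close> has square 1. Being continuous with finitely many values, it is
  constant, and at the identity matrix it is 1 because the integral is the positive real one and
  \<open>a 0 = 0\<close>.\<close>

lemma gaussian_det_branch:
  fixes X Y :: "real^'m::{finite,wellorder}^'m::_" and a :: "real \<Rightarrow> complex"
  assumes X: "transpose X = X" and Y: "transpose Y = Y" and pos: "\<And>y. y \<noteq> 0 \<Longrightarrow> y \<bullet> (X *v y) > 0"
    and a: "continuous_on {0..1} a" "a 0 = 0"
    and det: "\<And>s. s \<in> {0..1} \<Longrightarrow>
      exp (a s) = det (complex_pencil (mat 1 + s *\<^sub>R (X - mat 1)) (s *\<^sub>R Y) \<i>)"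
  shows "gaussian_det X Y = complex_of_real (sqrt pi ^ CARD('m)) * exp (- (a 1 / 2))"
proof -
  define X' where "X' s = mat 1 + s *\<^sub>R (X - mat 1)" for s
  have X'y: "y \<bullet> (X' s *v y) = (1 - s) * (y \<bullet> y) + s * (y \<bullet> (X *v y))" for s y
    by (simp add: X'_def matrix_vector_mult_add_rdistrib matrix_vector_mult_diff_rdistrib
        inner_add_right inner_diff_right algebra_simps flip: scaleR_matrix_vector_assoc)
  have Y'y: "y \<bullet> ((s *\<^sub>R Y) *v y) = s * (y \<bullet> (Y *v y))" for s y
    by (simp flip: scaleR_matrix_vector_assoc)
  obtain c where c: "c > 0" "\<And>y. c * (y \<bullet> y) \<le> y \<bullet> (X *v y)"
    using gaussian_matrix_real(2)[OF X pos] by blast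
  define c' where "c' = min c 1"
  have c': "0 < c'" using c by (simp add: c'_def)
  have low: "c' * (y \<bullet> y) \<le> y \<bullet> (X' s *v y)" if "s \<in> {0..1}" for s y
  proof -
    have "c' * (y \<bullet> y) = (1 - s) * (c' * (y \<bullet> y)) + s * (c' * (y \<bullet> y))" by (simp add: algebra_simps)
    also have "\<dots> \<le> (1 - s) * (y \<bullet> y) + s * (y \<bullet> (X *v y))"
    proof (intro add_mono mult_left_mono)
      show "c' * (y \<bullet> y) \<le> y \<bullet> y" using mult_right_mono[of c' 1 "y \<bullet> y"] by (simp add: c'_def)
      show "c' * (y \<bullet> y) \<le> y \<bullet> (X *v y)"
        using mult_right_mono[of c' c "y \<bullet> y"] c(2)[of y] by (simp add: c'_def)
    qed (use that in auto)
    finally show ?thesis by (simp add: X'y)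
  qed
  define q where "q y = complex_of_real (y \<bullet> (X *v y) - y \<bullet> y) + \<i> * complex_of_real (y \<bullet> (Y *v y))" for y
  obtain K where K: "K > 0" "\<And>y. \<bar>y \<bullet> (Y *v y)\<bar> \<le> K * (y \<bullet> y)"
    using quadratic_form_bound[of Y] by blast
  obtain L where L: "L > 0" "\<And>y. \<bar>y \<bullet> (X *v y)\<bar> \<le> L * (y \<bullet> y)"
    using quadratic_form_bound[of X] by blast
  define f where "f t = (LINT y|lborel. exp (- (complex_of_real (y \<bullet> y) + t * q y)))" for t
  have fG: "f (complex_of_real s) = gaussian_det (X' s) (s *\<^sub>R Y)" for s
    unfolding f_def gaussian_det_def X'y Y'y
    by (intro Bochner_Integration.integral_cong refl arg_cong[where f=exp]) (simp add: q_def algebra_simps)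
  have "\<exists>D. (f has_field_derivative D) (at (complex_of_real s))" if s: "s \<in> {0..1}" for s
    unfolding f_def
  proof (rule gaussian_family_deriv)
    show "continuous_on UNIV (\<lambda>y. complex_of_real (y \<bullet> y))" by (intro continuous_intros)
    show "continuous_on UNIV q"
      unfolding q_def by (intro continuous_intros quadratic_form_continuous)
    show "cmod (q y) \<le> (L + 1 + K) * (y \<bullet> y)" for y
    proof -
      have "cmod (q y) \<le> cmod (complex_of_real (y \<bullet> (X *v y) - y \<bullet> y)) + cmod (\<i> * complex_of_real (y \<bullet> (Y *v y)))"
        unfolding q_def by (rule norm_triangle_ineq)
      also have "\<dots> = \<bar>y \<bullet> (X *v y) - y \<bullet> y\<bar> + \<bar>y \<bullet> (Y *v y)\<bar>"
        by (simp only: norm_mult norm_of_real norm_ii mult_1)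
      also have "\<dots> \<le> (L * (y \<bullet> y) + (y \<bullet> y)) + K * (y \<bullet> y)"
        using L(2)[of y] K(2)[of y] inner_ge_zero[of y] by linarith
      finally show ?thesis by (simp add: algebra_simps)
    qed
    show "c' * (y \<bullet> y) \<le> Re (complex_of_real (y \<bullet> y) + complex_of_real s * q y)" for y
      using low[OF s, of y] by (simp add: q_def X'y algebra_simps)
  qed (rule c')
  then have "isCont f (complex_of_real s)" if "s \<in> {0..1}" for s
    using that DERIV_isCont by metis
  then have contG: "continuous_on {0..1} (\<lambda>s. gaussian_det (X' s) (s *\<^sub>R Y))"
    unfolding fG[symmetric]
    by (intro continuous_at_imp_continuous_on ballI isCont_o2[where g=f and f=complex_of_real]) auto
  define \<phi> where "\<phi> s = gaussian_det (X' s) (s *\<^sub>R Y) * exp (a s / 2) / complex_of_real (sqrt pi ^ CARD('m))" for s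
  have cont: "continuous_on {0..1} \<phi>"
    unfolding \<phi>_def by (intro continuous_intros contG a) auto
  have sq: "(\<phi> s)\<^sup>2 = 1" if s: "s \<in> {0..1}" for s
  proof -
    have 1: "transpose (X' s) = X' s" "transpose (s *\<^sub>R Y) = s *\<^sub>R Y"
      using X Y by (auto simp: X'_def transpose_eq_iff Finite_Cartesian_Product.mat_def)
    have 2: "y \<bullet> (X' s *v y) > 0" if "y \<noteq> 0" for y
    proof -
      have "0 < c' * (y \<bullet> y)" using c' that by simp
      then show ?thesis using low[OF s, of y] by linarith
    qed
    have "(\<phi> s)\<^sup>2 = (gaussian_det (X' s) (s *\<^sub>R Y))\<^sup>2 * (exp (a s / 2))\<^sup>2 / complex_of_real ((sqrt pi ^ CARD('m))\<^sup>2)"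
      by (simp add: \<phi>_def power_mult_distrib power_divide)
    also have "(exp (a s / 2))\<^sup>2 = det (complex_pencil (X' s) (s *\<^sub>R Y) \<i>)"
      using det[OF s] by (simp add: X'_def power2_eq_square mult_exp_exp)
    also have "(gaussian_det (X' s) (s *\<^sub>R Y))\<^sup>2 * det (complex_pencil (X' s) (s *\<^sub>R Y) \<i>) = pi ^ CARD('m)"
      by (rule gaussian_det_squared[OF 1 2])
    also have "(sqrt pi ^ CARD('m))\<^sup>2 = pi ^ CARD('m)"
      by (simp add: power_mult[symmetric] mult.commute[of _ 2]) (simp add: power_mult)
    finally show ?thesis by simp
  qed
  have "\<phi> ` {0..1} \<subseteq> {1, -1}"
  proof (intro image_subsetI)
    fix s :: real assume "s \<in> {0..1}"
    from sq[OF this] show "\<phi> s \<in> {1, -1}" by (simp add: power2_eq_1_iff)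
  qed
  then have fin: "finite (\<phi> ` {0..1})" by (rule finite_subset) simp
  have "\<phi> constant_on {0..1}"
    by (rule continuous_finite_range_constant[OF _ cont fin]) (simp add: is_interval_connected)
  then have "\<phi> 1 = \<phi> 0" by (auto simp: constant_on_def)
  moreover have "\<phi> 0 = 1"
  proof -
    have "gaussian_det (X' 0) (0 *\<^sub>R Y) = (LINT y::real^'m::{finite,wellorder}|lborel. complex_of_real (exp (- 1 * (y \<bullet> y))))"
      unfolding fG[symmetric] f_def by (intro Bochner_Integration.integral_cong refl) (simp flip: exp_of_real)
    also have "\<dots> = complex_of_real (sqrt pi ^ CARD('m))"
      using gaussian_integral_norm[of 1, where 'e="real^'m::{finite,wellorder}"] by (simp only: integral_complex_of_real) simp
    finally show ?thesis using a by (simp add: \<phi>_def)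
  qed
  ultimately have "\<phi> 1 = 1" by simp
  then have "gaussian_det X Y * exp (a 1 / 2) = complex_of_real (sqrt pi ^ CARD('m))"
    by (simp add: \<phi>_def X'_def field_simps)
  then show ?thesis by (simp add: exp_minus field_simps)
qed

section \<open>Determinants and their logarithms on subspaces\<close>

text \<open>Conjugation by \<open>h\<close> matches the permutations in the two Leibniz sums and
  preserves their signs. This links determinants of matrices indexed by numbers with those indexed
  by a finite type.\<close>

lemma det_mat_reindex:
  fixes M :: "'a::comm_ring_1^'m^'m"
  assumes h: "bij_betw h {0..<n} (UNIV :: 'm set)"
  shows "Determinant.det (Matrix.mat n n (\<lambda>(i, k). M $ h i $ h k)) = det M"
proof -
  let ?A = "Matrix.mat n n (\<lambda>(i, k). M $ h i $ h k)"
  have inj: "inj_on h {0..<n}" and img: "h ` {0..<n} = UNIV" using h by (auto simp: bij_betw_def)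
  have bij: "bij_betw (map_permutation {0..<n} h) {\<pi>. \<pi> permutes {0..<n}} {\<pi>. \<pi> permutes UNIV}"
  proof -
    have "map_permutation {0..<n} h \<pi> x = (if x \<in> UNIV then h (\<pi> (inv_into {0..<n} h x)) else x)" for \<pi> x
      unfolding map_permutation_def restrict_id_def img o_def by (rule refl)
    then have "map_permutation {0..<n} h = (\<lambda>\<pi> x. if x \<in> UNIV then h (\<pi> (inv_into {0..<n} h x)) else x)"
      by (intro ext)
    then show ?thesis using bij_betw_permutations[OF h] by (simp only:)
  qed
  have "det M = (\<Sum>p | p permutes {0..<n}. of_int (sign (map_permutation {0..<n} h p)) *
      (\<Prod>i\<in>UNIV. M $ i $ map_permutation {0..<n} h p i))"
    unfolding Determinants.det_def
    by (rule sum.reindex_bij_betw[OF bij, of "\<lambda>p. of_int (sign p) * (\<Prod>i\<in>UNIV. M $ i $ p i)", symmetric])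
  also have "\<dots> = (\<Sum>p | p permutes {0..<n}. of_int (sign p) * (\<Prod>i = 0..<n. ?A $$ (i, p i)))"
  proof (intro sum.cong refl arg_cong2[where f="(*)"])
    fix p assume "p \<in> {p. p permutes {0..<n}}"
    then have p: "p permutes {0..<n}" by simp
    show "of_int (sign (map_permutation {0..<n} h p)) = (of_int (sign p) :: 'a)"
      using sign_map_permutation[OF inj p] by simp
    have "(\<Prod>i\<in>UNIV. M $ i $ map_permutation {0..<n} h p i) = (\<Prod>i = 0..<n. M $ h i $ map_permutation {0..<n} h p (h i))"
      by (rule prod.reindex_bij_betw[OF h, symmetric])
    also have "\<dots> = (\<Prod>i = 0..<n. ?A $$ (i, p i))"
    proof (rule prod.cong[OF refl])
      fix i assume i: "i \<in> {0..<n}"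
      then have "p i < n" using permutes_in_image[OF p] by auto
      then show "M $ h i $ map_permutation {0..<n} h p (h i) = ?A $$ (i, p i)"
        using i by (simp add: map_permutation_def restrict_id_def img inv_into_f_f[OF inj])
    qed
    finally show "(\<Prod>i\<in>UNIV. M $ i $ map_permutation {0..<n} h p i) = (\<Prod>i = 0..<n. ?A $$ (i, p i))" .
  qed
  also have "\<dots> = Determinant.det ?A" by (simp add: Determinant.det_def)
  finally show ?thesis by simp
qed

text \<open>\<open>Det_on\<close> refers to an unspecified basis \<open>bs\<close>. The matrices of
  \<open>x\<close> in \<open>bs\<close> and in \<open>c\<close> are intertwined by the matrix
  \<open>Q\<close> of base change, and \<open>Q\<close> has a right inverse, so the two determinants
  coincide.\<close>

lemma Det_on_eq_det:
  fixes s :: "'a::field \<Rightarrow> 'w::ab_group_add \<Rightarrow> 'w" and c :: "'m::finite \<Rightarrow> 'w" and M :: "'a^'m^'m"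
  assumes vs: "vector_space s" and inj: "inj c" and ind: "\<not> module.dependent s (range c)"
    and span: "module.span s (range c) = W"
    and xW: "\<And>p. p \<in> W \<Longrightarrow> x p \<in> W"
    and add: "\<And>p q. p \<in> W \<Longrightarrow> q \<in> W \<Longrightarrow> x (p + q) = x p + x q"
    and scale: "\<And>a p. p \<in> W \<Longrightarrow> x (s a p) = s a (x p)"
    and M: "\<And>k. x (c k) = (\<Sum>i\<in>UNIV. s (M $ i $ k) (c i))"
  shows "Det_on s W x = det M"
proof -
  interpret vector_space s by fact
  define P where "P bs \<longleftrightarrow> distinct bs \<and> \<not> dependent (set bs) \<and> local.span (set bs) = W" for bs
  define bs where "bs = (SOME bs. P bs)"
  obtain cs where "distinct cs" "set cs = range c" using finite_distinct_list[of "range c"] by auto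
  then have "P cs" using ind span by (simp add: P_def)
  then have "P bs" unfolding bs_def by (rule someI)
  then have bs: "distinct bs" "independent (set bs)" "local.span (set bs) = W" by (auto simp: P_def)
  define n where "n = length bs"
  have "n = card (set bs)" using bs(1) by (simp add: n_def distinct_card)
  also have "\<dots> = card (range c)"
    using dim_span_eq_card_independent[OF bs(2)] dim_span_eq_card_independent[OF ind] bs(3) span by simp
  also have "\<dots> = CARD('m)" using inj by (simp add: card_image)
  finally have n: "card {0..<n} = CARD('m)" by simp
  then obtain h where h: "bij_betw h {0..<n} (UNIV :: 'm set)"
    using finite_same_card_bij[OF _ _ n] by auto
  have sum_bs: "(\<Sum>b\<in>set bs. f b) = (\<Sum>i = 0..<n. f (bs ! i))" for f :: "'w \<Rightarrow> 'b::comm_monoid_add"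
    using sum.reindex_bij_betw[OF bij_betw_nth[OF bs(1) refl refl], of f] by (simp add: n_def atLeast0LessThan)
  have bW: "bs ! i \<in> W" if "i < n" for i using that span_base[of "bs ! i" "set bs"] bs(3) by (simp add: n_def)
  have cW: "c k \<in> W" for k using span_base[of "c k" "range c"] span by simp
  define r where "r = representation (set bs)"
  have r_add: "r (u + v) b = r u b + r v b" if "u \<in> W" "v \<in> W" for u v b
    using representation_add[OF bs(2), of v u] that bs(3) by (simp add: r_def)
  have r_scale: "r (s a v) b = a * r v b" if "v \<in> W" for a v b
    using representation_scale[OF bs(2), of v a] that bs(3) by (simp add: r_def)
  have W0: "0 \<in> W" using span_zero[of "range c"] span by simp
  have Wsub: "(\<Sum>i\<in>A. s (f i) (v i)) \<in> W" if "\<And>i. i \<in> A \<Longrightarrow> v i \<in> W" for A :: "'i set" and f v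
    using that span_sum[of A "\<lambda>i. s (f i) (v i)" "range c"] span_scale[of _ "range c"] span by simp
  have r_sum: "r (\<Sum>i\<in>A. s (f i) (v i)) b = (\<Sum>i\<in>A. f i * r (v i) b)" if "\<And>i. i \<in> A \<Longrightarrow> v i \<in> W"
    for A :: "'i set" and f v b
  proof -
    have sv: "s (f i) (v i) \<in> W" if "i \<in> A" for i
      using span_scale[of "v i" "range c" "f i"] span \<open>\<And>i. i \<in> A \<Longrightarrow> v i \<in> W\<close> that by simp
    have "r (\<Sum>i\<in>A. s (f i) (v i)) = (\<lambda>b. \<Sum>i\<in>A. r (s (f i) (v i)) b)"
      unfolding r_def by (rule representation_sum[OF bs(2)]) (use sv bs(3) in simp)
    then show ?thesis using r_scale that by (simp cong: sum.cong)
  qed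
  have x0: "x 0 = 0" using scale[OF W0, of 0] by simp
  have x_sum: "x (\<Sum>i\<in>A. s (f i) (v i)) = (\<Sum>i\<in>A. s (f i) (x (v i)))" if "finite A" "\<And>i. i \<in> A \<Longrightarrow> v i \<in> W"
    for A :: "'i set" and f v
    using that
  proof (induction A rule: finite_induct)
    case (insert i A)
    have "x (s (f i) (v i) + (\<Sum>i\<in>A. s (f i) (v i))) = x (s (f i) (v i)) + x (\<Sum>i\<in>A. s (f i) (v i))"
      using insert.prems span_scale[of "v i" "range c" "f i"] span by (intro add Wsub) auto
    then show ?case using insert by (simp add: scale)
  qed (simp add: x0)
  have rep: "(\<Sum>i = 0..<n. s (r v (bs ! i)) (bs ! i)) = v" if "v \<in> W" for v
    using sum_representation_eq[OF bs(2), of v "set bs"] that bs(3) sum_bs[of "\<lambda>b. s (r v b) b"] by (simp add: r_def)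
  define B where "B = Matrix.mat n n (\<lambda>(i, k). r (x (bs ! k)) (bs ! i))"
  define N where "N = Matrix.mat n n (\<lambda>(i, k). M $ h i $ h k)"
  define Q where "Q = Matrix.mat n n (\<lambda>(i, k). r (c (h k)) (bs ! i))"
  define q where "q = representation (range c)"
  define Q' where "Q' = Matrix.mat n n (\<lambda>(i, k). q (bs ! k) (c (h i)))"
  have carrier: "B \<in> carrier_mat n n" "N \<in> carrier_mat n n" "Q \<in> carrier_mat n n" "Q' \<in> carrier_mat n n"
    by (auto simp: B_def N_def Q_def Q'_def)
  \<comment> \<open>Both products contain the coordinates of \<open>x (c (h k))\<close> in
    \<open>bs\<close>: either the argument is expanded in \<open>bs\<close> before \<open>x\<close>
    is applied, or the value is expanded in \<open>c\<close>.\<close>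
  have "B * Q = Q * N"
  proof (rule eq_matI)
    fix i k assume "i < dim_row (Q * N)" "k < dim_col (Q * N)"
    then have ik: "i < n" "k < n" using carrier by auto
    have "r (x (c (h k))) (bs ! i) = r (x (\<Sum>l = 0..<n. s (r (c (h k)) (bs ! l)) (bs ! l))) (bs ! i)"
      by (simp add: rep cW)
    also have "\<dots> = (\<Sum>l = 0..<n. r (c (h k)) (bs ! l) * r (x (bs ! l)) (bs ! i))"
    proof -
      have "x (\<Sum>l = 0..<n. s (r (c (h k)) (bs ! l)) (bs ! l)) = (\<Sum>l = 0..<n. s (r (c (h k)) (bs ! l)) (x (bs ! l)))"
        by (rule x_sum) (auto intro: bW)
      then show ?thesis by (simp only:) (rule r_sum, auto intro: bW xW)
    qed
    finally have 1: "r (x (c (h k))) (bs ! i) = (B * Q) $$ (i, k)"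
      using ik by (simp add: B_def Q_def scalar_prod_def mult.commute)
    have "r (x (c (h k))) (bs ! i) = (\<Sum>l\<in>UNIV. M $ l $ h k * r (c l) (bs ! i))"
      by (simp add: M r_sum cW)
    also have "\<dots> = (\<Sum>l = 0..<n. M $ h l $ h k * r (c (h l)) (bs ! i))"
      by (rule sum.reindex_bij_betw[OF h, symmetric])
    also have "\<dots> = (Q * N) $$ (i, k)"
      using ik by (simp add: N_def Q_def scalar_prod_def mult.commute)
    finally show "(B * Q) $$ (i, k) = (Q * N) $$ (i, k)" using 1 by simp
  qed (use carrier in auto)
  moreover have "Q * Q' = 1\<^sub>m n"
  proof (rule eq_matI)
    fix i k assume "i < dim_row (1\<^sub>m n)" "k < dim_col (1\<^sub>m n)"
    then have ik: "i < n" "k < n" by auto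
    have "bs ! k = (\<Sum>b\<in>range c. s (q (bs ! k) b) b)"
      using sum_representation_eq[OF ind, of "bs ! k" "range c"] bW[OF ik(2)] span by (simp add: q_def)
    also have "\<dots> = (\<Sum>l\<in>UNIV. s (q (bs ! k) (c l)) (c l))"
      by (rule sum.reindex[OF inj, simplified o_def])
    also have "\<dots> = (\<Sum>l = 0..<n. s (q (bs ! k) (c (h l))) (c (h l)))"
      by (rule sum.reindex_bij_betw[OF h, symmetric])
    finally have "r (bs ! k) (bs ! i) = (\<Sum>l = 0..<n. q (bs ! k) (c (h l)) * r (c (h l)) (bs ! i))"
      using r_sum[of "{0..<n}" "\<lambda>l. c (h l)" "\<lambda>l. q (bs ! k) (c (h l))" "bs ! i"] cW by metis
    also have "\<dots> = (Q * Q') $$ (i, k)"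
      using ik by (simp add: Q_def Q'_def scalar_prod_def mult.commute)
    finally have "(Q * Q') $$ (i, k) = r (bs ! k) (bs ! i)" ..
    also have "\<dots> = (if bs ! i = bs ! k then 1 else 0)"
      using representation_basis[OF bs(2), of "bs ! k"] ik by (simp add: r_def n_def)
    also have "\<dots> = 1\<^sub>m n $$ (i, k)"
      using ik bs(1) by (simp add: n_def nth_eq_iff_index_eq)
    finally show "(Q * Q') $$ (i, k) = 1\<^sub>m n $$ (i, k)" .
  qed (use carrier in auto)
  ultimately have d: "Determinant.det B * Determinant.det Q = Determinant.det Q * Determinant.det N"
    "Determinant.det Q * Determinant.det Q' = 1"
    using det_mult[OF carrier(1,3)] det_mult[OF carrier(3,2)] det_mult[OF carrier(3,4)] det_one by metis+
  then have "Determinant.det Q \<noteq> 0" by auto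
  then have "Determinant.det B = Determinant.det N" using d(1) by simp
  also have "\<dots> = det M" unfolding N_def by (rule det_mat_reindex[OF h])
  also have "Determinant.det B = Det_on s W x"
    unfolding Det_on_def Let_def P_def[symmetric] bs_def[symmetric] B_def n_def r_def ..
  finally show ?thesis .
qed

section \<open>Calculus of \<open>Ck_on\<close> and continuous logarithms\<close>

lemma Ck_on_const: "Ck_on k S (\<lambda>x. c)"
  by (induction k arbitrary: c) (auto intro!: exI[of _ "\<lambda>x v. 0"])

lemma Ck_on_bounded_linear:
  assumes "bounded_linear L"
  shows "Ck_on k S L"
proof (cases k)
  case 0
  then show ?thesis using assms by (simp add: linear_continuous_on)
next
  case (Suc m)
  then show ?thesis using assms
    by (auto intro!: exI[of _ "\<lambda>x. L"] Ck_on_const bounded_linear_imp_has_derivative)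
qed

lemma Ck_on_SucD: "Ck_on (Suc k) S f \<Longrightarrow> Ck_on k S f"
proof (induction k arbitrary: f)
  case 0
  then show ?case
    by (auto simp: continuous_on_eq_continuous_within dest!: bspec intro: has_derivative_continuous)
next
  case (Suc k)
  from Suc.prems obtain f' where "\<forall>x\<in>S. (f has_derivative f' x) (at x within S)" "\<forall>v. Ck_on (Suc k) S (\<lambda>x. f' x v)"
    by auto
  with Suc.IH show ?case unfolding Ck_on.simps(2)[of k] by blast
qed

lemma Ck_on_add:
  assumes "Ck_on k S f" "Ck_on k S g"
  shows "Ck_on k S (\<lambda>x. f x + g x)"
  using assms
proof (induction k arbitrary: f g)
  case 0
  then show ?case by (auto intro: continuous_intros)
next
  case (Suc k)
  from Suc.prems obtain f' g' where
    f': "\<forall>x\<in>S. (f has_derivative f' x) (at x within S)" "\<forall>v. Ck_on k S (\<lambda>x. f' x v)" and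
    g': "\<forall>x\<in>S. (g has_derivative g' x) (at x within S)" "\<forall>v. Ck_on k S (\<lambda>x. g' x v)" by auto
  then show ?case using Suc.IH
    by (auto intro!: exI[of _ "\<lambda>x v. f' x v + g' x v"] derivative_intros)
qed

lemma Ck_on_mult:
  fixes f g :: "'e::real_normed_vector \<Rightarrow> 'b::real_normed_algebra"
  assumes "Ck_on k S f" "Ck_on k S g"
  shows "Ck_on k S (\<lambda>x. f x * g x)"
  using assms
proof (induction k arbitrary: f g)
  case 0
  then show ?case by (auto intro: continuous_intros)
next
  case (Suc k)
  from Suc.prems obtain f' g' where
    f': "\<forall>x\<in>S. (f has_derivative f' x) (at x within S)" "\<forall>v. Ck_on k S (\<lambda>x. f' x v)" and
    g': "\<forall>x\<in>S. (g has_derivative g' x) (at x within S)" "\<forall>v. Ck_on k S (\<lambda>x. g' x v)" by auto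
  have "Ck_on k S f" "Ck_on k S g" using Suc.prems Ck_on_SucD by blast+
  then show ?case using f' g' Suc.IH
    by (auto intro!: exI[of _ "\<lambda>x v. f x * g' x v + f' x v * g x"] has_derivative_mult Ck_on_add)
qed

lemma Ck_on_inverse:
  fixes f :: "'e::real_normed_vector \<Rightarrow> 'b::real_normed_div_algebra"
  assumes "Ck_on k S f" "\<And>x. x \<in> S \<Longrightarrow> f x \<noteq> 0"
  shows "Ck_on k S (\<lambda>x. inverse (f x))"
  using assms
proof (induction k arbitrary: f)
  case 0
  then show ?case by (auto intro: continuous_intros)
next
  case (Suc k)
  from Suc.prems obtain f' where
    f': "\<forall>x\<in>S. (f has_derivative f' x) (at x within S)" "\<forall>v. Ck_on k S (\<lambda>x. f' x v)" by auto
  have "Ck_on k S (\<lambda>x. inverse (f x))" using Suc Ck_on_SucD by blast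
  then have "Ck_on k S (\<lambda>x. (- 1) * (inverse (f x) * f' x v * inverse (f x)))" for v
    using f' by (intro Ck_on_mult Ck_on_const) auto
  then show ?case using f' Suc.prems(2)
    by (auto intro!: exI[of _ "\<lambda>x v. - (inverse (f x) * f' x v * inverse (f x))"] has_derivative_inverse)
qed

lemma Ck_on_sum:
  "(\<And>i. i \<in> A \<Longrightarrow> Ck_on k S (f i)) \<Longrightarrow> Ck_on k S (\<lambda>x. \<Sum>i\<in>A. f i x)"
  by (induction A rule: infinite_finite_induct) (auto intro: Ck_on_const Ck_on_add)

lemma Ck_on_prod:
  fixes f :: "'i \<Rightarrow> 'e::real_normed_vector \<Rightarrow> 'b::real_normed_field"
  shows "(\<And>i. i \<in> A \<Longrightarrow> Ck_on k S (f i)) \<Longrightarrow> Ck_on k S (\<lambda>x. \<Prod>i\<in>A. f i x)"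
  by (induction A rule: infinite_finite_induct) (auto intro: Ck_on_const Ck_on_mult)

text \<open>Continuity keeps \<open>a y - a x\<close> inside the strip of the principal logarithm
  for \<open>y\<close> near \<open>x\<close>, so locally \<open>a\<close> equals
  \<open>a x + Ln (f y / f x)\<close>, which has the expected derivative.\<close>

lemma has_derivative_continuous_log:
  fixes a f :: "'e::real_normed_vector \<Rightarrow> complex"
  assumes a: "continuous_on S a" and exp: "\<And>x. x \<in> S \<Longrightarrow> exp (a x) = f x"
    and f: "(f has_derivative f') (at x within S)" and x: "x \<in> S"
  shows "(a has_derivative (\<lambda>v. f' v * inverse (f x))) (at x within S)"
proof -
  have fx: "f x \<noteq> 0" using exp[OF x] by (metis exp_not_eq_zero)
  have "((\<lambda>y. f y * inverse (f x)) has_derivative (\<lambda>v. f' v * inverse (f x))) (at x within S)"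
    by (rule has_derivative_mult_left[OF f])
  moreover have "(Ln has_derivative (*) 1) (at (f x * inverse (f x)))"
    using has_field_derivative_Ln[of 1] fx by (simp add: has_field_derivative_def)
  ultimately have "((\<lambda>y. Ln (f y * inverse (f x))) has_derivative (\<lambda>v. 1 * (f' v * inverse (f x)))) (at x within S)"
    by (rule has_derivative_compose)
  then have D: "((\<lambda>y. a x + Ln (f y * inverse (f x))) has_derivative (\<lambda>v. f' v * inverse (f x))) (at x within S)"
    by (auto intro!: derivative_eq_intros)
  obtain d where d: "0 < d" "\<And>y. y \<in> S \<Longrightarrow> dist y x < d \<Longrightarrow> dist (a y) (a x) < pi"
    using a x pi_gt_zero unfolding continuous_on_iff by metis
  show ?thesis
  proof (rule has_derivative_transform_within[OF D d(1) x])
    fix y assume y: "y \<in> S" "dist y x < d"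
    have "\<bar>Im (a y - a x)\<bar> < pi"
      using abs_Im_le_cmod[of "a y - a x"] d(2)[OF y] by (simp add: dist_norm)
    then have "Ln (exp (a y - a x)) = a y - a x" by (intro Ln_exp) auto
    moreover have "exp (a y - a x) = f y * inverse (f x)"
      using exp x y by (simp add: exp_diff field_simps)
    ultimately show "a x + Ln (f y * inverse (f x)) = a y" by simp
  qed
qed

text \<open>The derivative of \<open>a\<close> is that of \<open>f\<close> divided by
  \<open>f\<close>, an expression in which \<open>a\<close> itself no longer occurs; so one
  differentiation reduces smoothness of \<open>a\<close> to smoothness of \<open>f\<close>.\<close>

lemma Ck_on_continuous_log:
  fixes a f :: "'e::real_normed_vector \<Rightarrow> complex"
  assumes a: "continuous_on S a" and exp: "\<And>x. x \<in> S \<Longrightarrow> exp (a x) = f x" and f: "\<And>k. Ck_on k S f"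
  shows "Ck_on k S a"
proof (cases k)
  case 0
  then show ?thesis using a by simp
next
  case (Suc m)
  obtain f' where f': "\<And>x. x \<in> S \<Longrightarrow> (f has_derivative f' x) (at x within S)" "\<And>v. Ck_on m S (\<lambda>x. f' x v)"
    using f[of "Suc m"] by auto
  have nz: "f x \<noteq> 0" if "x \<in> S" for x using exp[OF that] by (metis exp_not_eq_zero)
  show ?thesis unfolding Suc Ck_on.simps
  proof (intro exI conjI ballI allI)
    show "(a has_derivative (\<lambda>v. f' x v * inverse (f x))) (at x within S)" if "x \<in> S" for x
      by (rule has_derivative_continuous_log[OF a exp f'(1)[OF that] that])
    show "Ck_on m S (\<lambda>x. f' x v * inverse (f x))" for v
      by (intro Ck_on_mult f' Ck_on_inverse f nz)
  qed
qed

text \<open>The difference of two logarithms, divided by \<open>2 * pi * i\<close>, takes integer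
  values. A continuous function with values in a discrete set is constant on a connected
  set.\<close>

lemma continuous_log_unique:
  fixes a b :: "'e::real_normed_vector \<Rightarrow> complex"
  assumes S: "convex S" and a: "continuous_on S a" and b: "continuous_on S b"
    and eq: "\<And>x. x \<in> S \<Longrightarrow> exp (a x) = exp (b x)" and x0: "x\<^sub>0 \<in> S" "a x\<^sub>0 = b x\<^sub>0" and x: "x \<in> S"
  shows "a x = b x"
proof -
  define g where "g y = (a y - b y) / (2 * pi * \<i>)" for y
  have "g y \<in> \<int>" if y: "y \<in> S" for y
  proof -
    obtain n :: int where "a y = b y + (of_int (2 * n) * pi) * \<i>"
      using eq[OF y] exp_eq by blast
    then have "g y = of_int n" by (simp add: g_def)
    then show ?thesis by simp
  qed
  moreover have "continuous_on S g" unfolding g_def by (intro continuous_intros a b) auto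
  moreover have "1 \<le> norm (u - v)" if uv: "u \<in> \<int>" "v \<in> \<int>" "u \<noteq> v" for u v :: complex
  proof -
    obtain k where k: "u - v = of_int k" using Ints_diff[OF uv(1,2)] by (elim Ints_cases)
    then have "k \<noteq> 0" using uv by auto
    then show ?thesis unfolding k by simp
  qed
  ultimately have "g constant_on S"
    by (intro continuous_discrete_range_constant[OF convex_connected[OF S]]) (auto intro!: exI[of _ 1])
  then have "g x = g x\<^sub>0" using x x0 by (auto simp: constant_on_def)
  then show ?thesis using x0 by (simp add: g_def)
qed

section \<open>Complex matrices with positive definite Hermitean part\<close>

definition hdot :: "complex^'m \<Rightarrow> complex^'m \<Rightarrow> complex" where
  "hdot c d = (\<Sum>i\<in>UNIV. c $ i * cnj (d $ i))"

lemma hdot_add_left: "hdot (c + c') d = hdot c d + hdot c' d"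
  by (simp add: hdot_def algebra_simps sum.distrib)

lemma hdot_diff_left: "hdot (c - c') d = hdot c d - hdot c' d"
  by (simp add: hdot_def algebra_simps sum_subtractf)

lemma hdot_scaleR_left: "hdot (r *\<^sub>R c) d = complex_of_real r * hdot c d"
  by (simp add: hdot_def sum_distrib_left scaleR_conv_of_real[where 'a=complex] mult.assoc)

lemma hdot_cnj: "hdot d c = cnj (hdot c d)"
  by (simp add: hdot_def mult.commute)

lemma hdot_self: "hdot c c = complex_of_real (\<Sum>i\<in>UNIV. (cmod (c $ i))\<^sup>2)"
  unfolding hdot_def of_real_sum complex_norm_square ..

lemma hdot_self_pos: "c \<noteq> 0 \<Longrightarrow> 0 < Re (hdot c c)"
  by (auto simp: hdot_self Finite_Cartesian_Product.vec_eq_iff intro!: sum_pos2)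

lemma hdot_adjoint: "hdot ((\<chi> i k. cnj (M $ k $ i)) *v c) d = hdot c (M *v d)"
proof -
  have "hdot ((\<chi> i k. cnj (M $ k $ i)) *v c) d = (\<Sum>i\<in>UNIV. \<Sum>k\<in>UNIV. cnj (M $ k $ i) * c $ k * cnj (d $ i))"
    by (simp add: hdot_def matrix_vector_mult_def sum_distrib_right)
  also have "\<dots> = hdot c (M *v d)"
    by (subst sum.swap) (simp add: hdot_def matrix_vector_mult_def sum_distrib_left mult_ac)
  finally show ?thesis .
qed

text \<open>The real part of \<open>hdot (M *v c) c\<close> is the quadratic form of the Hermitean
  part of \<open>M\<close>, so the condition avoids the adjoint and is linear in \<open>M\<close>,
  which makes convexity immediate.\<close>

definition pos_real_matrices :: "(complex^'m^'m) set" where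
  "pos_real_matrices = {M. \<forall>c. c \<noteq> 0 \<longrightarrow> 0 < Re (hdot (M *v c) c)}"

lemma pos_real_matrices_convex: "convex pos_real_matrices"
proof (rule convexI)
  fix M N :: "complex^'m^'m" and u v :: real
  assume MN: "M \<in> pos_real_matrices" "N \<in> pos_real_matrices" and uv: "0 \<le> u" "0 \<le> v" "u + v = 1"
  have "0 < u * Re (hdot (M *v c) c) + v * Re (hdot (N *v c) c)" if "c \<noteq> 0" for c
  proof -
    have "0 < Re (hdot (M *v c) c)" "0 < Re (hdot (N *v c) c)"
      using MN that by (auto simp: pos_real_matrices_def)
    then show ?thesis using uv by (cases "u = 0") (auto intro: add_pos_nonneg)
  qed
  moreover have "(u *\<^sub>R M + v *\<^sub>R N) *v c = u *\<^sub>R (M *v c) + v *\<^sub>R (N *v c)" for c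
    by (simp add: Finite_Cartesian_Product.vec_eq_iff matrix_vector_mult_def scaleR_sum_right sum.distrib algebra_simps)
  ultimately show "u *\<^sub>R M + v *\<^sub>R N \<in> pos_real_matrices"
    by (simp add: pos_real_matrices_def hdot_add_left hdot_scaleR_left)
qed

lemma pos_real_matrices_det: "M \<in> pos_real_matrices \<Longrightarrow> det M \<noteq> 0"
proof -
  assume M: "M \<in> pos_real_matrices"
  have "M *v c \<noteq> 0" if "c \<noteq> 0" for c
    using M that by (auto simp: pos_real_matrices_def hdot_def dest!: spec[of _ c])
  then have "invertible M"
    unfolding invertible_left_inverse matrix_left_invertible_ker by blast
  then show ?thesis by (simp add: invertible_det_nz)
qed

lemma mat_1_pos_real: "mat 1 \<in> pos_real_matrices"
  by (simp add: pos_real_matrices_def hdot_self_pos)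

text \<open>The set is convex, hence contractible, and the determinant is continuous and has no zero
  on it, so a continuous logarithm exists. Subtracting its value at the identity, whose exponential
  is 1, normalises it.\<close>

lemma log_det_exists:
  "\<exists>A. continuous_on pos_real_matrices A \<and> (\<forall>M\<in>pos_real_matrices. det M = exp (A M)) \<and> A (mat 1 :: complex^'m^'m) = 0"
proof -
  have "continuous_on pos_real_matrices (det :: complex^'m^'m \<Rightarrow> complex)"
    unfolding Determinants.det_def by (intro continuous_intros)
  then obtain g where g: "continuous_on pos_real_matrices g" "\<And>M::complex^'m^'m. M \<in> pos_real_matrices \<Longrightarrow> det M = exp (g M)"
    using continuous_logarithm_on_contractible[OF _ convex_imp_contractible[OF pos_real_matrices_convex]] pos_real_matrices_det
    by (metis (no_types, lifting))
  have "exp (g (mat 1 :: complex^'m^'m)) = 1" using g(2)[OF mat_1_pos_real] by simp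
  then show ?thesis
    using g by (intro exI[of _ "\<lambda>M. g M - g (mat 1)"]) (auto simp: exp_diff intro!: continuous_intros)
qed

text \<open>The matrix form of \<open>a_F\<close>. Continuity suffices in the choice, since a
  continuous logarithm of a smooth function is smooth and a normalised one is unique on a convex
  set.\<close>

definition log_det :: "complex^'m^'m \<Rightarrow> complex" where
  "log_det = (SOME A. continuous_on pos_real_matrices A \<and> (\<forall>M\<in>pos_real_matrices. det M = exp (A M)) \<and> A (mat 1) = 0)"

lemma log_det:
  shows log_det_continuous: "continuous_on pos_real_matrices log_det"
    and exp_log_det: "M \<in> pos_real_matrices \<Longrightarrow> exp (log_det M) = det M"
    and log_det_1: "log_det (mat 1) = 0"
  using someI_ex[OF log_det_exists] unfolding log_det_def[symmetric] by auto

lemma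
  assumes "x \<in> End_on s W"
  shows End_on_in: "p \<in> W \<Longrightarrow> x p \<in> W"
    and End_on_add: "p \<in> W \<Longrightarrow> q \<in> W \<Longrightarrow> x (p + q) = x p + x q"
    and End_on_scale: "p \<in> W \<Longrightarrow> x (s c p) = s c (x p)"
  using assms unfolding End_on_def by blast+

section \<open>Matrix coordinates on a subspace and on its complexification\<close>

locale orthonormal_coordinates =
  fixes B :: "'v::euclidean_space \<Rightarrow> 'v \<Rightarrow> real" and F :: "'v set"
    and \<tau> :: "real^'m \<Rightarrow> 'v"
  assumes bil: "bilinear B" and \<tau>: "linear \<tau>" and range_\<tau>: "range \<tau> = F" and iso: "B (\<tau> u) (\<tau> w) = u \<bullet> w"
begin

definition coord :: "'v \<Rightarrow> real^'m" where
  "coord v = (\<chi> i. B v (\<tau> (axis i 1)))"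

lemma coord_linear: "linear coord"
proof -
  have "linear (\<lambda>v. B v w)" for w using bil by (simp add: bilinear_def)
  from linear_add[OF this] linear_cmul[OF this] show ?thesis
    by (intro linearI) (simp_all add: coord_def Finite_Cartesian_Product.vec_eq_iff)
qed

lemma coord_\<tau>: "coord (\<tau> u) = u"
  by (simp add: coord_def iso inner_axis Finite_Cartesian_Product.vec_eq_iff)

lemma \<tau>_coord: "v \<in> F \<Longrightarrow> \<tau> (coord v) = v"
  using range_\<tau> coord_\<tau> by auto

lemma \<tau>_in: "\<tau> u \<in> F"
  using range_\<tau> by auto

lemma \<tau>_inj: "\<tau> u = \<tau> w \<longleftrightarrow> u = w"
  by (metis coord_\<tau>)

definition FC :: "('v \<times> 'v) set" where
  "FC = F \<times> F"

definition cvec :: "'v \<times> 'v \<Rightarrow> complex^'m" where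
  "cvec p = (\<chi> i. Complex (coord (fst p) $ i) (coord (snd p) $ i))"

definition emb :: "complex^'m \<Rightarrow> 'v \<times> 'v" where
  "emb c = (\<tau> (\<chi> i. Re (c $ i)), \<tau> (\<chi> i. Im (c $ i)))"

lemma cvec_emb: "cvec (emb c) = c"
  by (simp add: cvec_def emb_def coord_\<tau> Finite_Cartesian_Product.vec_eq_iff)

lemma emb_cvec: "p \<in> FC \<Longrightarrow> emb (cvec p) = p"
  by (cases p) (auto simp: FC_def cvec_def emb_def \<tau>_coord)

lemma emb_in: "emb c \<in> FC"
  by (simp add: FC_def emb_def \<tau>_in)

lemma emb_inj: "emb c = emb d \<longleftrightarrow> c = d"
  by (metis cvec_emb)

lemma emb_0: "emb 0 = 0"
proof -
  have "(\<chi> i. (0::real)) = (0 :: real^'m)" by (simp add: Finite_Cartesian_Product.vec_eq_iff)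
  then show ?thesis using linear_0[OF \<tau>] by (simp add: emb_def zero_prod_def)
qed

lemma emb_add: "emb (c + d) = emb c + emb d"
proof -
  have "(\<chi> i. Re ((c + d) $ i)) = (\<chi> i. Re (c $ i)) + (\<chi> i. Re (d $ i))"
    "(\<chi> i. Im ((c + d) $ i)) = (\<chi> i. Im (c $ i)) + (\<chi> i. Im (d $ i))"
    by (simp_all add: Finite_Cartesian_Product.vec_eq_iff)
  then show ?thesis by (simp only: emb_def linear_add[OF \<tau>]) simp
qed

lemma emb_scale: "emb (a *s c) = cx_scale a (emb c)"
proof -
  have "(\<chi> i. Re ((a *s c) $ i)) = Re a *\<^sub>R (\<chi> i. Re (c $ i)) - Im a *\<^sub>R (\<chi> i. Im (c $ i))"
    "(\<chi> i. Im ((a *s c) $ i)) = Re a *\<^sub>R (\<chi> i. Im (c $ i)) + Im a *\<^sub>R (\<chi> i. Re (c $ i))"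
    by (simp_all add: Finite_Cartesian_Product.vec_eq_iff)
  then show ?thesis
    by (simp only: emb_def linear_add[OF \<tau>] linear_diff[OF \<tau>] linear_cmul[OF \<tau>] cx_scale_def fst_conv snd_conv)
qed

lemma cvec_linear: "linear cvec"
  by (intro linearI) (simp_all add: cvec_def linear_add[OF coord_linear] linear_cmul[OF coord_linear]
      Finite_Cartesian_Product.vec_eq_iff complex_eq_iff)

lemma emb_linear: "linear emb"
proof (rule linearI)
  fix r and c :: "complex^'m"
  have "r *\<^sub>R c = complex_of_real r *s c"
    by (simp add: Finite_Cartesian_Product.vec_eq_iff scaleR_conv_of_real[where 'a=complex])
  then show "emb (r *\<^sub>R c) = r *\<^sub>R emb c"
    by (simp add: emb_scale cx_scale_def prod_eq_iff)
qed (rule emb_add)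

lemma herm_emb: "herm_ext B (emb c) (emb d) = hdot c d"
  by (simp add: herm_ext_def emb_def iso hdot_def inner_vec_def complex_eq_iff Re_sum Im_sum sum.distrib sum_subtractf)

definition mat_of :: "('v \<times> 'v \<Rightarrow> 'v \<times> 'v) \<Rightarrow> complex^'m^'m" where
  "mat_of x = (\<chi> i k. cvec (x (emb (axis k 1))) $ i)"

lemma End_on_emb:
  assumes x: "x \<in> End_on cx_scale FC"
  shows "x (emb c) = emb (mat_of x *v c)"
proof -
  have xW: "x p \<in> FC" if "p \<in> FC" for p using End_on_in[OF x] that .
  have "Vector_Spaces.linear (*s) (*s) (\<lambda>c. cvec (x (emb c)))"
  proof (unfold_locales)
    fix c d
    have "emb (cvec (x (emb (c + d)))) = emb (cvec (x (emb c)) + cvec (x (emb d)))"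
      unfolding emb_cvec[OF xW[OF emb_in]] emb_add[of "cvec _"] unfolding emb_add by (rule End_on_add[OF x emb_in emb_in])
    then show "cvec (x (emb (c + d))) = cvec (x (emb c)) + cvec (x (emb d))" by (simp only: emb_inj)
  next
    fix a c
    have "emb (cvec (x (emb (a *s c)))) = emb (a *s cvec (x (emb c)))"
      unfolding emb_cvec[OF xW[OF emb_in]] emb_scale[of _ "cvec _"] unfolding emb_scale by (rule End_on_scale[OF x emb_in])
    then show "cvec (x (emb (a *s c))) = a *s cvec (x (emb c))" by (simp only: emb_inj)
  qed
  from matrix_works[OF this, of c] have "mat_of x *v c = cvec (x (emb c))"
    by (simp add: mat_of_def matrix_def)
  then show ?thesis by (simp add: emb_cvec xW emb_in)
qed

text \<open>The real orthonormal basis of \<open>F\<close>, embedded in the complexification, is a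
  complex basis, and \<open>mat_of x\<close> is the matrix of \<open>x\<close> in it.\<close>

lemma Det_on_complexification:
  assumes x: "x \<in> End_on cx_scale FC"
  shows "Det_on cx_scale FC x = det (mat_of x)"
proof (rule Det_on_eq_det[OF vector_space_cx_scale, where c = "\<lambda>k. emb (axis k 1)"])
  interpret cx: vector_space cx_scale by (rule vector_space_cx_scale)
  have comb: "(\<Sum>k\<in>UNIV. cx_scale (d $ k) (emb (axis k 1))) = emb d" for d
  proof -
    have "emb d = emb (\<Sum>k\<in>UNIV. (d $ k) *s axis k 1)" by (simp add: basis_expansion)
    also have "\<dots> = (\<Sum>k\<in>UNIV. emb ((d $ k) *s axis k 1))" by (rule linear_sum[OF emb_linear])
    finally show ?thesis by (simp add: emb_scale)
  qed
  show inj: "inj (\<lambda>k. emb (axis k 1))"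
    by (rule injI) (simp add: emb_inj axis_eq_axis)
  have "finite (range (\<lambda>k. emb (axis k 1 :: complex^'m)))" by simp
  show "\<not> cx.dependent (range (\<lambda>k. emb (axis k 1)))"
    unfolding cx.dependent_finite[OF \<open>finite (range (\<lambda>k. emb (axis k 1 :: complex^'m)))\<close>]
  proof (rule notI, elim exE conjE bexE)
    fix u v
    assume v: "v \<in> range (\<lambda>k. emb (axis k 1))" and uv: "u v \<noteq> 0"
      and s: "(\<Sum>v\<in>range (\<lambda>k. emb (axis k 1)). cx_scale (u v) v) = 0"
    obtain k where u: "u (emb (axis k 1)) \<noteq> 0" using v uv by blast
    have "(\<Sum>v\<in>range (\<lambda>k. emb (axis k 1)). cx_scale (u v) v) = (\<Sum>k\<in>UNIV. cx_scale ((\<chi> k. u (emb (axis k 1))) $ k) (emb (axis k 1)))"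
      by (subst sum.reindex[OF inj]) simp
    then have "emb (\<chi> k. u (emb (axis k 1))) = emb 0" using s comb emb_0 by metis
    then show False using u unfolding emb_inj by (metis vec_lambda_beta zero_index)
  qed
  show "cx.span (range (\<lambda>k. emb (axis k 1))) = FC"
  proof
    have "cx.subspace FC"
    proof (rule cx.subspaceI)
      show "0 \<in> FC" using emb_in emb_0 by metis
      show "p + q \<in> FC" if "p \<in> FC" "q \<in> FC" for p q
        using that emb_in emb_add emb_cvec by metis
      show "cx_scale a p \<in> FC" if "p \<in> FC" for a p
        using that emb_in emb_scale emb_cvec by metis
    qed
    then show "cx.span (range (\<lambda>k. emb (axis k 1))) \<subseteq> FC"
      by (intro cx.span_minimal image_subsetI emb_in)
    show "FC \<subseteq> cx.span (range (\<lambda>k. emb (axis k 1)))"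
    proof
      fix p assume "p \<in> FC"
      then have "p = (\<Sum>k\<in>UNIV. cx_scale (cvec p $ k) (emb (axis k 1)))" by (simp add: comb emb_cvec)
      also have "\<dots> \<in> cx.span (range (\<lambda>k. emb (axis k 1)))"
        by (intro cx.span_sum cx.span_scale cx.span_base) auto
      finally show "p \<in> cx.span (range (\<lambda>k. emb (axis k 1)))" .
    qed
  qed
  show "x p \<in> FC" if "p \<in> FC" for p using End_on_in[OF x] that .
  show "x (p + q) = x p + x q" if "p \<in> FC" "q \<in> FC" for p q using End_on_add[OF x] that .
  show "x (cx_scale a p) = cx_scale a (x p)" if "p \<in> FC" for a p using End_on_scale[OF x] that .
  show "x (emb (axis k 1)) = (\<Sum>i\<in>UNIV. cx_scale (mat_of x $ i $ k) (emb (axis i 1)))" for k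
  proof -
    have "(mat_of x *v axis k 1) $ i = mat_of x $ i $ k" for i
      by (simp add: matrix_vector_mult_def axis_def if_distrib cong: if_cong)
    then show ?thesis using comb[of "mat_of x *v axis k 1"] by (simp add: End_on_emb[OF x])
  qed
qed

text \<open>In the coordinates the adjoint becomes the conjugate transpose, which the positivity of
  \<open>hdot\<close> singles out among all candidates. The form of the symmetrised operator then
  has the same real part as that of \<open>x\<close> itself.\<close>

lemma pos_real_part_iff:
  "x \<in> pos_real_part B F \<longleftrightarrow> x \<in> End_on cx_scale FC \<and> mat_of x \<in> pos_real_matrices"
proof (cases "x \<in> End_on cx_scale FC")
  case x: True
  let ?N = "\<chi> i k. cnj (mat_of x $ k $ i)"
  have adj: "adjoint_on FC (herm_ext B) x (emb c) = emb (?N *v c)" for c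
    unfolding adjoint_on_def restrict_apply'[OF emb_in]
  proof (rule the_equality)
    show "emb (?N *v c) \<in> FC \<and> (\<forall>r\<in>FC. herm_ext B (emb (?N *v c)) r = herm_ext B (emb c) (x r))"
      using emb_in hdot_adjoint[of "mat_of x" c] by (metis End_on_emb[OF x] emb_cvec herm_emb)
    fix q assume q: "q \<in> FC \<and> (\<forall>r\<in>FC. herm_ext B q r = herm_ext B (emb c) (x r))"
    have "hdot (cvec q - ?N *v c) d = 0" for d
      using q emb_in[of d] hdot_adjoint[of "mat_of x" c d]
      by (metis End_on_emb[OF x] emb_cvec herm_emb hdot_diff_left cancel_comm_monoid_add_class.diff_cancel)
    then have "cvec q - ?N *v c = 0" using hdot_self_pos[of "cvec q - ?N *v c"] by fastforce
    then show "q = emb (?N *v c)" using q by (metis emb_cvec eq_iff_diff_eq_0)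
  qed
  have "Re (herm_ext B ((1/2) *\<^sub>R (x (emb c) + adjoint_on FC (herm_ext B) x (emb c))) (emb c)) = Re (hdot (mat_of x *v c) c)" for c
  proof -
    have "(1/2) *\<^sub>R (x (emb c) + adjoint_on FC (herm_ext B) x (emb c)) = emb ((1/2) *\<^sub>R (mat_of x *v c + ?N *v c))"
      unfolding adj End_on_emb[OF x] by (simp only: linear_cmul[OF emb_linear] emb_add)
    then show ?thesis
      by (simp add: herm_emb hdot_scaleR_left hdot_add_left hdot_adjoint) (simp add: hdot_cnj[of c])
  qed
  moreover have "(\<forall>p\<in>FC. p \<noteq> 0 \<longrightarrow> P p) \<longleftrightarrow> (\<forall>c. c \<noteq> 0 \<longrightarrow> P (emb c))" for P
    using emb_in emb_cvec emb_0 emb_inj by metis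
  ultimately have "(\<forall>p\<in>FC. p \<noteq> 0 \<longrightarrow> 0 < Re (herm_ext B ((1/2) *\<^sub>R (x p + adjoint_on FC (herm_ext B) x p)) p))
      \<longleftrightarrow> (\<forall>c. c \<noteq> 0 \<longrightarrow> 0 < Re (hdot (mat_of x *v c) c))" by presburger
  then show ?thesis using x unfolding pos_real_part_def pos_real_matrices_def FC_def[symmetric] by blast
qed (simp add: pos_real_part_def FC_def[symmetric])

lemma mat_of_blinfun_bounded_linear: "bounded_linear (\<lambda>X :: ('v \<times> 'v) \<Rightarrow>\<^sub>L ('v \<times> 'v). mat_of (blinfun_apply X) $ i $ k)"
proof -
  have "bounded_linear (\<lambda>c::complex^'m. c $ i)" by (rule bounded_linear_vec_nth)
  then have 1: "bounded_linear (\<lambda>p. cvec p $ i)"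
    using bounded_linear_compose[of "\<lambda>c::complex^'m. c $ i" cvec] cvec_linear linear_conv_bounded_linear by blast
  show ?thesis unfolding mat_of_def
    using bounded_linear_compose[OF 1 blinfun.bounded_linear_left] by simp
qed

lemma mat_of_restrict: "mat_of (restrict x FC) = mat_of x"
  by (simp add: mat_of_def emb_in)

lemma End_on_blinfun:
  "restrict (blinfun_apply X) FC \<in> End_on cx_scale FC \<longleftrightarrow>
    (\<forall>p\<in>FC. X p \<in> FC) \<and> (\<forall>c. \<forall>p\<in>FC. X (cx_scale c p) = cx_scale c (X p))"
proof -
  have W: "p + q \<in> FC" "cx_scale a p \<in> FC" if "p \<in> FC" "q \<in> FC" for a p q
    using that emb_in emb_add emb_scale emb_cvec by metis+
  have "restrict (blinfun_apply X) FC \<in> FC \<rightarrow>\<^sub>E FC \<longleftrightarrow> (\<forall>p\<in>FC. X p \<in> FC)"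
    unfolding PiE_def Pi_def by auto
  moreover have "\<forall>p\<in>FC. \<forall>q\<in>FC. restrict (blinfun_apply X) FC (p + q) = restrict (blinfun_apply X) FC p + restrict (blinfun_apply X) FC q"
    using W by (simp add: blinfun.add_right)
  moreover have "(\<forall>a. \<forall>p\<in>FC. restrict (blinfun_apply X) FC (cx_scale a p) = cx_scale a (restrict (blinfun_apply X) FC p))
      \<longleftrightarrow> (\<forall>a. \<forall>p\<in>FC. X (cx_scale a p) = cx_scale a (X p))"
    using W by simp
  ultimately show ?thesis unfolding End_on_def mem_Collect_eq by simp
qed

text \<open>\<open>a_F\<close> is a definite description, so existence and uniqueness are both due.
  Both are treated after pullback to the set \<open>S\<close> of operators on the ambient space, as
  the notion of smoothness prescribes. \<open>S\<close> is convex and contains the identity, so a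
  second solution, being a continuous logarithm of the same determinant, agrees with
  \<open>log_det\<close>.\<close>

lemma a_F_eq_log_det:
  assumes x: "x \<in> pos_real_part B F"
  shows "a_F B F x = log_det (mat_of x)"
proof -
  define S where "S = {X :: ('v \<times> 'v) \<Rightarrow>\<^sub>L ('v \<times> 'v). restrict (blinfun_apply X) FC \<in> pos_real_part B F}"
  define a where "a = restrict (\<lambda>x. log_det (mat_of x)) (pos_real_part B F)"
  have S: "X \<in> S \<longleftrightarrow> (\<forall>p\<in>FC. X p \<in> FC) \<and> (\<forall>c. \<forall>p\<in>FC. X (cx_scale c p) = cx_scale c (X p))
      \<and> mat_of (blinfun_apply X) \<in> pos_real_matrices" for X
    by (simp add: S_def pos_real_part_iff End_on_blinfun mat_of_restrict)
  have mat_lin: "mat_of (blinfun_apply (u *\<^sub>R X + v *\<^sub>R Y)) = u *\<^sub>R mat_of (blinfun_apply X) + v *\<^sub>R mat_of (blinfun_apply Y)" for u v X Y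
    by (simp add: mat_of_def plus_blinfun.rep_eq scaleR_blinfun.rep_eq linear_add[OF cvec_linear] linear_cmul[OF cvec_linear]
        Finite_Cartesian_Product.vec_eq_iff)
  have convS: "convex S"
  proof (rule convexI)
    fix X Y :: "('v \<times> 'v) \<Rightarrow>\<^sub>L ('v \<times> 'v)" and u v :: real
    assume XY: "X \<in> S" "Y \<in> S" and uv: "0 \<le> u" "0 \<le> v" "u + v = 1"
    have "u *\<^sub>R mat_of (blinfun_apply X) + v *\<^sub>R mat_of (blinfun_apply Y) \<in> pos_real_matrices"
      using XY uv by (intro convexD[OF pos_real_matrices_convex]) (simp_all add: S)
    moreover have "u *\<^sub>R p + v *\<^sub>R q \<in> FC" if "p \<in> FC" "q \<in> FC" for p q
    proof -
      have "u *\<^sub>R p + v *\<^sub>R q = emb (u *\<^sub>R cvec p + v *\<^sub>R cvec q)"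
        using that by (simp add: emb_add linear_cmul[OF emb_linear] emb_cvec)
      then show ?thesis using emb_in by metis
    qed
    moreover have "cx_scale c (u *\<^sub>R p + v *\<^sub>R q) = u *\<^sub>R cx_scale c p + v *\<^sub>R cx_scale c q" for c and p q :: "'v \<times> 'v"
      by (simp add: cx_scale_def prod_eq_iff algebra_simps)
    ultimately show "u *\<^sub>R X + v *\<^sub>R Y \<in> S"
      using XY unfolding S mat_lin unfolding plus_blinfun.rep_eq scaleR_blinfun.rep_eq
      by (intro conjI ballI allI) simp_all
  qed
  have aS: "a (restrict (blinfun_apply X) FC) = log_det (mat_of (blinfun_apply X))" if "X \<in> S" for X
    using that by (simp add: a_def S_def mat_of_restrict)
  have expS: "exp (a (restrict (blinfun_apply X) FC)) = det (mat_of (blinfun_apply X))" if "X \<in> S" for X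
    using that by (simp add: aS S exp_log_det)
  have contS: "continuous_on S (\<lambda>X. a (restrict (blinfun_apply X) FC))"
  proof -
    have "continuous_on S (\<lambda>X. mat_of (blinfun_apply X))"
      unfolding mat_of_def
      by (intro continuous_on_vec_lambda linear_continuous_on mat_of_blinfun_bounded_linear[unfolded mat_of_def vec_lambda_beta])
    then have "continuous_on S (\<lambda>X. log_det (mat_of (blinfun_apply X)))"
      by (rule continuous_on_compose2[OF log_det_continuous]) (auto simp: S)
    then show ?thesis using aS by (simp cong: continuous_on_cong)
  qed
  have CkS: "Ck_on k S (\<lambda>X. det (mat_of (blinfun_apply X)))" for k
    unfolding Determinants.det_def
    by (intro Ck_on_sum Ck_on_mult Ck_on_const Ck_on_prod Ck_on_bounded_linear mat_of_blinfun_bounded_linear)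
  have smooth: "smooth_on_End FC (pos_real_part B F) a"
    unfolding smooth_on_End_def FC_def[symmetric] S_def[symmetric]
    by (intro allI Ck_on_continuous_log[OF contS expS CkS])
  have mat_id: "mat_of (blinfun_apply id_blinfun) = mat 1"
    by (simp add: mat_of_def cvec_emb axis_def Finite_Cartesian_Product.mat_def Finite_Cartesian_Product.vec_eq_iff)
  have idS: "id_blinfun \<in> S"
    unfolding S mat_id using mat_1_pos_real by simp
  \<comment> \<open>Uniqueness on \<open>S\<close> settles the matter only if every endomorphism is
    a restriction. Since \<open>cvec\<close> is defined on the whole ambient space, composing it
    with the matrix of \<open>y\<close> and \<open>emb\<close> gives an extension.\<close>
  have ext: "\<exists>X\<in>S. restrict (blinfun_apply X) FC = y" if y: "y \<in> pos_real_part B F" for y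
  proof -
    have "linear (\<lambda>p. emb (mat_of y *v cvec p))"
    proof (rule linear_compose[of "\<lambda>p. mat_of y *v cvec p" emb, unfolded o_def])
      show "linear (\<lambda>p. mat_of y *v cvec p)"
        by (rule linear_compose[OF cvec_linear, of "(*v) (mat_of y)", unfolded o_def])
          (intro linearI, simp_all only: matrix_vector_right_distrib,
            simp add: Finite_Cartesian_Product.vec_eq_iff matrix_vector_mult_def scaleR_sum_right)
    qed (rule emb_linear)
    then have "bounded_linear (\<lambda>p. emb (mat_of y *v cvec p))" by (simp add: linear_conv_bounded_linear)
    then have X: "blinfun_apply (Blinfun (\<lambda>p. emb (mat_of y *v cvec p))) = (\<lambda>p. emb (mat_of y *v cvec p))"
      by (rule bounded_linear_Blinfun_apply)
    have yE: "y \<in> End_on cx_scale FC" using y pos_real_part_iff by blast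
    have "restrict (\<lambda>p. emb (mat_of y *v cvec p)) FC = y"
    proof
      fix p show "restrict (\<lambda>p. emb (mat_of y *v cvec p)) FC p = y p"
      proof (cases "p \<in> FC")
        case True
        then show ?thesis using End_on_emb[OF yE, of "cvec p"] by (simp add: emb_cvec)
      next
        case False
        moreover have "y \<in> FC \<rightarrow>\<^sub>E FC" using yE by (simp add: End_on_def)
        ultimately show ?thesis using PiE_arb[of y FC "\<lambda>_. FC" p] by simp
      qed
    qed
    then show ?thesis using y by (intro bexI[of _ "Blinfun (\<lambda>p. emb (mat_of y *v cvec p))"]) (simp_all add: X S_def)
  qed
  have id_restrict: "restrict id FC = restrict (blinfun_apply id_blinfun) FC" by auto
  have "a_F B F = a"
    unfolding a_F_def FC_def[symmetric]
  proof (rule the_equality)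
    show "a \<in> extensional (pos_real_part B F) \<and> smooth_on_End FC (pos_real_part B F) a \<and>
       (\<forall>x\<in>pos_real_part B F. Det_on cx_scale FC x = exp (a x)) \<and> a (restrict id FC) = 0"
    proof (intro conjI smooth ballI)
      show "a \<in> extensional (pos_real_part B F)" by (simp add: a_def)
      show "Det_on cx_scale FC y = exp (a y)" if y: "y \<in> pos_real_part B F" for y
        using y pos_real_part_iff Det_on_complexification by (simp add: a_def exp_log_det)
      show "a (restrict id FC) = 0"
        unfolding id_restrict aS[OF idS]
        mat_id by (rule log_det_1)
    qed
  next
    fix b
    assume b: "b \<in> extensional (pos_real_part B F) \<and> smooth_on_End FC (pos_real_part B F) b \<and>
       (\<forall>x\<in>pos_real_part B F. Det_on cx_scale FC x = exp (b x)) \<and> b (restrict id FC) = 0"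
    have "Ck_on 0 S (\<lambda>X. b (restrict (blinfun_apply X) FC))"
      using b unfolding smooth_on_End_def FC_def[symmetric] S_def[symmetric] by blast
    then have contb: "continuous_on S (\<lambda>X. b (restrict (blinfun_apply X) FC))" by simp
    have eq: "b (restrict (blinfun_apply X) FC) = a (restrict (blinfun_apply X) FC)" if X: "X \<in> S" for X
    proof (rule continuous_log_unique[OF convS contb contS _ idS _ X])
      fix Y assume Y: "Y \<in> S"
      then have Y': "restrict (blinfun_apply Y) FC \<in> pos_real_part B F" by (simp add: S_def)
      then have "exp (b (restrict (blinfun_apply Y) FC)) = Det_on cx_scale FC (restrict (blinfun_apply Y) FC)"
        using b by metis
      also have "\<dots> = exp (a (restrict (blinfun_apply Y) FC))"
        using Y' pos_real_part_iff Det_on_complexification expS[OF Y] mat_of_restrict by simp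
      finally show "exp (b (restrict (blinfun_apply Y) FC)) = exp (a (restrict (blinfun_apply Y) FC))" .
    next
      have "a (restrict (blinfun_apply id_blinfun) FC) = 0"
        unfolding aS[OF idS]
        mat_id by (rule log_det_1)
      then show "b (restrict (blinfun_apply id_blinfun) FC) = a (restrict (blinfun_apply id_blinfun) FC)"
        using b unfolding id_restrict by simp
    qed
    show "b = a"
    proof
      fix y show "b y = a y"
      proof (cases "y \<in> pos_real_part B F")
        case True
        then show ?thesis using ext[OF True] eq by metis
      next
        case False
        then show ?thesis using b by (auto simp: a_def extensional_def)
      qed
    qed
  qed
  then show ?thesis using x by (simp add: a_def)
qed

end

section \<open>Reproducing kernels and unitary operators\<close>

text \<open>The form is only semidefinite, so that measurable functions themselves, not their
  classes modulo null sets, form an instance. The instances are the weighted square integrable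
  functions, the Fock space and the functions of Gaussian decay.\<close>

locale semi_inner_space =
  fixes H :: "('a \<Rightarrow> complex) set" and ip :: "('a \<Rightarrow> complex) \<Rightarrow> ('a \<Rightarrow> complex) \<Rightarrow> complex"
  assumes add: "f \<in> H \<Longrightarrow> g \<in> H \<Longrightarrow> (\<lambda>z. f z + g z) \<in> H"
    and scale: "f \<in> H \<Longrightarrow> (\<lambda>z. c * f z) \<in> H"
    and ip_add: "f \<in> H \<Longrightarrow> g \<in> H \<Longrightarrow> h \<in> H \<Longrightarrow> ip (\<lambda>z. f z + g z) h = ip f h + ip g h"
    and ip_scale: "f \<in> H \<Longrightarrow> h \<in> H \<Longrightarrow> ip (\<lambda>z. c * f z) h = c * ip f h"
    and ip_cnj: "f \<in> H \<Longrightarrow> g \<in> H \<Longrightarrow> ip g f = cnj (ip f g)"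
    and ip_pos: "f \<in> H \<Longrightarrow> 0 \<le> Re (ip f f)"
begin

definition sqn where "sqn f = Re (ip f f)"

lemma ip_self: "f \<in> H \<Longrightarrow> ip f f = complex_of_real (sqn f)"
  using ip_cnj[of f f] by (auto simp: sqn_def complex_eq_iff)

lemma sqn_nonneg: "f \<in> H \<Longrightarrow> 0 \<le> sqn f"
  by (simp add: sqn_def ip_pos)

lemma diff: "f \<in> H \<Longrightarrow> g \<in> H \<Longrightarrow> (\<lambda>z. f z - g z) \<in> H"
  using add[of f "\<lambda>z. (-1) * g z"] scale[of g "-1"] by simp

lemma ip_diff: "f \<in> H \<Longrightarrow> g \<in> H \<Longrightarrow> h \<in> H \<Longrightarrow> ip (\<lambda>z. f z - g z) h = ip f h - ip g h"
  using ip_add[of f "\<lambda>z. (-1) * g z" h] scale[of g "-1"] ip_scale[of g h "-1"] by simp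

lemma ip_add_right:
  assumes "f \<in> H" "g \<in> H" "h \<in> H"
  shows "ip h (\<lambda>z. f z + g z) = ip h f + ip h g"
  unfolding ip_cnj[OF add[OF assms(1,2)] assms(3)] ip_add[OF assms] complex_cnj_add
  using assms by (simp add: ip_cnj[symmetric])

lemma ip_diff_right:
  assumes "f \<in> H" "g \<in> H" "h \<in> H"
  shows "ip h (\<lambda>z. f z - g z) = ip h f - ip h g"
  unfolding ip_cnj[OF diff[OF assms(1,2)] assms(3)] ip_diff[OF assms] complex_cnj_diff
  using assms by (simp add: ip_cnj[symmetric])

lemma ip_scale_right: "f \<in> H \<Longrightarrow> h \<in> H \<Longrightarrow> ip h (\<lambda>z. c * f z) = cnj c * ip h f"
  by (metis scale ip_cnj complex_cnj_mult ip_scale)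

lemma sqn_scale: "f \<in> H \<Longrightarrow> sqn (\<lambda>z. c * f z) = (cmod c)\<^sup>2 * sqn f"
proof -
  assume f: "f \<in> H"
  have "ip (\<lambda>z. c * f z) (\<lambda>z. c * f z) = c * cnj c * ip f f"
    using f by (simp add: ip_scale ip_scale_right scale mult_ac)
  also have "\<dots> = complex_of_real ((cmod c)\<^sup>2 * sqn f)"
    using f by (simp add: ip_self flip: complex_norm_square)
  finally show ?thesis by (simp add: sqn_def)
qed

lemma sqn_add: "f \<in> H \<Longrightarrow> g \<in> H \<Longrightarrow> sqn (\<lambda>z. f z + g z) = sqn f + sqn g + 2 * Re (ip f g)"
  using ip_cnj[of f g] by (simp add: sqn_def ip_add ip_add_right add)

lemma sqn_diff: "f \<in> H \<Longrightarrow> g \<in> H \<Longrightarrow> sqn (\<lambda>z. f z - g z) = sqn f + sqn g - 2 * Re (ip f g)"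
  using ip_cnj[of f g] by (simp add: sqn_def ip_diff ip_diff_right diff)

lemma parallelogram:
  "f \<in> H \<Longrightarrow> g \<in> H \<Longrightarrow> sqn (\<lambda>z. f z + g z) + sqn (\<lambda>z. f z - g z) = 2 * sqn f + 2 * sqn g"
  by (simp add: sqn_add sqn_diff)

text \<open>The squared norm of \<open>f - t g\<close> is nonnegative for
  \<open>t = s * ip f g\<close> with real \<open>s\<close>; the choice \<open>s = 1 / sqn g\<close>
  gives the bound. Semidefiniteness makes the case \<open>sqn g = 0\<close> separate.\<close>

lemma cauchy_schwarz:
  assumes f: "f \<in> H" and g: "g \<in> H"
  shows "(cmod (ip f g))\<^sup>2 \<le> sqn f * sqn g"
proof -
  have *: "0 \<le> sqn f + (cmod t)\<^sup>2 * sqn g - 2 * Re (cnj t * ip f g)" for t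
    using sqn_nonneg[OF diff[OF f scale[OF g, of t]]] sqn_diff[OF f scale[OF g, of t]]
    by (simp add: sqn_scale g ip_scale_right f)
  have re: "Re (cnj (complex_of_real s * ip f g) * ip f g) = s * (cmod (ip f g))\<^sup>2" for s
    by (simp add: cmod_power2) (simp add: power2_eq_square algebra_simps)
  have *: "0 \<le> sqn f + s\<^sup>2 * (cmod (ip f g))\<^sup>2 * sqn g - 2 * s * (cmod (ip f g))\<^sup>2" for s
    using *[of "complex_of_real s * ip f g"] unfolding re by (simp add: norm_mult power_mult_distrib mult_ac)
  show ?thesis
  proof (cases "sqn g = 0")
    case True
    have "(cmod (ip f g))\<^sup>2 = 0"
    proof (rule ccontr)
      assume "(cmod (ip f g))\<^sup>2 \<noteq> 0"
      \<comment> \<open>When \<open>sqn g\<close> vanishes the expression is affine in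
        \<open>s\<close>, and at this value of \<open>s\<close> it equals -1.\<close>
      then show False using *[of "(sqn f + 1) / (2 * (cmod (ip f g))\<^sup>2)"] True by simp
    qed
    then show ?thesis using True by simp
  next
    case False
    then have "0 < sqn g" using sqn_nonneg[OF g] by simp
    then show ?thesis using *[of "1 / sqn g"]
      by (simp add: field_simps power2_eq_square)
  qed
qed

lemma ip_tendsto:
  assumes s: "\<And>n. s n \<in> H" and f: "f \<in> H" and g: "g \<in> H"
    and lim: "(\<lambda>n. sqn (\<lambda>z. s n z - f z)) \<longlonglongrightarrow> 0"
  shows "(\<lambda>n. ip (s n) g) \<longlonglongrightarrow> ip f g"
proof -
  have b: "norm (ip (s n) g - ip f g) \<le> sqrt (sqn (\<lambda>z. s n z - f z) * sqn g)" for n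
    using cauchy_schwarz[OF diff[OF s f] g, of n]
    unfolding ip_diff[OF s f g] by (rule real_le_rsqrt)
  have "(\<lambda>n. sqrt (sqn (\<lambda>z. s n z - f z) * sqn g)) \<longlonglongrightarrow> sqrt (0 * sqn g)"
    by (intro tendsto_intros lim)
  then have "(\<lambda>n. sqrt (sqn (\<lambda>z. s n z - f z) * sqn g)) \<longlonglongrightarrow> 0" by simp
  then have "(\<lambda>n. ip (s n) g - ip f g) \<longlonglongrightarrow> 0"
    by (rule Lim_null_comparison[OF always_eventually, rotated]) (rule allI, rule b)
  then show ?thesis by (simp add: LIM_zero_iff)
qed

lemma sqn_tendsto:
  assumes s: "\<And>n. s n \<in> H" and f: "f \<in> H"
    and lim: "(\<lambda>n. sqn (\<lambda>z. s n z - f z)) \<longlonglongrightarrow> 0"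
  shows "(\<lambda>n. sqn (s n)) \<longlonglongrightarrow> sqn f"
proof -
  have "sqn (s n) = sqn (\<lambda>z. s n z - f z) + 2 * Re (ip (s n) f) - sqn f" for n
    by (simp add: sqn_diff s f)
  moreover have "(\<lambda>n. sqn (\<lambda>z. s n z - f z) + 2 * Re (ip (s n) f) - sqn f) \<longlonglongrightarrow> 0 + 2 * Re (ip f f) - sqn f"
    by (intro tendsto_intros lim ip_tendsto s f)
  ultimately show ?thesis by (simp add: sqn_def)
qed

end

text \<open>The norm of \<open>f + c g\<close> contains the cross term
  \<open>Re (cnj c * ip f g)\<close>; the values \<open>c = 1\<close> and \<open>c = i\<close>
  recover both parts of the inner product. It upgrades equality of norms to equality of inner
  products between two different spaces.\<close>

lemma (in semi_inner_space) polarization: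
  assumes f: "f \<in> H" and g: "g \<in> H" and inner: "semi_inner_space H' ip'"
    and f': "f' \<in> H'" and g': "g' \<in> H'"
    and iso: "\<And>c. Re (ip' (\<lambda>z. f' z + c * g' z) (\<lambda>z. f' z + c * g' z)) =
      Re (ip (\<lambda>z. f z + c * g z) (\<lambda>z. f z + c * g z))"
    and isof: "Re (ip' f' f') = Re (ip f f)" and isog: "Re (ip' g' g') = Re (ip g g)"
  shows "ip' f' g' = ip f g"
proof -
  interpret S: semi_inner_space H' ip' by fact
  have "Re (cnj c * ip' f' g') = Re (cnj c * ip f g)" for c
    using iso[of c] S.sqn_add[OF f' S.scale[OF g', of c]] sqn_add[OF f scale[OF g, of c]]
      S.sqn_scale[OF g', of c] sqn_scale[OF g, of c]
      isof isog
    unfolding S.sqn_def sqn_def S.ip_scale_right[OF g' f', of c] ip_scale_right[OF g f, of c] by simp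
  from this[of 1] this[of \<i>] show ?thesis by (simp add: complex_eq_iff)
qed

locale reproducing_kernel_space = semi_inner_space +
  fixes e :: "'a \<Rightarrow> 'a \<Rightarrow> complex"
  assumes e_in: "e v \<in> H"
    and reproducing: "f \<in> H \<Longrightarrow> ip f (e v) = f v"
    and complete: "(\<And>n. s n \<in> H) \<Longrightarrow>
      (\<And>\<epsilon>. 0 < \<epsilon> \<Longrightarrow> \<exists>M. \<forall>m\<ge>M. \<forall>n\<ge>M. sqn (\<lambda>z. s m z - s n z) < \<epsilon>) \<Longrightarrow>
      \<exists>f\<in>H. (\<lambda>n. sqn (\<lambda>z. s n z - f z)) \<longlonglongrightarrow> 0"
begin

inductive_set kernel_span :: "('a \<Rightarrow> complex) set" where
  span_base: "e v \<in> kernel_span"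
| span_add: "f \<in> kernel_span \<Longrightarrow> g \<in> kernel_span \<Longrightarrow> (\<lambda>z. f z + g z) \<in> kernel_span"
| span_scale: "f \<in> kernel_span \<Longrightarrow> (\<lambda>z. c * f z) \<in> kernel_span"

lemma kernel_span_subset: "f \<in> kernel_span \<Longrightarrow> f \<in> H"
  by (induction rule: kernel_span.induct) (auto intro: e_in add scale)

text \<open>A minimising sequence for the distance from \<open>f\<close> to the span is Cauchy by
  the parallelogram law, with some limit \<open>d\<close>. The residual \<open>u = f - d\<close>
  cannot be shortened along any \<open>e v\<close>, so it is orthogonal to all of them, and by the
  reproducing property it vanishes at every point.\<close>

lemma kernel_span_dense:
  assumes f: "f \<in> H"
  obtains s where "\<And>n. s n \<in> kernel_span" "(\<lambda>n. sqn (\<lambda>z. s n z - f z)) \<longlonglongrightarrow> 0"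
proof -
  define \<delta> where "\<delta> = (INF d\<in>kernel_span. sqn (\<lambda>z. f z - d z))"
  have ne: "kernel_span \<noteq> {}" using span_base by blast
  have bdd: "bdd_below ((\<lambda>d. sqn (\<lambda>z. f z - d z)) ` kernel_span)"
    by (intro bdd_belowI2[of _ 0] sqn_nonneg diff f kernel_span_subset)
  have low: "\<delta> \<le> sqn (\<lambda>z. f z - d z)" if "d \<in> kernel_span" for d
    unfolding \<delta>_def by (rule cINF_lower[OF bdd that])
  have "\<exists>d\<in>kernel_span. sqn (\<lambda>z. f z - d z) < \<delta> + 1 / real (Suc n)" for n
    using cINF_less_iff[OF ne bdd, of "\<delta> + 1 / real (Suc n)"] by (simp add: \<delta>_def)
  then obtain s where s: "\<And>n. s n \<in> kernel_span"
      "\<And>n. sqn (\<lambda>z. f z - s n z) < \<delta> + 1 / real (Suc n)" by metis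
  have sH: "s n \<in> H" for n using kernel_span_subset s(1) .
  have cau: "sqn (\<lambda>z. s m z - s n z) \<le> 2 / real (Suc n) + 2 / real (Suc m)" for m n
  proof -
    define d where "d = (\<lambda>z. (1/2) * (s n z + s m z))"
    have dk: "d \<in> kernel_span" unfolding d_def by (intro span_scale span_add s)
    have "sqn (\<lambda>z. (f z - s n z) + (f z - s m z)) = 4 * sqn (\<lambda>z. f z - d z)"
      using sqn_scale[OF diff[OF f kernel_span_subset[OF dk]], of 2]
      by (simp add: d_def algebra_simps)
    moreover have "sqn (\<lambda>z. (f z - s n z) + (f z - s m z)) + sqn (\<lambda>z. (f z - s n z) - (f z - s m z))
       = 2 * sqn (\<lambda>z. f z - s n z) + 2 * sqn (\<lambda>z. f z - s m z)"
      by (rule parallelogram[OF diff[OF f sH] diff[OF f sH]])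
    moreover have "(\<lambda>z. (f z - s n z) - (f z - s m z)) = (\<lambda>z. s m z - s n z)" by auto
    ultimately show ?thesis using low[OF dk] s(2)[of n] s(2)[of m] by simp
  qed
  have "\<exists>M. \<forall>m\<ge>M. \<forall>n\<ge>M. sqn (\<lambda>z. s m z - s n z) < \<epsilon>" if \<epsilon>: "0 < \<epsilon>" for \<epsilon>
  proof -
    obtain M where M: "4 / \<epsilon> < real M" using reals_Archimedean2 by blast
    have "sqn (\<lambda>z. s m z - s n z) < \<epsilon>" if "M \<le> m" "M \<le> n" for m n
    proof -
      have le: "2 / real (Suc k) < \<epsilon> / 2" if "M \<le> k" for k
      proof -
        have "4 / \<epsilon> < real (Suc k)" using M that by linarith
        then have "4 < real (Suc k) * \<epsilon>" using \<epsilon> by (simp add: divide_less_eq)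
        then show ?thesis by (simp add: field_simps)
      qed
      show ?thesis using cau[of m n] le[OF that(1)] le[OF that(2)] by simp
    qed
    then show ?thesis by blast
  qed
  from complete[of s, OF sH this] obtain d
    where d: "d \<in> H" and lim: "(\<lambda>n. sqn (\<lambda>z. s n z - d z)) \<longlonglongrightarrow> 0" by blast
  define u where "u = (\<lambda>z. f z - d z)"
  have u: "u \<in> H" unfolding u_def by (intro diff f d)
  have lim2: "(\<lambda>n. sqn (\<lambda>z. (f z - (s n z + c * e v z)) - (u z - c * e v z))) \<longlonglongrightarrow> 0" for c v
  proof -
    have "sqn (\<lambda>z. (f z - (s n z + c * e v z)) - (u z - c * e v z)) = sqn (\<lambda>z. s n z - d z)" for n
      using sqn_scale[OF diff[OF sH d], of "-1"] by (simp add: u_def algebra_simps)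
    then show ?thesis using lim by simp
  qed
  have ge: "\<delta> \<le> sqn (\<lambda>z. u z - c * e v z)" for c v
  proof (rule LIMSEQ_le_const)
    show "(\<lambda>n. sqn (\<lambda>z. f z - (s n z + c * e v z))) \<longlonglongrightarrow> sqn (\<lambda>z. u z - c * e v z)"
      by (rule sqn_tendsto[OF diff[OF f add[OF sH scale[OF e_in]]] diff[OF u scale[OF e_in]] lim2])
    show "\<exists>N. \<forall>n\<ge>N. \<delta> \<le> sqn (\<lambda>z. f z - (s n z + c * e v z))"
      by (intro exI allI impI low span_add span_scale s span_base)
  qed
  have le: "sqn u \<le> \<delta>"
  proof (rule LIMSEQ_le)
    show "(\<lambda>n. sqn (\<lambda>z. f z - s n z)) \<longlonglongrightarrow> sqn u"
      using sqn_tendsto[OF diff[OF f sH] u] lim2[of 0] by simp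
    show "(\<lambda>n. \<delta> + 1 / real (Suc n)) \<longlonglongrightarrow> \<delta>"
      using tendsto_add[OF tendsto_const LIMSEQ_inverse_real_of_nat, of \<delta>]
      by (simp add: inverse_eq_divide)
    show "\<exists>N. \<forall>n\<ge>N. sqn (\<lambda>z. f z - s n z) \<le> \<delta> + 1 / real (Suc n)"
      using s(2) less_imp_le by blast
  qed
  have "u v = 0" for v
  proof (rule ccontr)
    assume "u v \<noteq> 0"
    have key: "0 \<le> (cmod c)\<^sup>2 * sqn (e v) - 2 * Re (cnj c * u v)" for c
      using ge[of c v] le sqn_diff[OF u scale[OF e_in], of c v]
      by (simp add: sqn_scale e_in ip_scale_right u reproducing)
    \<comment> \<open>Subtracting \<open>r * u v\<close> times \<open>e v\<close> from
      \<open>u\<close> changes the squared distance by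
      \<open>|u v|^2 * r * (r * sqn (e v) - 2)\<close>, which is negative for this
      \<open>r\<close>.\<close>
    define r where "r = 1 / (sqn (e v) + 1)"
    have r: "0 < r" "r * sqn (e v) < 1" using sqn_nonneg[OF e_in[of v]] by (auto simp: r_def field_simps)
    have "Re (cnj (complex_of_real r * u v) * u v) = r * (cmod (u v))\<^sup>2"
      by (simp add: cmod_power2) (simp add: power2_eq_square algebra_simps)
    then have "0 \<le> (cmod (u v))\<^sup>2 * r * (r * sqn (e v) - 2)"
      using key[of "complex_of_real r * u v"]
      by (simp add: norm_mult power_mult_distrib algebra_simps power2_eq_square)
    moreover have "0 < (cmod (u v))\<^sup>2 * r" using r \<open>u v \<noteq> 0\<close> by simp
    ultimately show False using r(2) by (simp add: zero_le_mult_iff)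
  qed
  then have "f = d" by (auto simp: u_def fun_eq_iff)
  then show ?thesis using that s(1) lim by blast
qed

end

text \<open>A kernel \<open>k\<close> with the same Gram matrix as \<open>e\<close>, whose adjoint kernel \<open>l\<close> has it too,
  comes from a unitary operator.\<close>

locale unitary_kernel = reproducing_kernel_space +
  fixes k l :: "'a \<Rightarrow> 'a \<Rightarrow> complex"
  assumes k_in: "k v \<in> H" and l_in: "l v \<in> H"
    and kk: "ip (k v) (k w) = e v w" and ll: "ip (l v) (l w) = e v w"
    and kl: "k v w = cnj (l w v)"
begin

text \<open>The value at \<open>z\<close> is the inner product with \<open>e z\<close>, and the
  adjoint operator is meant to send \<open>e z\<close> to \<open>l z\<close>. So the formula defines
  the operator on all of \<open>H\<close> at once, with no extension from a dense subspace.\<close>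

definition op where "op f = (\<lambda>z. ip f (l z))"
definition op' where "op' f = (\<lambda>z. ip f (k z))"

lemma op_e: "op (e v) = k v"
  by (simp add: op_def fun_eq_iff kl ip_cnj[OF l_in e_in] reproducing[OF l_in])

lemma op_add: "f \<in> H \<Longrightarrow> g \<in> H \<Longrightarrow> op (\<lambda>z. f z + g z) = (\<lambda>z. op f z + op g z)"
  by (simp add: op_def ip_add l_in)

lemma op_scale: "f \<in> H \<Longrightarrow> op (\<lambda>z. c * f z) = (\<lambda>z. c * op f z)"
  by (simp add: op_def ip_scale l_in)

lemma op_span: "f \<in> kernel_span \<Longrightarrow> op f \<in> H"
proof (induction rule: kernel_span.induct)
  case (span_base v) then show ?case by (simp add: op_e k_in)
next
  case (span_add f g)
  have "f \<in> H" "g \<in> H" using span_add.hyps kernel_span_subset by auto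
  then show ?case using span_add.IH op_add add by simp
next
  case (span_scale f c)
  have "f \<in> H" using span_scale.hyps kernel_span_subset by auto
  then show ?case using span_scale.IH op_scale scale by simp
qed

lemma op_span_ip_k: "f \<in> kernel_span \<Longrightarrow> ip (op f) (k w) = ip f (e w)"
proof (induction rule: kernel_span.induct)
  case (span_base v) then show ?case by (simp add: op_e kk reproducing e_in)
next
  case (span_add f g)
  have "f \<in> H" "g \<in> H" "op f \<in> H" "op g \<in> H" using span_add.hyps kernel_span_subset op_span by auto
  then show ?case using span_add.IH by (simp add: op_add ip_add k_in e_in)
next
  case (span_scale f c)
  have "f \<in> H" "op f \<in> H" using span_scale.hyps kernel_span_subset op_span by auto
  then show ?case using span_scale.IH by (simp add: op_scale ip_scale k_in e_in)
qed

lemma op_span_ip: "g \<in> kernel_span \<Longrightarrow> f \<in> kernel_span \<Longrightarrow> ip (op f) (op g) = ip f g"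
proof (induction rule: kernel_span.induct)
  case (span_base v) then show ?case by (simp add: op_e op_span_ip_k)
next
  case (span_add g g')
  have "f \<in> H" "op f \<in> H" "g \<in> H" "op g \<in> H" "g' \<in> H" "op g' \<in> H"
    using span_add.hyps span_add.prems kernel_span_subset op_span by auto
  then show ?case using span_add by (simp add: op_add ip_add_right)
next
  case (span_scale g c)
  have "f \<in> H" "op f \<in> H" "g \<in> H" "op g \<in> H"
    using span_scale.hyps span_scale.prems kernel_span_subset op_span by auto
  then show ?case using span_scale by (simp add: op_scale ip_scale_right)
qed

text \<open>On the span the operator preserves inner products, so it maps an approximating sequence
  to a Cauchy sequence. The limit of the latter is identified with \<open>op f\<close> by evaluating
  at points, where both converge.\<close>

lemma op_approx:
  assumes f: "f \<in> H"
  obtains s where "\<And>n. s n \<in> kernel_span" "(\<lambda>n. sqn (\<lambda>z. s n z - f z)) \<longlonglongrightarrow> 0"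
    "op f \<in> H" "(\<lambda>n. sqn (\<lambda>z. op (s n) z - op f z)) \<longlonglongrightarrow> 0"
proof -
  obtain s where s: "\<And>n. s n \<in> kernel_span" and lim: "(\<lambda>n. sqn (\<lambda>z. s n z - f z)) \<longlonglongrightarrow> 0"
    using kernel_span_dense[OF f] by blast
  have sH: "s n \<in> H" for n using kernel_span_subset s .
  have opH: "op (s n) \<in> H" for n using op_span s .
  have iso: "sqn (\<lambda>z. op (s m) z - op (s n) z) = sqn (\<lambda>z. s m z - s n z)" for m n
    by (simp add: sqn_diff opH sH op_span_ip s) (simp add: sqn_def op_span_ip s)
  have "\<exists>M. \<forall>m\<ge>M. \<forall>n\<ge>M. sqn (\<lambda>z. op (s m) z - op (s n) z) < \<epsilon>" if "0 < \<epsilon>" for \<epsilon>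
  proof -
    obtain M where M: "\<And>n. n \<ge> M \<Longrightarrow> sqn (\<lambda>z. s n z - f z) < \<epsilon> / 4"
      using order_tendstoD(2)[OF lim, of "\<epsilon> / 4"] \<open>0 < \<epsilon>\<close> by (auto simp: eventually_sequentially)
    have "sqn (\<lambda>z. s m z - s n z) < \<epsilon>" if "m \<ge> M" "n \<ge> M" for m n
    proof -
      have "sqn (\<lambda>z. (s m z - f z) + (s n z - f z)) + sqn (\<lambda>z. (s m z - f z) - (s n z - f z))
        = 2 * sqn (\<lambda>z. s m z - f z) + 2 * sqn (\<lambda>z. s n z - f z)"
        by (rule parallelogram[OF diff[OF sH f] diff[OF sH f]])
      moreover have "0 \<le> sqn (\<lambda>z. (s m z - f z) + (s n z - f z))"
        by (rule sqn_nonneg[OF add[OF diff[OF sH f] diff[OF sH f]]])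
      ultimately show ?thesis using M[OF that(1)] M[OF that(2)] by simp
    qed
    then show ?thesis by (auto simp: iso)
  qed
  then obtain g where g: "g \<in> H" "(\<lambda>n. sqn (\<lambda>z. op (s n) z - g z)) \<longlonglongrightarrow> 0"
    using complete[of "\<lambda>n. op (s n)", OF opH] by blast
  have "g z = op f z" for z
  proof (rule LIMSEQ_unique)
    show "(\<lambda>n. op (s n) z) \<longlonglongrightarrow> g z"
      using ip_tendsto[of "\<lambda>n. op (s n)" g "e z"] g by (simp add: opH e_in reproducing)
    show "(\<lambda>n. op (s n) z) \<longlonglongrightarrow> op f z"
      unfolding op_def by (intro ip_tendsto sH f l_in lim)
  qed
  then have "g = op f" by auto
  with g s lim that show ?thesis by blast
qed

lemma op_in: "f \<in> H \<Longrightarrow> op f \<in> H"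
  using op_approx by metis

lemma op_ip:
  assumes f: "f \<in> H" and g: "g \<in> H"
  shows "ip (op f) (op g) = ip f g"
proof -
  have 1: "ip (op f) (op g) = ip f g" if f: "f \<in> H" and g: "g \<in> kernel_span" for f g
  proof -
    obtain s where s: "\<And>n. s n \<in> kernel_span" "(\<lambda>n. sqn (\<lambda>z. s n z - f z)) \<longlonglongrightarrow> 0"
      "op f \<in> H" "(\<lambda>n. sqn (\<lambda>z. op (s n) z - op f z)) \<longlonglongrightarrow> 0"
      using op_approx[OF f] by blast
    have "(\<lambda>n. ip (op (s n)) (op g)) \<longlonglongrightarrow> ip (op f) (op g)"
      using s g by (intro ip_tendsto) (auto intro: op_span)
    moreover have "(\<lambda>n. ip (op (s n)) (op g)) \<longlonglongrightarrow> ip f g"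
      unfolding op_span_ip[OF g s(1)] using s g f by (intro ip_tendsto) (auto intro: kernel_span_subset)
    ultimately show ?thesis using LIMSEQ_unique by blast
  qed
  obtain s where s: "\<And>n. s n \<in> kernel_span" "(\<lambda>n. sqn (\<lambda>z. s n z - g z)) \<longlonglongrightarrow> 0"
    "op g \<in> H" "(\<lambda>n. sqn (\<lambda>z. op (s n) z - op g z)) \<longlonglongrightarrow> 0"
    using op_approx[OF g] by blast
  have eq: "ip (op (s n)) (op f) = ip (s n) f" for n
    using 1[OF f s(1)[of n]] ip_cnj[OF op_in[OF f] op_span[OF s(1)]] ip_cnj[OF f kernel_span_subset[OF s(1)]]
    by simp
  have "(\<lambda>n. ip (op (s n)) (op f)) \<longlonglongrightarrow> ip (op g) (op f)"
    using s f by (intro ip_tendsto) (auto intro: op_span op_in)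
  moreover have "(\<lambda>n. ip (op (s n)) (op f)) \<longlonglongrightarrow> ip g f"
    unfolding eq using s g f by (intro ip_tendsto) (auto intro: kernel_span_subset)
  ultimately have "ip (op g) (op f) = ip g f" using LIMSEQ_unique by blast
  then show ?thesis using ip_cnj op_in f g by metis
qed

lemma op'_op: "f \<in> H \<Longrightarrow> op' (op f) = f"
  using op_ip[OF _ e_in] by (simp add: op'_def op_e[symmetric] reproducing)

text \<open>The assumptions are symmetric under exchange of \<open>k\<close> and \<open>l\<close>,
  so everything shown for \<open>op\<close> holds for \<open>op'\<close>; this supplies the inverse
  and with it surjectivity.\<close>

lemma adjoint: "unitary_kernel H ip e l k"
  by unfold_locales (auto simp: k_in l_in kk ll kl)

lemma op_adjoint: "unitary_kernel.op ip k = op'"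
  by (simp add: unitary_kernel.op_def[OF adjoint] op'_def[abs_def] fun_eq_iff)

lemma op'_in: "f \<in> H \<Longrightarrow> op' f \<in> H"
  using unitary_kernel.op_in[OF adjoint] by (simp add: op_adjoint)

lemma op_op': "f \<in> H \<Longrightarrow> op (op' f) = f"
  using unitary_kernel.op'_op[OF adjoint]
  by (simp add: op_adjoint unitary_kernel.op'_def[OF adjoint] op_def)

lemma op_bij: "bij_betw op H H"
  by (rule bij_betwI[where g=op']) (auto simp: op_in op'_in op_op' op'_op)

lemma op_adj: "f \<in> H \<Longrightarrow> g \<in> H \<Longrightarrow> ip (op f) g = ip f (op' g)"
  by (metis op_ip op'_in op_op')

end

section \<open>The Bargmann--Fock space\<close>

lemma integrable_real_mult_bound:
  fixes f g :: "'a \<Rightarrow> real"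
  assumes "integrable M f" "g \<in> borel_measurable M" "\<And>x. \<bar>g x\<bar> \<le> f x"
  shows "integrable M g"
  by (rule Bochner_Integration.integrable_bound[OF assms(1,2)]) (use assms(3) order_trans[OF _ abs_ge_self] in auto)

locale bargmann_fock =
  fixes h :: real and n :: nat and \<Omega> :: "'v::euclidean_space \<Rightarrow> 'v \<Rightarrow> real" and j :: "'v \<Rightarrow> 'v"
  assumes h: "0 < h" and symplectic: "symplectic_form \<Omega>" and dim: "DIM('v) = 2 * n" and j: "j \<in> j_plus \<Omega>"
begin

abbreviation "G \<equiv> Gform \<Omega> j"
abbreviation "hp \<equiv> hprod \<Omega> j"

definition w :: real where "w = hbar h"
definition wt :: "'v \<Rightarrow> real" where "wt z = exp (- G z z / (2 * w))"

lemma w: "0 < w" using h by (simp add: w_def hbar_def)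

lemma \<Omega>_bilinear: "bilinear \<Omega>" and \<Omega>_self: "\<Omega> v v = 0"
  using symplectic by (auto simp: symplectic_form_def)

lemma \<Omega>_linear: "linear (\<Omega> v)" "linear (\<lambda>v. \<Omega> v u)"
  using \<Omega>_bilinear by (auto simp: bilinear_def)

lemma \<Omega>_simps:
  "\<Omega> (u + v) z = \<Omega> u z + \<Omega> v z" "\<Omega> z (u + v) = \<Omega> z u + \<Omega> z v"
  "\<Omega> (u - v) z = \<Omega> u z - \<Omega> v z" "\<Omega> z (u - v) = \<Omega> z u - \<Omega> z v"
  "\<Omega> (r *\<^sub>R u) z = r * \<Omega> u z" "\<Omega> z (r *\<^sub>R u) = r * \<Omega> z u"
  "\<Omega> (- u) z = - \<Omega> u z" "\<Omega> z (- u) = - \<Omega> z u" "\<Omega> 0 z = 0" "\<Omega> z 0 = 0"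
  using \<Omega>_linear by (simp_all add: linear_add linear_diff linear_cmul linear_neg linear_0)
    (simp_all add: linear_diff[OF \<Omega>_linear(2)] linear_diff[OF \<Omega>_linear(1)] linear_cmul[OF \<Omega>_linear(2)]
       linear_cmul[OF \<Omega>_linear(1)] linear_add[OF \<Omega>_linear(2)] linear_add[OF \<Omega>_linear(1)]
       linear_neg[OF \<Omega>_linear(2)] linear_neg[OF \<Omega>_linear(1)] linear_0[OF \<Omega>_linear(1)] linear_0[OF \<Omega>_linear(2)])

lemma \<Omega>_antisym: "\<Omega> u v = - \<Omega> v u"
  using \<Omega>_self[of "u + v"] \<Omega>_self[of u] \<Omega>_self[of v] unfolding \<Omega>_simps by linarith

lemma j_linear: "linear j" and j_\<Omega>: "\<Omega> (j u) (j v) = \<Omega> u v" and jj: "j (j v) = - v"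
  and G_pos: "v \<noteq> 0 \<Longrightarrow> 0 < G v v"
  using j by (auto simp: j_plus_def Sp_def)

lemma j_simps: "j (u + v) = j u + j v" "j (u - v) = j u - j v" "j (r *\<^sub>R u) = r *\<^sub>R j u" "j (- u) = - j u" "j 0 = 0"
  using j_linear by (simp_all add: linear_add linear_diff linear_cmul linear_neg linear_0)

lemma \<Omega>_j_left: "\<Omega> (j u) v = - \<Omega> u (j v)"
  using j_\<Omega>[of u "j v"] unfolding jj \<Omega>_simps by linarith

lemma G_sym: "G u v = G v u"
  using \<Omega>_antisym[of v "j u"] \<Omega>_j_left[of u v] unfolding Gform_def by linarith

lemma G_bilinear: "bilinear G"
  unfolding bilinear_def Gform_def by (auto intro!: linearI simp: \<Omega>_simps j_simps)

lemma G_simps: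
  "G (u + v) z = G u z + G v z" "G z (u + v) = G z u + G z v"
  "G (u - v) z = G u z - G v z" "G z (u - v) = G z u - G z v"
  "G (r *\<^sub>R u) z = r * G u z" "G z (r *\<^sub>R u) = r * G z u"
  "G (- u) z = - G u z" "G z (- u) = - G z u" "G 0 z = 0" "G z 0 = 0"
  by (simp_all add: Gform_def \<Omega>_simps j_simps)

lemma G_j: "G (j u) (j v) = G u v" "G (j u) u = 0" "G u (j u) = 0"
  by (simp_all add: Gform_def \<Omega>_self jj \<Omega>_simps \<Omega>_j_left)

lemma hp_simps:
  "hp (u + v) z = hp u z + hp v z" "hp z (u + v) = hp z u + hp z v"
  "hp (u - v) z = hp u z - hp v z" "hp z (u - v) = hp z u - hp z v"
  "hp (- u) z = - hp u z" "hp z (- u) = - hp z u" "hp 0 z = 0" "hp z 0 = 0"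
  "hp (r *\<^sub>R u) z = complex_of_real r * hp u z" "hp (j u) z = \<i> * hp u z"
  by (simp_all add: hprod_def \<Omega>_simps j_simps algebra_simps \<Omega>_j_left jj)

lemma hp_cnj: "hp v u = cnj (hp u v)"
  using G_sym[of u v] \<Omega>_antisym[of u v] by (simp add: hprod_def Gform_def)

lemma hp_self: "hp v v = complex_of_real (G v v)"
  by (simp add: hprod_def Gform_def \<Omega>_self)

lemma Re_hp: "Re (hp u v) = G u v"
  by (simp add: hprod_def Gform_def)

lemma hp_bound: obtains K where "0 < K" "\<And>u v. cmod (hp u v) \<le> K * norm u * norm v"
proof -
  obtain K where K: "K > 0" "\<And>u v. \<bar>\<Omega> u v\<bar> \<le> K * norm u * norm v"
    using bilinear_bounded_pos[OF \<Omega>_bilinear] by auto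
  obtain L where L: "L > 0" "\<And>u v. \<bar>G u v\<bar> \<le> L * norm u * norm v"
    using bilinear_bounded_pos[OF G_bilinear] by auto
  have "cmod (hp u v) \<le> (K + L) * norm u * norm v" for u v
  proof -
    have "cmod (hp u v) \<le> \<bar>G u v\<bar> + \<bar>\<Omega> u v\<bar>"
      using norm_triangle_ineq4[of "complex_of_real (G u v)" "\<i> * complex_of_real (\<Omega> u v)"]
      by (simp add: hprod_def Gform_def norm_mult)
    also have "\<dots> \<le> (K + L) * norm u * norm v" using K(2)[of u v] L(2)[of u v] by (simp add: algebra_simps)
    finally show ?thesis .
  qed
  with K(1) L(1) that[of "K + L"] show ?thesis by simp
qed

lemma hp_linear_left: "linear (\<lambda>u. hp u v)"
  by (intro linearI) (simp_all add: hp_simps scaleR_conv_of_real)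

lemma continuous_G: "continuous_on UNIV (\<lambda>z. G z z)"
proof -
  interpret B: bounded_bilinear G using G_bilinear by (simp add: bilinear_conv_bounded_bilinear)
  show ?thesis by (intro B.continuous_on continuous_on_id)
qed

lemma continuous_hp_left: "continuous_on UNIV (\<lambda>z. hp z v)"
  using hp_linear_left by (simp add: linear_continuous_on linear_conv_bounded_linear)

lemma continuous_hp_right: "continuous_on UNIV (\<lambda>v. hp z v)"
  by (subst hp_cnj) (intro continuous_intros continuous_hp_left)

lemma wt_measurable [measurable]: "wt \<in> borel_measurable borel"
  unfolding wt_def using w by (intro borel_measurable_continuous_onI continuous_intros continuous_G) auto

lemma wt_pos: "0 < wt z" by (simp add: wt_def)

lemma hp_measurable [measurable]: "(\<lambda>z. hp z v) \<in> borel_measurable borel" "(\<lambda>z. hp v z) \<in> borel_measurable borel"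
  by (intro borel_measurable_continuous_onI continuous_hp_left continuous_hp_right)+

section \<open>Integration over \<open>V\<close> and the Gaussian weight\<close>

definition \<mu> :: "'v measure" where "\<mu> = vol G"

lemma linear_measurable: "linear T \<Longrightarrow> T \<in> borel_measurable borel" for T :: "'a::euclidean_space \<Rightarrow> 'b::euclidean_space"
  by (simp add: borel_measurable_continuous_onI linear_continuous_on linear_conv_bounded_linear)

lemma isometry_exists: "\<exists>T :: 'v \<Rightarrow> 'v. linear T \<and> (\<forall>v u. G (T v) (T u) = v \<bullet> u)"
proof -
  obtain b where b: "finite b" "\<And>x y. x \<in> b \<Longrightarrow> y \<in> b \<Longrightarrow> G x y = (if x = y then 1 else 0)"
    "independent b" "span b = UNIV"
    by (rule orthonormal_family_exists[OF G_bilinear G_sym subspace_UNIV G_pos]) auto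
  have "card b = DIM('v)" using b(3,4) dim_eq_card[of b UNIV] by simp
  then obtain f where f: "bij_betw f (Basis :: 'v set) b"
    using finite_same_card_bij[of "Basis :: 'v set" b] b(1) by auto
  define T where "T x = (\<Sum>i\<in>Basis. (x \<bullet> i) *\<^sub>R f i)" for x :: 'v
  have "linear T"
    unfolding T_def by (intro linearI) (simp_all add: inner_add_left scaleR_add_left sum.distrib scaleR_sum_right)
  moreover have "G (T x) (T y) = x \<bullet> y" for x y
  proof -
    have l: "linear (\<lambda>v. G v u)" "linear (G u)" for u using G_bilinear by (auto simp: bilinear_def)
    have ff: "G (f i) (f k) = (if i = k then 1 else 0)" if "i \<in> Basis" "k \<in> Basis" for i k
      using b(2)[of "f i" "f k"] f that by (auto simp: bij_betw_def inj_on_def)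
    have "G (T x) (T y) = (\<Sum>i\<in>Basis. \<Sum>k\<in>Basis. (x \<bullet> i) * ((y \<bullet> k) * G (f i) (f k)))"
      unfolding T_def by (simp add: linear_sum[OF l(1)] linear_sum[OF l(2)] G_simps sum_distrib_left)
        (subst sum.swap, simp add: mult_ac)
    also have "\<dots> = (\<Sum>i\<in>Basis. (x \<bullet> i) * (y \<bullet> i))"
      by (intro sum.cong refl) (simp add: ff if_distrib cong: if_cong)
    finally show ?thesis by (simp add: euclidean_inner[of x y])
  qed
  ultimately show ?thesis by blast
qed

lemma vol_isometry:
  fixes T :: "'a::euclidean_space \<Rightarrow> 'v"
  assumes T: "linear T" "\<And>x y. G (T x) (T y) = x \<bullet> y" and d: "DIM('a) = DIM('v)"
  shows "\<mu> = distr lborel borel T"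
proof -
  define T0 where "T0 = (SOME T :: 'v \<Rightarrow> 'v. linear T \<and> (\<forall>v u. G (T v) (T u) = v \<bullet> u))"
  have T0: "linear T0" "\<And>x y. G (T0 x) (T0 y) = x \<bullet> y"
    using someI_ex[OF isometry_exists] unfolding T0_def by auto
  have "inj T0"
  proof (rule injI)
    fix x y assume "T0 x = T0 y"
    then have "T0 (x - y) = 0" using T0(1) by (simp add: linear_diff)
    then have "(x - y) \<bullet> (x - y) = 0" using T0(2)[of "x - y" "x - y"] by (simp add: G_simps)
    then show "x = y" by simp
  qed
  then obtain S where S: "linear S" "T0 \<circ> S = id" "S \<circ> T0 = id"
    using linear_injective_isomorphism[OF T0(1)] by (auto simp: fun_eq_iff)
  have ST: "T0 (S v) = v" for v using S(2) by (metis comp_apply id_apply)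
  note [measurable] = linear_measurable[OF T0(1)] linear_measurable[OF T(1)] linear_measurable[OF S(1)]
  have "distr lborel borel (S \<circ> T) = lborel"
  proof (rule lborel_isometry)
    show "linear (S \<circ> T)" using S(1) T(1) by (simp add: linear_compose)
    show "(S \<circ> T) x \<bullet> (S \<circ> T) y = x \<bullet> y" for x y
      using T0(2)[of "S (T x)" "S (T y)"] T(2) by (simp add: ST)
  qed (rule d)
  then have "distr lborel borel T0 = distr (distr lborel borel (S \<circ> T)) borel T0" by simp
  also have "\<dots> = distr lborel borel (T0 \<circ> (S \<circ> T))" by (subst distr_distr) auto
  also have "T0 \<circ> (S \<circ> T) = T" by (simp add: fun_eq_iff ST)
  finally show ?thesis by (simp add: \<mu>_def vol_def T0_def)
qed

definition iso where "iso = (SOME T :: 'v \<Rightarrow> 'v. linear T \<and> (\<forall>v u. G (T v) (T u) = v \<bullet> u))"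

lemma iso: "linear iso" "G (iso x) (iso y) = x \<bullet> y"
  using someI_ex[OF isometry_exists] unfolding iso_def by auto

lemma \<mu>_iso: "\<mu> = distr lborel borel iso"
  by (rule vol_isometry[OF iso refl])

lemma iso_measurable [measurable]: "iso \<in> borel_measurable borel"
  by (rule linear_measurable[OF iso(1)])

lemma sets_\<mu> [measurable_cong, simp]: "sets \<mu> = sets borel" and space_\<mu> [simp]: "space \<mu> = UNIV"
  by (simp_all add: \<mu>_iso)

lemma
  fixes f :: "'v \<Rightarrow> 'b::{banach,second_countable_topology}"
  assumes [measurable]: "f \<in> borel_measurable borel"
  shows integral_\<mu>: "(LINT z|\<mu>. f z) = (LINT x|lborel. f (iso x))"
    and integrable_\<mu>: "integrable \<mu> f \<longleftrightarrow> integrable lborel (\<lambda>x. f (iso x))"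
  by (simp_all add: \<mu>_iso integral_distr integrable_distr_eq)

lemma
  fixes f :: "'v \<Rightarrow> 'b::{banach,second_countable_topology}"
  assumes [measurable]: "f \<in> borel_measurable borel"
  shows integral_\<mu>_translate: "(LINT z|\<mu>. f (z - v)) = (LINT z|\<mu>. f z)"
    and integrable_\<mu>_translate: "integrable \<mu> (\<lambda>z. f (z - v)) \<longleftrightarrow> integrable \<mu> f"
proof -
  have "inj iso"
  proof (rule injI)
    fix x y assume "iso x = iso y"
    then have "iso (x - y) = 0" using iso(1) by (simp add: linear_diff)
    then have "(x - y) \<bullet> (x - y) = 0" using iso(2)[of "x - y" "x - y"] by (simp add: G_simps)
    then show "x = y" by simp
  qed
  then have "surj iso" using iso(1) linear_injective_imp_surjective by blast
  then obtain u where u: "iso u = v" by (metis surjD)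
  have e: "iso x - v = iso (x - u)" for x using u iso(1) by (simp add: linear_diff)
  have [measurable]: "(\<lambda>x. f (iso x)) \<in> borel_measurable borel" by measurable
  show "(LINT z|\<mu>. f (z - v)) = (LINT z|\<mu>. f z)"
    using integral_lborel_shift[of "\<lambda>x. f (iso x)" u] by (simp add: integral_\<mu> e)
  show "integrable \<mu> (\<lambda>z. f (z - v)) \<longleftrightarrow> integrable \<mu> f"
    using integrable_lborel_shift[of "\<lambda>x. f (iso x)" u] by (simp add: integrable_\<mu> e)
qed

lemma integral_\<mu>_isometry:
  fixes f :: "'v \<Rightarrow> 'b::{banach,second_countable_topology}"
  assumes R: "linear R" "\<And>u v. G (R u) (R v) = G u v" and [measurable]: "f \<in> borel_measurable borel"
  shows "(LINT z|\<mu>. f (R z)) = (LINT z|\<mu>. f z)"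
proof -
  note [measurable] = linear_measurable[OF R(1)]
  have "\<mu> = distr lborel borel (\<lambda>x. R (iso x))"
    using linear_compose[OF iso(1) R(1)] by (intro vol_isometry) (auto simp: R(2) iso(2) o_def)
  then have "(LINT z|\<mu>. f z) = (LINT x|lborel. f (R (iso x)))" by (simp add: integral_distr)
  also have "\<dots> = (LINT z|\<mu>. f (R z))" by (rule integral_\<mu>[symmetric]) measurable
  finally show ?thesis ..
qed

lemma wt_iso: "wt (iso x) = exp (- (1 / (2 * w)) * (x \<bullet> x))"
  by (simp add: wt_def iso)

lemma integrable_exp_wt: "integrable \<mu> (\<lambda>z. exp (K * norm z) * wt z)"
proof -
  obtain C where C: "C > 0" "\<And>x. norm (iso x) \<le> C * norm x"
    using linear_bounded_pos[OF iso(1)] by (auto simp: mult.commute)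
  have "(\<lambda>x::'v. complex_of_real (exp (- (1 / (2 * w)) * (x \<bullet> x)))) \<in> gauss_class"
    using w unfolding gauss_class_def
    by (intro CollectI conjI exI[of _ 1] exI[of _ "1 / (2 * w)"] continuous_intros) auto
  from gauss_class_exp_integrable[OF this, of "\<bar>K\<bar> * C"]
  have i: "integrable lborel (\<lambda>x::'v. exp (- (1 / (2 * w)) * (x \<bullet> x)) * exp (\<bar>K\<bar> * C * norm x))" by simp
  have "integrable lborel (\<lambda>x. exp (K * norm (iso x)) * wt (iso x))"
  proof (rule integrable_real_mult_bound[OF i])
    have "K * norm (iso x) \<le> \<bar>K\<bar> * C * norm x" for x
    proof -
      have "K * norm (iso x) \<le> \<bar>K\<bar> * norm (iso x)" by (intro mult_right_mono) auto
      also have "\<dots> \<le> \<bar>K\<bar> * (C * norm x)" using C by (intro mult_left_mono) auto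
      finally show ?thesis by (simp add: mult.assoc)
    qed
    then show "\<bar>exp (K * norm (iso x)) * wt (iso x)\<bar> \<le> exp (- (1 / (2 * w)) * (x \<bullet> x)) * exp (\<bar>K\<bar> * C * norm x)" for x
      unfolding wt_iso by (simp add: abs_mult)
  qed measurable
  then show ?thesis by (subst integrable_\<mu>) auto
qed

lemma integral_wt: "(LINT z|\<mu>. wt z) = h ^ n"
proof -
  have "(LINT z|\<mu>. wt z) = (LINT x::'v|lborel. exp (- (1 / (2 * w)) * (x \<bullet> x)))"
    by (simp add: integral_\<mu> wt_iso)
  also have "\<dots> = sqrt (pi / (1 / (2 * w))) ^ DIM('v)"
    using w by (intro gaussian_integral_norm) simp
  also have "pi / (1 / (2 * w)) = h" by (simp add: w_def hbar_def)
  finally show ?thesis using h by (simp add: dim power_mult)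
qed

definition L2 :: "('v \<Rightarrow> complex) set" where
  "L2 = {f. f \<in> borel_measurable borel \<and> integrable \<mu> (\<lambda>z. (cmod (f z))\<^sup>2 * wt z)}"

abbreviation "H \<equiv> fock h \<Omega> j"
abbreviation "ip \<equiv> fock_inner h \<Omega> j"
abbreviation "e \<equiv> coherent h \<Omega> j"

lemma L2_measurable: "f \<in> L2 \<Longrightarrow> f \<in> borel_measurable borel" by (simp add: L2_def)

lemma ip_eq: "ip f g = complex_of_real (1 / h ^ n) * (LINT z|\<mu>. f z * cnj (g z) * complex_of_real (wt z))"
  by (simp add: fock_inner_def \<mu>_def wt_def w_def dim)

lemma L2_integrable:
  assumes f: "f \<in> L2" and g: "g \<in> L2"
  shows "integrable \<mu> (\<lambda>z. f z * cnj (g z) * complex_of_real (wt z))"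
proof (rule Bochner_Integration.integrable_bound)
  note [measurable] = L2_measurable[OF f] L2_measurable[OF g]
  show "integrable \<mu> (\<lambda>z. (cmod (f z))\<^sup>2 * wt z + (cmod (g z))\<^sup>2 * wt z)"
    using f g by (simp add: L2_def)
  show "(\<lambda>z. f z * cnj (g z) * complex_of_real (wt z)) \<in> borel_measurable \<mu>" by measurable
  show "AE z in \<mu>. norm (f z * cnj (g z) * complex_of_real (wt z)) \<le> norm ((cmod (f z))\<^sup>2 * wt z + (cmod (g z))\<^sup>2 * wt z)"
  proof (rule AE_I2)
    fix z
    have "0 \<le> (cmod (f z) - cmod (g z))\<^sup>2" by simp
    then have "2 * (cmod (f z) * cmod (g z)) \<le> (cmod (f z))\<^sup>2 + (cmod (g z))\<^sup>2" by (simp add: power2_diff)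
    moreover have "0 \<le> cmod (f z) * cmod (g z)" by simp
    ultimately have "cmod (f z) * cmod (g z) \<le> (cmod (f z))\<^sup>2 + (cmod (g z))\<^sup>2" by linarith
    then have "cmod (f z) * cmod (g z) * wt z \<le> ((cmod (f z))\<^sup>2 + (cmod (g z))\<^sup>2) * wt z"
      using wt_pos[of z] by (intro mult_right_mono) auto
    then show "norm (f z * cnj (g z) * complex_of_real (wt z)) \<le> norm ((cmod (f z))\<^sup>2 * wt z + (cmod (g z))\<^sup>2 * wt z)"
      using wt_pos[of z] by (simp add: norm_mult algebra_simps)
  qed
qed

lemma L2_add:
  assumes f: "f \<in> L2" and g: "g \<in> L2"
  shows "(\<lambda>z. f z + g z) \<in> L2"
proof -
  note [measurable] = L2_measurable[OF f] L2_measurable[OF g]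
  have i: "integrable \<mu> (\<lambda>z. 2 * ((cmod (f z))\<^sup>2 * wt z) + 2 * ((cmod (g z))\<^sup>2 * wt z))"
    using f g by (simp add: L2_def)
  have "integrable \<mu> (\<lambda>z. (cmod (f z + g z))\<^sup>2 * wt z)"
  proof (rule integrable_real_mult_bound[OF i])
    fix z
    have "(cmod (f z + g z))\<^sup>2 \<le> (cmod (f z) + cmod (g z))\<^sup>2" by (intro power_mono norm_triangle_ineq) simp
    also have "\<dots> \<le> 2 * (cmod (f z))\<^sup>2 + 2 * (cmod (g z))\<^sup>2"
      using zero_le_power2[of "cmod (f z) - cmod (g z)"] by (simp add: power2_diff power2_sum)
    finally have "(cmod (f z + g z))\<^sup>2 * wt z \<le> (2 * (cmod (f z))\<^sup>2 + 2 * (cmod (g z))\<^sup>2) * wt z"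
      using wt_pos[of z] by (intro mult_right_mono) auto
    then show "\<bar>(cmod (f z + g z))\<^sup>2 * wt z\<bar> \<le> 2 * ((cmod (f z))\<^sup>2 * wt z) + 2 * ((cmod (g z))\<^sup>2 * wt z)"
      using wt_pos[of z] by (simp add: algebra_simps)
  qed measurable
  then show ?thesis by (simp add: L2_def)
qed

sublocale L2: semi_inner_space L2 ip
proof
  fix f g k :: "'v \<Rightarrow> complex" and c :: complex
  assume f: "f \<in> L2"
  note [measurable] = L2_measurable[OF f]
  show "(\<lambda>z. c * f z) \<in> L2"
    using f by (simp add: L2_def norm_mult power_mult_distrib mult.assoc)
  show "0 \<le> Re (ip f f)"
  proof -
    have "ip f f = complex_of_real (1 / h ^ n * (LINT z|\<mu>. (cmod (f z))\<^sup>2 * wt z))"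
      unfolding ip_eq of_real_mult integral_complex_of_real[symmetric] complex_norm_square ..
    then show ?thesis using h wt_pos by (simp add: less_imp_le)
  qed
  assume g: "g \<in> L2"
  show "(\<lambda>z. f z + g z) \<in> L2" by (rule L2_add[OF f g])
  show "ip g f = cnj (ip f g)"
  proof -
    have "cnj (LINT z|\<mu>. f z * cnj (g z) * complex_of_real (wt z)) = (LINT z|\<mu>. cnj (f z * cnj (g z) * complex_of_real (wt z)))"
      by (rule Bochner_Integration.integral_cnj[symmetric])
    then show ?thesis by (simp add: ip_eq mult.commute)
  qed
  show "ip (\<lambda>z. c * f z) g = c * ip f g"
  proof -
    have "(LINT z|\<mu>. c * f z * cnj (g z) * complex_of_real (wt z)) = c * (LINT z|\<mu>. f z * cnj (g z) * complex_of_real (wt z))"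
      by (subst integral_mult_right_zero[symmetric]) (simp only: mult.assoc)
    then show ?thesis by (simp add: ip_eq)
  qed
  assume k: "k \<in> L2"
  show "ip (\<lambda>z. f z + g z) k = ip f k + ip g k"
    using L2_integrable[OF f k] L2_integrable[OF g k] by (simp add: ip_eq algebra_simps)
qed

lemma ip_self_real: "L2.sqn f = 1 / h ^ n * (LINT z|\<mu>. (cmod (f z))\<^sup>2 * wt z)"
proof -
  have "ip f f = complex_of_real (1 / h ^ n * (LINT z|\<mu>. (cmod (f z))\<^sup>2 * wt z))"
    unfolding ip_eq of_real_mult integral_complex_of_real[symmetric] complex_norm_square ..
  then show ?thesis by (simp only: L2.sqn_def Re_complex_of_real)
qed

lemma holomorphic_continuous: "j_holomorphic j f \<Longrightarrow> continuous_on UNIV f"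
  unfolding j_holomorphic_def
  by (meson continuous_at_imp_continuous_on has_derivative_continuous)

lemma H_iff: "f \<in> H \<longleftrightarrow> j_holomorphic j f \<and> f \<in> L2"
  using holomorphic_continuous[of f] borel_measurable_continuous_onI[of f]
  by (auto simp: fock_def L2_def \<mu>_def wt_def w_def)

lemma H_L2: "f \<in> H \<Longrightarrow> f \<in> L2" by (simp add: H_iff)

sublocale semi_inner_space H ip
proof
  fix f g k :: "'v \<Rightarrow> complex" and c :: complex
  assume f: "f \<in> H"
  show "(\<lambda>z. c * f z) \<in> H"
  proof -
    have "j_holomorphic j (\<lambda>z. c * f z)" unfolding j_holomorphic_def
    proof
      fix z
      obtain D where "(f has_derivative D) (at z)" "\<forall>v. D (j v) = \<i> * D v"
        using f by (auto simp: H_iff j_holomorphic_def)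
      then show "\<exists>D. ((\<lambda>z. c * f z) has_derivative D) (at z) \<and> (\<forall>v. D (j v) = \<i> * D v)"
        by (intro exI[of _ "\<lambda>v. c * D v"]) (auto intro!: has_derivative_mult_right)
    qed
    then show ?thesis using f L2.scale by (simp add: H_iff)
  qed
  show "0 \<le> Re (ip f f)" by (intro L2.ip_pos H_L2 f)
  assume g: "g \<in> H"
  show "(\<lambda>z. f z + g z) \<in> H"
  proof -
    have "j_holomorphic j (\<lambda>z. f z + g z)" unfolding j_holomorphic_def
    proof
      fix z
      obtain D E where "(f has_derivative D) (at z)" "\<forall>v. D (j v) = \<i> * D v"
         "(g has_derivative E) (at z)" "\<forall>v. E (j v) = \<i> * E v"
        using f g unfolding H_iff j_holomorphic_def by meson
      then show "\<exists>D. ((\<lambda>z. f z + g z) has_derivative D) (at z) \<and> (\<forall>v. D (j v) = \<i> * D v)"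
        by (intro exI[of _ "\<lambda>v. D v + E v"]) (auto intro!: has_derivative_add simp: algebra_simps)
    qed
    then show ?thesis using f g L2.add by (simp add: H_iff)
  qed
  show "ip g f = cnj (ip f g)" by (intro L2.ip_cnj H_L2 f g)
  show "ip (\<lambda>z. c * f z) g = c * ip f g" by (intro L2.ip_scale H_L2 f g)
  assume k: "k \<in> H"
  show "ip (\<lambda>z. f z + g z) k = ip f k + ip g k" by (intro L2.ip_add H_L2 f g k)
qed

text \<open>The product of \<open>cmod (f z)\<close> with the exponential is bounded by the sum of
  their squares, each integrable against the weight. This is the domination needed to differentiate
  the reproducing integral.\<close>

lemma L2_exp_integrable:
  assumes f: "f \<in> L2"
  shows "integrable \<mu> (\<lambda>z. cmod (f z) * wt z * exp (K * norm z))"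
proof -
  note [measurable] = L2_measurable[OF f]
  have i: "integrable \<mu> (\<lambda>z. (cmod (f z))\<^sup>2 * wt z + exp (2 * K * norm z) * wt z)"
    using f integrable_exp_wt by (simp add: L2_def)
  show ?thesis
  proof (rule integrable_real_mult_bound[OF i])
    fix z
    have "0 \<le> (cmod (f z) - exp (K * norm z))\<^sup>2" by simp
    then have "2 * (cmod (f z) * exp (K * norm z)) \<le> (cmod (f z))\<^sup>2 + (exp (K * norm z))\<^sup>2" by (simp add: power2_diff)
    moreover have "0 \<le> cmod (f z) * exp (K * norm z)" by simp
    moreover have "(exp (K * norm z))\<^sup>2 = exp (2 * K * norm z)" by (simp flip: exp_double)
    ultimately have "cmod (f z) * exp (K * norm z) \<le> (cmod (f z))\<^sup>2 + exp (2 * K * norm z)" by linarith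
    then have "cmod (f z) * exp (K * norm z) * wt z \<le> ((cmod (f z))\<^sup>2 + exp (2 * K * norm z)) * wt z"
      using wt_pos[of z] by (intro mult_right_mono) auto
    then show "\<bar>cmod (f z) * wt z * exp (K * norm z)\<bar> \<le> (cmod (f z))\<^sup>2 * wt z + exp (2 * K * norm z) * wt z"
      using wt_pos[of z] by (simp add: algebra_simps abs_mult)
  qed measurable
qed

lemma e_eq: "e v z = exp (hp z v / (2 * w))"
  by (simp add: coherent_def w_def)

lemma e_holomorphic: "j_holomorphic j (e v)"
  unfolding j_holomorphic_def
proof
  fix z
  have "linear (\<lambda>u. hp u v / (2 * w))"
    by (intro linearI) (simp_all add: hp_simps add_divide_distrib scaleR_conv_of_real)
  then have "((\<lambda>u. hp u v / (2 * w)) has_derivative (\<lambda>u. hp u v / (2 * w))) (at z)"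
    by (intro bounded_linear_imp_has_derivative) (simp add: linear_conv_bounded_linear)
  then have "((\<lambda>u. exp (hp u v / (2 * w))) has_derivative (\<lambda>u. hp u v / (2 * w) * exp (hp z v / (2 * w)))) (at z)"
    by (rule has_derivative_compose) (metis DERIV_exp has_field_derivative_def mult_commute_abs)
  then show "\<exists>D. (e v has_derivative D) (at z) \<and> (\<forall>u. D (j u) = \<i> * D u)"
    by (intro exI[of _ "\<lambda>u. hp u v / (2 * w) * exp (hp z v / (2 * w))"]) (simp add: e_eq[abs_def] hp_simps)
qed

lemma e_H: "e v \<in> H"
proof -
  obtain K where K: "0 < K" "\<And>u v. cmod (hp u v) \<le> K * norm u * norm v" using hp_bound by blast
  note [measurable] = borel_measurable_continuous_onI[OF holomorphic_continuous[OF e_holomorphic]]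
  have "integrable \<mu> (\<lambda>z. (cmod (e v z))\<^sup>2 * wt z)"
  proof (rule integrable_real_mult_bound[OF integrable_exp_wt[of "K * norm v / w"]])
    fix z
    have "(cmod (e v z))\<^sup>2 = exp (G z v / w)"
      using w by (simp add: e_eq norm_exp_eq_Re Re_hp flip: exp_double)
    also have "\<dots> \<le> exp (K * norm v / w * norm z)"
    proof -
      have "G z v \<le> K * norm v * norm z"
        using complex_Re_le_cmod[of "hp z v"] K(2)[of z v] by (simp add: Re_hp mult_ac)
      then show ?thesis using w by (simp add: divide_right_mono)
    qed
    finally show "\<bar>(cmod (e v z))\<^sup>2 * wt z\<bar> \<le> exp (K * norm v / w * norm z) * wt z"
      using wt_pos[of z] by (simp add: abs_mult mult_right_mono)
  qed measurable
  then show ?thesis by (simp add: H_iff e_holomorphic L2_def)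
qed

text \<open>As a function of \<open>z\<close>, \<open>cnj (e z x)\<close> is the exponential of a
  \<open>j\<close>-linear function, and differentiation under the integral preserves this. The lemma
  makes limits in the weighted space holomorphic again.\<close>

lemma holomorphic_if_reproduced:
  assumes f: "f \<in> L2" and rep: "\<And>z. f z = ip f (e z)"
  shows "f \<in> H"
proof -
  note [measurable] = L2_measurable[OF f]
  obtain K where K: "0 < K" "\<And>u v. cmod (hp u v) \<le> K * norm u * norm v" using hp_bound by blast
  define \<psi> where "\<psi> x = f x * complex_of_real (wt x) * complex_of_real (1 / h ^ n)" for x
  define L where "L x \<eta> = hp \<eta> x / (2 * complex_of_real w)" for x \<eta>
  have [measurable]: "\<psi> \<in> borel_measurable \<mu>" "(\<lambda>x. L x \<eta>) \<in> borel_measurable \<mu>" for \<eta>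
    unfolding \<psi>_def L_def by measurable
  have "f z = (LINT x|\<mu>. \<psi> x * exp (L x z))" for z
  proof -
    have "f x * cnj (e z x) * complex_of_real (wt x) * complex_of_real (1 / h ^ n) = \<psi> x * exp (L x z)" for x
      using hp_cnj[of x z] by (simp add: \<psi>_def L_def e_eq exp_cnj mult_ac)
    then have "(LINT x|\<mu>. \<psi> x * exp (L x z)) = (LINT x|\<mu>. f x * cnj (e z x) * complex_of_real (wt x) * complex_of_real (1 / h ^ n))"
      by simp
    also have "\<dots> = ip f (e z)"
      unfolding ip_eq by (subst integral_mult_left_zero) (rule mult.commute)
    finally show ?thesis using rep by simp
  qed
  then have f_eq: "f = (\<lambda>z. LINT x|\<mu>. \<psi> x * exp (L x z))" by auto
  have lin: "linear (L x)" for x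
    unfolding L_def by (intro linearI) (simp_all add: hp_simps add_divide_distrib scaleR_conv_of_real)
  have "((\<lambda>z. LINT x|\<mu>. \<psi> x * exp (L x z)) has_derivative (\<lambda>\<eta>. LINT x|\<mu>. \<psi> x * exp (L x z) * L x \<eta>)) (at z)" for z
  proof (rule exp_integral_has_derivative[where \<l> = "\<lambda>x. K / (2 * w) * norm x", OF lin])
    show "cmod (L x \<eta>) \<le> K / (2 * w) * norm x * norm \<eta>" for x \<eta>
      using K(2)[of \<eta> x] w by (simp add: L_def norm_divide norm_mult divide_right_mono mult_ac)
    show "0 \<le> K / (2 * w) * norm x" for x :: 'v using K w by simp
    show "integrable \<mu> (\<lambda>x. cmod (\<psi> x) * exp (K' * (K / (2 * w) * norm x)))" for K'
    proof -
      have "cmod (\<psi> x) * exp (K' * (K / (2 * w) * norm x)) = 1 / h ^ n * (cmod (f x) * wt x * exp ((K' * (K / (2 * w))) * norm x))" for x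
        using wt_pos[of x] h by (simp add: \<psi>_def norm_mult norm_divide norm_power mult_ac)
      then show ?thesis using L2_exp_integrable[OF f, of "K' * (K / (2 * w))"] by (simp only: integrable_mult_right)
    qed
  qed measurable
  moreover have "(LINT x|\<mu>. \<psi> x * exp (L x z) * L x (j \<eta>)) = \<i> * (LINT x|\<mu>. \<psi> x * exp (L x z) * L x \<eta>)" for z \<eta>
    by (subst integral_mult_right_zero[symmetric]) (simp add: L_def hp_simps mult_ac)
  ultimately have "j_holomorphic j f"
    unfolding j_holomorphic_def by (subst f_eq) blast
  then show ?thesis using f by (simp add: H_iff)
qed

text \<open>Restricted to the complex line through \<open>z\<close>, with \<open>j\<close> acting as
  multiplication by \<open>i\<close>, the function is entire; this is the Cauchy integral formula at
  the centre of the unit circle.\<close>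

lemma circle_mean:
  assumes f: "j_holomorphic j f"
  shows "(LINT t|lborel. indicator {0..1} t *\<^sub>R f (cos (2 * pi * t) *\<^sub>R z + sin (2 * pi * t) *\<^sub>R j z)) = f 0"
proof -
  define l where "l \<zeta> = Re \<zeta> *\<^sub>R z + Im \<zeta> *\<^sub>R j z" for \<zeta>
  have l: "bounded_linear l" unfolding l_def
    by (intro bounded_linear_add bounded_linear_scaleR_const bounded_linear_Re bounded_linear_Im)
  define F where "F \<zeta> = f (l \<zeta>)" for \<zeta>
  have "\<exists>F'. (F has_field_derivative F') (at \<zeta>)" for \<zeta>
  proof -
    obtain D where D: "(f has_derivative D) (at (l \<zeta>))" "\<And>v. D (j v) = \<i> * D v"
      using f by (auto simp: j_holomorphic_def)
    have lin: "linear D" using D(1) has_derivative_linear by blast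
    have "(F has_derivative (\<lambda>\<eta>. D (l \<eta>))) (at \<zeta>)"
      unfolding F_def using has_derivative_compose[OF bounded_linear_imp_has_derivative[OF l] D(1)] .
    moreover have "D (l \<eta>) = D z * \<eta>" for \<eta>
      by (simp add: l_def linear_add[OF lin] linear_cmul[OF lin] D(2) scaleR_conv_of_real)
        (simp add: complex_eq_iff)
    ultimately show ?thesis by (auto simp: has_field_derivative_def)
  qed
  then have hol: "F holomorphic_on UNIV" using holomorphic_on_open[OF open_UNIV] by blast
  have "((\<lambda>u. F u / (u - 0)) has_contour_integral (2 * of_real pi * \<i> * F 0)) (circlepath 0 1)"
    by (rule Cauchy_integral_circlepath_simple) (use hol holomorphic_on_subset in auto)
  then have "((\<lambda>t. 2 * of_real pi * \<i> * F (exp (2 * of_real pi * \<i> * complex_of_real t))) has_integral 2 * of_real pi * \<i> * F 0) {0..1}"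
    unfolding has_contour_integral_def
    by (rule has_integral_eq[rotated]) (subst vector_derivative_circlepath01, simp_all add: circlepath)
  from has_integral_mult_right[OF this, of "1 / (2 * of_real pi * \<i>)"]
  have I: "((\<lambda>t. F (exp (2 * of_real pi * \<i> * complex_of_real t))) has_integral F 0) {0..1}" by simp
  have Fe: "F (exp (2 * of_real pi * \<i> * complex_of_real t)) = f (cos (2 * pi * t) *\<^sub>R z + sin (2 * pi * t) *\<^sub>R j z)" for t
  proof -
    have "exp (2 * of_real pi * \<i> * complex_of_real t) = cis (2 * pi * t)" by (simp add: cis_conv_exp mult_ac)
    then show ?thesis by (simp add: F_def l_def)
  qed
  have cont: "continuous_on {0..1} (\<lambda>t. F (exp (2 * of_real pi * \<i> * complex_of_real t)))"
    by (intro continuous_on_compose2[OF holomorphic_on_imp_continuous_on[OF hol]] continuous_intros) auto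
  have "set_integrable lborel {0..1} (\<lambda>t. F (exp (2 * of_real pi * \<i> * complex_of_real t)))"
    unfolding set_integrable_def by (rule borel_integrable_atLeastAtMost'[OF cont, unfolded set_integrable_def])
  from set_borel_integral_eq_integral(2)[OF this] I
  have "(LINT t:{0..1}|lborel. F (exp (2 * of_real pi * \<i> * complex_of_real t))) = F 0"
    by (simp add: integral_unique)
  then show ?thesis unfolding set_lebesgue_integral_def Fe by (simp add: F_def l_def)
qed

text \<open>The rotations \<open>R t\<close> of the complex structure preserve the measure and the
  weight, so the integral does not change when \<open>f\<close> is averaged over them. The average
  over each circle is \<open>f 0\<close>, and the total mass of the weight is
  \<open>h ^ n\<close>.\<close>

lemma mean_value:
  assumes f: "f \<in> H"
  shows "ip f (e 0) = f 0"
proof -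
  have hol: "j_holomorphic j f" and fL: "f \<in> L2" using f by (auto simp: H_iff)
  note cf = holomorphic_continuous[OF hol]
  note [measurable] = borel_measurable_continuous_onI[OF cf]
  define R where "R t z = cos (2 * pi * t) *\<^sub>R z + sin (2 * pi * t) *\<^sub>R j z" for t z
  have Rlin: "linear (R t)" for t
    unfolding R_def by (intro linearI) (simp_all add: j_simps algebra_simps)
  have RG: "G (R t u) (R t v) = G u v" for t u v
  proof -
    define a b where "a = cos (2 * pi * t)" and "b = sin (2 * pi * t)"
    have "G (R t u) (R t v) = (a\<^sup>2 + b\<^sup>2) * G u v + a * b * (G u (j v) + G (j u) v)"
      unfolding R_def a_def[symmetric] b_def[symmetric]
      by (simp add: G_simps G_j power2_eq_square algebra_simps)
    moreover have "G u (j v) + G (j u) v = 0" by (simp add: Gform_def jj \<Omega>_simps j_\<Omega>)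
    moreover have "a\<^sup>2 + b\<^sup>2 = 1" by (simp add: a_def b_def)
    ultimately show ?thesis by simp
  qed
  have wR: "wt (R t z) = wt z" for t z by (simp add: wt_def RG)
  define I where "I = (LINT z|\<mu>. f z * complex_of_real (wt z))"
  have one: "(\<lambda>z. 1) \<in> L2" using H_L2[OF e_H[of 0]] by (simp add: e_eq[abs_def] hp_simps)
  have fi: "integrable \<mu> (\<lambda>z. f z * complex_of_real (wt z))"
    using L2_integrable[OF fL one] by simp
  have rot: "(LINT z|\<mu>. f (R t z) * complex_of_real (wt z)) = I" for t
    unfolding I_def using integral_\<mu>_isometry[OF Rlin RG, of "\<lambda>z. f z * complex_of_real (wt z)" t] by (simp add: wR)
  have rotn: "(LINT z|\<mu>. cmod (f (R t z)) * wt z) = (LINT z|\<mu>. cmod (f z) * wt z)" for t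
    using integral_\<mu>_isometry[OF Rlin RG, of "\<lambda>z. cmod (f z) * wt z" t] by (simp add: wR)
  have Rc: "continuous_on UNIV (\<lambda>p. R (fst p) (iso (snd p)))"
    unfolding R_def using iso(1) j_linear
    by (intro continuous_intros linear_continuous_on_compose[OF _ iso(1)]
        linear_continuous_on_compose[OF linear_continuous_on_compose[OF _ iso(1)] j_linear])
  have [measurable]: "(\<lambda>p. f (R (fst p) (iso (snd p)))) \<in> borel_measurable (borel \<Otimes>\<^sub>M borel)"
    unfolding borel_prod
    by (intro borel_measurable_continuous_onI continuous_on_compose2[OF cf Rc]) auto
  have [measurable]: "(\<lambda>x. f (R t x)) \<in> borel_measurable borel" for t
    using linear_measurable[OF Rlin] by measurable
  define \<phi> where "\<phi> t x = indicator {0..1} t *\<^sub>R (f (R t (iso x)) * complex_of_real (wt (iso x)))" for t :: real and x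
  have intx: "integrable lborel (\<lambda>x. f (R t (iso x)) * complex_of_real (wt (iso x)))" for t
  proof -
    have "\<mu> = distr lborel borel (\<lambda>x. R t (iso x))"
      using linear_compose[OF iso(1) Rlin[of t]] by (intro vol_isometry) (auto simp: RG iso(2) o_def)
    then have "integrable (distr lborel borel (\<lambda>x. R t (iso x))) (\<lambda>z. f z * complex_of_real (wt z))"
      using fi by simp
    moreover have [measurable]: "(\<lambda>x. R t (iso x)) \<in> borel_measurable borel"
      using linear_measurable[OF Rlin] by measurable
    ultimately show ?thesis by (simp add: integrable_distr_eq wR)
  qed
  have int: "integrable (lborel \<Otimes>\<^sub>M lborel) (\<lambda>(t, x). \<phi> t x)"
  proof (rule lborel_pair.Fubini_integrable)
    have "(LINT x|lborel. norm (case (t, x) of (t, x) \<Rightarrow> \<phi> t x)) = indicator {0..1} t * (LINT z|\<mu>. cmod (f z) * wt z)" for t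
    proof -
      have "(LINT x|lborel. norm (case (t, x) of (t, x) \<Rightarrow> \<phi> t x)) = (LINT x|lborel. indicator {0..1} t * (cmod (f (R t (iso x))) * wt (iso x)))"
        using wt_pos by (intro Bochner_Integration.integral_cong refl) (simp add: \<phi>_def norm_mult less_imp_le)
      also have "\<dots> = indicator {0..1} t * (LINT z|\<mu>. cmod (f (R t z)) * wt z)"
        by (simp add: integral_\<mu>)
      finally show ?thesis by (simp add: rotn)
    qed
    then show "integrable lborel (\<lambda>t. LINT x|lborel. norm (case (t, x) of (t, x) \<Rightarrow> \<phi> t x))" by simp
    show "AE t in lborel. integrable lborel (\<lambda>x. case (t, x) of (t, x) \<Rightarrow> \<phi> t x)"
      using intx by (simp add: \<phi>_def)
  qed (simp add: \<phi>_def case_prod_beta)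
  have "(LINT t|lborel. LINT x|lborel. \<phi> t x) = (LINT t::real|lborel. indicator {0..1} t *\<^sub>R I)"
    using rot by (intro Bochner_Integration.integral_cong refl) (simp add: \<phi>_def integral_\<mu>)
  also have "\<dots> = I" by simp
  finally have "I = (LINT x|lborel. LINT t|lborel. \<phi> t x)" using lborel_pair.Fubini_integral[OF int] by simp
  also have "\<dots> = (LINT x|lborel. f 0 * complex_of_real (wt (iso x)))"
  proof (intro Bochner_Integration.integral_cong refl)
    fix x
    have "(LINT t|lborel. \<phi> t x) = (LINT t|lborel. indicator {0..1} t *\<^sub>R f (R t (iso x)) * complex_of_real (wt (iso x)))"
      by (simp add: \<phi>_def)
    also have "\<dots> = (LINT t|lborel. indicator {0..1} t *\<^sub>R f (R t (iso x))) * complex_of_real (wt (iso x))"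
      by (rule integral_mult_left_zero)
    finally show "(LINT t|lborel. \<phi> t x) = f 0 * complex_of_real (wt (iso x))"
      using circle_mean[OF hol, of "iso x"] by (simp add: R_def)
  qed
  also have "\<dots> = f 0 * complex_of_real (LINT z|\<mu>. wt z)"
    by (simp add: integral_\<mu>)
  finally have "I = f 0 * complex_of_real (h ^ n)" by (simp add: integral_wt)
  then show ?thesis using h by (simp add: ip_eq e_eq hp_simps I_def)
qed

section \<open>Heisenberg operators and the reproducing property\<close>

abbreviation "W v \<equiv> heis h \<Omega> j v 0"

lemma heis_eq: "heis h \<Omega> j v t f z = exp (- \<i> * complex_of_real t / w) * W v f z"
  by (simp add: heis_def w_def mult.assoc[symmetric] exp_add[symmetric] add_diff_eq)

lemma W_eq: "W v f z = exp (hp z v / (2 * w) - hp v v / (4 * w)) * f (z - v)"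
  by (simp add: heis_def w_def)

text \<open>Completing the square: the squared modulus of the multiplier is exactly the ratio of the
  weights at \<open>z - v\<close> and at \<open>z\<close>. Unitarity thus holds under the integral
  sign, up to a translation of the measure.\<close>

lemma W_norm: "(cmod (W v f z))\<^sup>2 * wt z = (cmod (f (z - v)))\<^sup>2 * wt (z - v)"
proof -
  have "(cmod (exp (hp z v / (2 * w) - hp v v / (4 * w))))\<^sup>2 = exp (2 * (G z v / (2 * w) - G v v / (4 * w)))"
    using w by (simp add: norm_exp_eq_Re Re_hp hp_self Re_divide_of_real flip: exp_double)
  moreover have "2 * (G z v / (2 * w) - G v v / (4 * w)) + (- G z z / (2 * w)) = - G (z - v) (z - v) / (2 * w)"
    using w by (simp add: G_simps G_sym[of v z] field_simps)
  ultimately show ?thesis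
    by (simp add: W_eq norm_mult power_mult_distrib wt_def mult.assoc) (simp add: mult_exp_exp)
qed

lemma W_ip_integrand: "W v f z * cnj (W v g z) * complex_of_real (wt z) = f (z - v) * cnj (g (z - v)) * complex_of_real (wt (z - v))"
proof -
  let ?E = "exp (hp z v / (2 * w) - hp v v / (4 * w))"
  have "W v (\<lambda>_. 1) z = ?E" by (simp add: W_eq)
  then have "complex_of_real ((cmod ?E)\<^sup>2 * wt z) = complex_of_real (wt (z - v))"
    using W_norm[of v "\<lambda>_. 1" z] by simp
  then have "?E * cnj ?E * complex_of_real (wt z) = complex_of_real (wt (z - v))"
    by (simp only: of_real_mult complex_norm_square)
  then have "(?E * cnj ?E * complex_of_real (wt z)) * (f (z - v) * cnj (g (z - v))) = complex_of_real (wt (z - v)) * (f (z - v) * cnj (g (z - v)))"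
    by (simp only:)
  then show ?thesis by (simp add: W_eq mult_ac)
qed

lemma W_H:
  assumes f: "f \<in> H"
  shows "W v f \<in> H"
proof -
  have hol: "j_holomorphic j f" and fL: "f \<in> L2" using f by (auto simp: H_iff)
  have "j_holomorphic j (W v f)"
    unfolding j_holomorphic_def
  proof
    fix z
    obtain D where D: "(f has_derivative D) (at (z - v))" "\<And>v. D (j v) = \<i> * D v"
      using hol by (auto simp: j_holomorphic_def)
    obtain E where E: "(e v has_derivative E) (at z)" "\<And>v. E (j v) = \<i> * E v"
      using e_holomorphic[of v] by (auto simp: j_holomorphic_def)
    have "((\<lambda>z. f (z - v)) has_derivative D) (at z)"
    proof -
      have "((\<lambda>z. z - v) has_derivative (\<lambda>z. z)) (at z)" by (auto intro!: derivative_eq_intros)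
      from has_derivative_compose[OF this D(1)] show ?thesis .
    qed
    then have "((\<lambda>z. exp (- hp v v / (4 * w)) * (e v z * f (z - v))) has_derivative (\<lambda>u. exp (- hp v v / (4 * w)) * (e v z * D u + E u * f (z - v)))) (at z)"
      by (intro has_derivative_mult_right has_derivative_mult E)
    moreover have "W v f = (\<lambda>z. exp (- hp v v / (4 * w)) * (e v z * f (z - v)))"
      by (simp add: fun_eq_iff W_eq e_eq exp_diff exp_minus field_simps)
    ultimately show "\<exists>D. (W v f has_derivative D) (at z) \<and> (\<forall>u. D (j u) = \<i> * D u)"
      using D(2) E(2) by (auto simp: algebra_simps)
  qed
  moreover have "W v f \<in> L2"
  proof -
    note [measurable] = L2_measurable[OF fL]
    have "integrable \<mu> (\<lambda>z. (\<lambda>z. (cmod (f z))\<^sup>2 * wt z) (z - v))"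
      using fL by (subst integrable_\<mu>_translate) (auto simp: L2_def)
    then have "integrable \<mu> (\<lambda>z. (cmod (W v f z))\<^sup>2 * wt z)" by (simp only: W_norm)
    moreover have "W v f \<in> borel_measurable borel"
      using holomorphic_continuous[OF \<open>j_holomorphic j (W v f)\<close>] by (rule borel_measurable_continuous_onI)
    ultimately show ?thesis by (simp add: L2_def)
  qed
  ultimately show ?thesis by (simp add: H_iff)
qed

lemma W_ip:
  assumes "f \<in> H" "g \<in> H"
  shows "ip (W v f) (W v g) = ip f g"
proof -
  note [measurable] = L2_measurable[OF H_L2[OF assms(1)]] L2_measurable[OF H_L2[OF assms(2)]]
  show ?thesis unfolding ip_eq W_ip_integrand
    by (subst integral_\<mu>_translate[of "\<lambda>z. f z * cnj (g z) * complex_of_real (wt z)"]) simp_all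
qed

lemma W_inverse: "W v (W (- v) f) = f"
proof
  fix z
  have "hp z v / (2 * w) - hp v v / (4 * w) + (hp (z - v) (- v) / (2 * w) - hp (- v) (- v) / (4 * w)) = 0"
    using w by (simp add: hp_simps field_simps)
  then show "W v (W (- v) f) z = f z" by (simp add: W_eq flip: mult.assoc exp_add)
qed

lemma W_adjoint: "f \<in> H \<Longrightarrow> g \<in> H \<Longrightarrow> ip (W v f) g = ip f (W (- v) g)"
  using W_ip[of f "W (- v) g" v] by (simp add: W_H W_inverse)

lemma e_W: "e v z = exp (hp v v / (4 * w)) * W v (e 0) z"
  by (simp add: W_eq e_eq hp_simps flip: exp_add)

text \<open>\<open>e v\<close> is a multiple of the Heisenberg translate of \<open>e 0\<close>, so
  the mean value property at 0 moves to \<open>v\<close>; the two normalising exponentials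
  cancel.\<close>

lemma reproducing_e:
  assumes f: "f \<in> H"
  shows "ip f (e v) = f v"
proof -
  have "ip f (e v) = ip f (\<lambda>z. exp (hp v v / (4 * w)) * W v (e 0) z)"
    by (rule arg_cong[where f = "ip f"], rule ext, rule e_W)
  also have "\<dots> = cnj (exp (hp v v / (4 * w))) * ip f (W v (e 0))"
    by (intro ip_scale_right W_H e_H f)
  also have "ip f (W v (e 0)) = ip (W (- v) f) (e 0)"
    using W_adjoint[OF f e_H, of "- v" 0] by simp
  also have "\<dots> = W (- v) f 0" by (intro mean_value W_H f)
  also have "\<dots> = exp (- hp v v / (4 * w)) * f v" by (simp add: W_eq hp_simps)
  also have "cnj (exp (hp v v / (4 * w))) = exp (hp v v / (4 * w))"
    by (simp add: hp_self exp_cnj)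
  finally show ?thesis by (simp flip: mult.assoc exp_add)
qed

text \<open>Cauchy-Schwarz against \<open>e z\<close> makes a Cauchy sequence converge at every
  point. Fatou's lemma turns the pointwise limit into a limit in norm, and the reproducing formula
  passes to it, so the limit is holomorphic.\<close>

lemma H_complete:
  assumes s: "\<And>k. s k \<in> H"
    and cauchy: "\<And>\<epsilon>. 0 < \<epsilon> \<Longrightarrow> \<exists>M. \<forall>m\<ge>M. \<forall>k\<ge>M. sqn (\<lambda>z. s m z - s k z) < \<epsilon>"
  shows "\<exists>f\<in>H. (\<lambda>k. sqn (\<lambda>z. s k z - f z)) \<longlonglongrightarrow> 0"
proof -
  have sL: "s k \<in> L2" for k using s H_L2 by blast
  note [measurable] = L2_measurable[OF sL]
  have bound: "(cmod (s m z - s k z))\<^sup>2 \<le> sqn (\<lambda>z. s m z - s k z) * sqn (e z)" for m k z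
    using cauchy_schwarz[OF diff[OF s[of m] s[of k]] e_H, of z] reproducing_e[OF diff[OF s[of m] s[of k]]] by simp
  have "Cauchy (\<lambda>k. s k z)" for z
    unfolding Cauchy_def dist_norm
  proof (intro allI impI)
    fix \<epsilon> :: real assume \<epsilon>: "0 < \<epsilon>"
    have q: "0 < sqn (e z) + 1" using sqn_nonneg[OF e_H[of z]] by simp
    obtain M where M: "\<forall>m\<ge>M. \<forall>k\<ge>M. sqn (\<lambda>z. s m z - s k z) < \<epsilon>\<^sup>2 / (sqn (e z) + 1)"
      using cauchy[of "\<epsilon>\<^sup>2 / (sqn (e z) + 1)"] \<epsilon> q by auto
    have "cmod (s m z - s k z) < \<epsilon>" if "m \<ge> M" "k \<ge> M" for m k
    proof -
      have "(cmod (s m z - s k z))\<^sup>2 \<le> sqn (\<lambda>z. s m z - s k z) * (sqn (e z) + 1)"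
        using bound[of m z k] sqn_nonneg[OF diff[OF s[of m] s[of k]]] by (simp add: algebra_simps)
      also have "\<dots> < \<epsilon>\<^sup>2" using M that q by (simp add: pos_less_divide_eq)
      finally show ?thesis using \<epsilon> by (simp add: power2_less_imp_less)
    qed
    then show "\<exists>M. \<forall>m\<ge>M. \<forall>k\<ge>M. cmod (s m z - s k z) < \<epsilon>" by blast
  qed
  then have "\<exists>l. (\<lambda>k. s k z) \<longlonglongrightarrow> l" for z using Cauchy_convergent convergent_def by blast
  then obtain f where f: "\<And>z. (\<lambda>k. s k z) \<longlonglongrightarrow> f z" by metis
  have [measurable]: "f \<in> borel_measurable borel"
    by (rule borel_measurable_LIMSEQ_metric[where f=s]) (auto simp: f)
  have hn: "0 < h ^ n" using h by simp
  \<comment> \<open>The Cauchy estimate is kept for fixed \<open>k\<close> while \<open>m\<close>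
    tends to infinity; Fatou's lemma yields integrability and the bound together.\<close>
  have tail: "(\<lambda>z. s k z - f z) \<in> L2 \<and> sqn (\<lambda>z. s k z - f z) \<le> \<epsilon>"
    if M: "\<forall>m\<ge>M. \<forall>k\<ge>M. sqn (\<lambda>z. s m z - s k z) < \<epsilon>" and k: "k \<ge> M" for M k \<epsilon>
  proof -
    have \<epsilon>: "0 \<le> \<epsilon>" using M k sqn_nonneg[OF diff[OF s[of k] s[of k]]] by force
    have "(\<integral>\<^sup>+ z. ennreal ((cmod (s k z - f z))\<^sup>2 * wt z) \<partial>\<mu>) \<le> ennreal (\<epsilon> * h ^ n)"
    proof -
      have "(\<lambda>m. ennreal ((cmod (s k z - s m z))\<^sup>2 * wt z)) \<longlonglongrightarrow> ennreal ((cmod (s k z - f z))\<^sup>2 * wt z)" for z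
        by (intro tendsto_intros f)
      then have "(\<integral>\<^sup>+ z. ennreal ((cmod (s k z - f z))\<^sup>2 * wt z) \<partial>\<mu>) =
          (\<integral>\<^sup>+ z. liminf (\<lambda>m. ennreal ((cmod (s k z - s m z))\<^sup>2 * wt z)) \<partial>\<mu>)"
        by (intro nn_integral_cong lim_imp_Liminf[symmetric]) auto
      also have "\<dots> \<le> liminf (\<lambda>m. \<integral>\<^sup>+ z. ennreal ((cmod (s k z - s m z))\<^sup>2 * wt z) \<partial>\<mu>)"
        by (rule nn_integral_liminf) measurable
      also have "\<dots> \<le> ennreal (\<epsilon> * h ^ n)"
      proof (rule Liminf_le)
        have "(\<integral>\<^sup>+ z. ennreal ((cmod (s k z - s m z))\<^sup>2 * wt z) \<partial>\<mu>) \<le> ennreal (\<epsilon> * h ^ n)" if "m \<ge> M" for m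
        proof -
          have "integrable \<mu> (\<lambda>z. (cmod (s k z - s m z))\<^sup>2 * wt z)"
            using L2.diff[OF sL[of k] sL[of m]] by (simp add: L2_def)
          then have "(\<integral>\<^sup>+ z. ennreal ((cmod (s k z - s m z))\<^sup>2 * wt z) \<partial>\<mu>) = ennreal (LINT z|\<mu>. (cmod (s k z - s m z))\<^sup>2 * wt z)"
            using wt_pos by (intro nn_integral_eq_integral) (auto simp: less_imp_le)
          also have "(LINT z|\<mu>. (cmod (s k z - s m z))\<^sup>2 * wt z) = sqn (\<lambda>z. s k z - s m z) * h ^ n"
            using h by (simp add: ip_self_real)
          also have "\<dots> \<le> \<epsilon> * h ^ n" using M k that hn by (intro mult_right_mono) (auto simp: less_imp_le)
          finally show ?thesis by (simp add: ennreal_leI)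
        qed
        then show "\<forall>\<^sub>F m in sequentially. (\<integral>\<^sup>+ z. ennreal ((cmod (s k z - s m z))\<^sup>2 * wt z) \<partial>\<mu>) \<le> ennreal (\<epsilon> * h ^ n)"
          by (auto simp: eventually_sequentially)
      qed simp
      finally show ?thesis .
    qed
    then have b: "(\<integral>\<^sup>+ z. ennreal ((cmod (s k z - f z))\<^sup>2 * wt z) \<partial>\<mu>) \<le> ennreal (\<epsilon> * h ^ n)" .
    have i: "integrable \<mu> (\<lambda>z. (cmod (s k z - f z))\<^sup>2 * wt z)"
    proof (rule integrableI_nonneg)
      show "(\<integral>\<^sup>+ z. ennreal ((cmod (s k z - f z))\<^sup>2 * wt z) \<partial>\<mu>) < \<infinity>"
        using b by (rule order.strict_trans1) simp
    qed (use wt_pos in \<open>auto simp: less_imp_le\<close>)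
    have "(\<integral>\<^sup>+ z. ennreal ((cmod (s k z - f z))\<^sup>2 * wt z) \<partial>\<mu>) = ennreal (LINT z|\<mu>. (cmod (s k z - f z))\<^sup>2 * wt z)"
      using wt_pos i by (intro nn_integral_eq_integral) (auto simp: less_imp_le)
    then have "(LINT z|\<mu>. (cmod (s k z - f z))\<^sup>2 * wt z) \<le> \<epsilon> * h ^ n"
      using b \<epsilon> hn by (simp add: ennreal_le_iff)
    then have "sqn (\<lambda>z. s k z - f z) \<le> \<epsilon>"
      using hn by (simp add: ip_self_real divide_le_eq)
    then show ?thesis using i by (simp add: L2_def)
  qed
  have lim: "(\<lambda>k. sqn (\<lambda>z. s k z - f z)) \<longlonglongrightarrow> 0"
  proof (rule LIMSEQ_I)
    fix r :: real assume r: "0 < r"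
    obtain M where M: "\<forall>m\<ge>M. \<forall>k\<ge>M. sqn (\<lambda>z. s m z - s k z) < r / 2" using cauchy[of "r / 2"] r by auto
    have "norm (sqn (\<lambda>z. s k z - f z) - 0) < r" if "k \<ge> M" for k
      using tail[OF M that] L2.sqn_nonneg[of "\<lambda>z. s k z - f z"] r by simp
    then show "\<exists>M. \<forall>k\<ge>M. norm (sqn (\<lambda>z. s k z - f z) - 0) < r" by blast
  qed
  have fL: "f \<in> L2"
  proof -
    obtain M where M: "\<forall>m\<ge>M. \<forall>k\<ge>M. sqn (\<lambda>z. s m z - s k z) < 1" using cauchy[of 1] by auto
    have "(\<lambda>z. s M z - (s M z - f z)) \<in> L2" using tail[OF M order_refl] L2.diff[OF sL] by blast
    then show ?thesis by simp
  qed
  have "f z = ip f (e z)" for z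
  proof (rule LIMSEQ_unique[OF f])
    have "(\<lambda>k. ip (s k) (e z)) \<longlonglongrightarrow> ip f (e z)"
      using lim by (intro L2.ip_tendsto sL fL H_L2 e_H)
    then show "(\<lambda>k. s k z) \<longlonglongrightarrow> ip f (e z)" by (simp add: reproducing_e s)
  qed
  then have "f \<in> H" by (rule holomorphic_if_reproduced[OF fL])
  with lim show ?thesis by blast
qed

sublocale reproducing_kernel_space H ip e
  by unfold_locales (auto intro: e_H reproducing_e H_complete)

text \<open>The derivative at each point is both complex linear and conjugate linear with respect to
  \<open>j\<close>, hence zero.\<close>

lemma holomorphic_antiholomorphic_constant:
  assumes f: "j_holomorphic j f" and g: "j_holomorphic j g" and eq: "\<And>z. f z = cnj (g z)"
  shows "f z = f 0"
proof -
  have "(f has_derivative (\<lambda>v. 0)) (at z)" for z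
  proof -
    obtain D where D: "(f has_derivative D) (at z)" "\<And>v. D (j v) = \<i> * D v"
      using f by (auto simp: j_holomorphic_def)
    obtain E where E: "(g has_derivative E) (at z)" "\<And>v. E (j v) = \<i> * E v"
      using g by (auto simp: j_holomorphic_def)
    have "((\<lambda>z. cnj (g z)) has_derivative (\<lambda>v. cnj (E v))) (at z)"
      using E(1) by (rule has_derivative_cnj)
    moreover have "(\<lambda>z. cnj (g z)) = f" using eq by auto
    ultimately have "(f has_derivative (\<lambda>v. cnj (E v))) (at z)" by simp
    then have DE: "D = (\<lambda>v. cnj (E v))" using D(1) has_derivative_unique by blast
    have "D v = 0" for v
    proof -
      have "\<i> * D v = cnj (\<i> * E v)" using D(2)[of v] E(2)[of v] DE by metis
      then have "\<i> * D v = - (\<i> * D v)" by (simp add: DE)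
      then show ?thesis by simp
    qed
    then have "D = (\<lambda>v. 0)" by auto
    then show ?thesis using D(1) by simp
  qed
  then show ?thesis using has_derivative_zero_unique[of UNIV f z 0] by simp
qed

end

section \<open>The Schroedinger model and the Bargmann transform\<close>

locale lagrangian_model = bargmann_fock h n \<Omega> j
  for h :: real and n :: nat and \<Omega> :: "'v::euclidean_space \<Rightarrow> 'v \<Rightarrow> real" and j :: "'v \<Rightarrow> 'v" +
  fixes F :: "'v set" and \<tau> :: "real^'m::{finite,wellorder} \<Rightarrow> 'v"
  assumes lagr: "lagrangian \<Omega> F" and card: "CARD('m) = n"
    and \<tau>_linear: "linear \<tau>" and \<tau>_range: "range \<tau> = F" and \<tau>_iso: "Gform \<Omega> j (\<tau> u) (\<tau> u') = u \<bullet> u'"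
begin

sublocale orthonormal_coordinates G F \<tau>
  by (intro orthonormal_coordinates.intro G_bilinear \<tau>_linear \<tau>_range \<tau>_iso)

lemma \<Omega>_F: "u \<in> F \<Longrightarrow> v \<in> F \<Longrightarrow> \<Omega> u v = 0"
  using lagr by (auto simp: lagrangian_def)

lemma in_F_iff: "v \<in> F \<longleftrightarrow> (\<forall>u\<in>F. \<Omega> v u = 0)"
  using lagr by (auto simp: lagrangian_def)

definition qc :: "'v \<Rightarrow> real^'m::_" where "qc v = coord v"
definition pc :: "'v \<Rightarrow> real^'m::_" where "pc v = coord (- j v)"

lemma \<tau>_simps: "\<tau> (u + v) = \<tau> u + \<tau> v" "\<tau> (u - v) = \<tau> u - \<tau> v" "\<tau> (r *\<^sub>R u) = r *\<^sub>R \<tau> u" "\<tau> (- u) = - \<tau> u" "\<tau> 0 = 0"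
  using \<tau>_linear by (simp_all add: linear_add linear_diff linear_cmul linear_neg linear_0)

lemma qc_linear: "linear qc" and pc_linear: "linear pc"
proof -
  show "linear qc" unfolding qc_def[abs_def] using coord_linear by simp
  have "linear (\<lambda>v. - j v)" using j_linear by (intro linearI) (simp_all add: j_simps)
  then show "linear pc" unfolding pc_def[abs_def]
    using linear_compose[of "\<lambda>v. - j v" coord] coord_linear by (simp add: o_def)
qed

lemma qpc_simps:
  "qc (u + v) = qc u + qc v" "qc (u - v) = qc u - qc v" "qc (r *\<^sub>R u) = r *\<^sub>R qc u" "qc (- u) = - qc u" "qc 0 = 0"
  "pc (u + v) = pc u + pc v" "pc (u - v) = pc u - pc v" "pc (r *\<^sub>R u) = r *\<^sub>R pc u" "pc (- u) = - pc u" "pc 0 = 0"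
  using qc_linear pc_linear by (simp_all add: linear_add linear_diff linear_cmul linear_neg linear_0)

lemma coord_eqI: "(\<And>u. G v (\<tau> u) = x \<bullet> u) \<Longrightarrow> coord v = x"
  by (simp add: coord_def Finite_Cartesian_Product.vec_eq_iff inner_axis)

lemma G_j\<tau>_\<tau>: "G (j (\<tau> p)) (\<tau> u) = 0"
  using \<Omega>_F[OF \<tau>_in \<tau>_in, of p u] by (simp add: Gform_def j_\<Omega>)

lemma qpc_\<tau>: "qc (\<tau> u) = u" "pc (\<tau> u) = 0" "qc (j (\<tau> u)) = 0" "pc (j (\<tau> u)) = u"
  unfolding qc_def pc_def jj
  by (auto simp: coord_\<tau> G_simps G_j\<tau>_\<tau> intro!: coord_eqI)

text \<open>The difference \<open>r\<close> of the two sides has vanishing coordinates. Vanishing of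
  \<open>pc r\<close> says that \<open>r\<close> is \<open>\<Omega>\<close>-orthogonal to
  \<open>F\<close>, so \<open>r\<close> lies in \<open>F\<close> by the Lagrangian condition, and
  there \<open>qc r = 0\<close> forces \<open>r = 0\<close>.\<close>

lemma decomposition: "\<tau> (qc v) + j (\<tau> (pc v)) = v"
proof -
  define r where "r = v - \<tau> (qc v) - j (\<tau> (pc v))"
  have Gc: "G x (\<tau> u) = coord x \<bullet> u" for x u
  proof -
    have l: "linear (G x)" using G_bilinear by (simp add: bilinear_def)
    have "G x (\<tau> u) = G x (\<tau> (\<Sum>i\<in>UNIV. (u $ i) *\<^sub>R axis i 1))"
      using basis_expansion[of u] by (simp add: scalar_mult_eq_scaleR)
    also have "\<dots> = (\<Sum>i\<in>UNIV. u $ i * G x (\<tau> (axis i 1)))"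
      by (simp add: linear_sum[OF \<tau>_linear] linear_sum[OF l] linear_cmul[OF \<tau>_linear] linear_cmul[OF l])
    finally show ?thesis by (simp add: coord_def inner_vec_def mult.commute)
  qed
  have r0: "qc r = 0" "pc r = 0" unfolding r_def by (simp_all add: qpc_simps qpc_\<tau>)
  have "\<Omega> r (\<tau> u) = 0" for u
    using r0(2) Gc[of "- j r" u] by (simp add: pc_def Gform_def \<Omega>_simps j_\<Omega>)
  then have "r \<in> F" unfolding in_F_iff using \<tau>_range by auto
  then obtain u where "r = \<tau> u" using \<tau>_range by auto
  then have "r = 0" using r0(1) by (simp add: qpc_\<tau> \<tau>_simps)
  then show ?thesis by (simp add: r_def algebra_simps)
qed

lemma qpc_eqI: "qc u = qc v \<Longrightarrow> pc u = pc v \<Longrightarrow> u = v"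
  by (metis decomposition)

lemma qpc_j: "qc (j v) = - pc v" "pc (j v) = qc v"
  by (simp_all add: pc_def qc_def jj linear_neg[OF coord_linear])

lemma \<Omega>_coord: "\<Omega> u v = qc u \<bullet> pc v - pc u \<bullet> qc v"
proof -
  have 1: "\<Omega> (\<tau> a) (j (\<tau> b)) = a \<bullet> b" for a b using \<tau>_iso[of a b] by (simp add: Gform_def)
  have "\<Omega> (\<tau> (qc u) + j (\<tau> (pc u))) (\<tau> (qc v) + j (\<tau> (pc v))) = qc u \<bullet> pc v - pc u \<bullet> qc v"
    by (simp add: \<Omega>_simps \<Omega>_F[OF \<tau>_in \<tau>_in] 1 jj \<Omega>_j_left)
  then show ?thesis by (simp add: decomposition)
qed

lemma G_coord: "G u v = qc u \<bullet> qc v + pc u \<bullet> pc v"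
  by (simp add: Gform_def \<Omega>_coord qpc_j)

lemma hp_coord: "hp u v = complex_of_real (qc u \<bullet> qc v + pc u \<bullet> pc v) + \<i> * complex_of_real (pc u \<bullet> qc v - qc u \<bullet> pc v)"
  using G_coord[of u v] by (simp add: hprod_def Gform_def \<Omega>_coord algebra_simps)

abbreviation "ipE \<psi> \<phi> \<equiv> LINT y|lborel. \<psi> y * cnj (\<phi> y)"

lemma E_integrable: "\<psi> \<in> gauss_class \<Longrightarrow> \<phi> \<in> gauss_class \<Longrightarrow> integrable lborel (\<lambda>y. \<psi> y * cnj (\<phi> y))"
  by (intro gauss_class_integrable gauss_class_prod gauss_class_cnj)

sublocale E: semi_inner_space "gauss_class :: (real^'m::_ \<Rightarrow> complex) set" "\<lambda>\<psi> \<phi>. ipE \<psi> \<phi>"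
proof
  fix f g k :: "real^'m::_ \<Rightarrow> complex" and c :: complex
  assume f: "f \<in> gauss_class"
  show "(\<lambda>z. c * f z) \<in> gauss_class" by (rule gauss_class_scale[OF f])
  show "0 \<le> Re (ipE f f)"
  proof -
    have "ipE f f = complex_of_real (LINT y|lborel. (cmod (f y))\<^sup>2)"
      unfolding integral_complex_of_real[symmetric] complex_norm_square ..
    then show ?thesis by simp
  qed
  assume g: "g \<in> gauss_class"
  show "(\<lambda>z. f z + g z) \<in> gauss_class" by (rule gauss_class_add[OF f g])
  show "ipE g f = cnj (ipE f g)"
    by (subst Bochner_Integration.integral_cnj[symmetric]) (simp add: mult.commute)
  show "ipE (\<lambda>z. c * f z) g = c * ipE f g"
    by (subst integral_mult_right_zero[symmetric]) (simp only: mult.assoc)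
  assume k: "k \<in> gauss_class"
  show "ipE (\<lambda>z. f z + g z) k = ipE f k + ipE g k"
    using E_integrable[OF f k] E_integrable[OF g k] by (simp add: algebra_simps)
qed

lemma E_sqn: "E.sqn \<psi> = (LINT y|lborel. (cmod (\<psi> y))\<^sup>2)"
proof -
  have "ipE \<psi> \<psi> = complex_of_real (LINT y|lborel. (cmod (\<psi> y))\<^sup>2)"
    unfolding integral_complex_of_real[symmetric] complex_norm_square ..
  then show ?thesis by (simp add: E.sqn_def)
qed

text \<open>This is \<open>(pi * w)\<close> to the power \<open>- n / 4\<close>, the constant that
  gives the ground state Gaussian on an \<open>n\<close>-dimensional space norm 1.\<close>

definition N :: real where "N = (1 / sqrt (sqrt (pi * w))) ^ n"

lemma N: "0 < N" "N\<^sup>2 * sqrt (pi * w) ^ n = 1"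
proof -
  have s: "0 < sqrt (pi * w)" using w by simp
  then show "0 < N" by (simp add: N_def)
  have "N\<^sup>2 = ((1 / sqrt (sqrt (pi * w)))\<^sup>2) ^ n" by (simp add: N_def mult.commute flip: power_mult)
  also have "(1 / sqrt (sqrt (pi * w)))\<^sup>2 = 1 / sqrt (pi * w)" using s by (simp add: power_divide)
  finally show "N\<^sup>2 * sqrt (pi * w) ^ n = 1" using w by (simp add: power_divide)
qed

text \<open>The coherent states of the Schroedinger model on \<open>L\<^sup>2\<close> of the coordinates of \<open>jF\<close>, in which \<open>F\<close>
  acts by multiplication; \<open>bR\<close> and \<open>bI\<close> are the real and imaginary parts of the exponent.\<close>

definition bR where "bR v y = (- (y \<bullet> y) + 2 * (pc v \<bullet> y) + (qc v \<bullet> qc v - pc v \<bullet> pc v) / 2) / (2 * w)"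
definition bI where "bI v y = (2 * (qc v \<bullet> y) - qc v \<bullet> pc v) / (2 * w)"
definition b :: "'v \<Rightarrow> real^'m::_ \<Rightarrow> complex" where
  "b v y = complex_of_real N * exp (complex_of_real (bR v y) + \<i> * complex_of_real (bI v y))"

lemma b_gauss: "b v \<in> gauss_class"
proof -
  define C where "C = N * exp ((2 * (pc v \<bullet> pc v) + (qc v \<bullet> qc v - pc v \<bullet> pc v) / 2) / (2 * w))"
  have "cmod (b v y) \<le> C * exp (- (1 / (4 * w)) * (y \<bullet> y))" for y
  proof -
    have "0 \<le> (y - 2 *\<^sub>R pc v) \<bullet> (y - 2 *\<^sub>R pc v)" by simp
    then have "- (y \<bullet> y) + 2 * (pc v \<bullet> y) \<le> - (y \<bullet> y) / 2 + 2 * (pc v \<bullet> pc v)"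
      by (simp add: inner_diff_left inner_diff_right inner_commute)
    then have "bR v y \<le> (- (y \<bullet> y) / 2 + 2 * (pc v \<bullet> pc v) + (qc v \<bullet> qc v - pc v \<bullet> pc v) / 2) / (2 * w)"
      unfolding bR_def using w by (intro divide_right_mono) auto
    also have "\<dots> = (2 * (pc v \<bullet> pc v) + (qc v \<bullet> qc v - pc v \<bullet> pc v) / 2) / (2 * w) + - (1 / (4 * w)) * (y \<bullet> y)"
      using w by (simp add: field_simps)
    finally have "exp (bR v y) \<le> exp ((2 * (pc v \<bullet> pc v) + (qc v \<bullet> qc v - pc v \<bullet> pc v) / 2) / (2 * w)) * exp (- (1 / (4 * w)) * (y \<bullet> y))"
      by (simp only: mult_exp_exp exp_le_cancel_iff)
    then show ?thesis using N(1)
      by (simp add: b_def C_def norm_mult norm_exp_eq_Re mult.assoc)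
  qed
  moreover have "continuous_on UNIV (b v)"
    unfolding b_def[abs_def] bR_def bI_def using w by (intro continuous_intros) auto
  ultimately show ?thesis using w
    unfolding gauss_class_def by (intro CollectI conjI exI[of _ C] exI[of _ "1 / (4 * w)"]) auto
qed

text \<open>The Gaussians have the same Gram matrix as the kernel functions of the Fock space. The
  phase and the real constant in \<open>bI\<close> and \<open>bR\<close> are fitted to this, since
  they decide the part of the exponent that does not depend on \<open>y\<close>.\<close>

lemma b_ip: "ipE (b v) (b u) = e v u"
proof -
  define \<sigma> where "\<sigma> = (1 / w) *\<^sub>R (pc v + pc u)"
  define \<delta> where "\<delta> = (1 / w) *\<^sub>R (qc v - qc u)"
  define cR where "cR = (qc v \<bullet> qc v - pc v \<bullet> pc v + qc u \<bullet> qc u - pc u \<bullet> pc u) / (4 * w)"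
  define cI where "cI = - (qc v \<bullet> pc v - qc u \<bullet> pc u) / (2 * w)"
  define K where "K = complex_of_real (N\<^sup>2) * exp (complex_of_real cR + \<i> * complex_of_real cI)"
  have "b v y * cnj (b u y) = K * exp (complex_of_real (- (1 / w) * (y \<bullet> y) + \<sigma> \<bullet> y) + \<i> * complex_of_real (\<delta> \<bullet> y))" for y
  proof -
    have R: "bR v y + bR u y = cR + (- (1 / w) * (y \<bullet> y) + \<sigma> \<bullet> y)"
      using w by (simp add: bR_def cR_def \<sigma>_def inner_add_left field_simps)
    have I: "bI v y - bI u y = cI + \<delta> \<bullet> y"
      using w by (simp add: bI_def cI_def \<delta>_def inner_diff_left field_simps)
    have "b v y * cnj (b u y) = complex_of_real (N\<^sup>2) * exp (complex_of_real (bR v y + bR u y) + \<i> * complex_of_real (bI v y - bI u y))"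
      by (simp add: b_def exp_cnj power2_eq_square algebra_simps mult_exp_exp flip: exp_add)
    also have "\<dots> = K * exp (complex_of_real (- (1 / w) * (y \<bullet> y) + \<sigma> \<bullet> y) + \<i> * complex_of_real (\<delta> \<bullet> y))"
      unfolding R I K_def mult.assoc mult_exp_exp by (simp add: algebra_simps)
    finally show ?thesis .
  qed
  then have "ipE (b v) (b u) = K * (LINT y|lborel. exp (complex_of_real (- (1 / w) * (y \<bullet> y) + \<sigma> \<bullet> y) + \<i> * complex_of_real (\<delta> \<bullet> y)))"
    by simp
  also have "\<dots> = K * (complex_of_real (sqrt (pi / (1 / w)) ^ CARD('m)) *
      exp ((complex_of_real (\<sigma> \<bullet> \<sigma> - \<delta> \<bullet> \<delta>) + 2 * \<i> * complex_of_real (\<sigma> \<bullet> \<delta>)) / complex_of_real (4 * (1 / w))))"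
    using gaussian_integral[of "1 / w" \<sigma> \<delta>] w by simp
  also have "\<dots> = complex_of_real (N\<^sup>2 * sqrt (pi * w) ^ n) * exp ((complex_of_real cR + \<i> * complex_of_real cI) +
      (complex_of_real (\<sigma> \<bullet> \<sigma> - \<delta> \<bullet> \<delta>) + 2 * \<i> * complex_of_real (\<sigma> \<bullet> \<delta>)) / complex_of_real (4 * (1 / w)))"
    unfolding K_def card exp_add by simp
  also have "(complex_of_real cR + \<i> * complex_of_real cI) +
      (complex_of_real (\<sigma> \<bullet> \<sigma> - \<delta> \<bullet> \<delta>) + 2 * \<i> * complex_of_real (\<sigma> \<bullet> \<delta>)) / complex_of_real (4 * (1 / w)) =
      complex_of_real (cR + (\<sigma> \<bullet> \<sigma> - \<delta> \<bullet> \<delta>) * w / 4) + \<i> * complex_of_real (cI + (\<sigma> \<bullet> \<delta>) * w / 2)"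
    using w by (simp add: field_simps)
  also have "cR + (\<sigma> \<bullet> \<sigma> - \<delta> \<bullet> \<delta>) * w / 4 = (qc u \<bullet> qc v + pc u \<bullet> pc v) / (2 * w)"
    using w by (simp add: cR_def \<sigma>_def \<delta>_def inner_add_left inner_add_right inner_diff_left inner_diff_right
        inner_commute field_simps)
  also have "cI + (\<sigma> \<bullet> \<delta>) * w / 2 = (pc u \<bullet> qc v - qc u \<bullet> pc v) / (2 * w)"
    using w by (simp add: cI_def \<sigma>_def \<delta>_def inner_add_left inner_add_right inner_diff_left inner_diff_right
        inner_commute field_simps)
  also have "complex_of_real ((qc u \<bullet> qc v + pc u \<bullet> pc v) / (2 * w)) + \<i> * complex_of_real ((pc u \<bullet> qc v - qc u \<bullet> pc v) / (2 * w)) = hp u v / (2 * w)"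
    unfolding hp_coord by (simp add: add_divide_distrib)
  finally show ?thesis by (simp add: e_eq N)
qed

text \<open>The term \<open>(qc v \<bullet> pc v) / 2\<close> is the symmetric (Weyl) ordering of
  the phase and the translation: it makes the operator for \<open>- v\<close> the inverse of that
  for \<open>v\<close>, and the cocycle a multiple of \<open>\<Omega>\<close>, as in the Heisenberg
  group.\<close>

definition schr :: "'v \<Rightarrow> (real^'m::_ \<Rightarrow> complex) \<Rightarrow> real^'m::_ \<Rightarrow> complex" where
  "schr v \<psi> y = exp (\<i> * complex_of_real ((qc v \<bullet> y - (qc v \<bullet> pc v) / 2) / w)) * \<psi> (y - pc v)"

lemma schr_gauss: "\<psi> \<in> gauss_class \<Longrightarrow> schr v \<psi> \<in> gauss_class"
  unfolding schr_def[abs_def] using w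
  by (intro gauss_class_mult[where B=1] gauss_class_shift continuous_intros) auto

lemma schr_ip:
  assumes "\<psi> \<in> gauss_class" "\<phi> \<in> gauss_class"
  shows "ipE (schr v \<psi>) \<phi> = ipE \<psi> (schr (- v) \<phi>)"
proof -
  note [measurable] = gauss_class_measurable[OF assms(1)] gauss_class_measurable[OF assms(2)]
  let ?f = "\<lambda>y. \<psi> y * cnj (schr (- v) \<phi> y)"
  have [measurable]: "schr (- v) \<phi> \<in> borel_measurable borel"
    by (rule gauss_class_measurable[OF schr_gauss[OF assms(2)]])
  have "schr v \<psi> y * cnj (\<phi> y) = ?f (y - pc v)" for y
    by (simp add: schr_def qpc_simps exp_cnj inner_diff_right algebra_simps diff_divide_distrib add_divide_distrib)
  then have "ipE (schr v \<psi>) \<phi> = (LINT y|lborel. ?f (y - pc v))" by simp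
  also have "\<dots> = ipE \<psi> (schr (- v) \<phi>)" by (rule integral_lborel_shift) measurable
  finally show ?thesis .
qed

text \<open>The factor is the one with which \<open>W v\<close> sends \<open>e u\<close> to a
  multiple of \<open>e (u + v)\<close>. This is why the Bargmann transform intertwines the two
  Heisenberg actions.\<close>

lemma schr_b: "schr v (b u) = (\<lambda>y. exp (- hp v v / (4 * w) - hp v u / (2 * w)) * b (u + v) y)"
proof
  fix y
  define R where "R = - (qc v \<bullet> qc v + pc v \<bullet> pc v) / (4 * w) - (qc v \<bullet> qc u + pc v \<bullet> pc u) / (2 * w)"
  define I where "I = - (pc v \<bullet> qc u - qc v \<bullet> pc u) / (2 * w)"
  have z: "- hp v v / (4 * w) - hp v u / (2 * w) = complex_of_real R + \<i> * complex_of_real I"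
    using w by (simp add: hp_coord R_def I_def inner_commute[of "pc v" "qc v"] field_simps)
  have bR: "bR u (y - pc v) = R + bR (u + v) y"
    using w by (simp add: bR_def R_def qpc_simps inner_add_left inner_add_right inner_diff_left inner_diff_right
        inner_commute field_simps)
  have bI: "(qc v \<bullet> y - (qc v \<bullet> pc v) / 2) / w + bI u (y - pc v) = I + bI (u + v) y"
    using w by (simp add: bI_def I_def qpc_simps inner_add_left inner_add_right inner_diff_left inner_diff_right
        inner_commute field_simps)
  have "schr v (b u) y = complex_of_real N * exp (complex_of_real (bR u (y - pc v)) + \<i> * complex_of_real ((qc v \<bullet> y - (qc v \<bullet> pc v) / 2) / w + bI u (y - pc v)))"
    by (simp add: schr_def b_def algebra_simps mult_exp_exp flip: exp_add)
  also have "\<dots> = complex_of_real N * exp ((complex_of_real R + \<i> * complex_of_real I) + (complex_of_real (bR (u + v) y) + \<i> * complex_of_real (bI (u + v) y)))"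
    unfolding bR bI by (simp add: algebra_simps)
  finally show "schr v (b u) y = exp (- hp v v / (4 * w) - hp v u / (2 * w)) * b (u + v) y"
    unfolding z b_def[of "u + v" y] by (simp only: exp_add mult_ac)
qed

definition bargmann :: "(real^'m::_ \<Rightarrow> complex) \<Rightarrow> 'v \<Rightarrow> complex" where
  "bargmann \<psi> z = ipE \<psi> (b z)"

lemma bargmann_schr:
  assumes "\<psi> \<in> gauss_class"
  shows "bargmann (schr v \<psi>) = W v (bargmann \<psi>)"
proof
  fix z
  have "bargmann (schr v \<psi>) z = ipE \<psi> (schr (- v) (b z))" unfolding bargmann_def by (rule schr_ip[OF assms b_gauss])
  also have "\<dots> = cnj (exp (- hp v v / (4 * w) + hp v z / (2 * w))) * ipE \<psi> (b (z - v))"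
    unfolding schr_b using E.ip_scale_right[OF b_gauss assms] by (simp add: hp_simps)
  also have "cnj (exp (- hp v v / (4 * w) + hp v z / (2 * w))) = exp (hp z v / (2 * w) - hp v v / (4 * w))"
    using hp_cnj[of z v] by (simp add: exp_cnj hp_self)
  finally show "bargmann (schr v \<psi>) z = W v (bargmann \<psi>) z" by (simp add: W_eq bargmann_def)
qed

lemma qc_measurable [measurable]: "qc \<in> borel_measurable borel" and pc_measurable [measurable]: "pc \<in> borel_measurable borel"
  by (rule linear_measurable[OF qc_linear] linear_measurable[OF pc_linear])+

text \<open>The conjugate of \<open>b z y\<close> splits into a factor \<open>P z\<close>
  independent of \<open>y\<close>, a Gaussian in \<open>y\<close>, and the exponential of a function
  \<open>j\<close>-linear in \<open>z\<close>. The Gaussian is merged into \<open>\<psi>\<close>,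
  and the rest is differentiated under the integral.\<close>

lemma bargmann_holomorphic:
  assumes \<psi>: "\<psi> \<in> gauss_class"
  shows "j_holomorphic j (bargmann \<psi>)"
proof -
  obtain K where K: "0 < K" "\<And>u v. cmod (hp u v) \<le> K * norm u * norm v" using hp_bound by blast
  obtain C where C: "C > 0" "\<And>y. norm (\<tau> y) \<le> C * norm y"
    using linear_bounded_pos[OF \<tau>_linear] by (auto simp: mult.commute)
  \<comment> \<open>The bilinear square of \<open>q + i p\<close>. As \<open>j\<close> sends
    \<open>(q, p)\<close> to \<open>(- p, q)\<close>, it multiplies \<open>q + i p\<close> by
    \<open>i\<close>, so this is a holomorphic quadratic function; \<open>zD z\<close> is its
    differential.\<close>
  define zz where "zz z = complex_of_real (qc z \<bullet> qc z - pc z \<bullet> pc z) + \<i> * complex_of_real (2 * (qc z \<bullet> pc z))" for z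
  define zD where "zD z \<eta> = complex_of_real (2 * (qc z \<bullet> qc \<eta>) - 2 * (pc z \<bullet> pc \<eta>)) + \<i> * complex_of_real (2 * (qc z \<bullet> pc \<eta> + pc z \<bullet> qc \<eta>))" for z \<eta>
  define L where "L y z = - \<i> * hp z (\<tau> y) / complex_of_real w" for y z
  define u where "u y = complex_of_real (N * exp (- (y \<bullet> y) / (2 * w)))" for y :: "real^'m::_"
  define \<psi>0 where "\<psi>0 y = u y * \<psi> y" for y
  have "cmod (u y) \<le> N" for y using N(1) w by (simp add: u_def norm_mult)
  moreover have "continuous_on UNIV u" unfolding u_def using w by (intro continuous_intros) auto
  ultimately have g: "\<psi>0 \<in> gauss_class" unfolding \<psi>0_def by (intro gauss_class_mult[OF \<psi>])
  note [measurable] = gauss_class_measurable[OF g] linear_measurable[OF \<tau>_linear]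
  define Q where "Q z = (LINT y|lborel. \<psi>0 y * exp (L y z))" for z
  define P where "P z = exp (zz z / (4 * w))" for z
  have bt_eq: "bargmann \<psi> = (\<lambda>z. P z * Q z)"
  proof
    fix z
    have "\<psi> y * cnj (b z y) = P z * (\<psi>0 y * exp (L y z))" for y
    proof -
      have e: "complex_of_real (bR z y) - \<i> * complex_of_real (bI z y) = zz z / (4 * w) + (complex_of_real (- (y \<bullet> y) / (2 * w)) + L y z)"
        using w by (simp add: bR_def bI_def zz_def L_def hp_coord qpc_\<tau> field_simps)
      have "cnj (b z y) = complex_of_real N * exp (complex_of_real (bR z y) - \<i> * complex_of_real (bI z y))"
        by (simp add: b_def exp_cnj)
      also have "\<dots> = complex_of_real N * (P z * (complex_of_real (exp (- (y \<bullet> y) / (2 * w))) * exp (L y z)))"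
        unfolding e exp_add P_def exp_of_real ..
      finally show ?thesis by (simp add: \<psi>0_def u_def mult_ac)
    qed
    then show "bargmann \<psi> z = P z * Q z" by (simp add: bargmann_def Q_def)
  qed
  have lin: "linear (L y)" for y
    unfolding L_def by (intro linearI) (simp_all add: hp_simps add_divide_distrib diff_divide_distrib scaleR_conv_of_real algebra_simps)
  have QD: "(Q has_derivative (\<lambda>\<eta>. LINT y|lborel. \<psi>0 y * exp (L y z) * L y \<eta>)) (at z)" for z
    unfolding Q_def
  proof (rule exp_integral_has_derivative[where \<l> = "\<lambda>y. K * C / w * norm y", OF lin])
    show "cmod (L y \<eta>) \<le> K * C / w * norm y * norm \<eta>" for y \<eta>
    proof -
      have "cmod (hp \<eta> (\<tau> y)) \<le> K * norm \<eta> * (C * norm y)"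
        using order_trans[OF K(2)[of \<eta> "\<tau> y"] mult_left_mono[OF C(2)[of y], of "K * norm \<eta>"]] K(1) by simp
      then show ?thesis using w by (simp add: L_def norm_divide norm_mult divide_right_mono mult_ac)
    qed
    show "0 \<le> K * C / w * norm y" for y :: "real^'m::_" using K C w by simp
    show "integrable lborel (\<lambda>y. cmod (\<psi>0 y) * exp (K' * (K * C / w * norm y)))" for K'
      using gauss_class_exp_integrable[OF g, of "K' * (K * C / w)"] by (simp add: mult.assoc)
    show "(\<lambda>y. L y \<eta>) \<in> borel_measurable lborel" for \<eta>
      unfolding L_def by measurable
  qed measurable
  have qb: "bounded_linear qc" "bounded_linear pc"
    using qc_linear pc_linear linear_conv_bounded_linear by blast+
  have zzD: "(zz has_derivative zD z) (at z)" for z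
    unfolding zz_def zD_def
    by (auto intro!: derivative_eq_intros bounded_linear_imp_has_derivative qb simp: inner_commute algebra_simps)
  have "((\<lambda>z. zz z / (4 * w)) has_derivative (\<lambda>\<eta>. zD z \<eta> / (4 * w))) (at z)" for z
    using has_derivative_mult_left[OF zzD, of "1 / (4 * complex_of_real w)"] by simp
  then have PD: "(P has_derivative (\<lambda>\<eta>. zD z \<eta> / (4 * w) * exp (zz z / (4 * w)))) (at z)" for z
    unfolding P_def by (rule has_derivative_compose) (metis DERIV_exp has_field_derivative_def mult_commute_abs)
  show ?thesis unfolding j_holomorphic_def
  proof
    fix z
    define D where "D \<eta> = P z * (LINT y|lborel. \<psi>0 y * exp (L y z) * L y \<eta>) + zD z \<eta> / (4 * w) * exp (zz z / (4 * w)) * Q z" for \<eta>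
    have "(bargmann \<psi> has_derivative D) (at z)"
      unfolding bt_eq D_def by (rule has_derivative_mult[OF PD QD])
    moreover have "D (j \<eta>) = \<i> * D \<eta>" for \<eta>
    proof -
      have "L y (j \<eta>) = \<i> * L y \<eta>" for y by (simp add: L_def hp_simps)
      then have "(LINT y|lborel. \<psi>0 y * exp (L y z) * L y (j \<eta>)) = \<i> * (LINT y|lborel. \<psi>0 y * exp (L y z) * L y \<eta>)"
        by (subst integral_mult_right_zero[symmetric]) (simp add: mult_ac)
      moreover have "zD z (j \<eta>) = \<i> * zD z \<eta>"
        by (simp add: zD_def qpc_j complex_eq_iff)
      ultimately show ?thesis by (simp add: D_def algebra_simps)
    qed
    ultimately show "\<exists>D. (bargmann \<psi> has_derivative D) (at z) \<and> (\<forall>v. D (j v) = \<i> * D v)" by blast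
  qed
qed

text \<open>For fixed \<open>p\<close> the transform is, up to a factor of known modulus, the
  Fourier transform in \<open>q\<close> of \<open>\<psi>\<close> times a Gaussian window centred at
  \<open>p\<close>. Plancherel integrates out \<open>q\<close> with the factor \<open>h ^ n\<close>,
  the windows integrate out \<open>p\<close> with \<open>sqrt (pi * w) ^ n\<close>, and
  \<open>N\<close> squared cancels the latter.\<close>

lemma bargmann_isometry:
  assumes \<psi>: "\<psi> \<in> gauss_class"
  shows "bargmann \<psi> \<in> H" and "sqn (bargmann \<psi>) = E.sqn \<psi>"
proof -
  define f where "f z = (cmod (bargmann \<psi> z))\<^sup>2 * wt z" for z
  have hol: "j_holomorphic j (bargmann \<psi>)" by (rule bargmann_holomorphic[OF \<psi>])
  have btm [measurable]: "bargmann \<psi> \<in> borel_measurable borel"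
    by (rule borel_measurable_continuous_onI[OF holomorphic_continuous[OF hol]])
  have fm [measurable]: "f \<in> borel_measurable borel" unfolding f_def by measurable
  note [measurable] = gauss_class_measurable[OF \<psi>]
  define T where "T = (\<lambda>(p, q). \<tau> q + j (\<tau> p))"
  have T: "linear T" unfolding T_def
    by (intro linearI) (auto simp: \<tau>_simps j_simps scaleR_add_right)
  have TG: "G (T x) (T y) = x \<bullet> y" for x y
    by (cases x, cases y) (simp add: T_def G_coord qpc_simps qpc_\<tau> inner_commute)
  have \<mu>T: "\<mu> = distr lborel borel T"
    by (rule vol_isometry[OF T TG]) (simp add: dim card)
  have Tm [measurable]: "T \<in> borel_measurable borel" by (rule linear_measurable[OF T])
  define \<Psi> where "\<Psi> p y = complex_of_real (exp (- (1 / (2 * w)) * ((y - p) \<bullet> (y - p)))) * \<psi> y" for p y :: "real^'m::_"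
  have \<Psi>: "\<Psi> p \<in> gauss_class" for p
    unfolding \<Psi>_def[abs_def] using w by (intro gauss_class_mult[where B=1] \<psi> continuous_intros) auto
  define FF where "FF p q = (LINT y|lborel. \<Psi> p y * exp (- \<i> * complex_of_real ((1 / w) * (q \<bullet> y))))" for p q
  have fT: "f (T (p, q)) = N\<^sup>2 * (cmod (FF p q))\<^sup>2" for p q
  proof -
    define z where "z = T (p, q)"
    have z: "qc z = q" "pc z = p" by (simp_all add: z_def T_def qpc_simps qpc_\<tau>)
    define K where "K = complex_of_real N * exp (complex_of_real ((q \<bullet> q + p \<bullet> p) / (4 * w)) + \<i> * complex_of_real ((q \<bullet> p) / (2 * w)))"
    have "\<psi> y * cnj (b z y) = K * (\<Psi> p y * exp (- \<i> * complex_of_real ((1 / w) * (q \<bullet> y))))" for y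
    proof -
      have e: "complex_of_real (bR z y) - \<i> * complex_of_real (bI z y) =
        (complex_of_real ((q \<bullet> q + p \<bullet> p) / (4 * w)) + \<i> * complex_of_real ((q \<bullet> p) / (2 * w)))
        + (complex_of_real (- (1 / (2 * w)) * ((y - p) \<bullet> (y - p))) + (- \<i> * complex_of_real ((1 / w) * (q \<bullet> y))))"
        using w by (simp add: bR_def bI_def z inner_diff_left inner_diff_right inner_commute field_simps)
      have "cnj (b z y) = complex_of_real N * exp (complex_of_real (bR z y) - \<i> * complex_of_real (bI z y))"
        by (simp add: b_def exp_cnj)
      also have "\<dots> = K * (complex_of_real (exp (- (1 / (2 * w)) * ((y - p) \<bullet> (y - p)))) * exp (- \<i> * complex_of_real ((1 / w) * (q \<bullet> y))))"
        unfolding e exp_add K_def exp_of_real by (simp only: mult.assoc)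
      finally show ?thesis by (simp add: \<Psi>_def mult_ac)
    qed
    then have "bargmann \<psi> z = K * FF p q" by (simp add: bargmann_def FF_def)
    moreover have "(cmod K)\<^sup>2 * wt z = N\<^sup>2"
    proof -
      have "(cmod K)\<^sup>2 = N\<^sup>2 * (exp ((q \<bullet> q + p \<bullet> p) / (4 * w)))\<^sup>2"
        by (simp add: K_def norm_mult norm_exp_eq_Re power_mult_distrib)
      also have "(exp ((q \<bullet> q + p \<bullet> p) / (4 * w)))\<^sup>2 = exp ((q \<bullet> q + p \<bullet> p) / (2 * w))"
        using w by (simp add: field_simps flip: exp_double)
      finally have "(cmod K)\<^sup>2 = N\<^sup>2 * exp ((q \<bullet> q + p \<bullet> p) / (2 * w))" .
      moreover have "wt z = exp (- (q \<bullet> q + p \<bullet> p) / (2 * w))" by (simp add: wt_def G_coord z)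
      ultimately show ?thesis by (simp add: mult_exp_exp add_divide_distrib[symmetric])
    qed
    ultimately show ?thesis
      unfolding f_def z_def[symmetric] by (simp add: norm_mult power_mult_distrib)
  qed
  have k: "0 < 1 / w" using w by simp
  have pi1: "integrable lborel (\<lambda>q. (cmod (FF p q))\<^sup>2)" for p
    unfolding FF_def by (rule plancherel_integrable[OF \<Psi> k])
  have pi2: "(LINT q|lborel. (cmod (FF p q))\<^sup>2) = h ^ n * (LINT y|lborel. (cmod (\<Psi> p y))\<^sup>2)" for p
  proof -
    have "2 * pi / (1 / w) = h" by (simp add: w_def hbar_def)
    then show ?thesis unfolding FF_def using plancherel_integral[OF \<Psi> k, of p] by (simp add: card)
  qed
  have \<Psi>n: "(cmod (\<Psi> p y))\<^sup>2 = exp (- (1 / w) * ((y - p) \<bullet> (y - p))) * (cmod (\<psi> y))\<^sup>2" for p y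
    using w by (simp add: \<Psi>_def norm_mult power_mult_distrib flip: exp_double)
  have sq: "integrable lborel (\<lambda>y. (cmod (\<psi> y))\<^sup>2)"
  proof -
    have "integrable lborel (\<lambda>y. norm (\<psi> y * cnj (\<psi> y)))" by (intro integrable_norm E_integrable \<psi>)
    then show ?thesis by (simp add: norm_mult power2_eq_square)
  qed
  have gp: "(LINT p|lborel. exp (- (1 / w) * ((y - p) \<bullet> (y - p)))) = sqrt (pi * w) ^ n"
    "integrable lborel (\<lambda>p. exp (- (1 / w) * ((y - p) \<bullet> (y - p))))" for y :: "real^'m::_"
  proof -
    have m: "(\<lambda>u::real^'m::_. exp (- (1 / w) * (u \<bullet> u))) \<in> borel_measurable borel" by measurable
    show "(LINT p|lborel. exp (- (1 / w) * ((y - p) \<bullet> (y - p)))) = sqrt (pi * w) ^ n"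
      using integral_lborel_reflect[OF m, of y] gaussian_integral_norm[OF k, where 'e="real^'m::_"] by (simp add: card)
    show "integrable lborel (\<lambda>p. exp (- (1 / w) * ((y - p) \<bullet> (y - p))))"
      using integrable_lborel_reflect[OF m, of y] gaussian_integrable_norm[OF k, where 'e="real^'m::_"] by simp
  qed
  have int2: "integrable (lborel \<Otimes>\<^sub>M lborel) (\<lambda>(y, p). exp (- (1 / w) * ((y - p) \<bullet> (y - p))) * (cmod (\<psi> y))\<^sup>2)"
  proof (rule lborel_pair.Fubini_integrable)
    show "integrable lborel (\<lambda>y. LINT p|lborel. norm (case (y, p) of (y, p) \<Rightarrow> exp (- (1 / w) * ((y - p) \<bullet> (y - p))) * (cmod (\<psi> y))\<^sup>2))"
    proof -
      have "(LINT p|lborel. norm (case (y, p) of (y, p) \<Rightarrow> exp (- (1 / w) * ((y - p) \<bullet> (y - p))) * (cmod (\<psi> y))\<^sup>2))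
        = sqrt (pi * w) ^ n * (cmod (\<psi> y))\<^sup>2" for y
        using gp(1)[of y] by (simp add: abs_mult)
      then show ?thesis by (simp only:) (rule integrable_mult_right[OF sq])
    qed
    show "AE y in lborel. integrable lborel (\<lambda>p. case (y, p) of (y, p) \<Rightarrow> exp (- (1 / w) * ((y - p) \<bullet> (y - p))) * (cmod (\<psi> y))\<^sup>2)"
      using gp(2) by auto
  qed measurable
  have inner_int: "integrable lborel (\<lambda>p. LINT y|lborel. (cmod (\<Psi> p y))\<^sup>2)"
    and inner_val: "(LINT p|lborel. LINT y|lborel. (cmod (\<Psi> p y))\<^sup>2) = sqrt (pi * w) ^ n * E.sqn \<psi>"
  proof -
    show "integrable lborel (\<lambda>p. LINT y|lborel. (cmod (\<Psi> p y))\<^sup>2)"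
      unfolding \<Psi>n using lborel_pair.integrable_snd[OF int2] by simp
    have "(LINT p|lborel. LINT y|lborel. (cmod (\<Psi> p y))\<^sup>2) = (LINT y|lborel. LINT p|lborel. exp (- (1 / w) * ((y - p) \<bullet> (y - p))) * (cmod (\<psi> y))\<^sup>2)"
      unfolding \<Psi>n by (rule lborel_pair.Fubini_integral[OF int2])
    also have "\<dots> = (LINT y|lborel. sqrt (pi * w) ^ n * (cmod (\<psi> y))\<^sup>2)" by (simp add: gp(1)[simplified])
    finally show "(LINT p|lborel. LINT y|lborel. (cmod (\<Psi> p y))\<^sup>2) = sqrt (pi * w) ^ n * E.sqn \<psi>"
      by (simp add: E_sqn)
  qed
  have fTint: "integrable (lborel \<Otimes>\<^sub>M lborel) (\<lambda>x. f (T x))"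
  proof (rule lborel_pair.Fubini_integrable)
    show "integrable lborel (\<lambda>p. LINT q|lborel. norm (f (T (p, q))))"
      using inner_int by (simp add: fT pi2)
    show "AE p in lborel. integrable lborel (\<lambda>q. f (T (p, q)))"
      using pi1 by (simp add: fT)
  qed (simp add: lborel_prod)
  have fi: "integrable \<mu> f"
    unfolding \<mu>T using fTint by (simp add: integrable_distr_eq lborel_prod)
  show bH: "bargmann \<psi> \<in> H"
    using fi hol btm by (simp add: H_iff L2_def f_def[abs_def])
  have "(LINT z|\<mu>. f z) = (LINT x|(lborel \<Otimes>\<^sub>M lborel). f (T x))"
    unfolding \<mu>T by (simp add: integral_distr lborel_prod)
  also have "\<dots> = (LINT p|lborel. LINT q|lborel. f (T (p, q)))"
    using lborel_pair.integral_fst'[OF fTint] by simp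
  also have "\<dots> = N\<^sup>2 * (h ^ n * (sqrt (pi * w) ^ n * E.sqn \<psi>))"
    by (simp add: fT pi2 inner_val)
  also have "\<dots> = (N\<^sup>2 * sqrt (pi * w) ^ n) * (h ^ n * E.sqn \<psi>)" by (simp only: mult_ac)
  finally have "(LINT z|\<mu>. f z) = h ^ n * E.sqn \<psi>" by (simp only: N(2) mult_1)
  then show "sqn (bargmann \<psi>) = E.sqn \<psi>"
    using h by (simp add: ip_self_real f_def)
qed

text \<open>The norm identity for all combinations \<open>\<psi> + c \<phi>\<close> gives the inner
  products by polarization.\<close>

lemma bargmann_ip:
  assumes "\<psi> \<in> gauss_class" "\<phi> \<in> gauss_class"
  shows "ip (bargmann \<psi>) (bargmann \<phi>) = ipE \<psi> \<phi>"
proof (rule E.polarization[OF assms semi_inner_space_axioms bargmann_isometry(1)[OF assms(1)] bargmann_isometry(1)[OF assms(2)]])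
  fix c
  have g: "(\<lambda>y. \<psi> y + c * \<phi> y) \<in> gauss_class" by (intro gauss_class_add gauss_class_scale assms)
  have "bargmann (\<lambda>y. \<psi> y + c * \<phi> y) = (\<lambda>z. bargmann \<psi> z + c * bargmann \<phi> z)"
    unfolding bargmann_def using assms b_gauss
    by (simp add: E.ip_add[OF assms(1) gauss_class_scale[OF assms(2)] b_gauss] E.ip_scale[OF assms(2) b_gauss])
  then show "Re (ip (\<lambda>z. bargmann \<psi> z + c * bargmann \<phi> z) (\<lambda>z. bargmann \<psi> z + c * bargmann \<phi> z)) = Re (ipE (\<lambda>z. \<psi> z + c * \<phi> z) (\<lambda>z. \<psi> z + c * \<phi> z))"
    using bargmann_isometry(2)[OF g] by (simp add: sqn_def E.sqn_def)
qed (use bargmann_isometry(2) assms in \<open>simp_all add: sqn_def E.sqn_def\<close>)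

end

section \<open>The action of the stabiliser of a Lagrangian subspace\<close>

lemma gauss_class_linear:
  assumes \<psi>: "\<psi> \<in> gauss_class" and f: "linear f" "inj f"
  shows "(\<lambda>y. \<psi> (f y)) \<in> gauss_class"
proof -
  obtain C c where C: "0 < c" "0 < C" "\<And>y. cmod (\<psi> y) \<le> C * exp (- c * (y \<bullet> y))"
    by (rule gauss_class_bound[OF \<psi>]) blast
  obtain K where K: "0 < K" "\<And>y. K * norm y \<le> norm (f y)"
    using linear_inj_bounded_below_pos[OF f] by blast
  have "cmod (\<psi> (f y)) \<le> C * exp (- (c * K\<^sup>2) * (y \<bullet> y))" for y
  proof -
    have "(K * norm y)\<^sup>2 \<le> (norm (f y))\<^sup>2" using K by (intro power_mono) auto
    then have "K\<^sup>2 * (y \<bullet> y) \<le> f y \<bullet> f y" by (simp add: power_mult_distrib power2_norm_eq_inner)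
    then have "c * (K\<^sup>2 * (y \<bullet> y)) \<le> c * (f y \<bullet> f y)" using C by (intro mult_left_mono) auto
    then have "exp (- c * (f y \<bullet> f y)) \<le> exp (- (c * K\<^sup>2) * (y \<bullet> y))" by (simp add: mult.assoc)
    then show ?thesis using C(2) C(3)[of "f y"] by (meson order_trans mult_left_mono less_imp_le)
  qed
  moreover have "continuous_on UNIV (\<lambda>y. \<psi> (f y))"
    using \<psi> f by (intro continuous_on_compose2[of UNIV \<psi> UNIV f])
      (auto simp: gauss_class_def linear_continuous_on linear_conv_bounded_linear)
  ultimately show ?thesis unfolding gauss_class_def using C K
    by (intro CollectI conjI exI[of _ C] exI[of _ "c * K\<^sup>2"]) auto
qed

context lagrangian_model
begin

definition SpF :: "('v \<Rightarrow> 'v) set" where "SpF = {g \<in> Sp \<Omega>. g ` F \<subseteq> F}"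

lemma SpF_linear: "g \<in> SpF \<Longrightarrow> linear g"
  and SpF_bij: "g \<in> SpF \<Longrightarrow> bij g"
  and SpF_\<Omega>: "g \<in> SpF \<Longrightarrow> \<Omega> (g u) (g v) = \<Omega> u v"
  and SpF_F: "g \<in> SpF \<Longrightarrow> v \<in> F \<Longrightarrow> g v \<in> F"
  by (auto simp: SpF_def Sp_def)

text \<open>The blocks of \<open>g\<close> for the decomposition \<open>F + jF\<close>: the matrix is \<open>(A, B; 0, D)\<close>, with \<open>D\<close> the inverse of
  the transpose \<open>T\<close> of \<open>A\<close>.\<close>

definition blockA :: "('v \<Rightarrow> 'v) \<Rightarrow> real^'m::_ \<Rightarrow> real^'m::_" where "blockA g u = qc (g (\<tau> u))"
definition blockB :: "('v \<Rightarrow> 'v) \<Rightarrow> real^'m::_ \<Rightarrow> real^'m::_" where "blockB g u = qc (g (j (\<tau> u)))"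
definition blockD :: "('v \<Rightarrow> 'v) \<Rightarrow> real^'m::_ \<Rightarrow> real^'m::_" where "blockD g u = pc (g (j (\<tau> u)))"
definition blockT :: "('v \<Rightarrow> 'v) \<Rightarrow> real^'m::_ \<Rightarrow> real^'m::_" where "blockT g = adjoint (blockA g)"

lemma blocks_linear: assumes "g \<in> SpF" shows "linear (blockA g)" "linear (blockB g)" "linear (blockD g)" "linear (blockT g)"
proof -
  note l = SpF_linear[OF assms]
  show A: "linear (blockA g)" "linear (blockB g)" "linear (blockD g)"
    by (intro linearI; simp add: blockA_def blockB_def blockD_def \<tau>_simps j_simps qpc_simps linear_add[OF l] linear_cmul[OF l])+
  show "linear (blockT g)" unfolding blockT_def by (rule adjoint_linear[OF A(1)])
qed

lemma blockT: "g \<in> SpF \<Longrightarrow> blockT g x \<bullet> y = x \<bullet> blockA g y" "g \<in> SpF \<Longrightarrow> y \<bullet> blockT g x = blockA g y \<bullet> x"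
  using adjoint_clauses[OF blocks_linear(1)] unfolding blockT_def by auto

lemma pc_F: "v \<in> F \<Longrightarrow> pc v = 0"
  using \<tau>_range qpc_\<tau> by auto

lemma SpF_coord:
  assumes g: "g \<in> SpF"
  shows "g (\<tau> u) = \<tau> (blockA g u)" "qc (g v) = blockA g (qc v) + blockB g (pc v)" "pc (g v) = blockD g (pc v)"
proof -
  note l = SpF_linear[OF g]
  have p0: "pc (g (\<tau> u)) = 0" for u using SpF_F[OF g \<tau>_in] by (rule pc_F)
  show "g (\<tau> u) = \<tau> (blockA g u)" by (rule qpc_eqI) (simp_all add: qpc_\<tau> blockA_def p0)
  have "g v = g (\<tau> (qc v) + j (\<tau> (pc v)))" by (simp add: decomposition)
  then have *: "g v = g (\<tau> (qc v)) + g (j (\<tau> (pc v)))" by (simp add: linear_add[OF l])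
  show "qc (g v) = blockA g (qc v) + blockB g (pc v)" "pc (g v) = blockD g (pc v)"
    unfolding * by (simp_all add: qpc_simps p0 blockA_def blockB_def blockD_def)
qed

lemma blockA_blockD: "g \<in> SpF \<Longrightarrow> blockA g u \<bullet> blockD g p = u \<bullet> p"
  using SpF_\<Omega>[of g "\<tau> u" "j (\<tau> p)"] by (simp add: \<Omega>_coord SpF_coord qpc_\<tau> linear_0[OF blocks_linear(3)])

text \<open>Invariance of \<open>\<Omega>\<close> on \<open>jF\<close>: the matrix
  \<open>D^T B\<close> is symmetric. It is the source of the quadratic phase and, later, of the
  symmetry of \<open>S_g\<close>.\<close>

lemma blockB_blockD: "g \<in> SpF \<Longrightarrow> blockB g p \<bullet> blockD g p' = blockD g p \<bullet> blockB g p'"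
  using SpF_\<Omega>[of g "j (\<tau> p)" "j (\<tau> p')"]
  by (simp add: \<Omega>_coord SpF_coord qpc_\<tau> linear_0[OF blocks_linear(1)])

lemma blockT_blockD: "g \<in> SpF \<Longrightarrow> blockT g (blockD g p) = p"
  by (rule vector_eq_ldot[THEN iffD1]) (simp add: blockT blockA_blockD)

lemma blockD_blockT: "g \<in> SpF \<Longrightarrow> blockD g (blockT g p) = p"
  using linear_inverse_left[OF blocks_linear(4,3), of g] blockT_blockD by (auto simp: fun_eq_iff)

lemma inj_blockT: "g \<in> SpF \<Longrightarrow> inj (blockT g)"
  by (metis injI blockD_blockT)

lemma det_blockT: "g \<in> SpF \<Longrightarrow> det (matrix (blockT g)) = det (matrix (blockA g))"
  unfolding blockT_def by (simp add: matrix_adjoint blocks_linear det_transpose)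

lemma det_blockA: "g \<in> SpF \<Longrightarrow> det (matrix (blockA g)) \<noteq> 0"
  unfolding det_blockT[symmetric] by (rule det_nz_iff_inj[THEN iffD2]) (auto intro: inj_blockT blocks_linear)

text \<open>Since \<open>g\<close> acts on the coordinate \<open>p\<close> by \<open>D\<close>,
  functions are pulled back by the inverse of \<open>D\<close>, which is \<open>blockT g\<close>.
  The phase is the quadratic form of \<open>B\<close> composed with this inverse, and the root
  compensates the Jacobian.\<close>

definition rep :: "('v \<Rightarrow> 'v) \<Rightarrow> (real^'m::_ \<Rightarrow> complex) \<Rightarrow> real^'m::_ \<Rightarrow> complex" where
  "rep g \<psi> y = complex_of_real (sqrt \<bar>det (matrix (blockA g))\<bar>) * exp (\<i> * complex_of_real (blockB g (blockT g y) \<bullet> y / (2 * w))) * \<psi> (blockT g y)"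

lemma rep_gauss: assumes g: "g \<in> SpF" and \<psi>: "\<psi> \<in> gauss_class" shows "rep g \<psi> \<in> gauss_class"
proof -
  have "linear (\<lambda>y. blockB g (blockT g y))"
    using linear_compose[OF blocks_linear(4)[OF g] blocks_linear(2)[OF g]] by (simp add: o_def)
  then have "continuous_on UNIV (\<lambda>y. blockB g (blockT g y))" by (simp add: linear_continuous_on linear_conv_bounded_linear)
  then show ?thesis
    unfolding rep_def[abs_def]
  proof (intro gauss_class_mult[where B="sqrt \<bar>det (matrix (blockA g))\<bar>"])
    show "(\<lambda>y. \<psi> (blockT g y)) \<in> gauss_class" by (rule gauss_class_linear[OF \<psi> blocks_linear(4)[OF g] inj_blockT[OF g]])
    assume *: "continuous_on UNIV (\<lambda>y. blockB g (blockT g y))"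
    show "continuous_on UNIV (\<lambda>y. complex_of_real (sqrt \<bar>det (matrix (blockA g))\<bar>) * exp (\<i> * complex_of_real (blockB g (blockT g y) \<bullet> y / (2 * w))))"
      using w by (intro continuous_intros *) auto
  qed (simp add: norm_mult)
qed

lemma rep_ip_unitary:
  assumes g: "g \<in> SpF" and \<psi>: "\<psi> \<in> gauss_class" and \<phi>: "\<phi> \<in> gauss_class"
  shows "ipE (rep g \<psi>) (rep g \<phi>) = ipE \<psi> \<phi>"
proof -
  let ?h = "\<lambda>y. \<psi> y * cnj (\<phi> y)"
  define D where "D = \<bar>det (matrix (blockA g))\<bar>"
  have D: "0 < D" using det_blockA[OF g] by (simp add: D_def)
  have m: "?h \<in> borel_measurable borel"
    using gauss_class_measurable[OF \<psi>] gauss_class_measurable[OF \<phi>] by measurable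
  have "rep g \<psi> y * cnj (rep g \<phi> y) = complex_of_real D * ?h (blockT g y)" for y
  proof -
    define E where "E = exp (\<i> * complex_of_real (blockB g (blockT g y) \<bullet> y / (2 * w)))"
    have 1: "E * cnj E = 1" unfolding E_def exp_cnj by (simp flip: exp_add)
    have 2: "complex_of_real (sqrt D) * complex_of_real (sqrt D) = complex_of_real D"
      using D by (simp flip: of_real_mult)
    have "rep g \<psi> y * cnj (rep g \<phi> y) = (complex_of_real (sqrt D) * complex_of_real (sqrt D)) * (E * cnj E) * ?h (blockT g y)"
      unfolding rep_def D_def[symmetric] E_def[symmetric] complex_cnj_mult complex_cnj_complex_of_real by (simp only: mult_ac)
    then show ?thesis unfolding 1 2 by simp
  qed
  then have "ipE (rep g \<psi>) (rep g \<phi>) = complex_of_real D * (LINT y|lborel. ?h (blockT g y))" by simp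
  also have "(LINT y|lborel. ?h (blockT g y)) = (1 / D) *\<^sub>R ipE \<psi> \<phi>"
    using integral_lborel_linear_vec[OF blocks_linear(4)[OF g] _ m] det_blockA[OF g] by (simp add: det_blockT[OF g] D_def)
  finally show ?thesis using D by (simp add: scaleR_conv_of_real)
qed

lemma SpF_comp: "g \<in> SpF \<Longrightarrow> k \<in> SpF \<Longrightarrow> g \<circ> k \<in> SpF"
  by (auto simp: SpF_def Sp_def linear_compose bij_comp image_subset_iff)

lemma SpF_id: "id \<in> SpF" by (simp add: SpF_def Sp_def linear_id)

text \<open>The condition on \<open>g\<close> is only an inclusion. The inverse preserves
  \<open>F\<close> as well because \<open>blockD g\<close> is injective, so a vector mapped into
  \<open>F\<close> has vanishing \<open>pc\<close>.\<close>

lemma SpF_inv: assumes g: "g \<in> SpF" shows "inv_into UNIV g \<in> SpF" "g (inv_into UNIV g v) = v" "inv_into UNIV g (g v) = v"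
proof -
  note b = SpF_bij[OF g]
  show 1: "g (inv_into UNIV g v) = v" and 2: "inv_into UNIV g (g v) = v" for v
    using b by (simp_all add: bij_is_surj surj_f_inv_f bij_is_inj)
  have "linear (inv_into UNIV g)"
    using 1 2 by (intro linearI) (metis linear_add[OF SpF_linear[OF g]], metis linear_cmul[OF SpF_linear[OF g]])
  moreover have "\<Omega> (inv_into UNIV g u) (inv_into UNIV g v) = \<Omega> u v" for u v
    using SpF_\<Omega>[OF g, of "inv_into UNIV g u" "inv_into UNIV g v"] by (simp add: 1)
  moreover have "inv_into UNIV g v \<in> F" if v: "v \<in> F" for v
  proof -
    have "blockD g (pc (inv_into UNIV g v)) = 0" using SpF_coord(3)[OF g, of "inv_into UNIV g v"] 1 pc_F[OF v] by simp
    then have "pc (inv_into UNIV g v) = 0" using blockT_blockD[OF g, of "pc (inv_into UNIV g v)"] linear_0[OF blocks_linear(4)[OF g]] by simp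
    then have "inv_into UNIV g v = \<tau> (qc (inv_into UNIV g v))" using decomposition[of "inv_into UNIV g v"] by (simp add: \<tau>_simps j_simps)
    then show ?thesis using \<tau>_in by metis
  qed
  ultimately show "inv_into UNIV g \<in> SpF" using b by (auto simp: SpF_def Sp_def bij_imp_bij_inv)
qed

lemma rep_id: "rep id \<psi> = \<psi>"
proof -
  have A: "blockA id = (\<lambda>x. x)" by (simp add: blockA_def qpc_\<tau> fun_eq_iff)
  have "blockT id y = y" for y by (rule vector_eq_rdot[THEN iffD1]) (simp add: blockT[OF SpF_id] A)
  moreover have "matrix (blockA id) = mat 1" unfolding A by (simp add: matrix_id_mat_1[unfolded id_def])
  moreover have "blockB id y = 0" for y by (simp add: blockB_def qpc_\<tau>)
  ultimately show ?thesis by (simp add: rep_def[abs_def])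
qed

text \<open>The block \<open>A\<close> is multiplicative, \<open>T\<close> reverses the order, and
  \<open>B\<close> of the product is \<open>A_g B_k + B_g D_k\<close>. Moving \<open>A_g\<close>
  across the inner product as \<open>T_g\<close> and cancelling \<open>D_k\<close> against
  \<open>T_k\<close> splits the phase into the two phases. The scalars multiply exactly, being roots
  of positive numbers.\<close>

lemma rep_comp:
  assumes g: "g \<in> SpF" and k: "k \<in> SpF"
  shows "rep (g \<circ> k) \<psi> = rep g (rep k \<psi>)"
proof
  fix y
  note gh = SpF_comp[OF g k]
  have A: "blockA (g \<circ> k) = blockA g \<circ> blockA k"
    using g k by (simp add: fun_eq_iff blockA_def[of "g \<circ> k"] SpF_coord qpc_\<tau>)
  have T: "blockT (g \<circ> k) y = blockT k (blockT g y)" for y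
    by (rule vector_eq_rdot[THEN iffD1]) (simp add: blockT[OF gh] blockT[OF g] blockT[OF k] A)
  have B: "blockB (g \<circ> k) p = blockA g (blockB k p) + blockB g (blockD k p)" for p
    using g k SpF_coord(2)[OF g] by (simp add: blockB_def[of "g \<circ> k"] blockB_def[of k] blockD_def[of k])
  have d: "det (matrix (blockA (g \<circ> k))) = det (matrix (blockA g)) * det (matrix (blockA k))"
    unfolding A by (simp add: matrix_compose blocks_linear g k det_mul)
  have e: "blockB (g \<circ> k) (blockT k (blockT g y)) \<bullet> y = blockB k (blockT k (blockT g y)) \<bullet> blockT g y + blockB g (blockT g y) \<bullet> y"
    by (simp add: B blockD_blockT[OF k] inner_add_left blockT(2)[OF g])
  show "rep (g \<circ> k) \<psi> y = rep g (rep k \<psi>) y"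
    unfolding rep_def e d T add_divide_distrib of_real_add distrib_left exp_add abs_mult real_sqrt_mult of_real_mult
    by (simp only: mult_ac)
qed

lemma rep_adjoint:
  assumes g: "g \<in> SpF" and \<psi>: "\<psi> \<in> gauss_class" and \<phi>: "\<phi> \<in> gauss_class"
  shows "ipE (rep g \<psi>) \<phi> = ipE \<psi> (rep (inv_into UNIV g) \<phi>)"
proof -
  have "g \<circ> inv_into UNIV g = id" using SpF_inv[OF g] by (simp add: fun_eq_iff)
  then have "rep g (rep (inv_into UNIV g) \<phi>) = \<phi>" using rep_comp[OF g SpF_inv(1)[OF g]] rep_id by metis
  then show ?thesis using rep_ip_unitary[OF g \<psi> rep_gauss[OF SpF_inv(1)[OF g] \<phi>]] by simp
qed

text \<open>After expanding the quadratic phase at the translated point, its linear part is twice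
  \<open>B p \<bullet> y\<close> by the symmetry of \<open>D^T B\<close>. This supplies the
  contribution of \<open>B p\<close> to the coordinate \<open>qc (g v)\<close>.\<close>

lemma rep_schr:
  assumes g: "g \<in> SpF"
  shows "rep g (schr v \<psi>) = schr (g v) (rep g \<psi>)"
proof
  fix y
  define q p where "q = qc v" "p = pc v"
  have T: "blockT g (y - blockD g p) = blockT g y - p" using g by (simp add: linear_diff[OF blocks_linear(4)] blockT_blockD)
  have sym: "blockB g (blockT g y) \<bullet> blockD g p = blockB g p \<bullet> y"
    using blockB_blockD[OF g, of "blockT g y" p] by (simp add: blockD_blockT[OF g] inner_commute)
  have "blockB g (blockT g y - p) \<bullet> (y - blockD g p) = blockB g (blockT g y) \<bullet> y - 2 * (blockB g p \<bullet> y) + blockB g p \<bullet> blockD g p"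
    using g by (simp add: linear_diff[OF blocks_linear(2)] inner_diff_left inner_diff_right sym)
  then have E: "blockB g (blockT g y) \<bullet> y / (2 * w) + (q \<bullet> blockT g y - q \<bullet> p / 2) / w =
     ((blockA g q + blockB g p) \<bullet> y - (blockA g q + blockB g p) \<bullet> blockD g p / 2) / w + blockB g (blockT g y - p) \<bullet> (y - blockD g p) / (2 * w)"
    using w by (simp add: inner_add_left blockA_blockD[OF g] blockT(2)[OF g] field_simps)
  have "rep g (schr v \<psi>) y = complex_of_real (sqrt \<bar>det (matrix (blockA g))\<bar>) *
      exp (\<i> * complex_of_real (blockB g (blockT g y) \<bullet> y / (2 * w) + (q \<bullet> blockT g y - q \<bullet> p / 2) / w)) * \<psi> (blockT g y - p)"
    unfolding rep_def schr_def q_p_def of_real_add distrib_left exp_add by (simp only: mult_ac)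
  also have "\<dots> = schr (g v) (rep g \<psi>) y"
    unfolding E of_real_add distrib_left[of \<i>] exp_add schr_def rep_def SpF_coord(2,3)[OF g] q_p_def[symmetric] T
    by (simp only: mult_ac)
  finally show "rep g (schr v \<psi>) y = schr (g v) (rep g \<psi>) y" .
qed

end

section \<open>The lifted unitary operators on the Fock space\<close>

context lagrangian_model
begin

lemma rep_scale: "rep g (\<lambda>y. c * \<psi> y) = (\<lambda>y. c * rep g \<psi> y)"
  by (simp add: rep_def fun_eq_iff mult_ac)

lemma bargmann_scale: "bargmann (\<lambda>y. c * \<psi> y) = (\<lambda>z. c * bargmann \<psi> z)"
proof
  fix z show "bargmann (\<lambda>y. c * \<psi> y) z = c * bargmann \<psi> z"
    unfolding bargmann_def by (subst integral_mult_right_zero[symmetric]) (simp only: mult.assoc)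
qed

text \<open>The prospective image of \<open>e v\<close> under the lift of \<open>g\<close>: the
  Bargmann transform of \<open>b v\<close> is \<open>e v\<close> itself, by the equality of Gram
  matrices.\<close>

definition transf_coh :: "('v \<Rightarrow> 'v) \<Rightarrow> 'v \<Rightarrow> 'v \<Rightarrow> complex" where
  "transf_coh g v = bargmann (rep g (b v))"

lemma transf_coh_H: "g \<in> SpF \<Longrightarrow> transf_coh g v \<in> H"
  unfolding transf_coh_def by (intro bargmann_isometry(1) rep_gauss b_gauss)

text \<open>Unitarity of \<open>rep\<close> together with the isometry of the transform gives the
  two Gram conditions; that \<open>rep\<close> of the inverse element is the adjoint of
  \<open>rep g\<close> gives the relation between the two kernels.\<close>

lemma unitary_kernel_transf_coh:
  assumes g: "g \<in> SpF"
  shows "unitary_kernel H ip e (transf_coh g) (transf_coh (inv_into UNIV g))"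
proof
  note g' = SpF_inv(1)[OF g]
  fix v u
  show "transf_coh g v \<in> H" "transf_coh (inv_into UNIV g) v \<in> H"
    by (intro transf_coh_H g g')+
  have "ip (transf_coh k v) (transf_coh k u) = e v u" if k: "k \<in> SpF" for k
    unfolding transf_coh_def by (simp add: bargmann_ip rep_gauss k b_gauss rep_ip_unitary b_ip)
  from this[OF g] this[OF g']
  show "ip (transf_coh g v) (transf_coh g u) = e v u"
    "ip (transf_coh (inv_into UNIV g) v) (transf_coh (inv_into UNIV g) u) = e v u" .
  show "transf_coh g v u = cnj (transf_coh (inv_into UNIV g) u v)"
    unfolding transf_coh_def bargmann_def
    by (simp add: rep_adjoint g b_gauss E.ip_cnj[OF rep_gauss[OF g' b_gauss] b_gauss, symmetric])
qed

definition lift :: "('v \<Rightarrow> 'v) \<Rightarrow> ('v \<Rightarrow> complex) \<Rightarrow> 'v \<Rightarrow> complex" where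
  "lift g f = (\<lambda>z. ip f (transf_coh (inv_into UNIV g) z))"

lemma lift_op: "g \<in> SpF \<Longrightarrow> unitary_kernel.op ip (transf_coh (inv_into UNIV g)) = lift g"
  by (simp add: unitary_kernel.op_def[OF unitary_kernel_transf_coh] lift_def fun_eq_iff)

lemma
  assumes g: "g \<in> SpF"
  shows lift_H: "f \<in> H \<Longrightarrow> lift g f \<in> H"
    and lift_bij: "bij_betw (lift g) H H"
    and lift_add: "f \<in> H \<Longrightarrow> f' \<in> H \<Longrightarrow> lift g (\<lambda>z. f z + f' z) = (\<lambda>z. lift g f z + lift g f' z)"
    and lift_scale: "f \<in> H \<Longrightarrow> lift g (\<lambda>z. c * f z) = (\<lambda>z. c * lift g f z)"
    and lift_ip: "f \<in> H \<Longrightarrow> f' \<in> H \<Longrightarrow> ip (lift g f) (lift g f') = ip f f'"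
    and lift_e: "lift g (e v) = transf_coh g v"
    and lift_adj: "f \<in> H \<Longrightarrow> f' \<in> H \<Longrightarrow> ip (lift g f) f' = ip f (\<lambda>z. ip f' (transf_coh g z))"
proof -
  interpret U: unitary_kernel H ip e "transf_coh g" "transf_coh (inv_into UNIV g)"
    by (rule unitary_kernel_transf_coh[OF g])
  show "f \<in> H \<Longrightarrow> lift g f \<in> H" "bij_betw (lift g) H H"
    "f \<in> H \<Longrightarrow> f' \<in> H \<Longrightarrow> lift g (\<lambda>z. f z + f' z) = (\<lambda>z. lift g f z + lift g f' z)"
    "f \<in> H \<Longrightarrow> lift g (\<lambda>z. c * f z) = (\<lambda>z. c * lift g f z)"
    "f \<in> H \<Longrightarrow> f' \<in> H \<Longrightarrow> ip (lift g f) (lift g f') = ip f f'" "lift g (e v) = transf_coh g v"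
    using U.op_in U.op_bij U.op_add U.op_scale U.op_ip U.op_e unfolding lift_op[OF g] by blast+
  show "f \<in> H \<Longrightarrow> f' \<in> H \<Longrightarrow> ip (lift g f) f' = ip f (\<lambda>z. ip f' (transf_coh g z))"
    using U.op_adj unfolding lift_op[OF g] U.op'_def .
qed

text \<open>\<open>f\<close> need not be the transform of a function of Gaussian decay, so
  \<open>rep_comp\<close> cannot be applied to it. It is applied instead to the vectors with which
  \<open>f\<close> is paired when \<open>lift g (lift k f)\<close> is evaluated at \<open>z\<close>;
  these are transforms of Gaussians.\<close>

lemma lift_comp:
  assumes g: "g \<in> SpF" and k: "k \<in> SpF" and f: "f \<in> H"
  shows "lift (g \<circ> k) f = lift g (lift k f)"
proof
  fix z
  note g' = SpF_inv(1)[OF g] and k' = SpF_inv(1)[OF k]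
  let ?\<phi> = "rep (inv_into UNIV g) (b z)"
  have \<phi>: "?\<phi> \<in> gauss_class" by (rule rep_gauss[OF g' b_gauss])
  have "lift g (lift k f) z = ip (lift k f) (bargmann ?\<phi>)" by (simp add: lift_def[of g] transf_coh_def)
  also have "\<dots> = ip f (\<lambda>u. ip (bargmann ?\<phi>) (transf_coh k u))"
    by (rule lift_adj[OF k f bargmann_isometry(1)[OF \<phi>]])
  also have "(\<lambda>u. ip (bargmann ?\<phi>) (transf_coh k u)) = bargmann (rep (inv_into UNIV k) ?\<phi>)"
  proof
    fix u
    have i: "inv_into UNIV (inv_into UNIV k) = k" by (rule inv_inv_eq[OF SpF_bij[OF k]])
    show "ip (bargmann ?\<phi>) (transf_coh k u) = bargmann (rep (inv_into UNIV k) ?\<phi>) u"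
      using rep_adjoint[OF k' \<phi> b_gauss[of u]]
      by (simp add: transf_coh_def bargmann_ip \<phi> rep_gauss[OF k] b_gauss bargmann_def[of "rep _ _"] i)
  qed
  also have "rep (inv_into UNIV k) ?\<phi> = rep (inv_into UNIV (g \<circ> k)) (b z)"
    by (simp add: o_inv_distrib SpF_bij g k rep_comp[OF k' g'])
  finally show "lift (g \<circ> k) f z = lift g (lift k f) z" by (simp add: lift_def[of "g \<circ> k"] transf_coh_def)
qed

text \<open>Again the operators are moved by adjoints to the vector paired with \<open>f\<close>,
  where the intertwining relation of \<open>rep\<close> with \<open>schr\<close> is available for
  the inverse element.\<close>

lemma lift_W:
  assumes g: "g \<in> SpF" and f: "f \<in> H"
  shows "lift g (W v f) = W (g v) (lift g f)"
proof
  fix z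
  note g' = SpF_inv(1)[OF g]
  let ?r = "rep (inv_into UNIV g)"
  let ?c = "exp (- hp (g v) (g v) / (4 * w) + hp (g v) z / (2 * w))"
  have "schr (- v) (?r (b z)) = ?r (schr (- g v) (b z))"
    unfolding rep_schr[OF g'] linear_neg[OF SpF_linear[OF g']] SpF_inv(3)[OF g] ..
  also have "\<dots> = (\<lambda>y. ?c * ?r (b (z - g v)) y)"
    unfolding schr_b rep_scale by (simp add: hp_simps)
  finally have *: "schr (- v) (?r (b z)) = (\<lambda>y. ?c * ?r (b (z - g v)) y)" .
  have "lift g (W v f) z = ip f (W (- v) (bargmann (?r (b z))))"
    unfolding lift_def transf_coh_def by (rule W_adjoint[OF f bargmann_isometry(1)[OF rep_gauss[OF g' b_gauss]]])
  also have "W (- v) (bargmann (?r (b z))) = (\<lambda>u. ?c * transf_coh (inv_into UNIV g) (z - g v) u)"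
    unfolding bargmann_schr[OF rep_gauss[OF g' b_gauss], symmetric] * bargmann_scale transf_coh_def ..
  also have "ip f \<dots> = cnj ?c * ip f (transf_coh (inv_into UNIV g) (z - g v))"
    by (rule ip_scale_right[OF transf_coh_H[OF g'] f])
  also have "cnj ?c = exp (hp z (g v) / (2 * w) - hp (g v) (g v) / (4 * w))"
    by (simp add: exp_cnj hp_cnj[of "g v" z] hp_self)
  finally show "lift g (W v f) z = W (g v) (lift g f) z" by (simp add: W_eq[of "g v"] lift_def)
qed

definition \<Phi> :: "('v \<Rightarrow> 'v) \<Rightarrow> (('v \<Rightarrow> complex) \<Rightarrow> 'v \<Rightarrow> complex) \<times> ('v \<Rightarrow> 'v)" where
  "\<Phi> g = (restrict (lift g) H, g)"

lemma heis_W: "heis h \<Omega> j v t f = (\<lambda>z. exp (- \<i> * complex_of_real t / w) * W v f z)"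
  by (rule ext) (rule heis_eq)

lemma \<Phi>_Mpc:
  assumes g: "g \<in> SpF"
  shows "\<Phi> g \<in> carrier (Mpc h \<Omega> j)"
proof -
  note bij = lift_bij[OF g]
  have bij': "bij_betw (restrict (lift g) H) H H" using bij by (simp cong: bij_betw_cong)
  have "restrict (lift g) H \<in> fock_unitary h \<Omega> j"
    using bij' by (simp add: fock_unitary_def add scale lift_add lift_scale lift_ip g)
  moreover have "heis h \<Omega> j (g v) t f = restrict (lift g) H (heis h \<Omega> j v t (inv_into H (restrict (lift g) H) f))"
    if f: "f \<in> H" for v t f
  proof -
    define f' where "f' = inv_into H (restrict (lift g) H) f"
    have f': "f' \<in> H" unfolding f'_def by (rule bij_betw_apply[OF bij_betw_inv_into[OF bij'] f])
    have "restrict (lift g) H f' = f" unfolding f'_def by (rule bij_betw_inv_into_right[OF bij' f])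
    then have "lift g f' = f" using f' by simp
    then show ?thesis
      unfolding f'_def[symmetric] heis_W[of _ t] using f' by (simp add: scale W_H lift_scale lift_W g)
  qed
  ultimately show ?thesis using g by (simp add: Mpc_def \<Phi>_def SpF_def)
qed

lemma \<Phi>_hom: "\<Phi> \<in> hom (SpF_group \<Omega> F) (Mpc h \<Omega> j)"
proof -
  have "\<Phi> (g \<circ> k) = (compose H (restrict (lift g) H) (restrict (lift k) H), g \<circ> k)" if "g \<in> SpF" "k \<in> SpF" for g k
    using that by (auto simp: \<Phi>_def compose_def lift_comp lift_H fun_eq_iff restrict_def)
  then show ?thesis
    using \<Phi>_Mpc by (auto simp: hom_def SpF_group_def Mpc_def SpF_def[symmetric] \<Phi>_def)
qed

text \<open>Schur's lemma for the Heisenberg action. \<open>T\<close> is determined by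
  \<open>T (e 0)\<close>, because each \<open>e v\<close> is a multiple of a translate of
  \<open>e 0\<close>. The inverse \<open>S\<close>, which is also the adjoint, commutes with the
  translations too, and this makes \<open>T (e 0)\<close> at \<open>z\<close> conjugate to
  \<open>S (e 0)\<close> at \<open>- z\<close>.\<close>

lemma intertwiner_scalar:
  assumes T: "bij_betw T H H" "\<And>f f'. f \<in> H \<Longrightarrow> f' \<in> H \<Longrightarrow> T (\<lambda>z. f z + f' z) = (\<lambda>z. T f z + T f' z)"
    "\<And>c f. f \<in> H \<Longrightarrow> T (\<lambda>z. c * f z) = (\<lambda>z. c * T f z)"
    "\<And>f f'. f \<in> H \<Longrightarrow> f' \<in> H \<Longrightarrow> ip (T f) (T f') = ip f f'"
    and W: "\<And>f v. f \<in> H \<Longrightarrow> T (W v f) = W v (T f)"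
    and f: "f \<in> H"
  shows "T f = (\<lambda>z. T (e 0) 0 * f z)"
proof -
  define S where "S = inv_into H T"
  have TH: "T f \<in> H" if "f \<in> H" for f using T(1) that by (auto simp: bij_betw_def)
  have SH: "S f \<in> H" if "f \<in> H" for f
    unfolding S_def by (rule bij_betw_apply[OF bij_betw_inv_into[OF T(1)] that])
  have TS: "T (S f) = f" if "f \<in> H" for f unfolding S_def by (rule bij_betw_inv_into_right[OF T(1) that])
  have adj: "ip (T f) f' = ip f (S f')" if "f \<in> H" "f' \<in> H" for f f'
    using T(4)[OF that(1) SH[OF that(2)]] TS[OF that(2)] by simp
  have We: "e v = (\<lambda>z. exp (hp v v / (4 * w)) * W v (e 0) z)" for v
    using e_W by (simp add: fun_eq_iff)
  have Te: "T (e v) = (\<lambda>z. exp (hp v v / (4 * w)) * W v (T (e 0)) z)" for v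
    by (subst We) (simp add: T(3) W W_H e_in)
  have Wv: "W v (T (e 0)) z = exp (hp z v / (2 * w) - hp v v / (4 * w)) * T (e 0) (z - v)" for v z
    by (rule W_eq)
  \<comment> \<open>So \<open>T\<close> is scalar on all the \<open>e v\<close> as soon as
    \<open>T (e 0)\<close> is a constant function.\<close>
  have Te': "T (e v) z = e v z * T (e 0) (z - v)" for v z
    using fun_cong[OF Te, of v z] by (simp add: Wv e_eq mult.assoc[symmetric] flip: exp_add)
  have inj: "f = f'" if "f \<in> H" "f' \<in> H" "T f = T f'" for f f'
    using T(1) that by (auto simp: bij_betw_def dest: inj_onD)
  have SW: "S (W v f) = W v (S f)" if f: "f \<in> H" for v f
    by (rule inj[OF SH[OF W_H[OF f]] W_H[OF SH[OF f]]]) (simp add: TS W_H W SH f)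
  have Sscale: "S (\<lambda>z. c * f z) = (\<lambda>z. c * S f z)" if f: "f \<in> H" for c f
    by (rule inj[OF SH[OF scale[OF f]] scale[OF SH[OF f]]]) (simp add: TS scale T(3) SH f)
  have Se: "S (e z) 0 = S (e 0) (- z)" for z
  proof -
    have "S (e z) = (\<lambda>u. exp (hp z z / (4 * w)) * W z (S (e 0)) u)"
      by (subst We) (simp add: Sscale SW W_H e_in)
    then have "S (e z) 0 = exp (hp z z / (4 * w)) * W z (S (e 0)) 0" by simp
    then show ?thesis by (simp add: W_eq[of z _ 0] hp_simps mult.assoc[symmetric] flip: exp_add)
  qed
  \<comment> \<open>The matrix coefficient of \<open>T\<close> between \<open>e 0\<close> and
    \<open>e z\<close> is read in two ways. The right-hand side is conjugate to a holomorphic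
    function, since the reflection commutes with \<open>j\<close>.\<close>
  have conj: "T (e 0) z = cnj (S (e 0) (- z))" for z
  proof -
    have "T (e 0) z = ip (T (e 0)) (e z)" by (simp add: reproducing TH e_in)
    also have "\<dots> = ip (e 0) (S (e z))" by (simp add: adj e_in)
    also have "\<dots> = cnj (ip (S (e z)) (e 0))" by (rule ip_cnj) (intro SH e_in)+
    also have "\<dots> = cnj (S (e z) 0)" by (simp add: reproducing SH e_in)
    finally show ?thesis by (simp only: Se)
  qed
  have "j_holomorphic j (S (e 0))" using SH[OF e_in] by (simp add: H_iff)
  then have hol: "j_holomorphic j (\<lambda>z. S (e 0) (- z))"
    unfolding j_holomorphic_def
  proof (intro allI)
    fix z
    assume "\<forall>z. \<exists>D. (S (e 0) has_derivative D) (at z) \<and> (\<forall>v. D (j v) = \<i> * D v)"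
    then obtain D where D: "(S (e 0) has_derivative D) (at (- z))" "\<And>v. D (j v) = \<i> * D v" by blast
    have "((\<lambda>z. S (e 0) (- z)) has_derivative (\<lambda>v. D (- v))) (at z)"
      using has_derivative_compose[OF has_derivative_minus[OF has_derivative_ident] D(1)] .
    moreover have "D (- j v) = \<i> * D (- v)" for v using D(2)[of "- v"] by (simp add: j_simps)
    ultimately show "\<exists>D. ((\<lambda>z. S (e 0) (- z)) has_derivative D) (at z) \<and> (\<forall>v. D (j v) = \<i> * D v)" by blast
  qed
  have holT: "j_holomorphic j (T (e 0))" using TH[OF e_in] by (simp add: H_iff)
  define c where "c = T (e 0) 0"
  have u: "T (e 0) z = c" for z
    unfolding c_def by (rule holomorphic_antiholomorphic_constant[OF holT hol conj])
  have Tc: "T (e v) = (\<lambda>z. c * e v z)" for v by (rule ext) (simp only: Te'[of v] u mult.commute)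
  have "c * cnj c * ip (e 0) (e 0) = ip (e 0) (e 0)"
    using T(4)[OF e_in[of 0] e_in[of 0]] unfolding Tc by (simp add: ip_scale ip_scale_right scale e_in mult.assoc)
  then have cc: "c * cnj c = 1" by (simp add: reproducing e_in e_eq hp_simps)
  have S: "S (e v) = (\<lambda>z. cnj c * e v z)" for v
  proof (rule inj[OF SH[OF e_in] scale[OF e_in]])
    have "T (\<lambda>z. cnj c * e v z) = (\<lambda>z. (c * cnj c) * e v z)"
      unfolding T(3)[OF e_in] Tc by (simp only: mult_ac)
    then show "T (S (e v)) = T (\<lambda>z. cnj c * e v z)" by (simp add: TS e_in cc)
  qed
  show ?thesis
  proof
    fix z
    have "T f z = ip (T f) (e z)" by (simp add: reproducing TH f)
    also have "\<dots> = c * f z" by (simp add: adj f e_in S ip_scale_right reproducing)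
    finally show "T f z = T (e 0) 0 * f z" by (simp add: c_def)
  qed
qed

text \<open>\<open>T\<close>, the operator of \<open>m\<close> followed by the inverse of
  \<open>lift g\<close>, commutes with all Heisenberg operators and is therefore a scalar. Equality
  of the second parameters forces the scalar to be 1 because that parameter is not zero.\<close>

lemma parameters_unique:
  assumes m: "m \<in> carrier (Mpc h \<Omega> j)" and g: "g \<in> SpF"
    and p: "parameters h \<Omega> j m = (g, transf_coh g 0 0)" and nz: "transf_coh g 0 0 \<noteq> 0"
  shows "m = \<Phi> g"
proof -
  obtain U where mU: "m = (U, g)" using p by (cases m) (simp add: parameters_def)
  have U: "U \<in> fock_unitary h \<Omega> j" and
    UW: "\<And>v t f. f \<in> H \<Longrightarrow> heis h \<Omega> j (g v) t f = U (heis h \<Omega> j v t (inv_into H U f))"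
    using m by (auto simp: mU Mpc_def)
  have Ub: "bij_betw U H H" and Ue: "U \<in> extensional H" using U by (auto simp: fock_unitary_def)
  have UH: "U f \<in> H" if "f \<in> H" for f by (rule bij_betw_apply[OF Ub that])
  have U_W: "U (W v f) = W (g v) (U f)" if f: "f \<in> H" for v f
    using UW[OF UH[OF f], of v 0] by (simp add: bij_betw_inv_into_left[OF Ub f])
  define L where "L = inv_into H (lift g)"
  have lb: "bij_betw (lift g) H H" by (rule lift_bij[OF g])
  have LH: "L f \<in> H" and lL: "lift g (L f) = f" if "f \<in> H" for f
    unfolding L_def by (rule bij_betw_apply[OF bij_betw_inv_into[OF lb] that], rule bij_betw_inv_into_right[OF lb that])
  have Leq: "L f = f'" if "f \<in> H" "f' \<in> H" "f = lift g f'" for f f'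
    using bij_betw_inv_into_left[OF lb that(2)] that(3) by (simp add: L_def)
  define T where "T f = L (U f)" for f
  have TH: "T f \<in> H" if "f \<in> H" for f using that by (simp add: T_def LH UH)
  have lT: "lift g (T f) = U f" if "f \<in> H" for f using that by (simp add: T_def lL UH)
  have Tf: "T f = (\<lambda>z. T (e 0) 0 * f z)" if f: "f \<in> H" for f
  proof (rule intertwiner_scalar[OF _ _ _ _ _ f])
    show "bij_betw T H H"
      using bij_betw_trans[OF Ub bij_betw_inv_into[OF lb]] by (simp add: T_def[abs_def] L_def o_def)
    show "T (\<lambda>z. f z + f' z) = (\<lambda>z. T f z + T f' z)" if "f \<in> H" "f' \<in> H" for f f'
    proof -
      have "U (\<lambda>z. f z + f' z) = (\<lambda>z. U f z + U f' z)" using U that unfolding fock_unitary_def by blast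
      then show ?thesis
        unfolding T_def[of "\<lambda>z. f z + f' z"]
        using that by (intro Leq) (simp_all add: UH add TH lift_add[OF g] lT)
    qed
    show "T (\<lambda>z. c * f z) = (\<lambda>z. c * T f z)" if "f \<in> H" for c f
    proof -
      have "U (\<lambda>z. c * f z) = (\<lambda>z. c * U f z)" using U that unfolding fock_unitary_def by blast
      then show ?thesis
        unfolding T_def[of "\<lambda>z. c * f z"]
        using that by (intro Leq) (simp_all add: UH scale TH lift_scale[OF g] lT)
    qed
    show "ip (T f) (T f') = ip f f'" if "f \<in> H" "f' \<in> H" for f f'
    proof -
      have "ip (U f) (U f') = ip f f'" using U that unfolding fock_unitary_def by blast
      then show ?thesis using lift_ip[OF g TH[OF that(1)] TH[OF that(2)]] that by (simp add: lT)
    qed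
    show "T (W v f) = W v (T f)" if "f \<in> H" for f v
      unfolding T_def[of "W v f"] using that by (intro Leq) (simp_all add: U_W UH W_H TH lift_W[OF g] lT)
  qed
  have Uf: "U f = (\<lambda>z. T (e 0) 0 * lift g f z)" if f: "f \<in> H" for f
    using lT[OF f] unfolding Tf[OF f] lift_scale[OF g f] by simp
  have "T (e 0) 0 * transf_coh g 0 0 = transf_coh g 0 0"
    using p Uf[OF e_in[of 0]] by (simp add: mU parameters_def lift_e[OF g])
  then have "T (e 0) 0 = 1" using nz by simp
  then have "U = restrict (lift g) H"
    using Uf Ue by (auto simp: fun_eq_iff extensional_def)
  then show ?thesis by (simp add: mU \<Phi>_def)
qed

lemma parameters_\<Phi>: "g \<in> SpF \<Longrightarrow> parameters h \<Omega> j (\<Phi> g) = (g, transf_coh g 0 0)"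
  by (simp add: parameters_def \<Phi>_def e_in lift_e)

end

section \<open>The matrix coefficient at the ground state as a Gaussian integral\<close>

text \<open>For real symmetric \<open>Y\<close> the form of \<open>i Y\<close> is purely imaginary
  on complex vectors, so the real part of the form is that of \<open>X\<close> on the real and the
  imaginary part of \<open>c\<close>.\<close>

lemma complex_pencil_pos_real:
  fixes X Y :: "real^'m::{finite,wellorder}^'m::_"
  assumes Y: "transpose Y = Y" and pos: "\<And>y. y \<noteq> 0 \<Longrightarrow> y \<bullet> (X *v y) > 0"
  shows "complex_pencil X Y \<i> \<in> pos_real_matrices"
  unfolding pos_real_matrices_def
proof (intro CollectI allI impI)
  fix c :: "complex^'m::_"
  assume c: "c \<noteq> 0"
  define u v where "u = (\<chi> i. Re (c $ i))" "v = (\<chi> i. Im (c $ i))"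
  have s: "Y $ i $ k = Y $ k $ i" for i k
    using Y by (simp add: transpose_def Finite_Cartesian_Product.vec_eq_iff)
  \<comment> \<open>The contribution of \<open>Y\<close> to the real part; it is antisymmetric in
    \<open>i\<close> and \<open>k\<close>, so its double sum vanishes.\<close>
  define K where "K i k = Y $ i $ k * (u $ i * v $ k - v $ i * u $ k)" for i k
  have "(\<Sum>i\<in>UNIV. \<Sum>k\<in>UNIV. K i k) = (\<Sum>k\<in>UNIV. \<Sum>i\<in>UNIV. K i k)" by (rule sum.swap)
  also have "\<dots> = - (\<Sum>k\<in>UNIV. \<Sum>i\<in>UNIV. K k i)"
    unfolding sum_negf[symmetric] K_def by (intro sum.cong refl) (simp add: s algebra_simps)
  finally have K0: "(\<Sum>i\<in>UNIV. \<Sum>k\<in>UNIV. K i k) = 0" by simp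
  have "Re (hdot (complex_pencil X Y \<i> *v c) c) = (\<Sum>i\<in>UNIV. \<Sum>k\<in>UNIV. u $ i * (X $ i $ k * u $ k) + v $ i * (X $ i $ k * v $ k) - K i k)"
    by (simp add: hdot_def complex_pencil_def matrix_vector_mult_def Re_sum Im_sum u_v_def K_def sum_distrib_left sum_distrib_right
        sum_subtractf sum.distrib sum_negf algebra_simps flip: sum.distrib)
  also have "\<dots> = u \<bullet> (X *v u) + v \<bullet> (X *v v)"
    unfolding sum_subtractf K0 by (simp add: inner_vec_def matrix_vector_mult_def sum_distrib_left sum.distrib)
  finally have *: "Re (hdot (complex_pencil X Y \<i> *v c) c) = u \<bullet> (X *v u) + v \<bullet> (X *v v)" .
  have "u \<noteq> 0 \<or> v \<noteq> 0"
    using c by (auto simp: u_v_def Finite_Cartesian_Product.vec_eq_iff complex_eq_iff)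
  moreover have "0 \<le> u \<bullet> (X *v u)" "0 \<le> v \<bullet> (X *v v)"
    using pos[of u] pos[of v] by (cases "u = 0"; cases "v = 0"; auto)+
  ultimately show "0 < Re (hdot (complex_pencil X Y \<i> *v c) c)"
    unfolding * using pos[of u] pos[of v] by (auto intro: add_pos_nonneg add_nonneg_pos)
qed

text \<open>The segment from the identity to \<open>X + i Y\<close> stays in the convex set on which
  \<open>log_det\<close> is continuous, so \<open>log_det\<close> along it is an admissible
  logarithm for the branch argument.\<close>

lemma gaussian_det_log_det:
  fixes X Y :: "real^'m::{finite,wellorder}^'m::_"
  assumes X: "transpose X = X" and Y: "transpose Y = Y" and pos: "\<And>y. y \<noteq> 0 \<Longrightarrow> y \<bullet> (X *v y) > 0"
  shows "gaussian_det X Y = complex_of_real (sqrt pi ^ CARD('m)) * exp (- (log_det (complex_pencil X Y \<i>) / 2))"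
proof -
  define P where "P s = complex_pencil (mat 1 + s *\<^sub>R (X - mat 1)) (s *\<^sub>R Y) \<i>" for s :: real
  have P: "P s = (1 - s) *\<^sub>R mat 1 + s *\<^sub>R complex_pencil X Y \<i>" for s
    by (simp add: P_def complex_pencil_def Finite_Cartesian_Product.vec_eq_iff Finite_Cartesian_Product.mat_def complex_eq_iff algebra_simps)
  have in_pos: "P s \<in> pos_real_matrices" if "s \<in> {0..1}" for s
    unfolding P using that
    by (intro convexD[OF pos_real_matrices_convex] mat_1_pos_real complex_pencil_pos_real Y pos) auto
  have "continuous_on {0..1} P" unfolding P[abs_def] by (intro continuous_intros)
  then have cont: "continuous_on {0..1} (\<lambda>s. log_det (P s))"
    by (rule continuous_on_compose2[OF log_det_continuous]) (use in_pos in auto)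
  have "gaussian_det X Y = complex_of_real (sqrt pi ^ CARD('m)) * exp (- (log_det (P 1) / 2))"
  proof (rule gaussian_det_branch[OF X Y pos cont])
    show "log_det (P 0) = 0" by (simp add: P log_det_1)
    show "exp (log_det (P s)) = det (complex_pencil (mat 1 + s *\<^sub>R (X - mat 1)) (s *\<^sub>R Y) \<i>)" if "s \<in> {0..1}" for s
      using exp_log_det[OF in_pos[OF that]] by (simp add: P_def)
  qed
  then show ?thesis by (simp add: P)
qed

lemma inner_transpose_matrix: "x \<bullet> (transpose M *v y) = (M *v x) \<bullet> y" for M :: "real^'k^'l"
  by (metis dot_lmul_matrix inner_commute transpose_matrix_vector)

context lagrangian_model
begin

text \<open>With \<open>D^T\<close> the inverse of \<open>A\<close>, the product
  \<open>D^T D\<close> is \<open>(A^T A)^{-1}\<close> and \<open>D^T B\<close> is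
  \<open>S_g\<close>. Hence \<open>gaussX g + i gaussY g\<close> is the matrix of the endomorphism
  at which \<open>a_F\<close> is evaluated in \<open>f_F\<close>.\<close>

definition gaussX :: "('v \<Rightarrow> 'v) \<Rightarrow> real^'m::_^'m::_" where
  "gaussX g = (1/2) *\<^sub>R (mat 1 + transpose (matrix (blockD g)) ** matrix (blockD g))"
definition gaussY :: "('v \<Rightarrow> 'v) \<Rightarrow> real^'m::_^'m::_" where
  "gaussY g = (- (1/2)) *\<^sub>R (transpose (matrix (blockD g)) ** matrix (blockB g))"

lemma matrix_blocks: assumes "g \<in> SpF" shows "matrix (blockD g) *v x = blockD g x" "matrix (blockB g) *v x = blockB g x" "matrix (blockA g) *v x = blockA g x"
  using blocks_linear[OF assms] by (simp_all add: matrix_works)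

lemma gaussX_inner: "g \<in> SpF \<Longrightarrow> x \<bullet> (gaussX g *v y) = (x \<bullet> y + blockD g x \<bullet> blockD g y) / 2"
  by (simp add: gaussX_def scaleR_matrix_vector_assoc[symmetric] matrix_vector_mult_add_rdistrib inner_add_right
      matrix_vector_mul_assoc[symmetric] inner_transpose_matrix matrix_blocks del: transpose_matrix_vector)

lemma gaussY_inner: "g \<in> SpF \<Longrightarrow> x \<bullet> (gaussY g *v y) = - (blockD g x \<bullet> blockB g y / 2)"
  unfolding gaussY_def scaleR_matrix_vector_assoc[symmetric] inner_scaleR_right matrix_vector_mul_assoc[symmetric] inner_transpose_matrix
  by (simp add: matrix_blocks)

lemma transpose_eqI: "(\<And>x y. x \<bullet> (M *v y) = y \<bullet> (M *v x)) \<Longrightarrow> transpose M = M" for M :: "real^'k^'k"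
  unfolding matrix_eq by (metis inner_transpose_matrix inner_commute vector_eq_ldot)

lemma gaussX_gaussY:
  assumes g: "g \<in> SpF"
  shows "transpose (gaussX g) = gaussX g" "transpose (gaussY g) = gaussY g" "y \<noteq> 0 \<Longrightarrow> 0 < y \<bullet> (gaussX g *v y)"
proof -
  show "transpose (gaussX g) = gaussX g" by (rule transpose_eqI) (simp add: gaussX_inner g inner_commute)
  show "transpose (gaussY g) = gaussY g" by (rule transpose_eqI) (metis gaussY_inner[OF g] blockB_blockD[OF g] inner_commute)
  show "0 < y \<bullet> (gaussX g *v y)" if "y \<noteq> 0" using that by (simp add: gaussX_inner g add_pos_nonneg)
qed

text \<open>The substitution \<open>x = blockT g y\<close> puts the exponent in terms of
  \<open>D\<close> and \<open>B\<close> only. Its Jacobian \<open>1 / D\<close> together with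
  \<open>sqrt D\<close> from \<open>rep\<close> gives the power \<open>- 1 / 2\<close> of the
  modulus of the determinant (here \<open>D\<close> is that modulus), while \<open>N\<close> squared
  cancels the Gaussian constant.\<close>

lemma transf_coh_0_0:
  assumes g: "g \<in> SpF"
  shows "transf_coh g 0 0 = complex_of_real (\<bar>det (matrix (blockA g))\<bar> powr (- 1 / 2)) *
    exp (- (1 / 2) * log_det (complex_pencil (gaussX g) (gaussY g) \<i>))"
proof -
  define D where "D = \<bar>det (matrix (blockA g))\<bar>"
  have D: "0 < D" using det_blockA[OF g] by (simp add: D_def)
  define h0 where "h0 x = exp (complex_of_real (- (x \<bullet> x + blockD g x \<bullet> blockD g x) / (2 * w)) + \<i> * complex_of_real (blockB g x \<bullet> blockD g x / (2 * w)))" for x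
  have lD: "linear (blockD g)" and lB: "linear (blockB g)" using blocks_linear[OF g] by auto
  have [measurable]: "h0 \<in> borel_measurable borel"
  proof -
    have "continuous_on UNIV (blockD g)" "continuous_on UNIV (blockB g)"
      using lD lB by (simp_all add: linear_continuous_on linear_conv_bounded_linear)
    then show ?thesis unfolding h0_def[abs_def] using w
      by (intro borel_measurable_continuous_onI continuous_intros) auto
  qed
  have b0: "b 0 y = complex_of_real N * exp (complex_of_real (- (y \<bullet> y) / (2 * w)))" for y
    by (simp add: b_def bR_def bI_def qpc_simps)
  have int: "rep g (b 0) y * cnj (b 0 y) = complex_of_real (N\<^sup>2 * sqrt D) * h0 (blockT g y)" for y
  proof -
    have "h0 (blockT g y) = exp (\<i> * complex_of_real (blockB g (blockT g y) \<bullet> y / (2 * w))) *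
        exp (complex_of_real (- (blockT g y \<bullet> blockT g y) / (2 * w))) * exp (complex_of_real (- (y \<bullet> y) / (2 * w)))"
      unfolding h0_def blockD_blockT[OF g] mult_exp_exp by (simp add: add_divide_distrib diff_divide_distrib algebra_simps)
    moreover have "cnj (b 0 y) = complex_of_real N * exp (complex_of_real (- (y \<bullet> y) / (2 * w)))"
      unfolding b0 by (simp only: complex_cnj_mult exp_cnj complex_cnj_complex_of_real)
    ultimately show ?thesis
      unfolding rep_def b0 D_def[symmetric] by (simp only: power2_eq_square of_real_mult mult_ac)
  qed
  \<comment> \<open>Scaling by \<open>sqrt w\<close> removes \<open>w\<close> from the exponent;
    this is why the factor does not depend on \<open>h\<close>.\<close>
  have h0: "h0 (sqrt w *\<^sub>R x) = exp (- (complex_of_real (x \<bullet> (gaussX g *v x)) + \<i> * complex_of_real (x \<bullet> (gaussY g *v x))))" for x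
  proof -
    have sw: "sqrt w * (sqrt w * r) / (2 * w) = r / 2" for r using w by (simp flip: mult.assoc)
    have 1: "- ((sqrt w *\<^sub>R x) \<bullet> (sqrt w *\<^sub>R x) + blockD g (sqrt w *\<^sub>R x) \<bullet> blockD g (sqrt w *\<^sub>R x)) / (2 * w) = - (x \<bullet> (gaussX g *v x))"
      using w by (simp add: linear_cmul[OF lD] gaussX_inner g field_simps)
    have 2: "blockB g (sqrt w *\<^sub>R x) \<bullet> blockD g (sqrt w *\<^sub>R x) / (2 * w) = - (x \<bullet> (gaussY g *v x))"
      using w by (simp add: linear_cmul[OF lD] linear_cmul[OF lB] gaussY_inner g inner_commute field_simps)
    show ?thesis unfolding h0_def 1 2 by simp
  qed
  have "(LINT x|lborel. h0 (sqrt w *\<^sub>R x)) = (1 / sqrt w ^ CARD('m)) *\<^sub>R (LINT x|lborel. h0 x)"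
    using integral_lborel_affine[of "sqrt w" h0 0] w by simp
  then have "(LINT x|lborel. h0 x) = (sqrt w ^ n) *\<^sub>R (LINT x|lborel. h0 (sqrt w *\<^sub>R x))"
    using w by (simp add: card)
  also have "(LINT x|lborel. h0 (sqrt w *\<^sub>R x)) = gaussian_det (gaussX g) (gaussY g)"
    unfolding h0 gaussian_det_def ..
  also have "\<dots> = complex_of_real (sqrt pi ^ CARD('m)) * exp (- (log_det (complex_pencil (gaussX g) (gaussY g) \<i>) / 2))"
    by (rule gaussian_det_log_det[OF gaussX_gaussY[OF g]])
  finally have I: "(LINT x|lborel. h0 x) = complex_of_real (sqrt w ^ n * sqrt pi ^ n) * exp (- (log_det (complex_pencil (gaussX g) (gaussY g) \<i>) / 2))"
    by (simp add: scaleR_conv_of_real card)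
  have "transf_coh g 0 0 = complex_of_real (N\<^sup>2 * sqrt D) * (LINT y|lborel. h0 (blockT g y))"
    by (simp add: transf_coh_def bargmann_def int)
  also have "(LINT y|lborel. h0 (blockT g y)) = (1 / D) *\<^sub>R (LINT x|lborel. h0 x)"
    using integral_lborel_linear_vec[OF blocks_linear(4)[OF g], of h0] det_blockA[OF g] by (simp add: det_blockT[OF g] D_def)
  also have "complex_of_real (N\<^sup>2 * sqrt D) * \<dots> = complex_of_real (N\<^sup>2 * (sqrt w ^ n * sqrt pi ^ n) * (sqrt D / D)) *
      exp (- (1 / 2) * log_det (complex_pencil (gaussX g) (gaussY g) \<i>))"
    by (simp add: I scaleR_conv_of_real)
  also have "N\<^sup>2 * (sqrt w ^ n * sqrt pi ^ n) = 1"
    using N(2) by (simp add: real_sqrt_mult power_mult_distrib mult.commute)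
  also have "sqrt D / D = D powr (- 1 / 2)"
  proof -
    have "D powr (- 1 / 2) = D powr (1 / 2 - 1)" by simp
    also have "\<dots> = sqrt D / D" unfolding powr_diff using D by (simp add: powr_half_sqrt)
    finally show ?thesis by simp
  qed
  finally show ?thesis by (simp add: D_def)
qed

end

section \<open>The factor of the lifting\<close>

context orthonormal_coordinates
begin

lemma cx_end_emb:
  fixes P Q :: "real^'m^'m"
  assumes X: "\<And>a. X (\<tau> a) = \<tau> (P *v a)" and Y: "\<And>a. Y (\<tau> a) = \<tau> (Q *v a)"
  shows "cx_end F X Y \<in> End_on cx_scale FC" and "mat_of (cx_end F X Y) = complex_pencil P Q \<i>"
proof -
  let ?x = "cx_end F X Y" and ?M = "complex_pencil P Q \<i>"
  have x: "?x (emb c) = emb (?M *v c)" for c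
  proof -
    have "(\<chi> i. Re ((?M *v c) $ i)) = P *v (\<chi> i. Re (c $ i)) - Q *v (\<chi> i. Im (c $ i))"
      "(\<chi> i. Im ((?M *v c) $ i)) = P *v (\<chi> i. Im (c $ i)) + Q *v (\<chi> i. Re (c $ i))"
      by (simp_all add: Finite_Cartesian_Product.vec_eq_iff matrix_vector_mult_def complex_pencil_def Re_sum Im_sum
          sum_subtractf sum.distrib)
    then show ?thesis
      using emb_in[of c] by (simp add: cx_end_def emb_def X Y FC_def linear_add[OF \<tau>] linear_diff[OF \<tau>])
  qed
  have xp: "?x p = emb (?M *v cvec p)" if "p \<in> FC" for p using x[of "cvec p"] emb_cvec[OF that] by simp
  have cs: "cvec (p + q) = cvec p + cvec q" for p q by (rule linear_add[OF cvec_linear])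
  have FC: "p + q \<in> FC" "cx_scale a p \<in> FC" "cvec (cx_scale a p) = a *s cvec p" if "p \<in> FC" "q \<in> FC" for a p q
    using that emb_in emb_add emb_scale emb_cvec cvec_emb by metis+
  show "?x \<in> End_on cx_scale FC"
    unfolding End_on_def
  proof (intro CollectI conjI ballI allI)
    show "?x \<in> FC \<rightarrow>\<^sub>E FC"
      by (rule PiE_I) (auto simp: xp emb_in, auto simp: cx_end_def FC_def)
    show "?x (p + q) = ?x p + ?x q" if "p \<in> FC" "q \<in> FC" for p q
      using that by (simp add: xp FC cs matrix_vector_right_distrib emb_add)
    show "?x (cx_scale a p) = cx_scale a (?x p)" if "p \<in> FC" for a p
      using that by (simp add: xp FC vector_scalar_commute emb_scale)
  qed
  show "mat_of ?x = ?M"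
    by (simp add: mat_of_def x cvec_emb Finite_Cartesian_Product.vec_eq_iff matrix_vector_mult_def axis_def if_distrib cong: if_cong)
qed

lemma Det_on_real:
  fixes M :: "real^'m^'m"
  assumes A: "\<And>u. A (\<tau> u) = \<tau> (M *v u)"
  shows "Det_on scaleR F A = det M"
proof (rule Det_on_eq_det[OF real_vector.vector_space_axioms, where c = "\<lambda>k. \<tau> (axis k 1)"])
  have comb: "(\<Sum>k\<in>UNIV. (d $ k) *\<^sub>R \<tau> (axis k 1)) = \<tau> d" for d
  proof -
    have "\<tau> d = \<tau> (\<Sum>k\<in>UNIV. (d $ k) *\<^sub>R axis k 1)"
      using basis_expansion[of d] by (simp add: scalar_mult_eq_scaleR)
    then show ?thesis by (simp add: linear_sum[OF \<tau>] linear_cmul[OF \<tau>])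
  qed
  have inj_\<tau>: "inj_on \<tau> (span Basis)" by (rule inj_onI) (simp add: \<tau>_inj)
  show "inj (\<lambda>k. \<tau> (axis k 1))"
    by (rule injI) (simp add: \<tau>_inj axis_eq_axis)
  have r: "range (\<lambda>k. \<tau> (axis k 1)) = \<tau> ` (range (\<lambda>k. axis k 1))" by auto
  have B: "range (\<lambda>k. axis k 1) = (Basis :: (real^'m) set)" by (auto simp: Basis_vec_def)
  show "\<not> module.dependent (*\<^sub>R) (range (\<lambda>k. \<tau> (axis k 1)))"
    unfolding dependent_raw_def[symmetric] r B
    by (rule linear_independent_injective_image[OF \<tau> independent_Basis inj_\<tau>])
  show "module.span (*\<^sub>R) (range (\<lambda>k. \<tau> (axis k 1))) = F"
    unfolding span_raw_def[symmetric] r B linear_span_image[OF \<tau>] span_Basis range_\<tau> ..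
  have AF: "A p = \<tau> (M *v coord p)" if "p \<in> F" for p using A[of "coord p"] \<tau>_coord[OF that] by simp
  have F: "p + q \<in> F" "a *\<^sub>R p \<in> F" if "p \<in> F" "q \<in> F" for p q a
    using that \<tau>_coord \<tau>_in linear_add[OF \<tau>] linear_cmul[OF \<tau>] by metis+
  show "A p \<in> F" if "p \<in> F" for p using that by (simp add: AF \<tau>_in)
  show "A (p + q) = A p + A q" if "p \<in> F" "q \<in> F" for p q
    using that by (simp add: AF F linear_add[OF \<tau>] linear_add[OF coord_linear] matrix_vector_right_distrib)
  show "A (a *\<^sub>R p) = a *\<^sub>R A p" if "p \<in> F" for p a
    using that by (simp add: AF F linear_cmul[OF \<tau>, symmetric] linear_cmul[OF coord_linear] matrix_vector_mult_scaleR)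
  show "A (\<tau> (axis k 1)) = (\<Sum>i\<in>UNIV. (M $ i $ k) *\<^sub>R \<tau> (axis i 1))" for k
  proof -
    have "(M *v axis k 1) $ i = M $ i $ k" for i
      by (simp add: matrix_vector_mult_def axis_def if_distrib cong: if_cong)
    then show ?thesis using comb[of "M *v axis k 1"] by (simp add: A)
  qed
qed

end

context lagrangian_model
begin

text \<open>The ingredients of \<open>f_F\<close> given by descriptions (the transpose, the inverse
  and \<open>S_map\<close>) are each identified in coordinates with a matrix in the blocks of
  \<open>g\<close>. The resulting complex matrix is that of the Gaussian integral, and
  \<open>a_F\<close> of it is \<open>log_det\<close>.\<close>

lemma f_F_eq:
  assumes g: "g \<in> SpF"
  shows "f_F \<Omega> j F g = transf_coh g 0 0"
proof -
  define A where "A = restrict g F"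
  define AT where "AT = adjoint_on F G A"
  define R where "R = inv_into F (\<lambda>v. AT (A v))"
  define x where "x = cx_end F (\<lambda>v. (1/2) *\<^sub>R (v + R v)) (\<lambda>v. - (1/2) *\<^sub>R S_map j F g v)"
  let ?D' = "transpose (matrix (blockD g))"
  note inner = inner_transpose_matrix matrix_blocks[OF g]
  have A: "A (\<tau> u) = \<tau> (blockA g u)" for u by (simp add: A_def \<tau>_in SpF_coord[OF g])
  have D'A: "?D' *v blockA g u = u" for u
    by (rule vector_eq_ldot[THEN iffD1]) (metis inner blockA_blockD[OF g] inner_commute)
  \<comment> \<open>\<open>blockD g\<close> is onto, so every test vector may be written as
    \<open>blockD g (blockT g y)\<close>, against which the pairing with \<open>blockA g\<close> is
    known.\<close>
  have AD': "blockA g (?D' *v u) = u" for u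
  proof (rule vector_eq_rdot[THEN iffD1], rule allI)
    fix y
    have "blockA g (?D' *v u) \<bullet> y = blockA g (?D' *v u) \<bullet> blockD g (blockT g y)" by (simp only: blockD_blockT[OF g])
    also have "\<dots> = blockT g y \<bullet> (?D' *v u)" by (metis blockA_blockD[OF g] inner_commute)
    also have "\<dots> = u \<bullet> y" by (metis inner blockD_blockT[OF g] inner_commute)
    finally show "blockA g (?D' *v u) \<bullet> y = u \<bullet> y" .
  qed
  have AT: "AT (\<tau> u) = \<tau> (blockT g u)" for u
    unfolding AT_def adjoint_on_def restrict_apply'[OF \<tau>_in]
  proof (rule the_equality)
    show "\<tau> (blockT g u) \<in> F \<and> (\<forall>r\<in>F. G (\<tau> (blockT g u)) r = G (\<tau> u) (A r))"
      using \<tau>_range by (auto simp: \<tau>_in A \<tau>_iso blockT[OF g])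
    fix q assume q: "q \<in> F \<and> (\<forall>r\<in>F. G q r = G (\<tau> u) (A r))"
    then obtain a where a: "q = \<tau> a" using \<tau>_range by auto
    have "a \<bullet> y = blockT g u \<bullet> y" for y
      using q \<tau>_in[of y] by (metis a A \<tau>_iso blockT(1)[OF g])
    then show "q = \<tau> (blockT g u)" using a by (metis vector_eq_rdot)
  qed
  \<comment> \<open>As \<open>D\<close> is inverse to \<open>A^T\<close> and \<open>D^T\<close> is
    inverse to \<open>A\<close>, the inverse of \<open>A^T A\<close> is
    \<open>D^T D\<close>.\<close>
  have R: "R (\<tau> u) = \<tau> (?D' *v blockD g u)" for u
    unfolding R_def
  proof (rule inv_into_f_eq)
    show "inj_on (\<lambda>v. AT (A v)) F"
    proof (rule inj_onI)
      fix p q assume "p \<in> F" "q \<in> F" "AT (A p) = AT (A q)"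
      moreover obtain a c where "p = \<tau> a" "q = \<tau> c" using \<open>p \<in> F\<close> \<open>q \<in> F\<close> \<tau>_range by auto
      ultimately have "blockT g (blockA g a) = blockT g (blockA g c)" by (simp add: A AT \<tau>_inj)
      then have "blockA g a = blockA g c" by (rule injD[OF inj_blockT[OF g]])
      then have "a = c" by (metis D'A)
      then show "p = q" using \<open>p = \<tau> a\<close> \<open>q = \<tau> c\<close> by simp
    qed
    show "AT (A (\<tau> (?D' *v blockD g u))) = \<tau> u" by (simp only: A AT AD' blockT_blockD[OF g])
  qed (rule \<tau>_in)
  have X: "(1/2) *\<^sub>R (\<tau> u + R (\<tau> u)) = \<tau> (gaussX g *v u)" for u
    unfolding R gaussX_def scaleR_matrix_vector_assoc[symmetric] matrix_vector_mult_add_rdistrib matrix_vector_mul_assoc[symmetric] matrix_blocks[OF g]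
    by (simp add: \<tau>_simps del: transpose_matrix_vector)
  \<comment> \<open>The \<open>F\<close>-component of \<open>g (j (\<tau> u))\<close> has
    coordinates \<open>B u\<close>, so the defining equation reads \<open>A S = B\<close>, and
    multiplication by \<open>D^T\<close> solves it.\<close>
  have "S_map j F g (\<tau> u) = \<tau> (?D' *v blockB g u)" for u
    unfolding S_map_def restrict_apply'[OF \<tau>_in] A_def[symmetric]
  proof (rule the_equality)
    have F: "F_component j F (g (j (\<tau> u))) = \<tau> (blockB g u)"
      unfolding F_component_def
    proof (rule the_equality)
      show "\<tau> (blockB g u) \<in> F \<and> (\<exists>v\<in>F. g (j (\<tau> u)) = \<tau> (blockB g u) + j v)"
        using decomposition[of "g (j (\<tau> u))"] \<tau>_in by (metis blockB_def)
      fix q assume "q \<in> F \<and> (\<exists>v\<in>F. g (j (\<tau> u)) = q + j v)"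
      then obtain a c where q: "q = \<tau> a" "g (j (\<tau> u)) = \<tau> a + j (\<tau> c)" using \<tau>_range by auto
      then show "q = \<tau> (blockB g u)" by (simp add: blockB_def qpc_simps qpc_\<tau>)
    qed
    show "\<tau> (?D' *v blockB g u) \<in> F \<and> A (\<tau> (?D' *v blockB g u)) = F_component j F (g (j (\<tau> u)))"
      by (simp only: F A AD' \<tau>_in simp_thms)
    fix s assume s: "s \<in> F \<and> A s = F_component j F (g (j (\<tau> u)))"
    then obtain a where a: "s = \<tau> a" using \<tau>_range by auto
    then have "blockA g a = blockB g u" using s F A \<tau>_inj by metis
    then show "s = \<tau> (?D' *v blockB g u)" using D'A[of a] a by simp
  qed
  then have Y: "- (1/2) *\<^sub>R S_map j F g (\<tau> u) = \<tau> (gaussY g *v u)" for u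
    unfolding gaussY_def scaleR_matrix_vector_assoc[symmetric] matrix_vector_mul_assoc[symmetric] matrix_blocks[OF g]
    by (simp only: \<tau>_simps)
  have xE: "x \<in> End_on cx_scale FC" and xM: "mat_of x = complex_pencil (gaussX g) (gaussY g) \<i>"
    unfolding x_def by (rule cx_end_emb(1)[OF X Y], rule cx_end_emb(2)[OF X Y])
  have "x \<in> pos_real_part G F"
    unfolding pos_real_part_iff xM using xE complex_pencil_pos_real[OF gaussX_gaussY(2)[OF g] gaussX_gaussY(3)[OF g]] by blast
  then have aF: "a_F G F x = log_det (complex_pencil (gaussX g) (gaussY g) \<i>)"
    by (simp add: a_F_eq_log_det xM)
  have det: "Det_on scaleR F A = det (matrix (blockA g))"
    by (rule Det_on_real) (simp add: A matrix_blocks[OF g])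
  show ?thesis
    unfolding f_F_def Let_def A_def[symmetric] AT_def[symmetric] R_def[symmetric] x_def[symmetric] aF det transf_coh_0_0[OF g] ..
qed

theorem lift_parameters:
  assumes g: "g \<in> carrier (SpF_group \<Omega> F)"
  shows "parameters h \<Omega> j (\<Phi> g) = (g, f_F \<Omega> j F g)"
    and "m \<in> carrier (Mpc h \<Omega> j) \<Longrightarrow> parameters h \<Omega> j m = (g, f_F \<Omega> j F g) \<Longrightarrow> m = \<Phi> g"
proof -
  have g: "g \<in> SpF" using g by (simp add: SpF_group_def SpF_def)
  show "parameters h \<Omega> j (\<Phi> g) = (g, f_F \<Omega> j F g)" by (simp add: f_F_eq g parameters_\<Phi>)
  have "transf_coh g 0 0 \<noteq> 0" using det_blockA[OF g] by (simp add: transf_coh_0_0 g)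
  then show "m = \<Phi> g" if "m \<in> carrier (Mpc h \<Omega> j)" "parameters h \<Omega> j m = (g, f_F \<Omega> j F g)"
    using parameters_unique[OF _ g] that by (simp add: f_F_eq g)
qed

end

text \<open>The point is that \<open>dim F = n\<close>, so that an orthonormal basis of
  \<open>F\<close> can be indexed by \<open>half_index\<close>. For a Lagrangian \<open>F\<close>
  the \<open>G\<close>-orthogonal complement is \<open>jF\<close>, which has the same dimension as
  \<open>F\<close>.\<close>

lemma (in bargmann_fock) lagrangian_coordinates_exist:
  assumes lagr: "lagrangian \<Omega> F"
  obtains \<tau> :: "real^('v half_index) \<Rightarrow> 'v" where "lagrangian_model h n \<Omega> j F \<tau>"
proof -
  have F: "subspace F" and F_\<Omega>: "v \<in> F \<longleftrightarrow> (\<forall>u\<in>F. \<Omega> v u = 0)" for v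
    using lagr by (auto simp: lagrangian_def)
  obtain b where b: "b \<subseteq> F" "finite b" "\<And>x y. x \<in> b \<Longrightarrow> y \<in> b \<Longrightarrow> G x y = (if x = y then 1 else 0)"
    "independent b" "span b = F"
    by (rule orthonormal_family_exists[OF G_bilinear G_sym F G_pos]) auto
  have l: "linear (\<lambda>v. G v u)" "linear (G u)" for u using G_bilinear by (auto simp: bilinear_def)
  have jF: "subspace (j ` F)" by (rule linear_subspace_image[OF j_linear F])
  have sum: "{x + y |x y. x \<in> F \<and> y \<in> j ` F} = UNIV"
  proof -
    have "\<exists>x\<in>F. \<exists>y\<in>F. v = x + j y" for v
    proof -
      \<comment> \<open>The orthogonal projection of \<open>v\<close> to \<open>F\<close>.
        Orthogonality of \<open>v - p\<close> to \<open>F\<close> for \<open>G\<close> means that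
        \<open>j (v - p)\<close> is \<open>\<Omega>\<close>-orthogonal to \<open>F\<close>, hence
        lies in \<open>F\<close>.\<close>
      define p where "p = (\<Sum>x\<in>b. G v x *\<^sub>R x)"
      have "G (v - p) x = 0" if "x \<in> b" for x
      proof -
        have "G p x = (\<Sum>y\<in>b. G v y * G y x)" by (simp add: p_def linear_sum[OF l(1)] G_simps)
        also have "\<dots> = G v x" using b(2) that by (simp add: b(3) if_distrib cong: if_cong)
        finally show ?thesis by (simp add: G_simps)
      qed
      then have "G (v - p) u = 0" if "u \<in> F" for u
        using linear_eq_0_on_span[OF l(2), of b "v - p" u] that b(5) by simp
      then have "\<Omega> (j (v - p)) u = 0" if "u \<in> F" for u
        using that by (simp only: Gform_def \<Omega>_j_left minus_zero)
      then have "j (v - p) \<in> F" by (intro F_\<Omega>[THEN iffD2] ballI)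
      then have "- j (v - p) \<in> F" using subspace_neg[OF F] by blast
      moreover have "p \<in> F" unfolding p_def using b(1) by (intro subspace_sum F subspace_scale) auto
      moreover have "v = p + j (- j (v - p))" by (simp add: j_simps jj)
      ultimately show ?thesis by blast
    qed
    then show ?thesis by blast
  qed
  have int: "F \<inter> j ` F = {0}"
  proof -
    have "v = 0" if "v \<in> F" "v \<in> j ` F" for v
    proof -
      have "j v \<in> F" using that(2) subspace_neg[OF F] by (auto simp: jj)
      then have "\<Omega> v (j v) = 0" using that(1) F_\<Omega>[of v] by blast
      then show ?thesis using G_pos[of v] by (auto simp: Gform_def)
    qed
    then show ?thesis using subspace_0[OF F] subspace_0[OF jF] by auto
  qed
  have "inj j" using j by (auto simp: j_plus_def Sp_def bij_is_inj)
  then have "dim (j ` F) = dim F" by (intro dim_image_eq j_linear) (auto intro: inj_on_subset)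
  moreover have "DIM('v) = dim F + dim (j ` F)" using dim_sums_Int[OF F jF] unfolding sum int by simp
  ultimately have "dim F = n" using dim by simp
  then have "card b = n" using dim_span_eq_card_independent[OF b(4)] unfolding b(5) by simp
  \<comment> \<open>The lower bound 1 in the definition of \<open>half_index\<close> does not
    interfere: \<open>DIM('v)\<close> is positive, so \<open>n\<close> is at least 1.\<close>
  moreover have nh: "CARD('v half_index) = n"
    using DIM_positive[where 'a='v] dim by (simp add: card_half_index del: DIM_positive)
  ultimately obtain f where f: "bij_betw f (UNIV :: 'v half_index set) b"
    using finite_same_card_bij[of "UNIV :: 'v half_index set" b] b(2) by auto
  define \<tau> where "\<tau> y = (\<Sum>i\<in>UNIV. (y $ i) *\<^sub>R f i)" for y :: "real^'v half_index"
  have \<tau>: "linear \<tau>"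
    unfolding \<tau>_def by (intro linearI) (simp_all add: scaleR_add_left sum.distrib scaleR_sum_right)
  have ff: "G (f i) (f k) = (if i = k then 1 else 0)" for i k
    using b(3)[of "f i" "f k"] f by (auto simp: bij_betw_def inj_on_def)
  have "\<tau> (axis i 1) = f i" for i by (simp add: \<tau>_def axis_def if_distrib[of "\<lambda>r. r *\<^sub>R _"] cong: if_cong)
  then have "b \<subseteq> range \<tau>" using f unfolding bij_betw_def by (metis image_subset_iff rangeI)
  then have "F \<subseteq> range \<tau>" unfolding b(5)[symmetric] by (intro span_minimal linear_subspace_image[OF \<tau>] subspace_UNIV)
  moreover have "\<tau> y \<in> F" for y
    unfolding \<tau>_def using b(1) f by (intro subspace_sum F subspace_scale) (auto simp: bij_betw_def)
  ultimately have "range \<tau> = F" by auto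
  moreover have "G (\<tau> x) (\<tau> y) = x \<bullet> y" for x y
  proof -
    have "G (\<tau> x) (\<tau> y) = (\<Sum>i\<in>UNIV. \<Sum>k\<in>UNIV. (x $ i) * ((y $ k) * G (f i) (f k)))"
      unfolding \<tau>_def by (simp add: linear_sum[OF l(1)] linear_sum[OF l(2)] G_simps sum_distrib_left)
        (subst sum.swap, simp add: mult_ac)
    also have "\<dots> = (\<Sum>i\<in>UNIV. (x $ i) * (y $ i))"
      by (intro sum.cong refl) (simp add: ff if_distrib cong: if_cong)
    finally show ?thesis by (simp add: inner_vec_def)
  qed
  ultimately have "lagrangian_model h n \<Omega> j F \<tau>"
    using lagr nh \<tau> by (intro lagrangian_model.intro bargmann_fock_axioms lagrangian_model_axioms.intro) auto
  then show ?thesis by (rule that)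
qed

text \<open>The last conjunct expresses that the parameters single out one element of the group, so
  that speaking of the element with parameters \<open>(g, f_F(g))\<close> is justified and the
  homomorphism is determined by its parameters.\<close>

theorem proposition2p19:
  fixes h :: real and n :: nat
    and \<Omega> :: "'v::euclidean_space \<Rightarrow> 'v \<Rightarrow> real"
    and F :: "'v set" and j :: "'v \<Rightarrow> 'v"
  assumes "h > 0"
    and "symplectic_form \<Omega>"
    and "DIM('v) = 2 * n"
    and "lagrangian \<Omega> F"
    and "j \<in> j_plus \<Omega>"
  shows "\<exists>\<Phi> \<in> hom (SpF_group \<Omega> F) (Mpc h \<Omega> j).
           \<forall>g \<in> carrier (SpF_group \<Omega> F).
             mpc_proj (\<Phi> g) = g \<and>
             parameters h \<Omega> j (\<Phi> g) = (g, f_F \<Omega> j F g) \<and>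
             (\<forall>m \<in> carrier (Mpc h \<Omega> j). parameters h \<Omega> j m = (g, f_F \<Omega> j F g) \<longrightarrow> m = \<Phi> g)"
proof -
  interpret bargmann_fock h n \<Omega> j using assms by unfold_locales
  obtain \<tau> :: "real^('v half_index) \<Rightarrow> 'v" where "lagrangian_model h n \<Omega> j F \<tau>"
    by (rule lagrangian_coordinates_exist[OF assms(4)])
  then interpret lagrangian_model h n \<Omega> j F \<tau> .
  show ?thesis
    using \<Phi>_hom lift_parameters by (intro bexI[of _ \<Phi>]) (auto simp: mpc_proj_def \<Phi>_def)
qed

end
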